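(* Up to isomorphism, there are exactly ten connected non-trivially Hoffman colorable graphs $G$ with $|V(G)|<3\chi(G)$. These are the graph $F$, the graph $M_{10}$, the graph $M_{21}$, and the seven (pairwise non-isomorphic) chromatic components of $M_{21}$ of orders $11$, $13$, $15$, $17$ and $20$.
   Context: All graphs are finite and simple; $\lambda_{\max},\lambda_{\min}$ are the largest/smallest adjacency eigenvalues. For a graph $G$ with an edge, $h(G)=1-\lambda_{\max}(G)/\lambda_{\min}(G)$; $G$ is Hoffman colorable if $\chi(G)=h(G)$; it is non-trivially Hoffman colorable if moreover it is not bipartite and not a complete multipartite graph $K_{m,\dots,m}$ with equal part sizes. For $m\ge 2$, $H$ is an $m$-chromatic component of $G$ if for some optimal coloring $V_1\sqcup\dots\sqcup V_{\chi(G)}$ of $G$ into cocliques, $H\cong G[V_1\cup\dots\cup V_m]$; a chromatic component is an $m$-chromatic component for some $2\le m\le\chi(G)$. $F$ is the graph on $\{1,\dots,6\}$ with edges $\{1,4\},\{1,5\},\{2,4\},\{2,6\},\{3,5\},\{3,6\},\{4,5\},\{4,6\},\{5,6\}$. In $\mathbb R^8$ with standard basis $e_1,\dots,e_8$ and all-ones vector $\mathbf 1$, put $a_{ij}=2e_i+2e_j$, $b_{ij}=\mathbf 1-2e_i-2e_j$, $c_{ij}=2e_i-2e_j$, $d_{ijkl}=\mathbf 1-2e_i-2e_j-2e_k-2e_l$, $e=\mathbf 1$. For a finite set $S$ of such vectors whose pairwise inner products lie in $\{0,4\}$, let $\Gamma(S)$ be the graph with vertex set $S$ in which two vectors are adjacent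 iff their inner product is $4$. $M_{10}=\Gamma(S_{10})$ with $S_{10}=\{a_{13},a_{26},c_{26},a_{47},c_{47},a_{23},a_{15},c_{15},a_{48},c_{48},d_{5678},e,b_{56},b_{57},b_{58},b_{67},b_{68},b_{78},a_{12},a_{34}\}$ (20 vertices). $M_{21}=\Gamma(S_{21})$ with $S_{21}=\{a_{15},c_{15},a_{26},c_{26},a_{37},c_{37},a_{48},c_{48},d_{5678},e,a_{12},a_{13},a_{14},a_{23},a_{24},a_{34},b_{56},b_{57},b_{58},b_{67},b_{68},b_{78}\}$ (22 vertices). *)

theory Defs
  imports "Graph_Theory.Graph_Theory" "Jordan_Normal_Form.Char_Poly"
begin

text \<open>
  A finite simple graph is a digraph satisfying the locale predicate \<^const>\<open>Digraph.graph\<close>: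
  finite, symmetric, without loops or parallel arcs; each edge is a pair of opposite arcs.
\<close>

section \<open>Spectrum, colorings, Hoffman colorability\<close>

definition adjacency_matrix :: "('a, 'b) pre_digraph \<Rightarrow> 'a list \<Rightarrow> real mat" where
  "adjacency_matrix G vs = mat (length vs) (length vs)
     (\<lambda>(i, j). if vs ! i \<rightarrow>\<^bsub>G\<^esub> vs ! j then 1 else 0)"

text \<open>
  The eigenvalues do not depend on the enumeration \<open>vs\<close> of the vertices, and all of them are
  real because the matrix of a graph is symmetric.
\<close>

definition adjacency_eigenvalues :: "('a, 'b) pre_digraph \<Rightarrow> real set" where
  "adjacency_eigenvalues G =
     {x. \<exists>vs. distinct vs \<and> set vs = verts G \<and> eigenvalue (adjacency_matrix G vs) x}"

definition lambda_max :: "('a, 'b) pre_digraph \<Rightarrow> real" where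
  "lambda_max G = Max (adjacency_eigenvalues G)"

definition lambda_min :: "('a, 'b) pre_digraph \<Rightarrow> real" where
  "lambda_min G = Min (adjacency_eigenvalues G)"

definition hoffman_bound :: "('a, 'b) pre_digraph \<Rightarrow> real" where
  "hoffman_bound G = 1 - lambda_max G / lambda_min G"

definition proper_coloring :: "('a, 'b) pre_digraph \<Rightarrow> nat \<Rightarrow> ('a \<Rightarrow> nat) \<Rightarrow> bool" where
  "proper_coloring G k c \<longleftrightarrow>
     c ` verts G \<subseteq> {..<k} \<and> (\<forall>u v. u \<rightarrow>\<^bsub>G\<^esub> v \<longrightarrow> c u \<noteq> c v)"

definition chromatic_number :: "('a, 'b) pre_digraph \<Rightarrow> nat" where
  "chromatic_number G = (LEAST k. \<exists>c. proper_coloring G k c)"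

definition bipartite :: "('a, 'b) pre_digraph \<Rightarrow> bool" where
  "bipartite G \<longleftrightarrow> (\<exists>c. proper_coloring G 2 c)"

text \<open>\<open>balanced_multipartite r m\<close> is $K_{m,\dots,m}$ with \<open>r\<close> parts.\<close>

definition balanced_multipartite :: "nat \<Rightarrow> nat \<Rightarrow> (nat \<times> nat) pair_pre_digraph" where
  "balanced_multipartite r m =
     \<lparr> pverts = {..<r} \<times> {..<m},
       parcs = {(u, v). u \<in> {..<r} \<times> {..<m} \<and> v \<in> {..<r} \<times> {..<m} \<and> fst u \<noteq> fst v} \<rparr>"

definition hoffman_colorable :: "('a, 'b) pre_digraph \<Rightarrow> bool" where
  "hoffman_colorable G \<longleftrightarrow> arcs G \<noteq> {} \<and> real (chromatic_number G) = hoffman_bound G"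

definition nontrivially_hoffman_colorable :: "('a, 'b) pre_digraph \<Rightarrow> bool" where
  "nontrivially_hoffman_colorable G \<longleftrightarrow>
     hoffman_colorable G \<and> \<not> bipartite G \<and>
     \<not> (\<exists>r m. digraph_iso G (with_proj (balanced_multipartite r m)))"

definition small_hoffman_graph :: "('a, 'b) pre_digraph \<Rightarrow> bool" where
  "small_hoffman_graph G \<longleftrightarrow>
     Digraph.graph G \<and> Digraph_Component.connected G \<and> nontrivially_hoffman_colorable G \<and>
     card (verts G) < 3 * chromatic_number G"

text \<open>
  The classes of an optimal coloring \<open>c\<close> are the sets \<open>{v. c v = i}\<close> for
  \<open>i < chromatic_number G\<close>; the first \<open>m\<close> of them form \<open>{v. c v < m}\<close>.
\<close>

definition m_chromatic_component ::
    "nat \<Rightarrow> ('c, 'd) pre_digraph \<Rightarrow> ('a, 'b) pre_digraph \<Rightarrow> bool" where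
  "m_chromatic_component m H G \<longleftrightarrow>
     (\<exists>c. proper_coloring G (chromatic_number G) c \<and>
          digraph_iso H (G \<restriction> {v \<in> verts G. c v < m}))"

definition chromatic_component :: "('c, 'd) pre_digraph \<Rightarrow> ('a, 'b) pre_digraph \<Rightarrow> bool" where
  "chromatic_component H G \<longleftrightarrow>
     (\<exists>m. 2 \<le> m \<and> m \<le> chromatic_number G \<and> m_chromatic_component m H G)"

section \<open>The graphs $F$, $M_{10}$, $M_{21}$\<close>

definition F_edges :: "nat rel" where
  "F_edges = {(1,4), (1,5), (2,4), (2,6), (3,5), (3,6), (4,5), (4,6), (5,6)}"

definition F_graph :: "nat pair_pre_digraph" where
  "F_graph = \<lparr> pverts = {1..6}, parcs = F_edges \<union> F_edges\<inverse> \<rparr>"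

text \<open>Coordinates of \<^typ>\<open>real vec\<close> are numbered from 0, those of $\mathbb{R}^8$ below from 1.\<close>

definition bas :: "nat \<Rightarrow> real vec" where
  "bas i = unit_vec 8 (i - 1)"

definition ones :: "real vec" where
  "ones = vec 8 (\<lambda>_. 1)"

definition a_vec :: "nat \<Rightarrow> nat \<Rightarrow> real vec" where
  "a_vec i j = 2 \<cdot>\<^sub>v bas i + 2 \<cdot>\<^sub>v bas j"

definition b_vec :: "nat \<Rightarrow> nat \<Rightarrow> real vec" where
  "b_vec i j = ones - 2 \<cdot>\<^sub>v bas i - 2 \<cdot>\<^sub>v bas j"

definition c_vec :: "nat \<Rightarrow> nat \<Rightarrow> real vec" where
  "c_vec i j = 2 \<cdot>\<^sub>v bas i - 2 \<cdot>\<^sub>v bas j"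

definition d_vec :: "nat \<Rightarrow> nat \<Rightarrow> nat \<Rightarrow> nat \<Rightarrow> real vec" where
  "d_vec i j k l = ones - 2 \<cdot>\<^sub>v bas i - 2 \<cdot>\<^sub>v bas j - 2 \<cdot>\<^sub>v bas k - 2 \<cdot>\<^sub>v bas l"

definition e_vec :: "real vec" where
  "e_vec = ones"

definition Gamma :: "real vec set \<Rightarrow> real vec pair_pre_digraph" where
  "Gamma S = \<lparr> pverts = S, parcs = {(v, w). v \<in> S \<and> w \<in> S \<and> v \<noteq> w \<and> v \<bullet> w = 4} \<rparr>"

definition S10 :: "real vec set" where
  "S10 = {a_vec 1 3, a_vec 2 6, c_vec 2 6, a_vec 4 7, c_vec 4 7, a_vec 2 3, a_vec 1 5, c_vec 1 5,
          a_vec 4 8, c_vec 4 8, d_vec 5 6 7 8, e_vec, b_vec 5 6, b_vec 5 7, b_vec 5 8, b_vec 6 7,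
          b_vec 6 8, b_vec 7 8, a_vec 1 2, a_vec 3 4}"

definition S21 :: "real vec set" where
  "S21 = {a_vec 1 5, c_vec 1 5, a_vec 2 6, c_vec 2 6, a_vec 3 7, c_vec 3 7, a_vec 4 8, c_vec 4 8,
          d_vec 5 6 7 8, e_vec, a_vec 1 2, a_vec 1 3, a_vec 1 4, a_vec 2 3, a_vec 2 4, a_vec 3 4,
          b_vec 5 6, b_vec 5 7, b_vec 5 8, b_vec 6 7, b_vec 6 8, b_vec 7 8}"

definition M10 :: "real vec pair_pre_digraph" where
  "M10 = Gamma S10"

definition M21 :: "real vec pair_pre_digraph" where
  "M21 = Gamma S21"

end

theory Submission
  imports Defs "HOL-Analysis.Function_Topology"
begin

text \<open>
  Write \<open>\<theta> = - \<lambda>\<^sub>m\<^sub>i\<^sub>n\<close> and let \<open>x\<close> be the Perron eigenvector. Equality in Hoffman's bound means that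
  \<open>k\<close> times the restriction of \<open>x\<close> to a colour class, minus \<open>x\<close>, lies in the kernel of the positive
  semidefinite matrix \<open>A + \<theta>I\<close>: for every vertex \<open>v\<close> and every other class, the weights \<open>x\<close> of the
  neighbours of \<open>v\<close> in that class add up to \<open>\<theta> x v\<close>. Conversely, such weights force equality.

  With fewer than three vertices per class on average, two classes of size 2 exist. Comparing their
  weights leaves \<open>\<theta>\<close> equal to 1 (complete graphs), to the golden ratio (the graph \<open>F\<close>), or to 2; in the
  last case all weights can be scaled to 1 or 1/2, and the classes have sizes 2, 5 or 8.

  For \<open>\<theta> = 2\<close>, project the vertices outside the classes of size 2 to the orthogonal complement of the
  vertices inside, with respect to \<open>A + 2I\<close>. The Gram matrix of the projections is explicit, and its
  positivity leaves few possibilities. A vertex outside selects one vertex from each class of size 2;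
  for a class of size 8 and seven classes of size 2 the selections that differ from a fixed one form
  a Fano plane, whose uniqueness yields \<open>M\<^sub>2\<^sub>1\<close>. The other cases are parts of this configuration,
  apart from \<open>M\<^sub>1\<^sub>0\<close>.
\<close>

section \<open>Quadratic forms on a finite set\<close>

text \<open>The locale \<open>hoffman_system\<close> keeps exactly what survives both recoloring and
  passing to some of the classes: positive semidefiniteness, positive weights and regularity between
  classes. For \<theta> = 2 let p, q, o be the numbers of classes of sizes 2, 5, 8. Order below 3k
  means 2q + 5o < p. A vertex of weight 1/2 is a sign vector of length p with diagonal entry 7 - p
  in \<open>kern\<close>, so p is at most 7; a class of size 5 lowers this to 6. Hence o = 1 and q =
  0, or o = 0 and q is at most 2. The obstacle is that optimal colorings are not unique: two classes
  of sizes 2 and 8 may be regrouped into two of size 5. Graphs are therefore compared through sign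
  tables, independently of the coloring. Two classes of size 5 lead back to size 8 unless their
  vertices of weight 1 are adjacent; this exception is M_10. Components of odd order arise from the
  coloring of M_21 with two classes of size 5, the one of order 20 from the coloring with a class of
  size 8.\<close>

definition qform :: "'a set \<Rightarrow> ('a \<Rightarrow> 'a \<Rightarrow> real) \<Rightarrow> ('a \<Rightarrow> real) \<Rightarrow> real" where
  "qform V M y = (\<Sum>u\<in>V. \<Sum>v\<in>V. M u v * y u * y v)"

definition psd_on :: "'a set \<Rightarrow> ('a \<Rightarrow> 'a \<Rightarrow> real) \<Rightarrow> bool" where
  "psd_on V M \<longleftrightarrow> (\<forall>y. 0 \<le> qform V M y)"

lemma qform_alt: "qform V M y = (\<Sum>u\<in>V. y u * (\<Sum>v\<in>V. M u v * y v))"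
  by (simp add: qform_def sum_distrib_left mult_ac)

lemma qform_cong:
  assumes "\<And>u v. u \<in> V \<Longrightarrow> v \<in> V \<Longrightarrow> M u v = N u v" "\<And>u. u \<in> V \<Longrightarrow> y u = z u"
  shows "qform V M y = qform V N z"
  unfolding qform_def by (intro sum.cong refl) (simp add: assms)

lemma qform_add_scaled:
  assumes "\<And>u v. u \<in> V \<Longrightarrow> v \<in> V \<Longrightarrow> M u v = M v u"
  shows "qform V M (\<lambda>u. s * y u + t * z u) =
    s\<^sup>2 * qform V M y + 2 * s * t * (\<Sum>u\<in>V. z u * (\<Sum>v\<in>V. M u v * y v)) + t\<^sup>2 * qform V M z"
proof -
  have 1: "(\<Sum>u\<in>V. \<Sum>v\<in>V. M u v * y u * z v) = (\<Sum>u\<in>V. \<Sum>v\<in>V. M u v * z u * y v)"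
  proof -
    have "(\<Sum>u\<in>V. \<Sum>v\<in>V. M u v * y u * z v) = (\<Sum>v\<in>V. \<Sum>u\<in>V. M u v * y u * z v)"
      by (rule sum.swap)
    also have "\<dots> = (\<Sum>u\<in>V. \<Sum>v\<in>V. M u v * z u * y v)"
      by (intro sum.cong refl) (simp add: assms)
    finally show ?thesis .
  qed
  have "qform V M (\<lambda>u. s * y u + t * z u) =
     (\<Sum>u\<in>V. \<Sum>v\<in>V. s\<^sup>2 * (M u v * y u * y v) + s * t * (M u v * y u * z v)
        + s * t * (M u v * z u * y v) + t\<^sup>2 * (M u v * z u * z v))"
    unfolding qform_def by (intro sum.cong refl) (simp add: algebra_simps power2_eq_square)
  also have "\<dots> = s\<^sup>2 * qform V M y + s * t * (\<Sum>u\<in>V. \<Sum>v\<in>V. M u v * y u * z v)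
     + s * t * (\<Sum>u\<in>V. \<Sum>v\<in>V. M u v * z u * y v) + t\<^sup>2 * qform V M z"
    unfolding qform_def by (simp add: sum.distrib sum_distrib_left)
  also have "\<dots> = s\<^sup>2 * qform V M y + 2 * s * t * (\<Sum>u\<in>V. \<Sum>v\<in>V. M u v * z u * y v)
      + t\<^sup>2 * qform V M z"
    unfolding 1 by simp
  also have "(\<Sum>u\<in>V. \<Sum>v\<in>V. M u v * z u * y v) = (\<Sum>u\<in>V. z u * (\<Sum>v\<in>V. M u v * y v))"
    by (simp add: sum_distrib_left mult_ac)
  finally show ?thesis .
qed

text \<open>Moving from \<open>y\<close> in the direction of \<open>M y\<close> adds a linear and a
  quadratic term to the form. A nonzero linear coefficient would make the form negative for a small
  step of the right sign.\<close>

lemma psd_on_null: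
  assumes fin: "finite V" and sym: "\<And>u v. u \<in> V \<Longrightarrow> v \<in> V \<Longrightarrow> M u v = M v u"
    and psd: "psd_on V M" and null: "qform V M y = 0" and v: "v \<in> V"
  shows "(\<Sum>u\<in>V. M v u * y u) = 0"
proof -
  define g where "g u = (\<Sum>w\<in>V. M u w * y w)" for u
  define S where "S = (\<Sum>u\<in>V. g u * g u)"
  define q where "q = qform V M g"
  have q0: "0 \<le> q" using psd by (simp add: psd_on_def q_def)
  have *: "0 \<le> 2 * t * S + t\<^sup>2 * q" for t
  proof -
    have "0 \<le> qform V M (\<lambda>u. 1 * y u + t * g u)" using psd by (simp add: psd_on_def)
    also have "\<dots> = 2 * t * S + t\<^sup>2 * q"
      by (subst qform_add_scaled[OF sym]) (simp_all add: null S_def q_def g_def)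
    finally show ?thesis .
  qed
  have "S = 0"
  proof (rule ccontr)
    assume "S \<noteq> 0"
    \<comment> \<open>The parabola has its minimum at - S / q; the denominator q + 1 also serves
      when q = 0.\<close>
    have "2 * (- S / (q + 1)) * S + (- S / (q + 1))\<^sup>2 * q = - (S\<^sup>2 * (q + 2)) / (q + 1)\<^sup>2"
    proof -
      define r where "r = q + 1"
      have "r \<noteq> 0" using q0 by (auto simp: r_def)
      then have "2 * (- S / r) * S + (- S / r)\<^sup>2 * q = - (S\<^sup>2 * (2 * r - q)) / r\<^sup>2"
        by (simp add: field_simps power2_eq_square)
      then show ?thesis by (simp add: r_def)
    qed
    moreover have "0 < S\<^sup>2 * (q + 2)" using \<open>S \<noteq> 0\<close> q0 by (simp add: zero_less_mult_iff)
    moreover have "0 < (q + 1)\<^sup>2" using q0 by simp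
    ultimately show False using *[of "- S / (q + 1)"]
      by (smt (verit) divide_neg_pos)
  qed
  then have "g v * g v = 0"
    using fin v unfolding S_def by (subst (asm) sum_nonneg_eq_0_iff) auto
  then show ?thesis by (simp add: g_def)
qed

lemma psd_on_subset:
  assumes "finite V" "S \<subseteq> V" "psd_on V M"
  shows "psd_on S M"
  unfolding psd_on_def
proof
  fix y :: "'a \<Rightarrow> real"
  define z where "z u = (if u \<in> S then y u else (0::real))" for u
  have "qform V M z = (\<Sum>u\<in>S. \<Sum>v\<in>V. M u v * z u * z v)"
    unfolding qform_def
    by (intro sum.mono_neutral_right) (use assms in \<open>auto simp: z_def\<close>)
  also have "\<dots> = (\<Sum>u\<in>S. \<Sum>v\<in>S. M u v * z u * z v)"
    by (intro sum.cong refl sum.mono_neutral_right) (use assms in \<open>auto simp: z_def\<close>)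
  also have "\<dots> = qform S M y" unfolding qform_def by (intro sum.cong refl) (simp add: z_def)
  finally show "0 \<le> qform S M y" using assms(3) by (metis psd_on_def)
qed

lemma psd_on_gram:
  assumes "\<And>u v. u \<in> V \<Longrightarrow> v \<in> V \<Longrightarrow> M u v = (\<Sum>t\<in>T. l u t * l v t)" "finite T"
  shows "psd_on V M"
  unfolding psd_on_def
proof
  fix y :: "'a \<Rightarrow> real"
  have "qform V M y = (\<Sum>u\<in>V. \<Sum>v\<in>V. \<Sum>t\<in>T. (l u t * y u) * (l v t * y v))"
    unfolding qform_def
    by (intro sum.cong refl) (simp add: assms(1) sum_distrib_left sum_distrib_right mult_ac)
  also have "\<dots> = (\<Sum>u\<in>V. \<Sum>t\<in>T. \<Sum>v\<in>V. (l u t * y u) * (l v t * y v))"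
    by (intro sum.cong refl) (rule sum.swap)
  also have "\<dots> = (\<Sum>t\<in>T. \<Sum>u\<in>V. \<Sum>v\<in>V. (l u t * y u) * (l v t * y v))"
    by (rule sum.swap)
  also have "\<dots> = (\<Sum>t\<in>T. (\<Sum>u\<in>V. l u t * y u)\<^sup>2)"
    by (intro sum.cong refl) (simp add: power2_eq_square sum_product)
  also have "\<dots> \<ge> 0" by (intro sum_nonneg) simp
  finally show "0 \<le> qform V M y" .
qed

lemma qform_minimum:
  fixes M :: "'a \<Rightarrow> 'a \<Rightarrow> real"
  assumes fin: "finite V" and ne: "V \<noteq> {}"
  obtains f where "(\<Sum>v\<in>V. (f v)\<^sup>2) = 1"
    "\<And>y. (\<Sum>v\<in>V. (y v)\<^sup>2) = 1 \<Longrightarrow> qform V M f \<le> qform V M y"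
proof -
  \<comment> \<open>Coordinates outside \<open>V\<close> are pinned to 0, so that \<open>B\<close>
    is a product of compact sets although the index type may be infinite.\<close>
  define B where "B = (PiE UNIV (\<lambda>v. if v \<in> V then {-1..1} else {0}) :: ('a \<Rightarrow> real) set)"
  define K where "K = B \<inter> {f. (\<Sum>v\<in>V. (f v)\<^sup>2) = 1}"
  have "compactin (product_topology (\<lambda>_. euclidean) UNIV) B"
    unfolding B_def by (subst compactin_PiE) auto
  then have "compact B" by (simp add: euclidean_product_topology)
  moreover have "closed {f :: 'a \<Rightarrow> real. (\<Sum>v\<in>V. (f v)\<^sup>2) = 1}"
    by (intro closed_Collect_eq continuous_intros continuous_on_product_coordinates)
  ultimately have "compact K" unfolding K_def by (rule compact_Int_closed)
  obtain v0 where v0: "v0 \<in> V" using ne by auto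
  have "(\<lambda>v. if v = v0 then 1 else 0) \<in> K"
    using v0 fin by (auto simp: K_def B_def if_distrib[of "\<lambda>x. x\<^sup>2"] cong: if_cong)
  then have "K \<noteq> {}" by auto
  moreover have "continuous_on K (qform V M)"
    unfolding qform_def
    by (intro continuous_intros) (auto intro: continuous_on_subset[OF continuous_on_product_coordinates])
  ultimately obtain f where f: "f \<in> K" "\<And>y. y \<in> K \<Longrightarrow> qform V M f \<le> qform V M y"
    using continuous_attains_inf[OF \<open>compact K\<close>] by blast
  show thesis
  proof
    show "(\<Sum>v\<in>V. (f v)\<^sup>2) = 1" using f(1) by (simp add: K_def)
    fix y :: "'a \<Rightarrow> real" assume y: "(\<Sum>v\<in>V. (y v)\<^sup>2) = 1"
    define z where "z v = (if v \<in> V then y v else 0)" for v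
    have "(y v)\<^sup>2 \<le> 1" if "v \<in> V" for v
      using member_le_sum[OF that, of "\<lambda>v. (y v)\<^sup>2"] fin y by simp
    then have "z \<in> B" unfolding B_def z_def by (auto simp: abs_square_le_1 abs_le_iff minus_le_iff)
    moreover have "(\<Sum>v\<in>V. (z v)\<^sup>2) = 1" using y by (simp add: z_def)
    ultimately have "qform V M f \<le> qform V M z" by (intro f(2)) (simp add: K_def)
    also have "qform V M z = qform V M y" by (rule qform_cong) (simp_all add: z_def)
    finally show "qform V M f \<le> qform V M y" .
  qed
qed

abbreviation diag :: "real \<Rightarrow> 'a \<Rightarrow> 'a \<Rightarrow> real" where
  "diag t u v \<equiv> (if u = v then t else 0)"

lemma qform_diag:
  assumes "finite V"
  shows "qform V (\<lambda>u v. M u v + diag t u v) y = qform V M y + t * (\<Sum>v\<in>V. (y v)\<^sup>2)"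
proof -
  have "(\<Sum>u\<in>V. \<Sum>v\<in>V. diag t u v * y u * y v) = (\<Sum>u\<in>V. t * (y u)\<^sup>2)"
    using assms by (intro sum.cong refl) (simp add: if_distrib[of "\<lambda>x. x * _"] power2_eq_square cong: if_cong)
  then show ?thesis
    by (simp add: qform_def distrib_right sum.distrib sum_distrib_left)
qed

lemma sum_diag:
  assumes "finite V" "u \<in> V"
  shows "(\<Sum>v\<in>V. (M u v + diag t u v) * y v) = (\<Sum>v\<in>V. M u v * y v) + t * y u"
  using assms by (simp add: distrib_right sum.distrib if_distrib[of "\<lambda>x. x * _"] cong: if_cong)

text \<open>Subtracting the minimum \<mu> of the form on the unit sphere leaves a positive
  semidefinite form with the minimizer as null vector; \<open>psd_on_null\<close> turns this into
  the eigenvalue equation.\<close>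

lemma least_eigenvalue:
  fixes M :: "'a \<Rightarrow> 'a \<Rightarrow> real"
  assumes fin: "finite V" and ne: "V \<noteq> {}"
    and sym: "\<And>u v. u \<in> V \<Longrightarrow> v \<in> V \<Longrightarrow> M u v = M v u"
  obtains f \<mu> where "\<exists>v\<in>V. f v \<noteq> 0" "\<And>v. v \<in> V \<Longrightarrow> (\<Sum>u\<in>V. M v u * f u) = \<mu> * f v"
    "psd_on V (\<lambda>u v. M u v + diag (- \<mu>) u v)"
proof -
  obtain f where f: "(\<Sum>v\<in>V. (f v)\<^sup>2) = 1"
    and min: "\<And>y. (\<Sum>v\<in>V. (y v)\<^sup>2) = 1 \<Longrightarrow> qform V M f \<le> qform V M y"
    using qform_minimum[OF fin ne, of M] by blast
  define \<mu> where "\<mu> = qform V M f"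
  let ?N = "\<lambda>u v. M u v + diag (- \<mu>) u v"
  have psd: "psd_on V ?N"
    unfolding psd_on_def
  proof
    fix y :: "'a \<Rightarrow> real"
    define r where "r = (\<Sum>v\<in>V. (y v)\<^sup>2)"
    show "0 \<le> qform V ?N y"
    proof (cases "r = 0")
      case True
      then have "\<And>v. v \<in> V \<Longrightarrow> y v = 0"
        unfolding r_def using fin by (subst (asm) sum_nonneg_eq_0_iff) auto
      then have "qform V ?N y = 0" unfolding qform_alt by simp
      then show ?thesis by simp
    next
      case False
      then have r: "r > 0" unfolding r_def using sum_nonneg[of V "\<lambda>v. (y v)\<^sup>2"] by simp
      have "(\<Sum>v\<in>V. (y v / sqrt r)\<^sup>2) = (\<Sum>v\<in>V. (y v)\<^sup>2 / r)"
        using r by (intro sum.cong refl) (simp add: power_divide)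
      also have "\<dots> = 1" using r by (simp add: r_def flip: sum_divide_distrib)
      finally have "\<mu> \<le> qform V M (\<lambda>v. y v / sqrt r)" unfolding \<mu>_def by (rule min)
      also have "qform V M (\<lambda>v. y v / sqrt r) = (\<Sum>u\<in>V. \<Sum>v\<in>V. M u v * y u * y v / r)"
        unfolding qform_def using r by (intro sum.cong refl) (simp add: field_simps)
      also have "\<dots> = qform V M y / r" by (simp add: qform_def sum_divide_distrib)
      finally have "\<mu> * r \<le> qform V M y" using r by (simp add: field_simps)
      then show ?thesis by (simp add: qform_diag[OF fin] r_def)
    qed
  qed
  have "qform V ?N f = 0" by (simp add: qform_diag[OF fin] f \<mu>_def)
  then have null: "(\<Sum>u\<in>V. ?N v u * f u) = 0" if "v \<in> V" for v
    using fin sym psd that by (intro psd_on_null[of V ?N]) auto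
  have "(\<Sum>u\<in>V. M v u * f u) = \<mu> * f v" if "v \<in> V" for v
    using null[OF that] by (simp add: sum_diag[OF fin that])
  moreover have "\<exists>v\<in>V. f v \<noteq> 0" using f by (rule_tac ccontr) simp
  ultimately show thesis using psd that by blast
qed

section \<open>Eigenvalues and Hoffman's bound\<close>

abbreviation adj :: "('a \<Rightarrow> 'a \<Rightarrow> bool) \<Rightarrow> 'a \<Rightarrow> 'a \<Rightarrow> real" where
  "adj E u v \<equiv> of_bool (E u v)"

definition eigvals :: "'a set \<Rightarrow> ('a \<Rightarrow> 'a \<Rightarrow> bool) \<Rightarrow> real set" where
  "eigvals V E = {\<mu>. \<exists>f. (\<exists>v\<in>V. f v \<noteq> 0) \<and> (\<forall>v\<in>V. (\<Sum>u\<in>V. adj E v u * f u) = \<mu> * f v)}"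

lemma eigvalsI:
  assumes "v \<in> V" "f v \<noteq> 0" "\<And>v. v \<in> V \<Longrightarrow> (\<Sum>u\<in>V. adj E v u * f u) = \<mu> * f v"
  shows "\<mu> \<in> eigvals V E"
  using assms unfolding eigvals_def by blast

lemma eigval_psd_bound:
  assumes "finite V" "psd_on V (\<lambda>u v. adj E u v + diag \<theta> u v)" "\<mu> \<in> eigvals V E"
  shows "- \<theta> \<le> \<mu>"
proof -
  obtain f where f: "\<exists>v\<in>V. f v \<noteq> 0" "\<And>v. v \<in> V \<Longrightarrow> (\<Sum>u\<in>V. adj E v u * f u) = \<mu> * f v"
    using assms(3) by (auto simp: eigvals_def)
  define r where "r = (\<Sum>v\<in>V. (f v)\<^sup>2)"
  have "r \<noteq> 0" unfolding r_def using f(1) assms(1) by (subst sum_nonneg_eq_0_iff) auto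
  then have r: "r > 0" unfolding r_def using sum_nonneg[of V "\<lambda>v. (f v)\<^sup>2"] by simp
  have "0 \<le> qform V (adj E) f + \<theta> * r"
    using assms(2) by (simp add: psd_on_def qform_diag[OF assms(1)] r_def)
  also have "qform V (adj E) f = (\<Sum>v\<in>V. \<mu> * (f v)\<^sup>2)"
    unfolding qform_alt by (intro sum.cong refl) (simp add: f(2) power2_eq_square)
  also have "\<dots> = \<mu> * r" by (simp add: r_def sum_distrib_left)
  finally have "0 \<le> (\<mu> + \<theta>) * r" by (simp add: algebra_simps)
  then show ?thesis using r by (simp add: zero_le_mult_iff)
qed

text \<open>The eigenvalue equation for \<open>f\<close> is evaluated at a vertex where the quotient
  of \<bar>f\<bar> by \<open>x\<close> is largest.\<close>

lemma positive_eigenvector_bound: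
  assumes fin: "finite V" and x: "\<And>v. v \<in> V \<Longrightarrow> x v > 0"
    and eig: "\<And>v. v \<in> V \<Longrightarrow> (\<Sum>u\<in>V. adj E v u * x u) = lam * x v" and mu: "\<mu> \<in> eigvals V E"
  shows "\<mu> \<le> lam"
proof -
  obtain f where f: "\<exists>v\<in>V. f v \<noteq> 0" "\<And>v. v \<in> V \<Longrightarrow> (\<Sum>u\<in>V. adj E v u * f u) = \<mu> * f v"
    using mu by (auto simp: eigvals_def)
  obtain v where v: "v \<in> V" and max: "\<And>u. u \<in> V \<Longrightarrow> \<bar>f u\<bar> / x u \<le> \<bar>f v\<bar> / x v"
  proof -
    let ?S = "(\<lambda>u. \<bar>f u\<bar> / x u) ` V"
    have "Max ?S \<in> ?S" using f(1) fin by (intro Max_in) auto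
    then obtain v where "v \<in> V" "Max ?S = \<bar>f v\<bar> / x v" by auto
    moreover have "\<bar>f u\<bar> / x u \<le> Max ?S" if "u \<in> V" for u using fin that by (intro Max_ge) auto
    ultimately show thesis using that by metis
  qed
  define r where "r = \<bar>f v\<bar> / x v"
  have le: "\<bar>f u\<bar> \<le> r * x u" if "u \<in> V" for u
    using max[OF that] x[OF that] by (simp add: r_def field_simps)
  have fv: "\<bar>f v\<bar> = r * x v" using x[OF v] by (simp add: r_def)
  have "r > 0"
  proof -
    obtain w where "w \<in> V" "f w \<noteq> 0" using f(1) by blast
    then have "0 < r * x w" using le[of w] by linarith
    then show ?thesis using x[of w] \<open>w \<in> V\<close> by (simp add: zero_less_mult_iff)
  qed
  have "\<mu> * \<bar>f v\<bar> \<le> \<bar>\<mu> * f v\<bar>" by (simp add: abs_mult mult_right_mono)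
  also have "\<dots> = \<bar>\<Sum>u\<in>V. adj E v u * f u\<bar>" using f(2)[OF v] by simp
  also have "\<dots> \<le> (\<Sum>u\<in>V. \<bar>adj E v u * f u\<bar>)" by (rule sum_abs)
  also have "\<dots> \<le> (\<Sum>u\<in>V. r * (adj E v u * x u))"
    by (intro sum_mono) (use le in \<open>auto simp: abs_mult\<close>)
  also have "\<dots> = r * (lam * x v)" by (simp add: eig[OF v] flip: sum_distrib_left)
  also have "\<dots> = lam * \<bar>f v\<bar>" by (simp add: fv)
  finally show ?thesis using \<open>r > 0\<close> x[OF v] fv by (simp add: mult_le_cancel_right)
qed

definition connected_on :: "'a set \<Rightarrow> ('a \<Rightarrow> 'a \<Rightarrow> bool) \<Rightarrow> bool" where
  "connected_on V E \<longleftrightarrow> (\<forall>u\<in>V. \<forall>v\<in>V. (u, v) \<in> {(a, b). a \<in> V \<and> b \<in> V \<and> E a b}\<^sup>*)"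

lemma connected_on_closed:
  assumes "connected_on V E" "v \<in> V" "P v" "\<And>a b. a \<in> V \<Longrightarrow> b \<in> V \<Longrightarrow> E a b \<Longrightarrow> P a \<Longrightarrow> P b" "u \<in> V"
  shows "P u"
proof -
  have "(v, u) \<in> {(a, b). a \<in> V \<and> b \<in> V \<and> E a b}\<^sup>*" using assms by (auto simp: connected_on_def)
  then show ?thesis
    by (induction rule: rtrancl_induct) (use assms in auto)
qed

text \<open>The matrix is negated so that the largest eigenvalue becomes a minimum. Its entries are
  then at most 0, so taking absolute values does not increase the form and \<bar>f\<bar> is a
  minimizer as well. A zero of it would spread along edges to the whole connected graph.\<close>

lemma perron_vector:
  assumes fin: "finite V" and ne: "V \<noteq> {}" and sym: "\<And>u v. E u v \<Longrightarrow> E v u"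
    and con: "connected_on V E"
  obtains x lam where "\<And>v. v \<in> V \<Longrightarrow> x v > 0"
    "\<And>v. v \<in> V \<Longrightarrow> (\<Sum>u\<in>V. adj E v u * x u) = lam * x v"
proof -
  let ?M = "\<lambda>u v. - adj E u v"
  have symM: "?M u v = ?M v u" for u v using sym by (auto simp: of_bool_def)
  obtain f \<mu> where f: "\<exists>v\<in>V. f v \<noteq> 0" "\<And>v. v \<in> V \<Longrightarrow> (\<Sum>u\<in>V. ?M v u * f u) = \<mu> * f v"
    and psd: "psd_on V (\<lambda>u v. ?M u v + diag (- \<mu>) u v)"
    using least_eigenvalue[of V ?M, OF fin ne symM] by blast
  let ?N = "\<lambda>u v. ?M u v + diag (- \<mu>) u v"
  define x where "x v = \<bar>f v\<bar>" for v
  have "qform V ?N x \<le> qform V ?N f"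
  proof -
    have "\<bar>f u\<bar> * \<bar>f v\<bar> \<ge> f u * f v" for u v by (simp flip: abs_mult)
    then have "qform V ?M x \<le> qform V ?M f"
      unfolding qform_def x_def by (intro sum_mono) (auto simp: mult.assoc)
    then show ?thesis unfolding qform_diag[OF fin] by (simp only: x_def power2_abs add_right_mono)
  qed
  also have "qform V ?N f = 0"
    unfolding qform_alt
    by (intro sum.neutral ballI) (subst sum_diag[OF fin], simp, simp only: f(2), simp)
  finally have "qform V ?N x = 0" using psd by (auto simp: psd_on_def intro: antisym)
  then have null: "(\<Sum>u\<in>V. ?N v u * x u) = 0" if "v \<in> V" for v
    using fin symM psd that by (intro psd_on_null[of V ?N]) auto
  have eig: "(\<Sum>u\<in>V. adj E v u * x u) = - \<mu> * x v" if "v \<in> V" for v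
    using null[OF that] sum_diag[OF fin that, of ?M "- \<mu>" x] by (simp add: sum_negf)
  have "x v > 0" if v: "v \<in> V" for v
  proof (rule ccontr)
    assume "\<not> x v > 0"
    then have "x v = 0" by (simp add: x_def)
    have step: "x b = 0" if "a \<in> V" "b \<in> V" "E a b" "x a = 0" for a b
    proof -
      have "(\<Sum>u\<in>V. adj E a u * x u) = 0" using eig[OF that(1)] that(4) by simp
      then have "adj E a b * x b = 0"
        using fin that(2) by (subst (asm) sum_nonneg_eq_0_iff) (auto simp: x_def)
      then show ?thesis using that by simp
    qed
    have "x u = 0" if "u \<in> V" for u
      by (rule connected_on_closed[OF con v, of "\<lambda>v. x v = 0"]) (use \<open>x v = 0\<close> step that in auto)
    then show False using f(1) by (auto simp: x_def)
  qed
  then show thesis using eig that by blast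
qed

context
  fixes V :: "'a set" and E :: "'a \<Rightarrow> 'a \<Rightarrow> bool" and x :: "'a \<Rightarrow> real" and c :: "'a \<Rightarrow> nat"
    and m :: nat and \<theta> lam :: real
  assumes fin: "finite V" and sym: "\<And>u v. E u v \<Longrightarrow> E v u"
    and irr: "\<And>u. \<not> E u u"
    and psd: "psd_on V (\<lambda>u v. adj E u v + diag \<theta> u v)"
    and eig: "\<And>v. v \<in> V \<Longrightarrow> (\<Sum>u\<in>V. adj E v u * x u) = lam * x v"
    and col: "\<And>v. v \<in> V \<Longrightarrow> c v < m"
    and proper: "\<And>u v. u \<in> V \<Longrightarrow> v \<in> V \<Longrightarrow> E u v \<Longrightarrow> c u \<noteq> c v"
begin

private definition B where "B u v = adj E u v + diag \<theta> u v"
private definition xc where "xc i v = (if c v = i then x v else 0)"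

private lemma B_sym: "B u v = B v u"
  unfolding B_def using sym by (auto simp: of_bool_def)

private lemma B_eig: "v \<in> V \<Longrightarrow> (\<Sum>u\<in>V. B v u * x u) = (lam + \<theta>) * x v"
  unfolding B_def using sum_diag[OF fin, of v "adj E" \<theta> x] eig[of v] by (simp add: algebra_simps)

private lemma qform_xc: "qform V B (xc i) = \<theta> * (\<Sum>v\<in>V. (xc i v)\<^sup>2)"
proof -
  have "qform V (adj E) (xc i) = 0"
    unfolding qform_def by (intro sum.neutral ballI) (auto simp: xc_def dest: proper)
  then show ?thesis unfolding B_def by (simp add: qform_diag[OF fin])
qed

private lemma sum_xc: "v \<in> V \<Longrightarrow> (\<Sum>i<m. xc i v) = x v" "v \<in> V \<Longrightarrow> (\<Sum>i<m. (xc i v)\<^sup>2) = (x v)\<^sup>2"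
  using col by (auto simp: xc_def if_distrib[of "\<lambda>x. x\<^sup>2"] cong: if_cong)

text \<open>The test vectors are m times the restriction of \<open>x\<close> to a class, minus
  \<open>x\<close>. Classes are cocliques, so the form of a restriction is \<theta> times its
  squared norm, which gives the sum a closed form. Its nonnegativity is Hoffman's bound; if it is 0,
  every test vector is a null vector.\<close>

private lemma qform_sum:
  "(\<Sum>i<m. qform V B (\<lambda>u. real m * xc i u + (- 1) * x u)) =
     real m * (real m * \<theta> - (lam + \<theta>)) * (\<Sum>v\<in>V. (x v)\<^sup>2)"
proof -
  define r where "r = (\<Sum>v\<in>V. (x v)\<^sup>2)"
  have qx: "qform V B x = (lam + \<theta>) * r"
  proof -
    have "qform V B x = (\<Sum>v\<in>V. (lam + \<theta>) * (x v)\<^sup>2)"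
      unfolding qform_alt by (intro sum.cong refl) (simp add: B_eig power2_eq_square)
    then show ?thesis by (simp add: r_def sum_distrib_left)
  qed
  have mixed: "(\<Sum>i<m. \<Sum>u\<in>V. x u * (\<Sum>v\<in>V. B u v * xc i v)) = (lam + \<theta>) * r"
  proof -
    have "(\<Sum>i<m. \<Sum>u\<in>V. x u * (\<Sum>v\<in>V. B u v * xc i v)) = (\<Sum>u\<in>V. \<Sum>i<m. x u * (\<Sum>v\<in>V. B u v * xc i v))"
      by (rule sum.swap)
    also have "\<dots> = (\<Sum>u\<in>V. x u * (\<Sum>i<m. \<Sum>v\<in>V. B u v * xc i v))"
      by (simp add: sum_distrib_left)
    also have "\<dots> = (\<Sum>u\<in>V. x u * (\<Sum>v\<in>V. B u v * x v))"
    proof (intro sum.cong refl arg_cong2[of _ _ _ _ "(*)"])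
      fix u assume "u \<in> V"
      have "(\<Sum>i<m. \<Sum>v\<in>V. B u v * xc i v) = (\<Sum>v\<in>V. \<Sum>i<m. B u v * xc i v)" by (rule sum.swap)
      also have "\<dots> = (\<Sum>v\<in>V. B u v * x v)" by (simp add: sum_xc flip: sum_distrib_left)
      finally show "(\<Sum>i<m. \<Sum>v\<in>V. B u v * xc i v) = (\<Sum>v\<in>V. B u v * x v)" .
    qed
    also have "\<dots> = (lam + \<theta>) * r" using qx by (simp add: qform_alt)
    finally show ?thesis .
  qed
  have sq: "(\<Sum>i<m. qform V B (xc i)) = \<theta> * r"
  proof -
    have "(\<Sum>i<m. qform V B (xc i)) = \<theta> * (\<Sum>i<m. \<Sum>v\<in>V. (xc i v)\<^sup>2)"
      by (simp add: qform_xc sum_distrib_left)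
    also have "(\<Sum>i<m. \<Sum>v\<in>V. (xc i v)\<^sup>2) = (\<Sum>v\<in>V. \<Sum>i<m. (xc i v)\<^sup>2)" by (rule sum.swap)
    also have "\<dots> = r" by (simp add: sum_xc r_def)
    finally show ?thesis .
  qed
  have "(\<Sum>i<m. qform V B (\<lambda>u. real m * xc i u + (- 1) * x u)) =
     (\<Sum>i<m. (real m)\<^sup>2 * qform V B (xc i) - 2 * real m * (\<Sum>u\<in>V. x u * (\<Sum>v\<in>V. B u v * xc i v)) + (lam + \<theta>) * r)"
    by (intro sum.cong refl) (subst qform_add_scaled[OF B_sym], simp add: qx)
  also have "\<dots> = (real m)\<^sup>2 * (\<theta> * r) - 2 * real m * ((lam + \<theta>) * r) + real m * ((lam + \<theta>) * r)"
    by (simp add: sum.distrib sum_subtractf sq mixed flip: sum_distrib_left)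
  finally show ?thesis by (simp add: r_def algebra_simps power2_eq_square)
qed

private lemma qform_B_nonneg: "0 \<le> qform V B y"
  using psd unfolding psd_on_def B_def by simp

lemma hoffman_coloring_bound:
  assumes "\<exists>v\<in>V. x v \<noteq> 0"
  shows "lam + \<theta> \<le> real m * \<theta>"
proof -
  have "m > 0" using assms col by (metis gr_implies_not0 bot_nat_0.not_eq_extremum)
  have "(\<Sum>v\<in>V. (x v)\<^sup>2) \<noteq> 0" using assms fin by (subst sum_nonneg_eq_0_iff) auto
  then have r: "(\<Sum>v\<in>V. (x v)\<^sup>2) > 0" using sum_nonneg[of V "\<lambda>v. (x v)\<^sup>2"] by simp
  have "0 \<le> real m * (real m * \<theta> - (lam + \<theta>)) * (\<Sum>v\<in>V. (x v)\<^sup>2)"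
    unfolding qform_sum[symmetric] by (intro sum_nonneg qform_B_nonneg)
  then show ?thesis using r \<open>m > 0\<close> by (simp add: zero_le_mult_iff)
qed

lemma hoffman_coloring_regular:
  assumes eq: "lam = (real m - 1) * \<theta>" and i: "i < m" and v: "v \<in> V" and "c v \<noteq> i"
  shows "(\<Sum>u | u \<in> V \<and> c u = i \<and> E v u. x u) = \<theta> * x v"
proof -
  have "(\<Sum>i<m. qform V B (\<lambda>u. real m * xc i u + (- 1) * x u)) = 0"
    unfolding qform_sum eq by (simp add: algebra_simps)
  then have "qform V B (\<lambda>u. real m * xc i u + (- 1) * x u) = 0"
    using i by (subst (asm) sum_nonneg_eq_0_iff) (auto simp: qform_B_nonneg)
  then have "(\<Sum>u\<in>V. B v u * (real m * xc i u + (- 1) * x u)) = 0"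
    using psd B_sym v fin by (intro psd_on_null[of V B]) (auto simp: B_def[abs_def])
  then have "real m * (\<Sum>u\<in>V. B v u * xc i u) = (\<Sum>u\<in>V. B v u * x u)"
    by (simp add: algebra_simps sum.distrib sum_negf sum_distrib_left sum_subtractf)
  also have "\<dots> = real m * (\<theta> * x v)" unfolding B_eig[OF v] eq by (simp add: algebra_simps)
  finally have "(\<Sum>u\<in>V. B v u * xc i u) = \<theta> * x v" using i by simp
  moreover have "(\<Sum>u\<in>V. B v u * xc i u) = (\<Sum>u\<in>V. adj E v u * xc i u)"
    unfolding B_def using sum_diag[OF fin v, of "adj E" \<theta> "xc i"] \<open>c v \<noteq> i\<close>
    by (simp add: xc_def[of i v])
  moreover have "(\<Sum>u\<in>V. adj E v u * xc i u) = (\<Sum>u | u \<in> V \<and> c u = i \<and> E v u. x u)"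
    by (rule sum.mono_neutral_cong_right) (use fin in \<open>auto simp: xc_def\<close>)
  ultimately show ?thesis by simp
qed

end

section \<open>Digraphs as relations\<close>

abbreviation edge :: "('a, 'b) pre_digraph \<Rightarrow> 'a \<Rightarrow> 'a \<Rightarrow> bool" where
  "edge G \<equiv> \<lambda>u v. u \<rightarrow>\<^bsub>G\<^esub> v"

lemma graph_edge:
  assumes "Digraph.graph G"
  shows "finite (verts G)" "u \<rightarrow>\<^bsub>G\<^esub> v \<Longrightarrow> v \<rightarrow>\<^bsub>G\<^esub> u" "\<not> u \<rightarrow>\<^bsub>G\<^esub> u"
    "u \<rightarrow>\<^bsub>G\<^esub> v \<Longrightarrow> u \<in> verts G" "u \<rightarrow>\<^bsub>G\<^esub> v \<Longrightarrow> v \<in> verts G"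
proof -
  interpret G: Digraph.graph G by fact
  show "finite (verts G)" by simp
  show "u \<rightarrow>\<^bsub>G\<^esub> v \<Longrightarrow> v \<rightarrow>\<^bsub>G\<^esub> u"
    using G.sym_arcs by (auto dest: arcs_ends_symmetric)
  show "\<not> u \<rightarrow>\<^bsub>G\<^esub> u" by (auto simp: arcs_ends_conv dest: G.no_loops)
  show "u \<rightarrow>\<^bsub>G\<^esub> v \<Longrightarrow> u \<in> verts G" "u \<rightarrow>\<^bsub>G\<^esub> v \<Longrightarrow> v \<in> verts G"
    by (auto simp: arcs_ends_conv)
qed

lemma graph_with_projI:
  assumes "finite (pverts G)" "parcs G \<subseteq> pverts G \<times> pverts G" "sym (parcs G)"
    "\<And>u. (u, u) \<notin> parcs G"
  shows "Digraph.graph (with_proj G)"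
proof -
  have "finite (parcs G)" using assms(1,2) by (meson finite_SigmaI finite_subset)
  then show ?thesis using assms
    by unfold_locales (auto simp: arc_to_ends_def symmetric_def prod_eq_iff)
qed

definition rel_iso :: "'a set \<Rightarrow> ('a \<Rightarrow> 'a \<Rightarrow> bool) \<Rightarrow> 'b set \<Rightarrow> ('b \<Rightarrow> 'b \<Rightarrow> bool) \<Rightarrow> bool" where
  "rel_iso V E W F \<longleftrightarrow> (\<exists>f. bij_betw f V W \<and> (\<forall>u\<in>V. \<forall>v\<in>V. E u v \<longleftrightarrow> F (f u) (f v)))"

lemma rel_iso_sym:
  assumes "rel_iso V E W F" shows "rel_iso W F V E"
proof -
  obtain f where f: "bij_betw f V W" "\<And>u v. u \<in> V \<Longrightarrow> v \<in> V \<Longrightarrow> E u v \<longleftrightarrow> F (f u) (f v)"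
    using assms by (auto simp: rel_iso_def)
  let ?g = "the_inv_into V f"
  have "bij_betw ?g W V" using f(1) by (rule bij_betw_the_inv_into)
  moreover have "F u v \<longleftrightarrow> E (?g u) (?g v)" if "u \<in> W" "v \<in> W" for u v
    using that f(2)[of "?g u" "?g v"] f(1) calculation
    by (auto simp: bij_betwE f_the_inv_into_f_bij_betw)
  ultimately show ?thesis by (auto simp: rel_iso_def)
qed

lemma rel_iso_trans:
  assumes "rel_iso V E W F" "rel_iso W F U D" shows "rel_iso V E U D"
proof -
  obtain f where f: "bij_betw f V W" "\<And>u v. u \<in> V \<Longrightarrow> v \<in> V \<Longrightarrow> E u v \<longleftrightarrow> F (f u) (f v)"
    using assms by (auto simp: rel_iso_def)
  obtain g where g: "bij_betw g W U" "\<And>u v. u \<in> W \<Longrightarrow> v \<in> W \<Longrightarrow> F u v \<longleftrightarrow> D (g u) (g v)"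
    using assms by (auto simp: rel_iso_def)
  have "bij_betw (g \<circ> f) V U" using f(1) g(1) by (rule bij_betw_trans)
  moreover have "E u v \<longleftrightarrow> D ((g \<circ> f) u) ((g \<circ> f) v)" if "u \<in> V" "v \<in> V" for u v
    using that f g by (auto simp: bij_betwE)
  ultimately show ?thesis by (auto simp: rel_iso_def)
qed

lemma digraph_iso_graph:
  assumes "Digraph.graph G" "digraph_iso G H"
  shows "Digraph.graph H \<and> rel_iso (verts G) (edge G) (verts H) (edge H)"
proof -
  interpret G: Digraph.graph G by fact
  obtain f where f: "G.digraph_isomorphism f" and H: "H = app_iso f G"
    using assms by (auto simp: digraph_iso_def)
  interpret H: fin_digraph H unfolding H using f by (rule G.fin_digraphI_app_iso)
  have inj: "inj_on (iso_verts f) (verts G)" and injA: "inj_on (iso_arcs f) (arcs G)"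
    and th: "\<And>a. a \<in> arcs G \<Longrightarrow> iso_tail f (iso_arcs f a) = iso_verts f (tail G a)"
      "\<And>a. a \<in> arcs G \<Longrightarrow> iso_head f (iso_arcs f a) = iso_verts f (head G a)"
    using f by (auto simp: G.digraph_isomorphism_def)
  have edge: "edge H a b \<longleftrightarrow> (\<exists>u v. a = iso_verts f u \<and> b = iso_verts f v \<and> edge G u v)" for a b
    unfolding H by (force simp: arcs_ends_conv th)
  have "Digraph.graph H"
  proof
    show "tail H e \<noteq> head H e" if e: "e \<in> arcs H" for e
    proof -
      obtain a where a: "a \<in> arcs G" "e = iso_arcs f a" using e unfolding H by auto
      then show ?thesis using G.no_loops[OF a(1)] inj by (auto simp: H th inj_on_eq_iff)
    qed
    show "e1 = e2" if e: "e1 \<in> arcs H" "e2 \<in> arcs H" "arc_to_ends H e1 = arc_to_ends H e2" for e1 e2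
    proof -
      obtain a b where a: "a \<in> arcs G" "e1 = iso_arcs f a" and b: "b \<in> arcs G" "e2 = iso_arcs f b"
        using e(1,2) unfolding H by auto
      have "arc_to_ends G a = arc_to_ends G b"
        using e(3) a b inj by (auto simp: H arc_to_ends_def th inj_on_eq_iff)
      then show ?thesis using G.no_multi_arcs a b by blast
    qed
    show "symmetric H"
      unfolding symmetric_def sym_def using edge graph_edge(2)[OF assms(1)] by blast
  qed
  moreover have "bij_betw (iso_verts f) (verts G) (verts H)"
    using inj by (simp add: bij_betw_def H)
  moreover have "edge G u v \<longleftrightarrow> edge H (iso_verts f u) (iso_verts f v)"
    if "u \<in> verts G" "v \<in> verts G" for u v
  proof
    assume "edge H (iso_verts f u) (iso_verts f v)"
    then obtain u' v' where "iso_verts f u = iso_verts f u'" "iso_verts f v = iso_verts f v'" "edge G u' v'"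
      using edge by auto
    moreover have "u' \<in> verts G" "v' \<in> verts G" using graph_edge[OF assms(1)] calculation by auto
    ultimately show "edge G u v" using inj that by (auto simp: inj_on_eq_iff)
  qed (use edge in auto)
  ultimately show ?thesis unfolding rel_iso_def by blast
qed

text \<open>Without parallel arcs the map on vertices determines the map on arcs.\<close>

lemma digraph_isoI:
  assumes G: "Digraph.graph G" and H: "Digraph.graph H"
    and iso: "rel_iso (verts G) (edge G) (verts H) (edge H)"
  shows "digraph_iso G H"
proof -
  interpret G: Digraph.graph G by fact
  interpret H: Digraph.graph H by fact
  obtain f where f: "bij_betw f (verts G) (verts H)"
    and fe: "\<And>u v. u \<in> verts G \<Longrightarrow> v \<in> verts G \<Longrightarrow> edge G u v \<longleftrightarrow> edge H (f u) (f v)"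
    using iso by (auto simp: rel_iso_def)
  have inj: "inj_on f (verts G)" and im: "f ` verts G = verts H" using f by (auto simp: bij_betw_def)
  have "\<exists>b. b \<in> arcs H \<and> tail H b = f (tail G a) \<and> head H b = f (head G a)" if "a \<in> arcs G" for a
  proof -
    have "edge G (tail G a) (head G a)" using that by (auto simp: arcs_ends_conv)
    then have "edge H (f (tail G a)) (f (head G a))" using that fe by auto
    then show ?thesis by (auto simp: arcs_ends_conv)
  qed
  then obtain g where g: "\<And>a. a \<in> arcs G \<Longrightarrow> g a \<in> arcs H \<and> tail H (g a) = f (tail G a) \<and> head H (g a) = f (head G a)"
    by metis
  have injg: "inj_on g (arcs G)"
  proof
    fix a b assume a: "a \<in> arcs G" and b: "b \<in> arcs G" and "g a = g b"
    then have "f (tail G a) = f (tail G b)" "f (head G a) = f (head G b)"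
      using g[OF a] g[OF b] by auto
    then have "arc_to_ends G a = arc_to_ends G b"
      using a b inj by (auto simp: arc_to_ends_def inj_on_eq_iff)
    then show "a = b" using G.no_multi_arcs a b by blast
  qed
  have img: "g ` arcs G = arcs H"
  proof
    show "arcs H \<subseteq> g ` arcs G"
    proof
      fix b assume b: "b \<in> arcs H"
      then have "tail H b \<in> f ` verts G" "head H b \<in> f ` verts G" using im by auto
      then obtain u v where uv: "u \<in> verts G" "v \<in> verts G" "tail H b = f u" "head H b = f v" by auto
      have "edge H (f u) (f v)" using b uv by (auto simp: arcs_ends_conv intro!: image_eqI[of _ _ b])
      then have "edge G u v" using fe uv by auto
      then obtain a where a: "a \<in> arcs G" "tail G a = u" "head G a = v" by (auto simp: arcs_ends_conv)
      have "arc_to_ends H (g a) = arc_to_ends H b" using g[OF a(1)] a uv by (simp add: arc_to_ends_def)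
      then have "g a = b" using H.no_multi_arcs g[OF a(1)] b by blast
      then show "b \<in> g ` arcs G" using a by blast
    qed
  qed (use g in blast)
  define h where "h = \<lparr>iso_verts = f, iso_arcs = g, iso_head = head H, iso_tail = tail H\<rparr>"
  have "G.digraph_isomorphism h"
    using inj injg g by (auto simp: G.digraph_isomorphism_def h_def intro: G.wf_digraph)
  moreover have "H = app_iso h G"
    by (rule pre_digraph.equality) (auto simp: h_def im img)
  ultimately show ?thesis by (auto simp: digraph_iso_def)
qed

lemma digraph_iso_iff:
  assumes "Digraph.graph G" "Digraph.graph H"
  shows "digraph_iso G H \<longleftrightarrow> rel_iso (verts G) (edge G) (verts H) (edge H)"
  using assms digraph_isoI digraph_iso_graph by blast

lemma digraph_iso_graph_left:
  assumes "digraph_iso G H" "Digraph.graph H"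
  shows "Digraph.graph G"
proof -
  have "wf_digraph G" using assms(1) by (auto simp: digraph_iso_def pre_digraph.digraph_isomorphism_def)
  then show ?thesis using digraph_iso_swap[OF _ assms(1)] digraph_iso_graph[OF assms(2)] by blast
qed

lemma graph_induce:
  assumes "Digraph.graph G" "S \<subseteq> verts G"
  shows "Digraph.graph (G \<restriction> S)" "edge (G \<restriction> S) = (\<lambda>u v. edge G u v \<and> u \<in> S \<and> v \<in> S)"
proof -
  interpret G: Digraph.graph G by fact
  show e: "edge (G \<restriction> S) = (\<lambda>u v. edge G u v \<and> u \<in> S \<and> v \<in> S)"
    by (force simp: arcs_ends_conv fun_eq_iff)
  have "finite S" using finite_subset[OF assms(2)] by simp
  then show "Digraph.graph (G \<restriction> S)"
    using G.no_loops G.no_multi_arcs e graph_edge(2)[OF assms(1)]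
    by unfold_locales (auto simp: symmetric_def sym_def fun_cong[OF fun_cong[OF e]] arc_to_ends_def)
qed

lemma connected_edge:
  assumes "Digraph.graph G"
  shows "Digraph_Component.connected G \<longleftrightarrow> verts G \<noteq> {} \<and> connected_on (verts G) (edge G)"
proof -
  interpret G: Digraph.graph G by fact
  have r: "(u, v) \<in> rtrancl_on (verts G) ((arcs_ends G)\<^sup>s) \<longleftrightarrow>
      (u, v) \<in> {(a, b). a \<in> verts G \<and> b \<in> verts G \<and> edge G a b}\<^sup>*" if "u \<in> verts G" for u v
  proof
    assume "(u, v) \<in> rtrancl_on (verts G) ((arcs_ends G)\<^sup>s)"
    then show "(u, v) \<in> {(a, b). a \<in> verts G \<and> b \<in> verts G \<and> edge G a b}\<^sup>*"
    proof (induction rule: rtrancl_on_induct)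
      case (step a b)
      then have "(a, b) \<in> {(a, b). a \<in> verts G \<and> b \<in> verts G \<and> edge G a b}"
        using graph_edge(2)[OF assms] by (auto simp: symcl_def)
      with step show ?case by (meson rtrancl.rtrancl_into_rtrancl)
    qed simp
  next
    assume "(u, v) \<in> {(a, b). a \<in> verts G \<and> b \<in> verts G \<and> edge G a b}\<^sup>*"
    then show "(u, v) \<in> rtrancl_on (verts G) ((arcs_ends G)\<^sup>s)"
    proof (induction rule: rtrancl_induct)
      case (step a b)
      then show ?case by (auto simp: symcl_def intro: rtrancl_on_into_rtrancl_on)
    qed (use that in auto)
  qed
  show ?thesis unfolding connected_conv connected_on_def using r by blast
qed

lemma eigenvalue_adjacency_matrix:
  assumes "distinct vs" "set vs = verts G"
  shows "eigenvalue (adjacency_matrix G vs) \<mu> \<longleftrightarrow> \<mu> \<in> eigvals (verts G) (edge G)"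
proof -
  let ?n = "length vs" and ?A = "adjacency_matrix G vs"
  have bij: "bij_betw ((!) vs) {0..<?n} (verts G)"
    using bij_betw_nth[OF assms(1), of "{0..<?n}" "verts G"] assms(2) by (simp add: atLeast0LessThan)
  have A: "?A \<in> carrier_mat ?n ?n" by (simp add: adjacency_matrix_def)
  have mult: "(?A *\<^sub>v w) $ i = (\<Sum>u\<in>verts G. adj (edge G) (vs ! i) u * f u)"
    if "i < ?n" "w \<in> carrier_vec ?n" "\<And>j. j < ?n \<Longrightarrow> w $ j = f (vs ! j)" for w f i
  proof -
    have "(?A *\<^sub>v w) $ i = (\<Sum>j = 0..<?n. adj (edge G) (vs ! i) (vs ! j) * f (vs ! j))"
      using that by (auto simp: adjacency_matrix_def scalar_prod_def of_bool_def intro!: sum.cong)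
    also have "\<dots> = (\<Sum>u\<in>verts G. adj (edge G) (vs ! i) u * f u)"
      by (rule sum.reindex_bij_betw[OF bij, of "\<lambda>u. adj (edge G) (vs ! i) u * f u"])
    finally show ?thesis .
  qed
  show ?thesis
  proof
    assume "eigenvalue ?A \<mu>"
    then obtain w where w: "w \<in> carrier_vec ?n" "w \<noteq> 0\<^sub>v ?n" "?A *\<^sub>v w = \<mu> \<cdot>\<^sub>v w"
      using A by (auto simp: eigenvalue_def eigenvector_def)
    define f where "f u = w $ (the_inv_into {0..<?n} ((!) vs) u)" for u
    have f: "w $ j = f (vs ! j)" if "j < ?n" for j
      using that bij by (simp add: f_def bij_betw_def the_inv_into_f_f)
    obtain j where j: "j < ?n" "w $ j \<noteq> 0" using w(1,2) by (metis carrier_vecD eq_vecI index_zero_vec)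
    have "(\<Sum>u\<in>verts G. adj (edge G) v u * f u) = \<mu> * f v" if v: "v \<in> verts G" for v
    proof -
      obtain i where i: "i < ?n" "v = vs ! i" using v assms(2) by (metis in_set_conv_nth)
      show ?thesis using mult[OF i(1) w(1) f] w(1,3) i f by simp
    qed
    moreover have "vs ! j \<in> verts G" "f (vs ! j) \<noteq> 0" using j f assms(2) by auto
    ultimately show "\<mu> \<in> eigvals (verts G) (edge G)" by (auto simp: eigvals_def)
  next
    assume "\<mu> \<in> eigvals (verts G) (edge G)"
    then obtain f v where f: "\<And>v. v \<in> verts G \<Longrightarrow> (\<Sum>u\<in>verts G. adj (edge G) v u * f u) = \<mu> * f v"
      and v: "v \<in> verts G" "f v \<noteq> 0" by (auto simp: eigvals_def)
    define w where "w = vec ?n (\<lambda>i. f (vs ! i))"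
    obtain i where "i < ?n" "v = vs ! i" using v assms(2) by (metis in_set_conv_nth)
    then have "w $ i \<noteq> 0\<^sub>v ?n $ i" using v by (simp add: w_def)
    then have "w \<noteq> 0\<^sub>v ?n" by auto
    moreover have "?A *\<^sub>v w = \<mu> \<cdot>\<^sub>v w"
    proof (rule eq_vecI)
      fix i assume "i < dim_vec (\<mu> \<cdot>\<^sub>v w)"
      then have i: "i < ?n" by (simp add: w_def)
      then have "vs ! i \<in> verts G" using assms(2) nth_mem by blast
      then show "(?A *\<^sub>v w) $ i = (\<mu> \<cdot>\<^sub>v w) $ i"
        using mult[OF i, of w f] f[of "vs ! i"] i by (simp add: w_def)
    qed (simp add: w_def adjacency_matrix_def)
    ultimately show "eigenvalue ?A \<mu>"
      unfolding eigenvalue_def eigenvector_def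
      by (intro exI[of _ w]) (simp add: w_def adjacency_matrix_def)
  qed
qed

text \<open>Finiteness, obtained from the roots of the characteristic polynomial, gives
  \<open>Max\<close> and \<open>Min\<close> in \<open>lambda_max\<close> and
  \<open>lambda_min\<close> their intended meaning.\<close>

lemma adjacency_eigenvalues_eq:
  assumes "finite (verts G)"
  shows "adjacency_eigenvalues G = eigvals (verts G) (edge G)" "finite (adjacency_eigenvalues G)"
proof -
  obtain vs where vs: "distinct vs" "set vs = verts G"
    using assms finite_distinct_list by metis
  show eq: "adjacency_eigenvalues G = eigvals (verts G) (edge G)"
    unfolding adjacency_eigenvalues_def using eigenvalue_adjacency_matrix vs by blast
  have A: "adjacency_matrix G vs \<in> carrier_mat (length vs) (length vs)" by (simp add: adjacency_matrix_def)
  have "char_poly (adjacency_matrix G vs) \<noteq> 0"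
    using degree_monic_char_poly[OF A] by auto
  then have "finite {\<mu>. poly (char_poly (adjacency_matrix G vs)) \<mu> = 0}" by (rule poly_roots_finite)
  then show "finite (adjacency_eigenvalues G)"
    unfolding eq set_eq_iff using eigenvalue_adjacency_matrix[OF vs] eigenvalue_root_char_poly[OF A]
    by (auto elim!: rev_finite_subset)
qed

lemma psd_on_edge:
  assumes "finite V" "psd_on V (\<lambda>u v. adj E u v + diag \<theta> u v)" "u \<in> V" "v \<in> V" "u \<noteq> v"
    "E u v" "E v u" "\<not> E u u" "\<not> E v v"
  shows "1 \<le> \<theta>"
proof -
  have "psd_on {u, v} (\<lambda>u v. adj E u v + diag \<theta> u v)"
    by (rule psd_on_subset[OF assms(1) _ assms(2)]) (use assms in auto)
  then have "0 \<le> qform {u, v} (\<lambda>u v. adj E u v + diag \<theta> u v) (\<lambda>w. if w = u then 1 else - 1)"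
    by (simp add: psd_on_def)
  also have "\<dots> = 2 * \<theta> - 2" using assms(5-9) by (auto simp: qform_def)
  finally show ?thesis by simp
qed

section \<open>Weighted Hoffman colorings\<close>

text \<open>\<open>regular\<close> expresses equality in Hoffman's bound, and for k at least 2 the
  number - \<theta> is the least eigenvalue. The relation \<open>E\<close> is not confined to
  \<open>V\<close>, so passing to a union of classes leaves \<open>E\<close>, \<open>c\<close>,
  \<open>x\<close> and \<theta> untouched.\<close>

locale hoffman_system =
  fixes V :: "'a set" and E :: "'a \<Rightarrow> 'a \<Rightarrow> bool" and k :: nat and c :: "'a \<Rightarrow> nat"
    and x :: "'a \<Rightarrow> real" and \<theta> :: real
  assumes fin: "finite V" and ne: "V \<noteq> {}"
    and sym: "E u v \<Longrightarrow> E v u" and irr: "\<not> E u u"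
    and psd: "psd_on V (\<lambda>u v. adj E u v + diag \<theta> u v)"
    and pos: "v \<in> V \<Longrightarrow> x v > 0" and \<theta>_pos: "\<theta> > 0"
    and col: "v \<in> V \<Longrightarrow> c v < k"
    and proper: "u \<in> V \<Longrightarrow> v \<in> V \<Longrightarrow> E u v \<Longrightarrow> c u \<noteq> c v"
    and regular: "v \<in> V \<Longrightarrow> i < k \<Longrightarrow> c v \<noteq> i \<Longrightarrow> (\<Sum>u | u \<in> V \<and> c u = i \<and> E v u. x u) = \<theta> * x v"
begin

definition cls :: "nat \<Rightarrow> 'a set" where
  "cls i = {v \<in> V. c v = i}"

lemma fin_cls: "finite (cls i)" using fin by (simp add: cls_def)

lemma cls_disjoint: "i \<noteq> j \<Longrightarrow> cls i \<inter> cls j = {}" by (auto simp: cls_def)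

lemma V_cls: "V = (\<Union>i<k. cls i)" using col by (auto simp: cls_def)

lemma sum_cls: "(\<Sum>v\<in>V. (f v :: 'b :: comm_monoid_add)) = (\<Sum>i<k. \<Sum>v\<in>cls i. f v)"
proof -
  have "(\<Sum>v\<in>V. f v) = (\<Sum>v\<in>(\<Union>i<k. cls i). f v)" using V_cls by simp
  also have "\<dots> = (\<Sum>i<k. \<Sum>v\<in>cls i. f v)"
    by (rule sum.UNION_disjoint) (auto simp: fin_cls cls_disjoint)
  finally show ?thesis .
qed

lemma card_V: "card V = (\<Sum>i<k. card (cls i))"
  using sum_cls[of "\<lambda>_. 1 :: nat"] by simp

lemma regular_cls:
  "v \<in> V \<Longrightarrow> i < k \<Longrightarrow> c v \<noteq> i \<Longrightarrow> (\<Sum>u\<in>cls i. adj E v u * x u) = \<theta> * x v"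
  unfolding regular[symmetric]
  by (rule sum.mono_neutral_cong_right) (auto simp: cls_def fin)

lemma own_cls: "v \<in> V \<Longrightarrow> (\<Sum>u\<in>cls (c v). adj E v u * f u) = 0"
  by (rule sum.neutral) (auto simp: cls_def dest: proper)

lemma neighbour_in_cls:
  assumes "v \<in> V" "i < k" "c v \<noteq> i" shows "\<exists>u\<in>cls i. E v u"
proof (rule ccontr)
  assume "\<not> ?thesis"
  then have "(\<Sum>u\<in>cls i. adj E v u * x u) = 0" by (intro sum.neutral) auto
  then show False using regular_cls[OF assms] pos[OF assms(1)] \<theta>_pos by simp
qed

lemma cls_nonempty:
  assumes "i < k" shows "cls i \<noteq> {}"
proof -
  obtain v where "v \<in> V" using ne by auto
  then show ?thesis using neighbour_in_cls[of v i] assms by (cases "c v = i") (auto simp: cls_def)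
qed

lemma eigenvector:
  assumes v: "v \<in> V" shows "(\<Sum>u\<in>V. adj E v u * x u) = (real k - 1) * \<theta> * x v"
proof -
  have "(\<Sum>u\<in>V. adj E v u * x u) = (\<Sum>i<k. \<Sum>u\<in>cls i. adj E v u * x u)" by (rule sum_cls)
  also have "\<dots> = (\<Sum>i<k. if i = c v then 0 else \<theta> * x v)"
    by (intro sum.cong refl) (auto simp: own_cls regular_cls v)
  also have "\<dots> = (\<Sum>i\<in>{..<k} - {c v}. \<theta> * x v)"
    by (rule sum.mono_neutral_cong_right) auto
  also have "\<dots> = (real k - 1) * \<theta> * x v" using col[OF v] by (simp add: of_nat_diff Suc_leI)
  finally show ?thesis .
qed

text \<open>The bilinear form of the adjacency matrix between the two classes is computed from
  either side; each side yields \<theta> times the squared norm of that class.\<close>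

lemma cls_norm:
  assumes "i < k" "j < k" shows "(\<Sum>v\<in>cls i. (x v)\<^sup>2) = (\<Sum>v\<in>cls j. (x v)\<^sup>2)"
proof (cases "i = j")
  case False
  have half: "\<theta> * (\<Sum>v\<in>cls i. (x v)\<^sup>2) = (\<Sum>v\<in>cls i. \<Sum>u\<in>cls j. adj E v u * x v * x u)"
    if "i \<noteq> j" "j < k" for i j
  proof -
    have "\<theta> * (\<Sum>v\<in>cls i. (x v)\<^sup>2) = (\<Sum>v\<in>cls i. x v * (\<Sum>u\<in>cls j. adj E v u * x u))"
      unfolding sum_distrib_left[of \<theta>]
      by (intro sum.cong refl, subst regular_cls) (use that in \<open>auto simp: cls_def power2_eq_square\<close>)
    then show ?thesis by (simp add: sum_distrib_left mult_ac)
  qed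
  have "\<theta> * (\<Sum>v\<in>cls i. (x v)\<^sup>2) = (\<Sum>v\<in>cls i. \<Sum>u\<in>cls j. adj E v u * x v * x u)"
    using half False assms by simp
  also have "\<dots> = (\<Sum>u\<in>cls j. \<Sum>v\<in>cls i. adj E v u * x v * x u)" by (rule sum.swap)
  also have "\<dots> = (\<Sum>u\<in>cls j. \<Sum>v\<in>cls i. adj E u v * x u * x v)"
    by (intro sum.cong refl) (use sym in \<open>auto simp: of_bool_def\<close>)
  also have "\<dots> = \<theta> * (\<Sum>v\<in>cls j. (x v)\<^sup>2)" using half[of j i] False assms by simp
  finally show ?thesis using \<theta>_pos by simp
qed simp

text \<open>Equality in Hoffman's bound depends on the eigenvalue (k - 1) \<theta> of
  \<open>x\<close> and not on the coloring, so every other proper coloring with k colors attains it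
  too.\<close>

lemma recolor:
  assumes "\<And>v. v \<in> V \<Longrightarrow> d v < k" "\<And>u v. u \<in> V \<Longrightarrow> v \<in> V \<Longrightarrow> E u v \<Longrightarrow> d u \<noteq> d v"
  shows "hoffman_system V E k d x \<theta>"
proof
  show "(\<Sum>u | u \<in> V \<and> d u = i \<and> E v u. x u) = \<theta> * x v" if "v \<in> V" "i < k" "d v \<noteq> i" for v i
    by (rule hoffman_coloring_regular[of V E \<theta> x "(real k - 1) * \<theta>" d k])
      (use assms that eigenvector fin sym irr psd in auto)
qed (use assms fin ne sym irr psd pos \<theta>_pos in auto)

text \<open>This is why chromatic components are again Hoffman colorable: regularity between two
  classes does not involve the remaining ones.\<close>

lemma restrict:
  assumes "W = {v \<in> V. c v < m}" "m > 0" "m \<le> k"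
  shows "hoffman_system W E m c x \<theta>"
proof
  have W: "W \<subseteq> V" using assms by auto
  show "psd_on W (\<lambda>u v. adj E u v + diag \<theta> u v)" by (rule psd_on_subset[OF fin W psd])
  show "W \<noteq> {}" using cls_nonempty[of 0] assms by (auto simp: cls_def)
  show "finite W" using W fin by (rule finite_subset)
  show "(\<Sum>u | u \<in> W \<and> c u = i \<and> E v u. x u) = \<theta> * x v" if "v \<in> W" "i < m" "c v \<noteq> i" for v i
  proof -
    have "{u. u \<in> W \<and> c u = i \<and> E v u} = {u. u \<in> V \<and> c u = i \<and> E v u}" using assms that by auto
    then show ?thesis using regular[of v i] that assms by auto
  qed
qed (use assms sym irr pos \<theta>_pos proper in auto)

lemma rescale:
  assumes "t > 0" shows "hoffman_system V E k c (\<lambda>v. t * x v) \<theta>"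
  by unfold_locales (use assms fin ne sym irr psd pos \<theta>_pos col proper regular in
    \<open>auto simp flip: sum_distrib_left\<close>)

text \<open>Hoffman's bound for an arbitrary proper coloring \<open>d\<close>; it identifies k as
  the chromatic number.\<close>

lemma k_le:
  assumes "\<And>v. v \<in> V \<Longrightarrow> d v < m" "\<And>u v. u \<in> V \<Longrightarrow> v \<in> V \<Longrightarrow> E u v \<Longrightarrow> d u \<noteq> d v"
  shows "k \<le> m"
proof -
  obtain v where "v \<in> V" using ne by auto
  then have nz: "\<exists>v\<in>V. x v \<noteq> 0" using pos[of v] by force
  have "(real k - 1) * \<theta> + \<theta> \<le> real m * \<theta>"
    by (rule hoffman_coloring_bound[of V E \<theta> x "(real k - 1) * \<theta>" d m])
      (use assms nz eigenvector fin sym irr psd in auto)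
  then have "real k * \<theta> \<le> real m * \<theta>" by (simp add: algebra_simps)
  then show ?thesis using \<theta>_pos by simp
qed

text \<open>The eigenvector is \<open>x\<close> on class 0 and its negative on class 1; seen from
  any third class the two contributions cancel by regularity.\<close>

lemma min_eigenvalue:
  assumes "2 \<le> k" shows "- \<theta> \<in> eigvals V E"
proof -
  define f where "f v = (if c v = 0 then x v else if c v = 1 then - x v else 0)" for v
  obtain v0 where v0: "v0 \<in> V" "c v0 = 0" using cls_nonempty[of 0] assms by (auto simp: cls_def)
  have "(\<Sum>u\<in>V. adj E v u * f u) = - \<theta> * f v" if v: "v \<in> V" for v
  proof -
    have "(\<Sum>u\<in>V. adj E v u * f u) = (\<Sum>i<k. \<Sum>u\<in>cls i. adj E v u * f u)" by (rule sum_cls)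
    also have "\<dots> = (\<Sum>i\<in>{0,1}. \<Sum>u\<in>cls i. adj E v u * f u)"
      by (rule sum.mono_neutral_right) (use assms in \<open>auto simp: cls_def f_def intro!: sum.neutral\<close>)
    also have "\<dots> = (\<Sum>u\<in>cls 0. adj E v u * x u) - (\<Sum>u\<in>cls 1. adj E v u * x u)"
      by (simp add: cls_def f_def sum_negf)
    also have "\<dots> = - \<theta> * f v"
    proof -
      have "(\<Sum>u\<in>cls i. adj E v u * x u) = (if c v = i then 0 else \<theta> * x v)" if "i < k" for i
        using own_cls[OF v, of x] regular_cls[OF v that] by auto
      then show ?thesis using assms by (simp add: f_def)
    qed
    finally show ?thesis .
  qed
  moreover have "f v0 \<noteq> 0" using v0 pos by (simp add: f_def less_imp_neq[symmetric])
  ultimately show ?thesis using v0 by (auto simp: eigvals_def)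
qed

end

theorem hoffman_colorable_system:
  assumes G: "Digraph.graph G" "Digraph_Component.connected G" "hoffman_colorable G"
    and c: "proper_coloring G (chromatic_number G) c"
  obtains x \<theta> where "hoffman_system (verts G) (edge G) (chromatic_number G) c x \<theta>"
    "lambda_min G = - \<theta>"
proof -
  let ?V = "verts G" and ?E = "edge G" and ?k = "chromatic_number G"
  note ge = graph_edge[OF G(1)]
  have ne: "?V \<noteq> {}" and con: "connected_on ?V ?E" using connected_edge[OF G(1)] G(2) by auto
  note eigs = adjacency_eigenvalues_eq[OF ge(1)]
  obtain x lam where x: "\<And>v. v \<in> ?V \<Longrightarrow> x v > 0"
    and eig: "\<And>v. v \<in> ?V \<Longrightarrow> (\<Sum>u\<in>?V. adj ?E v u * x u) = lam * x v"
    using perron_vector[OF ge(1) ne ge(2) con] by blast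
  have "lam \<in> eigvals ?V ?E" 
  proof -
    obtain v where "v \<in> ?V" using ne by auto
    then show ?thesis using x[of v] eig by (intro eigvalsI[of v ?V x]) auto
  qed
  then have max: "lambda_max G = lam"
    unfolding lambda_max_def using eigs positive_eigenvector_bound[OF ge(1) x eig]
    by (intro Max_eqI) auto
  have symA: "adj ?E u v = adj ?E v u" for u v using ge(2) by (auto simp: of_bool_def)
  obtain f \<mu> where f: "\<exists>v\<in>?V. f v \<noteq> 0" "\<And>v. v \<in> ?V \<Longrightarrow> (\<Sum>u\<in>?V. adj ?E v u * f u) = \<mu> * f v"
    and psd: "psd_on ?V (\<lambda>u v. adj ?E u v + diag (- \<mu>) u v)"
    using least_eigenvalue[of ?V "adj ?E", OF ge(1) ne symA] by blast
  have "\<mu> \<in> eigvals ?V ?E" using f by (auto simp: eigvals_def)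
  then have min: "lambda_min G = \<mu>"
    unfolding lambda_min_def using eigs eigval_psd_bound[OF ge(1) psd]
    by (intro Min_eqI) auto
  obtain u v where uv: "?E u v" "u \<in> ?V" "v \<in> ?V" "u \<noteq> v"
  proof -
    obtain a where a: "a \<in> arcs G" using G(3) by (auto simp: hoffman_colorable_def)
    then have e: "?E (tail G a) (head G a)" by (auto simp: arcs_ends_conv)
    moreover have "tail G a \<noteq> head G a" using e ge(3)[of "tail G a"] by metis
    ultimately show thesis using that ge(4,5) by metis
  qed
  have "\<mu> < 0"
  proof -
    have "1 \<le> - \<mu>"
      by (rule psd_on_edge[OF ge(1) psd uv(2-4) uv(1) ge(2)[OF uv(1)]]) (rule ge(3))+
    then show ?thesis by simp
  qed
  have "real ?k = 1 - lam / \<mu>" using G(3) by (simp add: hoffman_colorable_def hoffman_bound_def max min)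
  then have lam: "lam = (real ?k - 1) * (- \<mu>)" using \<open>\<mu> < 0\<close> by (simp add: field_simps)
  have col: "\<And>v. v \<in> ?V \<Longrightarrow> c v < ?k" and proper: "\<And>u v. ?E u v \<Longrightarrow> c u \<noteq> c v"
    using c by (auto simp: proper_coloring_def)
  have "hoffman_system ?V ?E ?k c x (- \<mu>)"
  proof
    show "(\<Sum>u | u \<in> ?V \<and> c u = i \<and> ?E v u. x u) = - \<mu> * x v" if "v \<in> ?V" "i < ?k" "c v \<noteq> i" for v i
      by (rule hoffman_coloring_regular[of ?V ?E "- \<mu>" x lam c ?k])
        (use that col proper eig lam psd ge in auto)
  qed (use ge ne psd x \<open>\<mu> < 0\<close> col proper in auto)
  then show thesis using that min by auto
qed

text \<open>The positive eigenvector identifies the largest eigenvalue, \<open>psd\<close> together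
  with \<open>min_eigenvalue\<close> the smallest one, and \<open>k_le\<close> the chromatic
  number.\<close>

theorem hoffman_system_colorable:
  assumes G: "Digraph.graph G" and sys: "hoffman_system (verts G) (edge G) k c x \<theta>" and k: "2 \<le> k"
  shows "hoffman_colorable G" "chromatic_number G = k"
proof -
  interpret hoffman_system "verts G" "edge G" k c x \<theta> by fact
  note ge = graph_edge[OF G(1)]
  note eigs = adjacency_eigenvalues_eq[OF ge(1)]
  have "(real k - 1) * \<theta> \<in> eigvals (verts G) (edge G)"
  proof -
    obtain v where "v \<in> verts G" using ne by auto
    then show ?thesis using pos[of v] eigenvector by (intro eigvalsI[of v _ x]) auto
  qed
  then have max: "lambda_max G = (real k - 1) * \<theta>"
    unfolding lambda_max_def using eigs positive_eigenvector_bound[OF fin pos eigenvector]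
    by (intro Max_eqI) auto
  have min: "lambda_min G = - \<theta>"
    unfolding lambda_min_def using eigs eigval_psd_bound[OF fin psd] min_eigenvalue[OF k]
    by (intro Min_eqI) auto
  have "proper_coloring G k c"
    unfolding proper_coloring_def using col proper ge by auto
  moreover have "k \<le> m" if "proper_coloring G m d" for m d
    by (rule k_le[of d]) (use that in \<open>auto simp: proper_coloring_def\<close>)
  ultimately show chi: "chromatic_number G = k"
    unfolding chromatic_number_def by (intro Least_equality) auto
  obtain v where v: "v \<in> verts G" using ne by auto
  obtain u where "edge G v u" 
    using neighbour_in_cls[of v 0] neighbour_in_cls[of v 1] v k by (cases "c v = 0") auto
  then have "arcs G \<noteq> {}" by (auto simp: arcs_ends_conv)
  then show "hoffman_colorable G"
    using \<theta>_pos by (simp add: hoffman_colorable_def hoffman_bound_def max min chi)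
qed

text \<open>The vertices \<open>u\<close>, \<open>v\<close>, \<open>w\<close> show that nonadjacency
  is not transitive, which rules out complete multipartite graphs; three necessary colors rule out
  bipartite ones.\<close>

theorem small_hoffman_graphI:
  assumes G: "Digraph.graph G" and sys: "hoffman_system (verts G) (edge G) k c x \<theta>" and k: "3 \<le> k"
    and con: "connected_on (verts G) (edge G)" and card: "card (verts G) < 3 * k"
    and path: "u \<in> verts G" "v \<in> verts G" "w \<in> verts G"
      "\<not> edge G u v" "\<not> edge G v w" "edge G u w"
  shows "small_hoffman_graph G"
proof -
  have hc: "hoffman_colorable G" "chromatic_number G = k"
    using hoffman_system_colorable[OF G sys] k by auto
  have "\<not> bipartite G"
  proof
    assume "bipartite G"
    then have "chromatic_number G \<le> 2"
      unfolding bipartite_def chromatic_number_def by (rule Least_le)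
    then show False using hc k by simp
  qed
  moreover have "\<not> digraph_iso G (with_proj (balanced_multipartite r m))" for r m
  proof
    let ?K = "balanced_multipartite r m"
    assume "digraph_iso G (with_proj ?K)"
    from digraph_iso_graph[OF G this]
    have "rel_iso (verts G) (edge G) (pverts ?K) (\<lambda>u v. (u, v) \<in> parcs ?K)" by simp
    then obtain f where f: "\<And>v. v \<in> verts G \<Longrightarrow> f v \<in> pverts ?K"
      "\<And>u v. u \<in> verts G \<Longrightarrow> v \<in> verts G \<Longrightarrow> edge G u v \<longleftrightarrow> (f u, f v) \<in> parcs ?K"
      by (auto simp: rel_iso_def bij_betw_def)
    have "(f u, f v) \<notin> parcs ?K" "(f v, f w) \<notin> parcs ?K" "(f u, f w) \<in> parcs ?K"
      using f(2) path by auto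
    moreover have "f u \<in> pverts ?K" "f v \<in> pverts ?K" "f w \<in> pverts ?K" using f(1) path by auto
    ultimately show False by (auto simp: balanced_multipartite_def)
  qed
  moreover have "verts G \<noteq> {}" using path by auto
  ultimately show ?thesis
    using hc con card G connected_edge[OF G] by (simp add: small_hoffman_graph_def nontrivially_hoffman_colorable_def)
qed

section \<open>Class sizes of small Hoffman colorings\<close>

context hoffman_system
begin

lemma sum_adj_const:
  assumes "finite A"
  shows "(\<Sum>y\<in>A. adj E v y * t) = real (card {y \<in> A. E v y}) * t"
  using assms by (simp add: Int_def)

text \<open>A single vertex \<open>u\<close> in its class is adjacent to everything else, so all
  other weights equal \<open>x u\<close> divided by \<theta> and all other classes have \<theta>
  squared vertices. Comparing two of these classes makes \<theta> an integer d. For d = 1 the graph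
  is complete, for larger d it has at least 1 + 4 (k - 1) vertices.\<close>

lemma no_singleton_class:
  assumes k: "3 \<le> k" and small: "card V < 3 * k" and i: "i < k"
    and nc: "\<exists>u\<in>V. \<exists>v\<in>V. u \<noteq> v \<and> \<not> E u v"
  shows "card (cls i) \<noteq> 1"
proof
  assume "card (cls i) = 1"
  then obtain u where u: "cls i = {u}" by (auto simp: card_1_singleton_iff)
  have uV: "u \<in> V" "c u = i" using u by (auto simp: cls_def)
  have xv: "\<theta> * x v = x u" if "v \<in> V" "c v \<noteq> i" for v
  proof -
    have "E v u" using neighbour_in_cls[OF that(1) i that(2)] u by auto
    then show ?thesis using regular_cls[OF that(1) i that(2)] u by simp
  qed
  have cardj: "real (card (cls j)) = \<theta>\<^sup>2" if "j < k" "j \<noteq> i" for j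
  proof -
    have all: "E u v" if "v \<in> cls j" for v
    proof -
      have "v \<in> V" "c v \<noteq> i" using that \<open>j \<noteq> i\<close> by (auto simp: cls_def)
      then have "\<exists>y\<in>cls i. E v y" using i by (intro neighbour_in_cls)
      then have "E v u" using u by simp
      then show ?thesis by (rule sym)
    qed
    have "\<theta> * (\<theta> * x u) = (\<Sum>v\<in>cls j. \<theta> * (adj E u v * x v))"
      unfolding sum_distrib_left[symmetric] using regular_cls[OF uV(1) that(1)] that uV by simp
    also have "\<dots> = (\<Sum>v\<in>cls j. x u)"
      by (intro sum.cong refl) (use all xv that in \<open>auto simp: cls_def\<close>)
    also have "\<dots> = real (card (cls j)) * x u" by simp
    finally show ?thesis using pos[OF uV(1)] by (simp add: power2_eq_square)
  qed
  \<comment> \<open>Two distinct indices other than \<open>i\<close>, both below 3.\<close>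
  define j where "j = (if i = 0 then 1 else 0 :: nat)"
  define l where "l = (if i = 2 then 1 else 2 :: nat)"
  have jl: "j < k" "l < k" "j \<noteq> i" "l \<noteq> i" "j \<noteq> l" using k by (auto simp: j_def l_def)
  obtain v where v: "v \<in> cls j" using cls_nonempty jl by auto
  define d where "d = card {y \<in> cls l. E v y}"
  have "\<theta> * (\<theta> * x v) = (\<Sum>y\<in>cls l. \<theta> * (adj E v y * x y))"
    unfolding sum_distrib_left[symmetric] using regular_cls[of v l] jl v by (simp add: cls_def)
  also have "\<dots> = (\<Sum>y\<in>cls l. adj E v y * x u)"
    by (intro sum.cong refl) (use xv jl in \<open>auto simp: cls_def\<close>)
  also have "\<dots> = real d * x u"
    unfolding d_def by (rule sum_adj_const[OF fin_cls])
  finally have "\<theta> * x u = real d * x u" using xv[of v] v jl by (simp add: cls_def)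
  then have d: "\<theta> = real d" using pos[OF uV(1)] by simp
  then have cardj': "card (cls j) = d\<^sup>2" if "j < k" "j \<noteq> i" for j
    using cardj[OF that] by (metis of_nat_eq_iff of_nat_power)
  have "d > 0" using \<theta>_pos d by simp
  have tot: "card V = 1 + (k - 1) * d\<^sup>2"
  proof -
    have "card V = card (cls i) + (\<Sum>j\<in>{..<k} - {i}. card (cls j))"
      unfolding card_V using i by (intro sum.remove) auto
    also have "(\<Sum>j\<in>{..<k} - {i}. card (cls j)) = (\<Sum>j\<in>{..<k} - {i}. d\<^sup>2)"
      by (intro sum.cong refl) (simp add: cardj')
    finally show ?thesis using u i by simp
  qed
  show False
  proof (cases "d = 1")
    case True
    then have "card (cls j) = 1" if "j < k" for j using cardj' that u by (cases "j = i") auto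
    then have one: "\<exists>v. cls j = {v}" if "j < k" for j using that by (auto simp: card_1_singleton_iff)
    obtain a b where ab: "a \<in> V" "b \<in> V" "a \<noteq> b" "\<not> E a b" using nc by auto
    obtain v where v: "cls (c b) = {v}" using one col ab by blast
    then have "v = b" using ab by (auto simp: cls_def)
    have "c a \<noteq> c b"
    proof
      assume "c a = c b"
      then have "a \<in> cls (c b)" using ab by (simp add: cls_def)
      then show False using v \<open>v = b\<close> ab by simp
    qed
    then have "\<exists>y\<in>cls (c b). E a y" using ab col by (intro neighbour_in_cls) auto
    then show False using v \<open>v = b\<close> ab by simp
  next
    case False
    then have "2 ^ 2 \<le> d\<^sup>2" using \<open>d > 0\<close> by (intro power_mono) auto
    then have "(k - 1) * 4 \<le> (k - 1) * d\<^sup>2" by simp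
    then show False using tot small k by linarith
  qed
qed

text \<open>On an induced path of length 2 the vector 1, - 1, 1 has form 3 \<theta> - 4. For
  \<theta> = 1 adjacency is thus transitive, and a connected graph is complete.\<close>

lemma \<theta>_neq_1:
  assumes con: "connected_on V E" and nc: "\<exists>u\<in>V. \<exists>v\<in>V. u \<noteq> v \<and> \<not> E u v"
  shows "\<theta> \<noteq> 1"
proof
  assume \<theta>: "\<theta> = 1"
  have trans: "E a d" if "a \<in> V" "b \<in> V" "d \<in> V" "E a b" "E b d" "a \<noteq> d" for a b d
  proof (rule ccontr)
    assume "\<not> E a d"
    have ne: "a \<noteq> b" "b \<noteq> d" using that irr by auto
    have "psd_on {a, b, d} (\<lambda>u v. adj E u v + diag \<theta> u v)"
      by (rule psd_on_subset[OF fin _ psd]) (use that in auto)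
    then have "0 \<le> qform {a, b, d} (\<lambda>u v. adj E u v + diag \<theta> u v) (\<lambda>v. if v = b then - 1 else 1)"
      by (simp add: psd_on_def)
    also have "\<dots> = - 1"
      using that ne \<open>\<not> E a d\<close> sym[of a b] sym[of b d] sym[of d a] irr \<theta> by (auto simp: qform_def)
    finally show False by simp
  qed
  obtain a b where ab: "a \<in> V" "b \<in> V" "a \<noteq> b" "\<not> E a b" using nc by auto
  have "b = a \<or> E a b"
    by (rule connected_on_closed[OF con ab(1), of "\<lambda>b. b = a \<or> E a b"]) (use ab trans in blast)+
  then show False using ab by auto
qed

section \<open>Neighbourhoods into a class of size 2\<close>

definition only_at :: "nat \<Rightarrow> 'a \<Rightarrow> 'a \<Rightarrow> 'a set" where
  "only_at j u w = {v \<in> cls j. E v u \<and> \<not> E v w}"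

definition both_at :: "nat \<Rightarrow> 'a \<Rightarrow> 'a \<Rightarrow> 'a set" where
  "both_at j u w = {v \<in> cls j. E v u \<and> E v w}"

lemma both_at_commute: "both_at j u w = both_at j w u" by (auto simp: both_at_def)

context
  fixes i u w assumes i: "i < k" and cls_i: "cls i = {u, w}" and uw: "u \<noteq> w"
begin

lemma pair_weight:
  assumes "v \<in> V" "c v \<noteq> i" shows "\<theta> * x v = adj E v u * x u + adj E v w * x w"
  using regular_cls[OF assms(1) i assms(2)] uw
  by (simp add: cls_i del: sum_of_bool_mult_eq sum_mult_of_bool_eq)

lemma cls_split:
  assumes "j < k" "j \<noteq> i"
  shows "cls j = only_at j u w \<union> only_at j w u \<union> both_at j u w"
proof -
  have "E v u \<or> E v w" if "v \<in> cls j" for v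
  proof -
    have "v \<in> V" "c v \<noteq> i" using that assms by (auto simp: cls_def)
    from neighbour_in_cls[OF this(1) i this(2)] show ?thesis using cls_i by auto
  qed
  then show ?thesis unfolding only_at_def both_at_def by blast
qed

lemma sum_cls_split:
  assumes "j < k" "j \<noteq> i"
  shows "(\<Sum>v\<in>cls j. (f v :: 'b :: comm_monoid_add)) =
    (\<Sum>v\<in>only_at j u w. f v) + (\<Sum>v\<in>only_at j w u. f v) + (\<Sum>v\<in>both_at j u w. f v)"
proof -
  have "finite (only_at j u w)" "finite (only_at j w u)" "finite (both_at j u w)"
    using fin_cls[of j] by (auto simp: only_at_def both_at_def)
  then show ?thesis unfolding cls_split[OF assms]
    by (subst sum.union_disjoint, auto simp: only_at_def both_at_def)+
qed

lemma card_cls_split: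
  assumes "j < k" "j \<noteq> i"
  shows "card (cls j) = card (only_at j u w) + card (only_at j w u) + card (both_at j u w)"
  using sum_cls_split[OF assms, of "\<lambda>_. 1 :: nat"] by simp

lemma weights_at:
  assumes "j \<noteq> i"
  shows "v \<in> only_at j u w \<Longrightarrow> \<theta> * x v = x u" "v \<in> only_at j w u \<Longrightarrow> \<theta> * x v = x w"
    "v \<in> both_at j u w \<Longrightarrow> \<theta> * x v = x u + x w"
  using pair_weight[of v] assms by (auto simp: only_at_def both_at_def cls_def)

lemma pair_count:
  assumes j: "j < k" "j \<noteq> i"
  shows "real (card (only_at j u w)) * x u + real (card (both_at j u w)) * (x u + x w) = \<theta>\<^sup>2 * x u"
proof -
  have uV: "u \<in> V" "c u = i" using cls_i by (auto simp: cls_def)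
  have "\<theta>\<^sup>2 * x u = (\<Sum>v\<in>cls j. \<theta> * (adj E u v * x v))"
    unfolding sum_distrib_left[symmetric] using regular_cls[of u j] uV j by (simp add: power2_eq_square)
  also have "\<dots> = (\<Sum>v\<in>only_at j u w. x u) + (\<Sum>v\<in>only_at j w u. 0) + (\<Sum>v\<in>both_at j u w. x u + x w)"
    unfolding sum_cls_split[OF j]
    by (intro arg_cong2[of _ _ _ _ "(+)"] sum.cong refl)
      (use weights_at[OF j(2)] sym in \<open>auto simp: only_at_def both_at_def\<close>)
  finally show ?thesis by simp
qed

text \<open>Each vertex of class \<open>j\<close> has a weight determined by \<open>x u\<close> and
  \<open>x w\<close> according to its kind. Counting the neighbours of \<open>v\<close> by kind
  gives a relation with bounded integer coefficients, hence finitely many cases.\<close>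

lemma mutual_count:
  assumes j: "j < k" "j \<noteq> i" and v: "v \<in> V" "c v \<noteq> j"
  obtains \<alpha> \<beta> \<gamma> where "\<alpha> \<le> card (only_at j u w)" "\<beta> \<le> card (only_at j w u)" "\<gamma> \<le> card (both_at j u w)"
    "real \<alpha> * x u + real \<beta> * x w + real \<gamma> * (x u + x w) = \<theta> * (\<theta> * x v)"
proof -
  define N where "N A = card {y \<in> A. E v y}" for A
  have finA: "finite (only_at j u w)" "finite (only_at j w u)" "finite (both_at j u w)"
    using fin_cls[of j] by (auto simp: only_at_def both_at_def)
  have 1: "\<theta> * (\<theta> * x v) = (\<Sum>y\<in>cls j. \<theta> * (adj E v y * x y))"
    unfolding sum_distrib_left[symmetric] using regular_cls[of v j] v j by simp
  have 2: "(\<Sum>y\<in>A. \<theta> * (adj E v y * x y)) = real (N A) * t"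
    if "finite A" "\<And>y. y \<in> A \<Longrightarrow> \<theta> * x y = t" for A t
  proof -
    have "(\<Sum>y\<in>A. \<theta> * (adj E v y * x y)) = (\<Sum>y\<in>A. adj E v y * t)"
      by (intro sum.cong refl) (metis mult.left_commute that(2))
    then show ?thesis unfolding N_def sum_adj_const[OF that(1)] .
  qed
  have eq: "\<theta> * (\<theta> * x v) = real (N (only_at j u w)) * x u + real (N (only_at j w u)) * x w
      + real (N (both_at j u w)) * (x u + x w)"
    unfolding 1 sum_cls_split[OF j]
    by (intro arg_cong2[of _ _ _ _ "(+)"] 2 finA weights_at[OF j(2)])
  have le: "N A \<le> card A" if "finite A" for A
    unfolding N_def using that by (intro card_mono) auto
  show thesis by (rule that[OF le le le eq[symmetric]]) (rule finA)+
qed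

end

end

text \<open>Here \<open>p\<close>, \<open>q\<close>, \<open>r\<close> count the vertices of the
  second class that see only the first vertex, only the second, or both. The case r = 0 forces t =
  1, r = 2 forces t = 2, and r = 1 leads to the golden ratio.\<close>

lemma pair_pair_weights:
  fixes a b t :: real and p q r :: nat
  assumes "a > 0" "b > 0" "t > 0" "p + q + r = 2"
    "real p * a + real r * (a + b) = t\<^sup>2 * a" "real q * b + real r * (a + b) = t\<^sup>2 * b"
  shows "t = 1 \<or> t = 2 \<and> a = b \<or> t\<^sup>2 = t + 1 \<and> (a = t * b \<or> b = t * a)"
proof -
  have golden: "t\<^sup>2 = t + 1 \<and> a = t * b"
    if "a > 0" "b > 0" "2 * a + b = t\<^sup>2 * a" "a + b = t\<^sup>2 * b" for a b :: real
  proof -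
    have a: "a = (t\<^sup>2 - 1) * b" using that by (simp add: algebra_simps)
    have "(2 * (t\<^sup>2 - 1) + 1) * b = t\<^sup>2 * (t\<^sup>2 - 1) * b" using that(3) unfolding a by (simp add: algebra_simps)
    then have "2 * (t\<^sup>2 - 1) + 1 = t\<^sup>2 * (t\<^sup>2 - 1)" using that by simp
    \<comment> \<open>The equation reads t^4 - 3 t^2 + 1 = 0, and the left side is (t^2 - 1)^2 -
      t^2.\<close>
    then have "(t\<^sup>2 - t - 1) * (t\<^sup>2 + t - 1) = 0" by (simp add: algebra_simps power2_eq_square)
    moreover have "t\<^sup>2 + t - 1 \<noteq> 0"
    proof -
      have "t\<^sup>2 - 1 > 0" using a that by (simp add: zero_less_mult_iff)
      then show ?thesis using \<open>t > 0\<close> by linarith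
    qed
    ultimately have "t\<^sup>2 = t + 1" by simp
    then show ?thesis using a by simp
  qed
  have "r = 0 \<or> r = 1 \<or> r = 2" using assms(4) by auto
  then show ?thesis
  proof (elim disjE)
    assume "r = 0"
    then have "real p = t\<^sup>2" "real q = t\<^sup>2" using assms by auto
    then have "p = q" using of_nat_eq_iff[where ?'a = real] by metis
    then have "p = 1" using assms(4) \<open>r = 0\<close> by simp
    then have "t\<^sup>2 = 1\<^sup>2" using \<open>real p = t\<^sup>2\<close> by simp
    then show ?thesis using assms(3) by (subst (asm) power2_eq_iff_nonneg) auto
  next
    assume r: "r = 1"
    then consider "p = 1 \<and> q = 0" | "p = 0 \<and> q = 1" using assms(4) by force
    then show ?thesis
      using golden[of a b] golden[of b a] assms r by cases (auto simp: algebra_simps)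
  next
    assume r: "r = 2"
    then have "2 * (a + b) = t\<^sup>2 * a" "2 * (a + b) = t\<^sup>2 * b" using assms by auto
    then have "a = b" using assms by simp
    then have "t\<^sup>2 = 2\<^sup>2" using \<open>2 * (a + b) = t\<^sup>2 * a\<close> assms(1) by simp
    then show ?thesis using assms(3) \<open>a = b\<close> by (subst (asm) power2_eq_iff_nonneg) auto
  qed
qed

lemma nat_square_neq:
  fixes d :: nat shows "d\<^sup>2 \<noteq> 3" "d\<^sup>2 \<noteq> 6" "d * d \<noteq> d + 1"
proof -
  consider "d = 0" | "d = 1" | "d = 2" | "3 \<le> d" by linarith
  then have "d\<^sup>2 \<noteq> 3 \<and> d\<^sup>2 \<noteq> 6 \<and> d * d \<noteq> d + 1"
  proof cases
    case 4
    then have "3 * d \<le> d * d" by (rule mult_le_mono1)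
    then have "9 \<le> d * d \<and> d * d \<noteq> d + 1" using 4 by linarith
    then show ?thesis by (auto simp: power2_eq_square)
  qed auto
  then show "d\<^sup>2 \<noteq> 3" "d\<^sup>2 \<noteq> 6" "d * d \<noteq> d + 1" by auto
qed

text \<open>
  The equations for \<open>a = b\<close> force \<open>t\<close> to be an integer with square 3 or 6. The other solutions
  have \<open>a / b\<close> about 1.28 or 2.41, and \<open>t\<close> about 2.14 or 1.85, which no admissible
  \<open>\<alpha>, \<beta>, \<gamma>\<close> realise.
\<close>

lemma pair_triple_impossible:
  fixes a b t :: real and p q r \<alpha> \<beta> \<gamma> :: nat
  assumes pos: "a > 0" "b > 0" "t > 0" and sum: "p + q + r = 3" and ge: "q \<le> p"
    and eqs: "real p * a + real r * (a + b) = t\<^sup>2 * a" "real q * b + real r * (a + b) = t\<^sup>2 * b"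
    and le: "\<alpha> \<le> p" "\<beta> \<le> q" "\<gamma> \<le> r"
    and eq: "real \<alpha> * a + real \<beta> * b + real \<gamma> * (a + b) = t * (if p = 0 then a + b else a)"
  shows False
proof -
  have equal: "a = b" if "p = q"
  proof -
    have "(real p * a + real r * (a + b)) * b = (real q * b + real r * (a + b)) * a"
      unfolding eqs by simp
    then have "real r * (a + b) * (b - a) = 0" using that by (simp add: algebra_simps)
    moreover have "r \<noteq> 0" using that sum by presburger
    ultimately show ?thesis using pos by simp
  qed
  define s where "s = a / b"
  have s: "a = s * b" "s > 0" using pos by (auto simp: s_def)
  have "r = 0 \<or> p = 0 \<and> q = 0 \<and> r = 3 \<or> p = 1 \<and> q = 1 \<and> r = 1 \<or> p = 1 \<and> q = 0 \<and> r = 2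
      \<or> p = 2 \<and> q = 0 \<and> r = 1"
    using sum ge by presburger
  then show False
  proof (elim disjE conjE)
    assume "r = 0"
    then have "real p = t\<^sup>2" "real q = t\<^sup>2" using eqs pos by auto
    then have "p = q" using of_nat_eq_iff[where ?'a = real] by metis
    then show False using sum \<open>r = 0\<close> by presburger
  next
    assume "p = 0" "q = 0" "r = 3"
    then have "t = real \<gamma>" "t\<^sup>2 = 6" using equal eqs eq le pos by auto
    then have "real (\<gamma>\<^sup>2) = real 6" by simp
    then have "\<gamma>\<^sup>2 = 6" by (simp only: of_nat_eq_iff)
    then show False using nat_square_neq by simp
  next
    assume c: "p = 1" "q = 1" "r = 1"
    then have "a = b" using equal by simp
    then have "t * b = real (\<alpha> + \<beta> + 2 * \<gamma>) * b" "t\<^sup>2 * b = 3 * b"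
      using eqs eq c by (auto simp: algebra_simps)
    then have "t = real (\<alpha> + \<beta> + 2 * \<gamma>)" "t\<^sup>2 = 3" using pos by (simp_all only: mult_cancel_right) auto
    then have "real ((\<alpha> + \<beta> + 2 * \<gamma>)\<^sup>2) = real 3" by simp
    then have "(\<alpha> + \<beta> + 2 * \<gamma>)\<^sup>2 = 3" by (simp only: of_nat_eq_iff)
    then show False using nat_square_neq by blast
  next
    assume c: "p = 1" "q = 0" "r = 2"
    have "(3 * s + 2) * b = t\<^sup>2 * s * b" "(2 * s + 2) * b = t\<^sup>2 * b"
      "((real \<alpha> + real \<gamma>) * s + real \<gamma>) * b = t * s * b"
      subgoal using eqs(1) c unfolding s(1) by (simp add: algebra_simps)
      subgoal using eqs(2) c unfolding s(1) by (simp add: algebra_simps)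
      subgoal using eq c le unfolding s(1) by (simp add: algebra_simps)
      done
    then have *: "3 * s + 2 = t\<^sup>2 * s" "2 * s + 2 = t\<^sup>2" "(real \<alpha> + real \<gamma>) * s + real \<gamma> = t * s"
      using pos by (simp_all only: mult_cancel_right) auto
    \<comment> \<open>The positive root is (1 + sqrt 17) / 4, about 1.2808, and t is then about
      2.1358; the decimal bounds below enclose both.\<close>
    have sq: "2 * s\<^sup>2 = s + 2" using *(1) unfolding *(2)[symmetric] by (simp add: algebra_simps power2_eq_square)
    have "s > 1.28"
    proof (rule ccontr)
      assume "\<not> s > 1.28"
      then have "s * s \<le> 1.28 * s" using s(2) by (intro mult_right_mono) auto
      then show False using sq \<open>\<not> s > 1.28\<close> by (simp add: power2_eq_square)
    qed
    have "s < 1.29"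
    proof (rule ccontr)
      assume "\<not> s < 1.29"
      then have "1.29 * s \<le> s * s" using s(2) by (intro mult_right_mono) auto
      then show False using sq \<open>\<not> s < 1.29\<close> by (simp add: power2_eq_square)
    qed
    have "t > 2.13" "t < 2.15"
      using *(2) \<open>s > 1.28\<close> \<open>s < 1.29\<close> power_mono[of t "2.13" 2] power_mono[of "2.15" t 2] pos
      by (auto simp: power2_eq_square intro!: not_le_imp_less)
    have ts: "t * s > 2.13 * 1.28" "t * s < 2.15 * 1.29"
      using \<open>s > 1.28\<close> \<open>s < 1.29\<close> \<open>t > 2.13\<close> \<open>t < 2.15\<close>
      by (intro mult_strict_mono; simp)+
    have "(\<alpha> = 0 \<or> \<alpha> = 1) \<and> (\<gamma> = 0 \<or> \<gamma> = 1 \<or> \<gamma> = 2)" using le c by auto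
    then show False using *(3) ts \<open>s > 1.28\<close> \<open>s < 1.29\<close> by auto
  next
    assume c: "p = 2" "q = 0" "r = 1"
    have "(3 * s + 1) * b = t\<^sup>2 * s * b" "(s + 1) * b = t\<^sup>2 * b"
      "((real \<alpha> + real \<gamma>) * s + real \<gamma>) * b = t * s * b"
      subgoal using eqs(1) c unfolding s(1) by (simp add: algebra_simps)
      subgoal using eqs(2) c unfolding s(1) by (simp add: algebra_simps)
      subgoal using eq c le unfolding s(1) by (simp add: algebra_simps)
      done
    then have *: "3 * s + 1 = t\<^sup>2 * s" "s + 1 = t\<^sup>2" "(real \<alpha> + real \<gamma>) * s + real \<gamma> = t * s"
      using pos by (simp_all only: mult_cancel_right) auto
    \<comment> \<open>The positive root is 1 + sqrt 2, and the square of t is then 2 + sqrt 2, so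
      that t is about 1.8478.\<close>
    have sq: "s\<^sup>2 = 2 * s + 1" using *(1) unfolding *(2)[symmetric] by (simp add: algebra_simps power2_eq_square)
    have "s > 2.41"
    proof (rule ccontr)
      assume "\<not> s > 2.41"
      then have "s * s \<le> 2.41 * s" using s(2) by (intro mult_right_mono) auto
      then show False using sq \<open>\<not> s > 2.41\<close> by (simp add: power2_eq_square)
    qed
    have "s < 2.42"
    proof (rule ccontr)
      assume "\<not> s < 2.42"
      then have "2.42 * s \<le> s * s" using s(2) by (intro mult_right_mono) auto
      then show False using sq \<open>\<not> s < 2.42\<close> by (simp add: power2_eq_square)
    qed
    have "t > 1.84" "t < 1.86"
      using *(2) \<open>s > 2.41\<close> \<open>s < 2.42\<close> power_mono[of t "1.84" 2] power_mono[of "1.86" t 2] pos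
      by (auto simp: power2_eq_square intro!: not_le_imp_less)
    have ts: "t * s > 1.84 * 2.41" "t * s < 1.86 * 2.42"
      using \<open>s > 2.41\<close> \<open>s < 2.42\<close> \<open>t > 1.84\<close> \<open>t < 1.86\<close>
      by (intro mult_strict_mono; simp)+
    have "(\<alpha> = 0 \<or> \<alpha> = 1 \<or> \<alpha> = 2) \<and> (\<gamma> = 0 \<or> \<gamma> = 1)" using le c by auto
    then show False using *(3) ts \<open>s > 2.41\<close> \<open>s < 2.42\<close> by auto
  qed
qed


text \<open>If one solution had the larger \<open>r\<close>, its \<open>p\<close> and
  \<open>q\<close> would each be smaller by more than the excess of \<open>r\<close>, which
  contradicts equal sums. Two classes of the same size therefore meet a class of size 2 in the same
  pattern.\<close>

lemma triple_unique:
  fixes a b T :: real and p q r p' q' r' :: nat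
  assumes "a > 0" "b > 0" "p + q + r = p' + q' + r'"
    "real p * a + real r * (a + b) = T * a" "real q * b + real r * (a + b) = T * b"
    "real p' * a + real r' * (a + b) = T * a" "real q' * b + real r' * (a + b) = T * b"
  shows "p = p' \<and> q = q' \<and> r = r'"
proof -
  have le: "r \<le> r'"
    if h: "p + q + r = p' + q' + r'"
      "real p * a + real r * (a + b) = real p' * a + real r' * (a + b)"
      "real q * b + real r * (a + b) = real q' * b + real r' * (a + b)" for p q r p' q' r' :: nat
  proof (rule ccontr)
    assume "\<not> r \<le> r'"
    then have d: "real r - real r' > 0" by simp
    have "(real p' - real p) * a = (real r - real r') * (a + b)"
      "(real q' - real q) * b = (real r - real r') * (a + b)" using h by (simp_all add: algebra_simps)
    moreover have "(real r - real r') * (a + b) > (real r - real r') * a"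
      "(real r - real r') * (a + b) > (real r - real r') * b" using d assms by auto
    ultimately have "(real p' - real p) * a > (real r - real r') * a"
      "(real q' - real q) * b > (real r - real r') * b" by auto
    then have "real p' - real p > real r - real r'" "real q' - real q > real r - real r'"
      using assms by (simp_all only: mult_less_cancel_right_pos)
    moreover have "real p + real q + real r = real p' + real q' + real r'" using h(1) by linarith
    ultimately show False using d by linarith
  qed
  have r: "r = r'"
  proof (rule antisym)
    show "r \<le> r'" by (rule le[OF assms(3)]) (simp_all only: assms(4-7))
    show "r' \<le> r" by (rule le[OF assms(3)[symmetric]]) (simp_all only: assms(4-7))
  qed
  have "real p * a = real p' * a" "real q * b = real q' * b"
    using assms(4-7) unfolding r by linarith+
  then show ?thesis using r assms(1,2) by simp
qed

context hoffman_system
begin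

text \<open>Both triples have the same pattern towards the pair, and the pair can be ordered such
  that \<open>le\<close> holds. A vertex of the first triple with known weight, seeing only
  \<open>u\<close> if possible and otherwise both, is then counted against the second triple, which
  gives the impossible last equation.\<close>

lemma no_pair_with_two_triples:
  assumes i: "i < k" "cls i = {u, w}" "u \<noteq> w"
    and j: "j < k" "j \<noteq> i" "card (cls j) = 3" and l: "l < k" "l \<noteq> i" "l \<noteq> j" "card (cls l) = 3"
    and le: "card (only_at j w u) \<le> card (only_at j u w)"
  shows False
proof -
  have i': "cls i = {w, u}" "w \<noteq> u" using i by auto
  have uw: "x u > 0" "x w > 0" using i(2) pos[of u] pos[of w] by (auto simp: cls_def)
  let ?p = "card (only_at j u w)" and ?q = "card (only_at j w u)" and ?r = "card (both_at j u w)"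
  have sum: "?p + ?q + ?r = 3" using card_cls_split[OF i j(1,2)] j(3) by simp
  have suml: "card (only_at l u w) + card (only_at l w u) + card (both_at l u w) = 3"
    using card_cls_split[OF i l(1,2)] l(4) by simp
  have eqs: "real ?p * x u + real ?r * (x u + x w) = \<theta>\<^sup>2 * x u"
      "real ?q * x w + real ?r * (x u + x w) = \<theta>\<^sup>2 * x w"
    using pair_count[OF i j(1,2)] pair_count[OF i(1) i' j(1,2)]
    by (simp_all add: both_at_commute add.commute)
  have eqsl: "real (card (only_at l u w)) * x u + real (card (both_at l u w)) * (x u + x w) = \<theta>\<^sup>2 * x u"
      "real (card (only_at l w u)) * x w + real (card (both_at l u w)) * (x u + x w) = \<theta>\<^sup>2 * x w"
    using pair_count[OF i l(1,2)] pair_count[OF i(1) i' l(1,2)]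
    by (simp_all add: both_at_commute add.commute)
  have same: "?p = card (only_at l u w) \<and> ?q = card (only_at l w u) \<and> ?r = card (both_at l u w)"
    by (rule triple_unique[OF uw _ eqs eqsl]) (use sum suml in simp)
  obtain v where v: "v \<in> cls j" "\<theta> * x v = (if ?p = 0 then x u + x w else x u)"
  proof (cases "?p = 0")
    case True
    then have "?r = 3" using sum le by simp
    then have "both_at j u w \<noteq> {}" by (metis card.empty zero_neq_numeral)
    then obtain v where "v \<in> both_at j u w" by blast
    then show thesis using that[of v] True weights_at[OF i j(2)] by (simp add: both_at_def)
  next
    case False
    then have "only_at j u w \<noteq> {}" by (metis card.empty)
    then obtain v where "v \<in> only_at j u w" by blast
    then show thesis using that[of v] False weights_at[OF i j(2)] by (simp add: only_at_def)
  qed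
  have "v \<in> V" "c v \<noteq> l" using v l by (auto simp: cls_def)
  from mutual_count[OF i l(1,2) this]
  obtain \<alpha> \<beta> \<gamma> where le': "\<alpha> \<le> card (only_at l u w)" "\<beta> \<le> card (only_at l w u)" "\<gamma> \<le> card (both_at l u w)"
    and eq: "real \<alpha> * x u + real \<beta> * x w + real \<gamma> * (x u + x w) = \<theta> * (\<theta> * x v)" .
  show False
    by (rule pair_triple_impossible[OF uw \<theta>_pos sum le eqs])
      (use le' same eq v(2) in auto)
qed

text \<open>No class is a singleton, so some class has size 2. If it were the only one, the order
  would be at most 2 + 3 (k - 1), and all other classes would be triples; there are two of them
  because k is at least 3.\<close>

lemma two_pair_classes:
  assumes k: "3 \<le> k" and small: "card V < 3 * k"
    and nc: "\<exists>u\<in>V. \<exists>v\<in>V. u \<noteq> v \<and> \<not> E u v"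
  obtains i j where "i < k" "j < k" "i \<noteq> j" "card (cls i) = 2" "card (cls j) = 2"
proof -
  have ge2: "2 \<le> card (cls i)" if "i < k" for i
  proof -
    have "card (cls i) > 0" using cls_nonempty[OF that] fin_cls[of i] by (simp add: card_gt_0_iff)
    then show ?thesis using no_singleton_class[OF k small that nc] by linarith
  qed
  have "\<exists>i<k. card (cls i) = 2"
  proof (rule ccontr)
    assume "\<not> ?thesis"
    then have "3 \<le> card (cls i)" if "i < k" for i using ge2[OF that] that by force
    then have "(\<Sum>i<k. 3) \<le> (\<Sum>i<k. card (cls i))" by (intro sum_mono) auto
    then show False using small by (simp add: card_V)
  qed
  then obtain i where i: "i < k" "card (cls i) = 2" by auto
  have "\<exists>j<k. j \<noteq> i \<and> card (cls j) = 2"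
  proof (rule ccontr)
    assume "\<not> ?thesis"
    then have ge3: "3 \<le> card (cls j)" if "j < k" "j \<noteq> i" for j using ge2[OF that(1)] that by force
    have eq3: "card (cls j) = 3" if j: "j < k" "j \<noteq> i" for j
    proof (rule ccontr)
      assume "card (cls j) \<noteq> 3"
      then have "4 \<le> card (cls j)" using ge3[OF j] by simp
      have "card V = card (cls i) + (card (cls j) + (\<Sum>l\<in>{..<k} - {i} - {j}. card (cls l)))"
      proof -
        have "card V = card (cls i) + (\<Sum>l\<in>{..<k} - {i}. card (cls l))"
          unfolding card_V using i by (intro sum.remove) auto
        also have "(\<Sum>l\<in>{..<k} - {i}. card (cls l)) = card (cls j) + (\<Sum>l\<in>{..<k} - {i} - {j}. card (cls l))"
          using j by (intro sum.remove) auto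
        finally show ?thesis .
      qed
      moreover have "(\<Sum>l\<in>{..<k} - {i} - {j}. 3) \<le> (\<Sum>l\<in>{..<k} - {i} - {j}. card (cls l))"
        by (intro sum_mono) (use ge3 in auto)
      moreover have "(\<Sum>l\<in>{..<k} - {i} - {j}. 3) = 3 * (k - 2)" using i j by simp
      ultimately show False using small i \<open>4 \<le> card (cls j)\<close> k by simp
    qed
    define j where "j = (if i = 0 then 1 else 0 :: nat)"
    define l where "l = (if i = 2 then 1 else 2 :: nat)"
    have jl: "j < k" "l < k" "j \<noteq> i" "l \<noteq> i" "l \<noteq> j" using k by (auto simp: j_def l_def)
    obtain u w where uw: "cls i = {u, w}" "u \<noteq> w" using i(2) by (auto simp: card_2_iff)
    have wu: "cls i = {w, u}" "w \<noteq> u" using uw by auto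
    show False
      using no_pair_with_two_triples[OF i(1) uw jl(1,3) eq3[OF jl(1,3)] jl(2,4,5) eq3[OF jl(2,4)]]
        no_pair_with_two_triples[OF i(1) wu jl(1,3) eq3[OF jl(1,3)] jl(2,4,5) eq3[OF jl(2,4)]]
      by linarith
  qed
  then show thesis using that i by metis
qed

end

lemma rel_iso_listI:
  assumes "distinct xs" "distinct ys" "length xs = length ys"
    "\<And>i j. i < length xs \<Longrightarrow> j < length xs \<Longrightarrow> E (xs ! i) (xs ! j) \<longleftrightarrow> F (ys ! i) (ys ! j)"
  shows "rel_iso (set xs) E (set ys) F"
proof -
  let ?n = "length xs"
  have x: "bij_betw ((!) xs) {..<?n} (set xs)" and y: "bij_betw ((!) ys) {..<?n} (set ys)"
    using assms by (auto intro: bij_betw_nth)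
  have "rel_iso {..<?n} (\<lambda>i j. E (xs ! i) (xs ! j)) (set xs) E"
    unfolding rel_iso_def using x by blast
  moreover have "rel_iso {..<?n} (\<lambda>i j. E (xs ! i) (xs ! j)) (set ys) F"
    unfolding rel_iso_def using y assms(4) by (intro exI[of _ "(!) ys"]) auto
  ultimately show ?thesis using rel_iso_sym rel_iso_trans by blast
qed

section \<open>The golden ratio and the graph F\<close>

context hoffman_system
begin

context
  assumes golden: "\<theta>\<^sup>2 = \<theta> + 1"
begin

text \<open>With \<open>u\<close> heavy and \<open>w\<close> light, r = 0 would make \<theta> an
  integer and r at least 2 exceeds the total weight. What remains is a heavy vertex adjacent to both
  and a light one adjacent only to \<open>u\<close>.\<close>

lemma golden_pair:
  assumes i: "i < k" "cls i = {u, w}" "u \<noteq> w" and w: "x u = \<theta> * x w" and j: "j < k" "j \<noteq> i"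
  obtains b s where "cls j = {b, s}" "b \<noteq> s" "x b = x u" "x s = x w" "E b u" "E b w" "E s u" "\<not> E s w"
proof -
  have i': "cls i = {w, u}" "w \<noteq> u" using i by auto
  have wpos: "x w > 0" using i pos[of w] by (auto simp: cls_def)
  define p q r where "p = card (only_at j u w)" and "q = card (only_at j w u)" and "r = card (both_at j u w)"
  have "(real p * \<theta> + real r * (\<theta> + 1)) * x w = \<theta>\<^sup>2 * \<theta> * x w"
    using pair_count[OF i j] by (simp add: w p_def r_def algebra_simps)
  then have 1: "real p * \<theta> + real r * (\<theta> + 1) = (\<theta> + 1) * \<theta>" using wpos golden by simp
  have "(real q + real r * (\<theta> + 1)) * x w = \<theta>\<^sup>2 * x w"
    using pair_count[OF i(1) i' j] by (simp add: w q_def r_def both_at_commute algebra_simps)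
  then have 2: "real q + real r * (\<theta> + 1) = \<theta> + 1" using wpos golden by simp
  have "r \<noteq> 0"
  proof
    assume "r = 0"
    then have q: "real q = \<theta> + 1" using 2 by simp
    then have "q > 1" using \<theta>_pos by linarith
    then have d: "real (q - 1) = \<theta>" using q by (simp add: of_nat_diff)
    have "real ((q - 1) * (q - 1)) = real (q - 1 + 1)"
      using golden unfolding of_nat_mult of_nat_add d by (simp add: power2_eq_square)
    then have "(q - 1) * (q - 1) = q - 1 + 1" by (simp only: of_nat_eq_iff)
    then show False using nat_square_neq(3) by blast
  qed
  moreover have "\<not> 2 \<le> r"
  proof
    assume "2 \<le> r"
    then have "2 * (\<theta> + 1) \<le> real r * (\<theta> + 1)" using \<theta>_pos by (intro mult_right_mono) auto
    then show False using 2 \<theta>_pos by simp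
  qed
  ultimately have r: "r = 1" by simp
  then have q: "q = 0" using 2 by simp
  have "real p * \<theta> = 1 * \<theta>" using 1 r golden by (simp add: algebra_simps power2_eq_square)
  then have p: "p = 1" using \<theta>_pos by simp
  obtain s where s: "only_at j u w = {s}" using p by (auto simp: p_def card_1_singleton_iff)
  obtain b where b: "both_at j u w = {b}" using r by (auto simp: r_def card_1_singleton_iff)
  have "finite (only_at j w u)" using fin_cls[of j] by (simp add: only_at_def)
  then have "only_at j w u = {}" using q by (simp add: q_def)
  then have "cls j = {b, s}" using cls_split[OF i j] s b by auto
  moreover have "\<theta> * x b = \<theta> * x u"
  proof -
    have "\<theta> * x b = (\<theta> + 1) * x w" using weights_at(3)[OF i j(2), of b] b w by (simp add: algebra_simps)
    also have "\<dots> = \<theta> * x u" using golden w by (simp flip: golden add: power2_eq_square)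
    finally show ?thesis .
  qed
  moreover have "\<theta> * x s = \<theta> * x w" using weights_at(1)[OF i j(2), of s] s w by simp
  moreover have "E b u" "E b w" "E s u" "\<not> E s w" using s b by (auto simp: only_at_def both_at_def)
  moreover have "b \<noteq> s" using calculation by auto
  ultimately show thesis using that \<theta>_pos by simp
qed

lemma golden_F:
  assumes k: "3 \<le> k" and i0: "i0 < k" "cls i0 = {u0, w0}" "u0 \<noteq> w0" and w0: "x u0 = \<theta> * x w0"
  shows "k = 3 \<and> rel_iso V E (pverts F_graph) (edge (with_proj F_graph))"
proof -
  define a where "a = x w0"
  have "a > 0" using i0 pos[of w0] by (auto simp: a_def cls_def)
  have \<theta>1: "\<theta> \<noteq> 1" using golden by auto
  have "\<exists>b s. cls i = {b, s} \<and> b \<noteq> s \<and> x b = \<theta> * a \<and> x s = a" if "i < k" for i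
  proof (cases "i = i0")
    case False
    from golden_pair[OF i0 w0 that this] show ?thesis by (metis w0 a_def)
  qed (use i0 w0 a_def in blast)
  then obtain b s where bs: "\<And>i. i < k \<Longrightarrow> cls i = {b i, s i} \<and> b i \<noteq> s i \<and> x (b i) = \<theta> * a \<and> x (s i) = a"
    by metis
  have E: "E (b j) (b i) \<and> E (b j) (s i) \<and> E (s j) (b i) \<and> \<not> E (s j) (s i)"
    if ij: "i < k" "j < k" "j \<noteq> i" for i j
  proof -
    have i: "cls i = {b i, s i}" "b i \<noteq> s i" "x (b i) = \<theta> * x (s i)" using bs[OF ij(1)] by auto
    obtain b' s' where *: "cls j = {b', s'}" "b' \<noteq> s'" "x b' = \<theta> * a" "x s' = a"
      "E b' (b i)" "E b' (s i)" "E s' (b i)" "\<not> E s' (s i)"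
      using golden_pair[OF ij(1) i ij(2,3)] bs[OF ij(1)] by metis
    have "\<theta> * a \<noteq> a" using \<theta>1 \<open>a > 0\<close> by simp
    then have "b' = b j" "s' = s j" using bs[OF ij(2)] *(1-4) by (metis doubleton_eq_iff)+
    then show ?thesis using * by simp
  qed
  have cb: "c (b i) = i" "c (s i) = i" "b i \<in> V" "s i \<in> V" if "i < k" for i
    using bs[OF that] by (auto simp: cls_def)
  have "\<not> 4 \<le> k"
  proof
    assume "4 \<le> k"
    \<comment> \<open>A heavy vertex with three pairwise nonadjacent light neighbours: the values -
      2, 1, 1, 1 give the form 7 \<theta> - 12, which is negative for the golden ratio.\<close>
    let ?S = "{b 0, s 1, s 2, s 3}"
    have "psd_on ?S (\<lambda>u v. adj E u v + diag \<theta> u v)"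
      by (rule psd_on_subset[OF fin _ psd]) (use cb \<open>4 \<le> k\<close> in auto)
    then have "0 \<le> qform ?S (\<lambda>u v. adj E u v + diag \<theta> u v) (\<lambda>v. if v = b 0 then - 2 else 1)"
      by (simp add: psd_on_def)
    also have "\<dots> = 7 * \<theta> - 12"
    proof -
      have "distinct (map c [b 0, s 1, s 2, s 3])" using cb \<open>4 \<le> k\<close> by simp
      then have "distinct [b 0, s 1, s 2, s 3]" by (simp only: distinct_map)
      then have d: "b 0 \<noteq> s 1" "b 0 \<noteq> s 2" "b 0 \<noteq> s 3" "s 1 \<noteq> s 2" "s 1 \<noteq> s 3" "s 2 \<noteq> s 3"
        by auto
      have e: "E (b 0) (s 1)" "E (b 0) (s 2)" "E (b 0) (s 3)" "E (s 1) (b 0)" "E (s 2) (b 0)" "E (s 3) (b 0)"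
        "\<not> E (s 1) (s 2)" "\<not> E (s 1) (s 3)" "\<not> E (s 2) (s 1)" "\<not> E (s 2) (s 3)" "\<not> E (s 3) (s 1)" "\<not> E (s 3) (s 2)"
        "\<not> E (b 0) (b 0)" "\<not> E (s 1) (s 1)" "\<not> E (s 2) (s 2)" "\<not> E (s 3) (s 3)"
        using E \<open>4 \<le> k\<close> irr by auto
      show ?thesis using d e d[symmetric] by (simp add: qform_def)
    qed
    finally have "12 / 7 \<le> \<theta>" by simp
    then have "12 / 7 * \<theta> \<le> \<theta> * \<theta>" using \<theta>_pos by (intro mult_right_mono) auto
    also have "\<theta> * \<theta> = \<theta> + 1" using golden by (simp add: power2_eq_square)
    finally show False using \<open>12 / 7 \<le> \<theta>\<close> by linarith
  qed
  then have k3: "k = 3" using k by simp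
  \<comment> \<open>In F the vertices 1, 2, 3 miss the triangle vertices 6, 5, 4 in this order,
    whereas \<open>s i\<close> misses \<open>b i\<close>; hence the light vertices come in reverse
    order.\<close>
  define xs where "xs = [s 2, s 1, s 0, b 0, b 1, b 2]"
  define ys :: "nat list" where "ys = [1, 2, 3, 4, 5, 6]"
  have V: "V = set xs"
  proof -
    have "V = cls 0 \<union> cls 1 \<union> cls 2" using V_cls by (auto simp: k3 numeral_3_eq_3 lessThan_Suc numeral_2_eq_2)
    then show ?thesis using bs[of 0] bs[of 1] bs[of 2] by (auto simp: k3 xs_def)
  qed
  have "\<theta> * a \<noteq> a" using \<theta>1 \<open>a > 0\<close> by simp
  then have "distinct (map (\<lambda>v. (c v, x v)) xs)" using cb bs by (simp add: xs_def k3)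
  then have d: "distinct xs" by (simp only: distinct_map)
  have Fv: "pverts F_graph = set ys" by (auto simp: F_graph_def ys_def)
  have E': "E (b j) (b i)" "E (b j) (s i)" "E (s j) (b i)" "\<not> E (s j) (s i)"
    if "i < 3" "j < 3" "j \<noteq> i" for i j using E that by (auto simp: k3)
  have nE: "\<not> E (b i) (b i)" "\<not> E (s i) (s i)" "\<not> E (b i) (s i)" "\<not> E (s i) (b i)" if "i < 3" for i
    using that irr proper[of "b i" "s i"] proper[of "s i" "b i"] cb[of i] by (auto simp: k3)
  have "rel_iso (set xs) E (set ys) (edge (with_proj F_graph))"
  proof (rule rel_iso_listI[OF d])
    show "E (xs ! i) (xs ! j) \<longleftrightarrow> edge (with_proj F_graph) (ys ! i) (ys ! j)"
      if "i < length xs" "j < length xs" for i j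
    proof -
      have "i \<in> {0,1,2,3,4,5}" "j \<in> {0,1,2,3,4,5}" using that by (auto simp: xs_def)
      then show ?thesis
        by (elim insertE emptyE; simp add: xs_def ys_def F_graph_def F_edges_def E' nE)
    qed
  qed (simp_all add: xs_def ys_def)
  then show ?thesis using k3 V Fv by simp
qed

end

end

section \<open>Systems with \<theta> = 2 and weights 1 and 1/2\<close>

locale half_system = hoffman_system V E k c x 2
  for V :: "'a set" and E :: "'a \<Rightarrow> 'a \<Rightarrow> bool" and k :: nat and c :: "'a \<Rightarrow> nat" and x :: "'a \<Rightarrow> real" +
  assumes weight: "v \<in> V \<Longrightarrow> x v = 1 \<or> x v = 1 / 2"
    and norm: "i < k \<Longrightarrow> (\<Sum>v\<in>cls i. (x v)\<^sup>2) = 2"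

context hoffman_system
begin

theorem small_system_cases:
  assumes k: "3 \<le> k" and small: "card V < 3 * k" and con: "connected_on V E"
    and nc: "\<exists>u\<in>V. \<exists>v\<in>V. u \<noteq> v \<and> \<not> E u v"
  obtains (half) t where "t > 0" "\<theta> = 2" "half_system V E k c (\<lambda>v. t * x v)"
  | (F) "k = 3" "rel_iso V E (pverts F_graph) (edge (with_proj F_graph))"
proof -
  obtain i j where ij: "i < k" "j < k" "i \<noteq> j" "card (cls i) = 2" "card (cls j) = 2"
    using two_pair_classes[OF k small nc] by metis
  obtain u w where uw: "cls i = {u, w}" "u \<noteq> w" using ij by (auto simp: card_2_iff)
  have wu: "cls i = {w, u}" "w \<noteq> u" using uw by auto
  have p: "x u > 0" "x w > 0" using uw pos[of u] pos[of w] by (auto simp: cls_def)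
  have ji: "j \<noteq> i" using ij by simp
  have "\<theta> = 1 \<or> \<theta> = 2 \<and> x u = x w \<or> \<theta>\<^sup>2 = \<theta> + 1 \<and> (x u = \<theta> * x w \<or> x w = \<theta> * x u)"
    by (rule pair_pair_weights[OF p \<theta>_pos, of "card (only_at j u w)" "card (only_at j w u)" "card (both_at j u w)"])
      (use card_cls_split[OF ij(1) uw ij(2) ji] ij pair_count[OF ij(1) uw ij(2) ji]
         pair_count[OF ij(1) wu ij(2) ji] in \<open>simp_all add: both_at_commute add.commute\<close>)
  then consider "\<theta> = 2" "x u = x w" | "\<theta>\<^sup>2 = \<theta> + 1" "x u = \<theta> * x w" | "\<theta>\<^sup>2 = \<theta> + 1" "x w = \<theta> * x u"
    using \<theta>_neq_1[OF con nc] by blast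
  then show thesis
  proof cases
    case 1
    define t where "t = 1 / x u"
    have t: "t > 0" "t * x u = 1" using p by (auto simp: t_def)
    interpret R: hoffman_system V E k c "\<lambda>v. t * x v" 2
      using rescale[OF t(1)] 1 by simp
    have "half_system V E k c (\<lambda>v. t * x v)"
    proof
      show "t * x v = 1 \<or> t * x v = 1 / 2" if v: "v \<in> V" for v
      proof (cases "c v = i")
        case True
        then have "v \<in> {u, w}" using v uw by (auto simp: cls_def)
        then show ?thesis using t 1 by auto
      next
        case False
        obtain y where y: "y \<in> cls i" "E v y" using neighbour_in_cls[OF v ij(1) False] by blast
        \<comment> \<open>Both vertices of the chosen pair have weight 1 after scaling, so one or
          two neighbours in it give \<open>v\<close> the weight 1/2 or 1.\<close>
        have "2 * (t * x v) = adj E v u * (t * x u) + adj E v w * (t * x w)"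
          using R.pair_weight[OF ij(1) _ uw(2) v False] uw by simp
        then show ?thesis using t 1 y uw by (cases "E v u"; cases "E v w") auto
      qed
      show "(\<Sum>v\<in>cls l. (t * x v)\<^sup>2) = 2" if "l < k" for l
      proof -
        have "(\<Sum>v\<in>cls l. (t * x v)\<^sup>2) = (\<Sum>v\<in>cls i. (t * x v)\<^sup>2)"
          using R.cls_norm that ij by blast
        also have "\<dots> = 2" using t 1 by (simp add: uw(1)) (use uw in simp)
        finally show ?thesis .
      qed
    qed
    then show thesis using half[OF t(1)] 1 by simp
  next
    case 2
    then show thesis using F golden_F[OF 2(1) k ij(1) uw 2(2)] by simp
  next
    case 3
    then show thesis using F golden_F[OF 3(1) k ij(1) wu 3(2)] by simp
  qed
qed

end

context half_system
begin

definition ones :: "nat \<Rightarrow> 'a set" where "ones i = {v \<in> cls i. x v = 1}"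
definition halves :: "nat \<Rightarrow> 'a set" where "halves i = {v \<in> cls i. x v = 1 / 2}"

lemma cls_ones_halves: "cls i = ones i \<union> halves i" "ones i \<inter> halves i = {}"
  using weight by (auto simp: ones_def halves_def cls_def)

lemma fin_ones_halves: "finite (ones i)" "finite (halves i)"
  using fin_cls[of i] by (auto simp: ones_def halves_def)

lemma sum_ones_halves: "(\<Sum>v\<in>cls i. (f v :: 'b :: comm_monoid_add)) = (\<Sum>v\<in>ones i. f v) + (\<Sum>v\<in>halves i. f v)"
  using cls_ones_halves(2) fin_ones_halves unfolding cls_ones_halves(1) by (subst sum.union_disjoint) auto

lemma card_cls_ones: "card (cls i) = card (ones i) + card (halves i)"
  using sum_ones_halves[of "\<lambda>_. 1 :: nat"] by simp

text \<open>The squares 1 and 1/4 add up to 2 in every class. This leaves two ones, a one with four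
  halves, or eight halves, the origin of the sizes 2, 5 and 8.\<close>

lemma card_halves:
  assumes "i < k" shows "card (halves i) + 4 * card (ones i) = 8"
proof -
  have "2 = (\<Sum>v\<in>ones i. (x v)\<^sup>2) + (\<Sum>v\<in>halves i. (x v)\<^sup>2)"
    using norm[OF assms] by (simp add: sum_ones_halves)
  also have "\<dots> = (\<Sum>v\<in>ones i. 1) + (\<Sum>v\<in>halves i. 1 / 4)"
  proof (intro arg_cong2[of _ _ _ _ "(+)"] sum.cong refl)
    show "(x v)\<^sup>2 = 1" if "v \<in> ones i" for v using that by (simp add: ones_def)
    show "(x v)\<^sup>2 = 1 / 4" if "v \<in> halves i" for v
    proof -
      have "x v = 1 / 2" using that unfolding halves_def by blast
      then show ?thesis by (simp only:) (simp add: power2_eq_square)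
    qed
  qed
  also have "\<dots> = real (card (ones i)) + real (card (halves i)) / 4" by simp
  finally have "real (card (halves i) + 4 * card (ones i)) = real 8" by simp
  then show ?thesis by (simp only: of_nat_eq_iff)
qed

lemma class_cases:
  assumes "i < k"
  obtains "card (cls i) = 2" "card (ones i) = 2" "card (halves i) = 0"
    | "card (cls i) = 5" "card (ones i) = 1" "card (halves i) = 4"
    | "card (cls i) = 8" "card (ones i) = 0" "card (halves i) = 8"
proof -
  have "card (ones i) = 0 \<or> card (ones i) = 1 \<or> card (ones i) = 2" using card_halves[OF assms] by presburger
  then show thesis using that card_halves[OF assms] card_cls_ones[of i] by force
qed

definition pairs :: "nat set" where "pairs = {i. i < k \<and> card (cls i) = 2}"
definition quints :: "nat set" where "quints = {i. i < k \<and> card (cls i) = 5}"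
definition octs :: "nat set" where "octs = {i. i < k \<and> card (cls i) = 8}"

lemma fin_pairs: "finite pairs" "finite quints" "finite octs"
  by (auto simp: pairs_def quints_def octs_def)

lemma sum_classes:
  "(\<Sum>i<k. (f i :: 'b :: comm_monoid_add)) = (\<Sum>i\<in>pairs. f i) + (\<Sum>i\<in>quints. f i) + (\<Sum>i\<in>octs. f i)"
proof -
  have "{..<k} = (pairs \<union> quints) \<union> octs"
    using class_cases by (auto simp: pairs_def quints_def octs_def)
  then have "(\<Sum>i<k. f i) = (\<Sum>i\<in>(pairs \<union> quints) \<union> octs. f i)" by simp
  also have "\<dots> = (\<Sum>i\<in>pairs \<union> quints. f i) + (\<Sum>i\<in>octs. f i)"
    by (rule sum.union_disjoint) (use fin_pairs in \<open>auto simp: pairs_def quints_def octs_def\<close>)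
  also have "(\<Sum>i\<in>pairs \<union> quints. f i) = (\<Sum>i\<in>pairs. f i) + (\<Sum>i\<in>quints. f i)"
    by (rule sum.union_disjoint) (use fin_pairs in \<open>auto simp: pairs_def quints_def\<close>)
  finally show ?thesis .
qed

lemma k_eq: "k = card pairs + card quints + card octs"
  using sum_classes[of "\<lambda>_. 1 :: nat"] by simp

lemma card_V_eq: "card V = 2 * card pairs + 5 * card quints + 8 * card octs"
proof -
  have "card V = (\<Sum>i\<in>pairs. card (cls i)) + (\<Sum>i\<in>quints. card (cls i)) + (\<Sum>i\<in>octs. card (cls i))"
    unfolding card_V by (rule sum_classes)
  also have "\<dots> = (\<Sum>i\<in>pairs. 2) + (\<Sum>i\<in>quints. 5) + (\<Sum>i\<in>octs. 8)"
    by (intro arg_cong2[of _ _ _ _ "(+)"] sum.cong refl) (auto simp: pairs_def quints_def octs_def)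
  finally show ?thesis by simp
qed

section \<open>Sign vectors on the classes of size 2 and the projected Gram matrix\<close>

lemma pair_ones: "q \<in> pairs \<Longrightarrow> v \<in> cls q \<Longrightarrow> x v = 1"
proof -
  assume q: "q \<in> pairs" "v \<in> cls q"
  then have "card (halves q) = 0" using class_cases[of q] by (auto simp: pairs_def)
  then have "halves q = {}" using fin_ones_halves by simp
  then have "v \<in> ones q" using q(2) unfolding cls_ones_halves(1)[of q] by simp
  then show ?thesis by (simp add: ones_def)
qed

lemma pair_adj:
  assumes q: "q \<in> pairs" "cls q = {u, w}" "u \<noteq> w" and v: "v \<in> V" "c v \<noteq> q"
  shows "x v = 1 \<Longrightarrow> E v u \<and> E v w" "x v = 1 / 2 \<Longrightarrow> E v u \<longleftrightarrow> \<not> E v w"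
proof -
  have "x u = 1" "x w = 1" using pair_ones q by auto
  then have *: "2 * x v = adj E v u + adj E v w"
    using pair_weight[OF _ q(2,3) v] q(1) by (simp add: pairs_def)
  show "x v = 1 \<Longrightarrow> E v u \<and> E v w" "x v = 1 / 2 \<Longrightarrow> E v u \<longleftrightarrow> \<not> E v w"
    using * by (cases "E v u"; cases "E v w"; simp)+
qed

lemma one_adj_pair:
  assumes "q \<in> pairs" "v \<in> V" "c v \<noteq> q" "x v = 1" "u \<in> cls q"
  shows "E v u" "E u v"
proof -
  obtain a b where "cls q = {a, b}" "a \<noteq> b" using assms(1) by (auto simp: pairs_def card_2_iff)
  then show "E v u" using pair_adj(1)[OF assms(1) _ _ assms(2,3)] assms by auto
  then show "E u v" by (rule sym)
qed

text \<open>The vertex \<open>u\<close> must receive weight 2 from class \<open>i\<close>. Every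
  vertex of weight 1 there is a neighbour, and the rest amounts to half of the vertices of weight
  1/2.\<close>

lemma halves_balanced:
  assumes q: "q \<in> pairs" and u: "u \<in> cls q" and i: "i < k" "i \<noteq> q"
  shows "2 * card {h \<in> halves i. E h u} = card (halves i)"
proof -
  have uV: "u \<in> V" "c u = q" using u by (auto simp: cls_def)
  have x1: "x u = 1" by (rule pair_ones[OF q u])
  have "2 = (\<Sum>v\<in>cls i. adj E u v * x v)" using regular_cls[OF uV(1) i(1)] uV i x1 by simp
  also have "\<dots> = (\<Sum>v\<in>ones i. 1) + (\<Sum>v\<in>halves i. adj E u v * (1 / 2))"
    unfolding sum_ones_halves
    by (intro arg_cong2[of _ _ _ _ "(+)"] sum.cong refl)
      (use one_adj_pair[OF q _ _ _ u] i in \<open>auto simp: ones_def halves_def cls_def\<close>)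
  also have "\<dots> = real (card (ones i)) + real (card {h \<in> halves i. E u h}) / 2"
    by (simp only: sum_adj_const[OF fin_ones_halves(2)]) simp
  finally have "real (2 * card {h \<in> halves i. E u h} + 4 * card (ones i)) = real 8" by simp
  then have "2 * card {h \<in> halves i. E u h} + 4 * card (ones i) = 8" by (simp only: of_nat_eq_iff)
  moreover have "{h \<in> halves i. E u h} = {h \<in> halves i. E h u}" using sym by blast
  ultimately show ?thesis using card_halves[OF i(1)] by simp
qed

text \<open>A vertex of weight 1/2 outside the classes of size 2 has one neighbour in each of them
  and so is a sign vector indexed by \<open>pairs\<close>. For two such vertices
  \<open>agree\<close> is the set of coordinates with equal signs.\<close>

definition agree :: "'a \<Rightarrow> 'a \<Rightarrow> nat set" where
  "agree a b = {q \<in> pairs. \<exists>y\<in>cls q. E a y \<and> E b y}"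

definition rest :: "'a set" where "rest = {v \<in> V. c v \<notin> pairs}"

text \<open>
  Four times the Gram matrix, with respect to \<open>A + 2I\<close>, of the projections of the vertices
  outside the classes of size 2 to the orthogonal complement of the vertices in these classes.
\<close>

definition kern :: "'a \<Rightarrow> 'a \<Rightarrow> real" where
  "kern a b = 4 * (adj E a b + diag 2 a b) - 4 * x a * x b
     - (if x a = 1 / 2 \<and> x b = 1 / 2 then 2 * real (card (agree a b)) - real (card pairs) else 0)"

lemma kern_sym: "kern a b = kern b a"
proof -
  have "agree a b = agree b a" by (auto simp: agree_def)
  then show ?thesis using sym by (auto simp: kern_def of_bool_def)
qed

text \<open>A Schur complement: \<open>y\<close> on \<open>rest\<close> is extended to
  \<open>Y\<close> on \<open>V\<close> in such a way that A + 2I applied to \<open>Y\<close>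
  vanishes on the classes of size 2. The form of \<open>Y\<close> is then a quarter of the form of
  \<open>kern\<close> at \<open>y\<close>.\<close>

lemma kern_psd:
  assumes ne: "pairs \<noteq> {}" shows "psd_on rest kern"
proof -
  have "\<exists>u w. cls q = {u, w} \<and> u \<noteq> w" if "q \<in> pairs" for q
    using that by (auto simp: pairs_def card_2_iff)
  then obtain U W where UW: "\<And>q. q \<in> pairs \<Longrightarrow> cls q = {U q, W q} \<and> U q \<noteq> W q" by metis
  define n where "n = real (card pairs)"
  have n: "n > 0" using ne fin_pairs by (simp add: n_def card_gt_0_iff)
  define D where "D a q = adj E a (U q) - adj E a (W q)" for a q
  have finR: "finite rest" using fin by (simp add: rest_def)
  have sumV: "(\<Sum>v\<in>V. f v) = (\<Sum>v\<in>rest. f v) + (\<Sum>q\<in>pairs. f (U q) + f (W q))" for f :: "'a \<Rightarrow> real"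
  proof -
    have "V = rest \<union> (\<Union>q\<in>pairs. cls q)" by (auto simp: rest_def cls_def)
    then have "(\<Sum>v\<in>V. f v) = (\<Sum>v\<in>rest \<union> (\<Union>q\<in>pairs. cls q). f v)" by simp
    also have "\<dots> = (\<Sum>v\<in>rest. f v) + (\<Sum>v\<in>(\<Union>q\<in>pairs. cls q). f v)"
      by (rule sum.union_disjoint) (use finR fin_pairs fin_cls in \<open>auto simp: rest_def cls_def\<close>)
    also have "(\<Sum>v\<in>(\<Union>q\<in>pairs. cls q). f v) = (\<Sum>q\<in>pairs. \<Sum>v\<in>cls q. f v)"
      by (rule sum.UNION_disjoint) (use fin_pairs fin_cls cls_disjoint in auto)
    also have "\<dots> = (\<Sum>q\<in>pairs. f (U q) + f (W q))"
      by (intro sum.cong refl) (simp add: UW)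
    finally show ?thesis .
  qed
  have UWV: "U q \<in> V" "W q \<in> V" "c (U q) = q" "c (W q) = q" "x (U q) = 1" "x (W q) = 1" if "q \<in> pairs" for q
    using UW[OF that] pair_ones[OF that] by (auto simp: cls_def)
  have restQ: "a \<in> V" "c a \<noteq> q" if "a \<in> rest" "q \<in> pairs" for a q using that by (auto simp: rest_def)
  have sumD: "adj E a (U q) + adj E a (W q) = 2 * x a" if "a \<in> rest" "q \<in> pairs" for a q
    using pair_adj[OF that(2) _ _ restQ[OF that], of "U q" "W q"] UW[OF that(2)] weight[of a] restQ[OF that]
    by auto
  have DD: "(\<Sum>q\<in>pairs. D a q * D b q) =
      (if x a = 1 / 2 \<and> x b = 1 / 2 then 2 * real (card (agree a b)) - n else 0)"
    if a: "a \<in> rest" and b: "b \<in> rest" for a b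
  proof (cases "x a = 1 / 2 \<and> x b = 1 / 2")
    case True
    have "(\<Sum>q\<in>pairs. D a q * D b q) = (\<Sum>q\<in>pairs. 2 * of_bool (q \<in> agree a b) - 1)"
    proof (intro sum.cong refl)
      fix q assume q: "q \<in> pairs"
      have "E a (U q) \<longleftrightarrow> \<not> E a (W q)" "E b (U q) \<longleftrightarrow> \<not> E b (W q)"
        using pair_adj(2)[OF q _ _ restQ[OF a q], of "U q" "W q"]
          pair_adj(2)[OF q _ _ restQ[OF b q], of "U q" "W q"] UW[OF q] True by auto
      then show "D a q * D b q = 2 * of_bool (q \<in> agree a b) - 1"
        unfolding D_def agree_def using UW[OF q] q by (auto simp: of_bool_def)
    qed
    also have "\<dots> = 2 * real (card (agree a b)) - n"
    proof -
      have "pairs \<inter> {q. q \<in> agree a b} = agree a b" by (auto simp: agree_def)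
      then show ?thesis using fin_pairs(1) by (simp add: sum_subtractf n_def flip: sum_distrib_left)
    qed
    finally show ?thesis using True by simp
  next
    case False
    moreover have "a \<in> V" "b \<in> V" using a b by (auto simp: rest_def)
    ultimately have one: "x a = 1 \<or> x b = 1" using weight by blast
    have D0: "D a q = 0" if "a \<in> rest" "x a = 1" and q: "q \<in> pairs" for a q
      using pair_adj(1)[OF q _ _ restQ[OF that(1) q] that(2), of "U q" "W q"] UW[OF q] by (simp add: D_def)
    have "D a q * D b q = 0" if q: "q \<in> pairs" for q
      using one D0[OF a _ q] D0[OF b _ q] by auto
    then show ?thesis unfolding if_not_P[OF False] by (intro sum.neutral) blast
  qed
  show ?thesis
    unfolding psd_on_def
  proof
    fix y :: "'a \<Rightarrow> real"
    define B where "B u v = adj E u v + diag 2 u v" for u v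
    define \<alpha> where "\<alpha> = (\<Sum>a\<in>rest. 2 * x a * y a)"
    define \<beta> where "\<beta> q = (\<Sum>a\<in>rest. D a q * y a)" for q
    \<comment> \<open>On the n classes of size 2 the matrix A + 2I has eigenvalue 2n on the constant
      vector and 2 on the difference of the two vertices of a class. Dividing the constant part
      \<alpha> / 2 and the difference part \<beta> q / 2 of \<open>adjU\<close> by these eigenvalues
      gives the two values, up to sign.\<close>
    define Y where "Y v = (if v \<in> rest then y v
       else if v = U (c v) then - \<alpha> / (4 * n) - \<beta> (c v) / 4 else - \<alpha> / (4 * n) + \<beta> (c v) / 4)" for v
    have YU: "Y (U q) = - \<alpha> / (4 * n) - \<beta> q / 4" "Y (W q) = - \<alpha> / (4 * n) + \<beta> q / 4" if "q \<in> pairs" for q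
      using UW[OF that] UWV[OF that] that by (auto simp: Y_def rest_def)
    have YR: "Y a = y a" if "a \<in> rest" for a using that by (simp add: Y_def)
    have adjU: "(\<Sum>a\<in>rest. adj E (U q) a * y a) = (\<alpha> + \<beta> q) / 2"
      "(\<Sum>a\<in>rest. adj E (W q) a * y a) = (\<alpha> - \<beta> q) / 2" if q: "q \<in> pairs" for q
    proof -
      have E: "adj E (U q) a = (2 * x a + D a q) / 2" "adj E (W q) a = (2 * x a - D a q) / 2" if "a \<in> rest" for a
        using sumD[OF that q] sym[of a "U q"] sym[of "U q" a] sym[of a "W q"] sym[of "W q" a]
        by (auto simp: D_def of_bool_def split: if_splits)
      have "(\<Sum>a\<in>rest. adj E (U q) a * y a) = (\<Sum>a\<in>rest. (2 * x a * y a + D a q * y a) / 2)"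
        by (intro sum.cong refl) (simp only: E, simp add: algebra_simps)
      then show "(\<Sum>a\<in>rest. adj E (U q) a * y a) = (\<alpha> + \<beta> q) / 2"
        unfolding \<alpha>_def \<beta>_def by (simp only: sum.distrib flip: sum_divide_distrib)
      have "(\<Sum>a\<in>rest. adj E (W q) a * y a) = (\<Sum>a\<in>rest. (2 * x a * y a - D a q * y a) / 2)"
        by (intro sum.cong refl) (simp only: E, simp add: algebra_simps)
      then show "(\<Sum>a\<in>rest. adj E (W q) a * y a) = (\<alpha> - \<beta> q) / 2"
        unfolding \<alpha>_def \<beta>_def by (simp only: sum_subtractf flip: sum_divide_distrib)
    qed
    have pairsum: "(\<Sum>p\<in>pairs. B u (U p) * Y (U p) + B u (W p) * Y (W p)) = 2 * Y u + \<alpha> / (2 * n) - \<alpha> / 2"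
      if q: "q \<in> pairs" and u: "u \<in> cls q" for q u
    proof -
      have uV: "u \<in> V" "c u = q" "x u = 1" using u pair_ones[OF q u] by (auto simp: cls_def)
      have *: "B u (U p) * Y (U p) + B u (W p) * Y (W p) = (if p = q then 2 * Y u + \<alpha> / (2 * n) else 0) - \<alpha> / (2 * n)"
        if p: "p \<in> pairs" for p
      proof (cases "p = q")
        case True
        have "\<not> E u (U p)" "\<not> E u (W p)" using proper UWV[OF p] uV True by metis+
        then show ?thesis using True u UW[OF p] by (auto simp: B_def)
      next
        case False
        then have "E u (U p)" "E u (W p)" "u \<noteq> U p" "u \<noteq> W p"
          using one_adj_pair[OF p uV(1) _ uV(3)] UW[OF p] UWV[OF p] uV by auto
        then show ?thesis using False by (simp add: B_def YU[OF p])
      qed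
      have "(\<Sum>p\<in>pairs. B u (U p) * Y (U p) + B u (W p) * Y (W p)) =
         (\<Sum>p\<in>pairs. (if p = q then 2 * Y u + \<alpha> / (2 * n) else 0) - \<alpha> / (2 * n))"
        by (intro sum.cong refl *)
      also have "\<dots> = 2 * Y u + \<alpha> / (2 * n) - n * (\<alpha> / (2 * n))"
        using q fin_pairs(1) by (simp add: sum_subtractf n_def)
      finally have "(\<Sum>p\<in>pairs. B u (U p) * Y (U p) + B u (W p) * Y (W p)) =
        2 * Y u + \<alpha> / (2 * n) - n * (\<alpha> / (2 * n))" .
      then show ?thesis using n by simp
    qed
    have zero: "(\<Sum>v\<in>V. B (U q) v * Y v) = 0" "(\<Sum>v\<in>V. B (W q) v * Y v) = 0" if q: "q \<in> pairs" for q
    proof -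
      have BR: "(\<Sum>a\<in>rest. B u a * Y a) = (\<Sum>a\<in>rest. adj E u a * y a)" if "u \<in> cls q" for u
        by (intro sum.cong refl) (use that q YR in \<open>auto simp: B_def rest_def cls_def\<close>)
      show "(\<Sum>v\<in>V. B (U q) v * Y v) = 0"
        using pairsum[OF q, of "U q"] BR[of "U q"] adjU(1)[OF q] YU(1)[OF q] UW[OF q] n
        by (simp add: sumV field_simps)
      show "(\<Sum>v\<in>V. B (W q) v * Y v) = 0"
        using pairsum[OF q, of "W q"] BR[of "W q"] adjU(2)[OF q] YU(2)[OF q] UW[OF q] n
        by (simp add: sumV field_simps)
    qed
    have GR: "(\<Sum>v\<in>V. B u v * Y v) = (\<Sum>a\<in>rest. kern u a * y a) / 4" if u: "u \<in> rest" for u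
    proof -
      have "(\<Sum>a\<in>rest. kern u a * y a) =
         (\<Sum>a\<in>rest. 4 * (B u a * y a) - 2 * x u * (2 * x a * y a) - (\<Sum>p\<in>pairs. D u p * (D a p * y a)))"
      proof (intro sum.cong refl)
        fix a assume a: "a \<in> rest"
        have "(\<Sum>p\<in>pairs. D u p * (D a p * y a)) = (\<Sum>p\<in>pairs. D u p * D a p) * y a"
          by (simp add: sum_distrib_right mult.assoc)
        then show "kern u a * y a =
            4 * (B u a * y a) - 2 * x u * (2 * x a * y a) - (\<Sum>p\<in>pairs. D u p * (D a p * y a))"
          unfolding DD[OF u a] kern_def B_def n_def by (simp add: algebra_simps)
      qed
      also have "\<dots> = 4 * (\<Sum>a\<in>rest. B u a * y a) - 2 * x u * \<alpha> - (\<Sum>a\<in>rest. \<Sum>p\<in>pairs. D u p * (D a p * y a))"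
        unfolding \<alpha>_def by (simp only: sum_subtractf sum_distrib_left)
      also have "(\<Sum>a\<in>rest. \<Sum>p\<in>pairs. D u p * (D a p * y a)) = (\<Sum>p\<in>pairs. D u p * \<beta> p)"
        unfolding \<beta>_def sum_distrib_left by (rule sum.swap)
      finally have k: "(\<Sum>a\<in>rest. kern u a * y a) =
        4 * (\<Sum>a\<in>rest. B u a * y a) - 2 * x u * \<alpha> - (\<Sum>p\<in>pairs. D u p * \<beta> p)" .
      have "(\<Sum>p\<in>pairs. B u (U p) * Y (U p) + B u (W p) * Y (W p)) =
        (\<Sum>p\<in>pairs. - \<alpha> * x u / (2 * n) - D u p * \<beta> p / 4)"
      proof (intro sum.cong refl)
        fix p assume p: "p \<in> pairs"
        have "u \<noteq> U p" "u \<noteq> W p" using u UWV[OF p] p by (auto simp: rest_def)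
        then have "B u (U p) * Y (U p) + B u (W p) * Y (W p) =
           (adj E u (U p) + adj E u (W p)) * (- \<alpha> / (4 * n)) - D u p * \<beta> p / 4"
          unfolding YU[OF p] B_def D_def by (simp add: algebra_simps)
        then show "B u (U p) * Y (U p) + B u (W p) * Y (W p) = - \<alpha> * x u / (2 * n) - D u p * \<beta> p / 4"
          unfolding sumD[OF u p] by simp
      qed
      also have "\<dots> = - \<alpha> * x u / 2 - (\<Sum>p\<in>pairs. D u p * \<beta> p) / 4"
        using n by (simp add: sum_subtractf n_def flip: sum_divide_distrib)
      finally have p: "(\<Sum>p\<in>pairs. B u (U p) * Y (U p) + B u (W p) * Y (W p)) =
        - \<alpha> * x u / 2 - (\<Sum>p\<in>pairs. D u p * \<beta> p) / 4" .
      have "(\<Sum>a\<in>rest. B u a * Y a) = (\<Sum>a\<in>rest. B u a * y a)"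
        by (intro sum.cong refl) (simp add: YR)
      then show ?thesis unfolding sumV k p by (simp add: field_simps)
    qed
    have "0 \<le> qform V B Y" using psd by (simp add: psd_on_def B_def[abs_def])
    also have "qform V B Y = (\<Sum>u\<in>rest. y u * ((\<Sum>a\<in>rest. kern u a * y a) / 4))"
      unfolding qform_alt by (subst sumV) (simp add: zero GR YR)
    also have "\<dots> = qform rest kern y / 4" by (simp add: qform_alt flip: sum_divide_distrib)
    finally show "0 \<le> qform rest kern y" by simp
  qed
qed

end

section \<open>Sign models\<close>

text \<open>
  A vertex \<open>Inl (m, s)\<close> is one of the two vertices in the class of size 2 with label \<open>m\<close>; the
  vertices \<open>Inr r\<close> are the others.
\<close>

definition model_verts :: "nat set \<Rightarrow> nat set \<Rightarrow> (nat \<times> bool + nat) set" where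
  "model_verts P R = Inl ` (P \<times> UNIV) \<union> Inr ` R"

fun model_edge :: "(nat \<Rightarrow> nat \<Rightarrow> bool \<Rightarrow> bool) \<Rightarrow> (nat \<Rightarrow> nat \<Rightarrow> bool) \<Rightarrow> nat \<times> bool + nat \<Rightarrow> nat \<times> bool + nat \<Rightarrow> bool" where
  "model_edge T W (Inl (m, s)) (Inl (m', s')) \<longleftrightarrow> m \<noteq> m'"
| "model_edge T W (Inl (m, s)) (Inr r) \<longleftrightarrow> T r m s"
| "model_edge T W (Inr r) (Inl (m, s)) \<longleftrightarrow> T r m s"
| "model_edge T W (Inr r) (Inr r') \<longleftrightarrow> W r r'"

context half_system
begin

lemma halvesD: "h \<in> halves i \<Longrightarrow> h \<in> V" "h \<in> halves i \<Longrightarrow> c h = i" "h \<in> halves i \<Longrightarrow> x h = 1 / 2"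
  unfolding halves_def cls_def by blast+

lemma onesD: "z \<in> ones i \<Longrightarrow> z \<in> V" "z \<in> ones i \<Longrightarrow> c z = i" "z \<in> ones i \<Longrightarrow> x z = 1"
  unfolding ones_def cls_def by blast+

lemma pair_cls:
  assumes "q \<in> pairs"
  obtains u w where "cls q = {u, w}" "u \<noteq> w"
  using assms by (auto simp: pairs_def card_2_iff)

lemma half_rest: "h \<in> halves i \<Longrightarrow> h \<in> rest"
  using pair_ones[of i h] by (force simp: halves_def cls_def rest_def)

lemma quint_one_rest: "z \<in> ones i \<Longrightarrow> i \<in> quints \<Longrightarrow> z \<in> rest"
  by (auto simp: ones_def cls_def rest_def quints_def pairs_def)

lemma rest_eq: "rest = (\<Union>i\<in>quints. cls i) \<union> (\<Union>i\<in>octs. cls i)"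
proof -
  have "c v \<in> pairs \<or> c v \<in> quints \<or> c v \<in> octs" if "v \<in> V" for v
    using class_cases[OF col[OF that]] col[OF that] by (auto simp: pairs_def quints_def octs_def)
  moreover have "i \<notin> pairs" if "i \<in> quints \<or> i \<in> octs" for i
    using that by (auto simp: pairs_def quints_def octs_def)
  ultimately show ?thesis unfolding rest_def cls_def by blast
qed

lemma fin_rest: "finite rest" using fin by (simp add: rest_def)

lemma agree_iff:
  assumes q: "q \<in> pairs" "cls q = {u, w}" "u \<noteq> w" and a: "a \<in> rest" "x a = 1 / 2" and b: "b \<in> rest" "x b = 1 / 2"
  shows "q \<in> agree a b \<longleftrightarrow> (E a u \<longleftrightarrow> E b u)"
proof -
  have "a \<in> V" "c a \<noteq> q" "b \<in> V" "c b \<noteq> q" using a b q by (auto simp: rest_def)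
  then have "E a u \<longleftrightarrow> \<not> E a w" "E b u \<longleftrightarrow> \<not> E b w"
    using pair_adj(2)[OF q, of a] pair_adj(2)[OF q, of b] a b by auto
  then show ?thesis using q by (auto simp: agree_def)
qed

lemma agree_subset: "agree a b \<subseteq> pairs" by (auto simp: agree_def)

lemma fin_agree: "finite (agree a b)" using agree_subset fin_pairs(1) by (rule finite_subset)

lemma agree_commute: "agree a b = agree b a" by (auto simp: agree_def)

lemma agree_self:
  assumes "a \<in> rest" "x a = 1 / 2" shows "agree a a = pairs"
proof -
  have "q \<in> agree a a" if "q \<in> pairs" for q
    using pair_cls[OF that] agree_iff[OF that _ _ assms assms] by metis
  then show ?thesis using agree_subset by blast
qed

lemma agree_agree:
  assumes "h \<in> rest" "x h = 1 / 2" "a \<in> rest" "x a = 1 / 2" "b \<in> rest" "x b = 1 / 2" "q \<in> pairs"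
  shows "q \<in> agree a b \<longleftrightarrow> (q \<in> agree h a \<longleftrightarrow> q \<in> agree h b)"
proof -
  obtain u w where uw: "cls q = {u, w}" "u \<noteq> w" using pair_cls[OF assms(7)] .
  show ?thesis
    unfolding agree_iff[OF assms(7) uw assms(3-6)] agree_iff[OF assms(7) uw assms(1-4)]
      agree_iff[OF assms(7) uw assms(1,2,5,6)] by blast
qed

lemma same_class: "a \<in> V \<Longrightarrow> b \<in> V \<Longrightarrow> c a = c b \<Longrightarrow> \<not> E a b"
  using proper by blast

lemma kern_half_half:
  assumes "a \<in> rest" "x a = 1 / 2" "b \<in> rest" "x b = 1 / 2" "a \<noteq> b"
  shows "kern a b = 4 * adj E a b - 1 + real (card pairs) - 2 * real (card (agree a b))"
  using assms(5) unfolding kern_def assms(2,4) by simp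

lemma kern_half_self:
  assumes "a \<in> rest" "x a = 1 / 2" shows "kern a a = 7 - real (card pairs)"
  unfolding kern_def assms(2) agree_self[OF assms] by (simp add: irr)

lemma kern_one:
  assumes "x a = 1"
  shows "kern a a = 4" "b \<noteq> a \<Longrightarrow> x b = 1 / 2 \<Longrightarrow> kern a b = 4 * adj E a b - 2"
    "b \<noteq> a \<Longrightarrow> x b = 1 \<Longrightarrow> kern a b = 4 * adj E a b - 4"
proof -
  show "kern a a = 4" by (simp add: kern_def assms irr)
  show "kern a b = 4 * adj E a b - 2" if "b \<noteq> a" "x b = 1 / 2"
    unfolding kern_def assms that(2) using that(1) by simp
  show "kern a b = 4 * adj E a b - 4" if "b \<noteq> a" "x b = 1"
    unfolding kern_def assms that(2) using that(1) by simp
qed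

lemma kern_nonneg:
  assumes "pairs \<noteq> {}" "S \<subseteq> rest" shows "0 \<le> qform S kern y"
  using psd_on_subset[OF fin_rest assms(2) kern_psd[OF assms(1)]] by (simp add: psd_on_def)

text \<open>A null vector supported on a few vertices constrains the row of every other vertex; this
  forces adjacencies in the extremal cases.\<close>

lemma kern_null:
  assumes "pairs \<noteq> {}" "S \<subseteq> rest" "qform S kern y = 0" "v \<in> rest"
  shows "(\<Sum>u\<in>S. kern v u * y u) = 0"
proof -
  let ?S = "insert v S"
  have finS: "finite S" using assms(2) fin_rest by (rule finite_subset)
  define z where "z u = (if u \<in> S then y u else 0)" for u
  have sum: "(\<Sum>u\<in>?S. f u * z u) = (\<Sum>u\<in>S. f u * y u)" for f
    by (rule sum.mono_neutral_cong_right) (use finS in \<open>auto simp: z_def\<close>)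
  have sum': "(\<Sum>u\<in>?S. z u * f u) = (\<Sum>u\<in>S. y u * f u)" for f
    using sum[of f] by (simp only: mult.commute)
  have "qform ?S kern z = qform S kern y" unfolding qform_alt sum sum' ..
  then have "qform ?S kern z = 0" using assms(3) by simp
  moreover have "psd_on ?S kern"
    by (rule psd_on_subset[OF fin_rest _ kern_psd[OF assms(1)]]) (use assms in auto)
  ultimately have "(\<Sum>u\<in>?S. kern v u * z u) = 0"
    using finS kern_sym by (intro psd_on_null[of ?S kern z v]) auto
  then show ?thesis unfolding sum .
qed

lemma kern_pair_bound:
  assumes "pairs \<noteq> {}" "a \<in> rest" "b \<in> rest" "a \<noteq> b"
  shows "0 \<le> kern a a + kern b b + 2 * kern a b" "0 \<le> kern a a + kern b b - 2 * kern a b"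
  using kern_nonneg[OF assms(1), of "{a, b}" "\<lambda>_. 1"] kern_nonneg[OF assms(1), of "{a, b}" "\<lambda>u. if u = a then 1 else - 1"]
    assms kern_sym[of b a] by (auto simp: qform_def)

section \<open>Bounds on the number of classes of size 2\<close>

lemma oct_card:
  assumes "i \<in> octs" shows "card (halves i) = 8" "cls i = halves i"
proof -
  have i: "i < k" "card (cls i) = 8" using assms by (auto simp: octs_def)
  from class_cases[OF i(1)] have *: "card (halves i) = 8 \<and> card (ones i) = 0" by cases (simp_all add: i(2))
  then show "card (halves i) = 8" by simp
  show "cls i = halves i" using * cls_ones_halves(1)[of i] fin_ones_halves(1)[of i] by simp
qed

lemma quint_card:
  assumes "i \<in> quints" shows "card (halves i) = 4" "card (ones i) = 1"
proof -
  have i: "i < k" "card (cls i) = 5" using assms by (auto simp: quints_def)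
  from class_cases[OF i(1)] have *: "card (halves i) = 4 \<and> card (ones i) = 1" by cases (simp_all add: i(2))
  then show "card (halves i) = 4" "card (ones i) = 1" by simp_all
qed

lemma oct_pairs_le: assumes "octs \<noteq> {}" shows "card pairs \<le> 7"
proof (rule ccontr)
  assume large: "\<not> ?thesis"
  then have ne: "pairs \<noteq> {}" by auto
  obtain i where i: "i \<in> octs" using assms by auto
  have "card (halves i) = 8" by (rule oct_card[OF i])
  then have "halves i \<noteq> {}" by auto
  then obtain h where h: "h \<in> halves i" by auto
  have "0 \<le> qform {h} kern (\<lambda>_. 1)" by (rule kern_nonneg[OF ne]) (use half_rest h in auto)
  also have "\<dots> = 7 - real (card pairs)"
    using kern_half_self[OF half_rest[OF h] halvesD(3)[OF h]] by (simp add: qform_def)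
  finally show False using large by simp
qed

text \<open>A vertex of a class of size 2 sees exactly two of the four halves, so every such class
  splits them two and two. The three sets sort these classes by the partner of
  \<open>a\<close>.\<close>

lemma quint_agree:
  assumes i: "i \<in> quints" and h: "halves i = {a, b, d, e}" "distinct [a, b, d, e]"
  shows "agree d e = agree a b" "agree b e = agree a d" "agree b d = agree a e"
    "pairs = agree a b \<union> agree a d \<union> agree a e"
    "agree a b \<inter> agree a d = {}" "agree a b \<inter> agree a e = {}" "agree a d \<inter> agree a e = {}"
    "card pairs = card (agree a b) + card (agree a d) + card (agree a e)"
proof -
  have r: "v \<in> rest" "x v = 1 / 2" if "v \<in> {a, b, d, e}" for v
    using that half_rest[of v i] halvesD(3)[of v i] h(1) by auto
  have P: "(q \<in> agree d e \<longleftrightarrow> q \<in> agree a b) \<and> (q \<in> agree b e \<longleftrightarrow> q \<in> agree a d) \<and> (q \<in> agree b d \<longleftrightarrow> q \<in> agree a e)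
     \<and> (q \<in> agree a b \<or> q \<in> agree a d \<or> q \<in> agree a e) \<and> \<not> (q \<in> agree a b \<and> q \<in> agree a d)
     \<and> \<not> (q \<in> agree a b \<and> q \<in> agree a e) \<and> \<not> (q \<in> agree a d \<and> q \<in> agree a e)"
    if q: "q \<in> pairs" for q
  proof -
    obtain u w where uw: "cls q = {u, w}" "u \<noteq> w" using pair_cls[OF q] .
    have "i < k" "i \<noteq> q" using i q by (auto simp: quints_def pairs_def)
    then have "2 * card {h \<in> halves i. E h u} = card (halves i)" using uw q by (intro halves_balanced[of q]) auto
    then have two: "card {v \<in> {a, b, d, e}. E v u} = 2" using h by simp
    have "card {v \<in> {a, b, d, e}. E v u} = of_bool (E a u) + of_bool (E b u) + of_bool (E d u) + of_bool (E e u)"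
    proof -
      have "card {v \<in> {a, b, d, e}. E v u} = (\<Sum>v\<in>{a, b, d, e}. of_bool (E v u))"
        by (simp add: Int_def)
      also have "\<dots> = of_bool (E a u) + of_bool (E b u) + of_bool (E d u) + of_bool (E e u)"
        using h(2) by (simp del: sum_of_bool_eq)
      finally show ?thesis .
    qed
    note two = two[unfolded this]
    show ?thesis
      using two
      by (simp add: agree_iff[OF q uw r r]) (cases "E a u"; cases "E b u"; cases "E d u"; cases "E e u"; simp)
  qed
  show 1: "agree d e = agree a b" "agree b e = agree a d" "agree b d = agree a e"
    "pairs = agree a b \<union> agree a d \<union> agree a e"
    "agree a b \<inter> agree a d = {}" "agree a b \<inter> agree a e = {}" "agree a d \<inter> agree a e = {}"
    using P agree_subset by blast+
  have "card pairs = card (agree a b \<union> agree a d \<union> agree a e)" using 1(4) by simp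
  also have "\<dots> = card (agree a b) + card (agree a d) + card (agree a e)"
    using 1(5-7) fin_agree by (subst card_Un_disjoint; auto)+
  finally show "card pairs = card (agree a b) + card (agree a d) + card (agree a e)" .
qed

lemma quint_kern:
  assumes "i \<in> quints" "a \<in> halves i" "b \<in> halves i" "a \<noteq> b"
  shows "kern a b = real (card pairs) - 1 - 2 * real (card (agree a b))"
  using kern_half_half[OF half_rest halvesD(3) half_rest halvesD(3), of a i i b i i] assms
    same_class[of a b] halvesD[of a i] halvesD[of b i] by simp

text \<open>The vector with value 1 on \<open>a\<close>, \<open>b\<close> and - 1 on
  \<open>d\<close>, \<open>e\<close> has a form that does not depend on the number of classes of
  size 2, namely 32 - 16 \<open>card (agree a b)\<close>.\<close>

lemma quint_agree_le:
  assumes ne: "pairs \<noteq> {}" and i: "i \<in> quints" and h: "halves i = {a, b, d, e}" "distinct [a, b, d, e]"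
  shows "card (agree a b) \<le> 2"
proof -
  note A = quint_agree[OF i h]
  have hs: "a \<in> halves i" "b \<in> halves i" "d \<in> halves i" "e \<in> halves i" using h by auto
  note K = quint_kern[OF i]
  have "0 \<le> qform {a, b, d, e} kern (\<lambda>v. if v = a \<or> v = b then 1 else - 1)"
    by (rule kern_nonneg[OF ne]) (use hs half_rest in auto)
  also have "\<dots> = kern a a + kern b b + kern d d + kern e e
      + 2 * (kern a b + kern d e - kern a d - kern a e - kern b d - kern b e)"
    using h(2) kern_sym[of b a] kern_sym[of d a] kern_sym[of e a] kern_sym[of d b] kern_sym[of e b] kern_sym[of e d]
    by (auto simp: qform_def)
  also have "\<dots> = 32 - 16 * real (card (agree a b))"
    using h(2) hs A(8) by (simp add: K A(1-3) kern_half_self[OF half_rest halvesD(3)])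
  finally show ?thesis by simp
qed

lemma quint_halves:
  assumes "i \<in> quints"
  obtains z a b d e where "ones i = {z}" "halves i = {a, b, d, e}" "distinct [a, b, d, e]"
    "cls i = {z, a, b, d, e}" "z \<notin> {a, b, d, e}"
    "card (agree a b) \<ge> card (agree a d)" "card (agree a d) \<ge> card (agree a e)"
proof -
  note cards = quint_card[OF assms]
  obtain z where z: "ones i = {z}" using cards by (auto simp: card_1_singleton_iff)
  obtain hs where hs: "set hs = halves i" "distinct hs" "length hs = 4"
    using finite_distinct_list[OF fin_ones_halves(2)] cards(1) distinct_card by metis
  then obtain a b d e where "hs = [a, b, d, e]"
    by (auto simp: numeral_eq_Suc length_Suc_conv)
  then have abde: "halves i = {a, b, d, e}" "distinct [a, b, d, e]" using hs by simp_all
  have nz: "z \<notin> halves i" using z cls_ones_halves(2)[of i] by auto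
  have "\<exists>b' d' e'. {b', d', e'} = {b, d, e} \<and> distinct [b', d', e']
      \<and> card (agree a b') \<ge> card (agree a d') \<and> card (agree a d') \<ge> card (agree a e')"
  proof -
    let ?f = "\<lambda>v. card (agree a v)"
    consider "?f b \<ge> ?f d \<and> ?f d \<ge> ?f e" | "?f b \<ge> ?f e \<and> ?f e \<ge> ?f d" | "?f d \<ge> ?f b \<and> ?f b \<ge> ?f e"
      | "?f d \<ge> ?f e \<and> ?f e \<ge> ?f b" | "?f e \<ge> ?f b \<and> ?f b \<ge> ?f d" | "?f e \<ge> ?f d \<and> ?f d \<ge> ?f b"
      by linarith
    then show ?thesis
    proof cases
      case 1 then show ?thesis using abde(2) by (intro exI[of _ b] exI[of _ d] exI[of _ e]) auto
    next
      case 2 then show ?thesis using abde(2) by (intro exI[of _ b] exI[of _ e] exI[of _ d]) auto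
    next
      case 3 then show ?thesis using abde(2) by (intro exI[of _ d] exI[of _ b] exI[of _ e]) auto
    next
      case 4 then show ?thesis using abde(2) by (intro exI[of _ d] exI[of _ e] exI[of _ b]) auto
    next
      case 5 then show ?thesis using abde(2) by (intro exI[of _ e] exI[of _ b] exI[of _ d]) auto
    next
      case 6 then show ?thesis using abde(2) by (intro exI[of _ e] exI[of _ d] exI[of _ b]) auto
    qed
  qed
  then obtain b' d' e' where *: "{b', d', e'} = {b, d, e}" "distinct [b', d', e']"
    "card (agree a b') \<ge> card (agree a d')" "card (agree a d') \<ge> card (agree a e')" by blast
  have h: "halves i = {a, b', d', e'}" using abde(1) *(1) by simp
  moreover have "distinct [a, b', d', e']"
  proof -
    have "a \<notin> {b', d', e'}" unfolding *(1) using abde(2) by simp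
    then show ?thesis using *(2) by simp
  qed
  ultimately show thesis using that[OF z h _ _ _ *(3,4)] cls_ones_halves(1)[of i] z nz by auto
qed

lemma quint_pairs_le: assumes "quints \<noteq> {}" "pairs \<noteq> {}" shows "card pairs \<le> 6"
proof -
  obtain i where i: "i \<in> quints" using assms by auto
  obtain z a b d e where h: "halves i = {a, b, d, e}" "distinct [a, b, d, e]"
    and "card (agree a b) \<ge> card (agree a d)" "card (agree a d) \<ge> card (agree a e)"
    using quint_halves[OF i] by metis
  then show ?thesis using quint_agree(8)[OF i h] quint_agree_le[OF assms(2) i h] by linarith
qed

text \<open>The vertex \<open>h\<close> orients the classes of size 2: its neighbour in each of them
  becomes the \<open>True\<close> vertex. The signs of every other vertex of weight 1/2 can then be
  read off from its agreements with \<open>h\<close>.\<close>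

theorem model_iso:
  fixes \<pi> :: "nat \<Rightarrow> nat" and \<rho> :: "nat \<Rightarrow> 'a"
  assumes h: "h \<in> rest" "x h = 1 / 2" and \<pi>: "bij_betw \<pi> P pairs" and \<rho>: "bij_betw \<rho> R rest"
    and T: "\<And>r m s. r \<in> R \<Longrightarrow> m \<in> P \<Longrightarrow> T r m s \<longleftrightarrow> x (\<rho> r) = 1 \<or> (s \<longleftrightarrow> \<pi> m \<in> agree h (\<rho> r))"
    and W: "\<And>r r'. r \<in> R \<Longrightarrow> r' \<in> R \<Longrightarrow> W r r' \<longleftrightarrow> E (\<rho> r) (\<rho> r')"
  shows "rel_iso V E (model_verts P R) (model_edge T W)"
proof -
  have "\<exists>u w. cls q = {u, w} \<and> u \<noteq> w \<and> E h u \<and> \<not> E h w" if q: "q \<in> pairs" for q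
  proof -
    obtain u w where uw: "cls q = {u, w}" "u \<noteq> w" using pair_cls[OF q] .
    have "h \<in> V" "c h \<noteq> q" using h q by (auto simp: rest_def)
    then have "E h u \<longleftrightarrow> \<not> E h w" using pair_adj(2)[OF q uw] h by auto
    then show ?thesis using uw by (cases "E h u") (auto simp: insert_commute)
  qed
  then obtain U W' where UW: "\<And>q. q \<in> pairs \<Longrightarrow> cls q = {U q, W' q} \<and> U q \<noteq> W' q \<and> E h (U q) \<and> \<not> E h (W' q)"
    by metis
  have UWV: "U q \<in> V" "W' q \<in> V" "c (U q) = q" "c (W' q) = q" if "q \<in> pairs" for q
    using UW[OF that] by (auto simp: cls_def)
  have \<pi>P: "\<pi> m \<in> pairs" if "m \<in> P" for m using \<pi> that by (auto simp: bij_betw_def)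
  have \<rho>R: "\<rho> r \<in> rest" if "r \<in> R" for r using \<rho> that by (auto simp: bij_betw_def)
  define g where "g v = (case v of Inl (m, s) \<Rightarrow> if s then U (\<pi> m) else W' (\<pi> m) | Inr r \<Rightarrow> \<rho> r)" for v
  have inj: "inj_on g (model_verts P R)"
  proof (rule inj_onI)
    fix v v' assume v: "v \<in> model_verts P R" "v' \<in> model_verts P R" "g v = g v'"
    have c1: "c (g (Inl (m, s))) = \<pi> m" if "m \<in> P" for m s using UWV[OF \<pi>P[OF that]] by (simp add: g_def)
    have c2: "c (g (Inr r)) \<notin> pairs" if "r \<in> R" for r using \<rho>R[OF that] by (simp add: g_def rest_def)
    consider m s m' s' where "v = Inl (m, s)" "v' = Inl (m', s')" "m \<in> P" "m' \<in> P"
      | r r' where "v = Inr r" "v' = Inr r'" "r \<in> R" "r' \<in> R"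
      | m s r where "v = Inl (m, s)" "v' = Inr r" "m \<in> P" "r \<in> R"
      | m s r where "v' = Inl (m, s)" "v = Inr r" "m \<in> P" "r \<in> R"
      using v by (auto simp: model_verts_def)
    then show "v = v'"
    proof cases
      case 1
      then have "\<pi> m = \<pi> m'" using v(3) c1 by metis
      then have "m = m'" using \<pi> 1 by (auto simp: bij_betw_def inj_on_eq_iff)
      moreover have "s = s'" using v(3) UW[OF \<pi>P[OF 1(3)]] 1 \<open>m = m'\<close> by (auto simp: g_def split: if_splits)
      ultimately show ?thesis using 1 by simp
    next
      case 2
      then show ?thesis using v(3) \<rho> by (auto simp: g_def bij_betw_def inj_on_eq_iff)
    next
      case 3
      then show ?thesis using v(3) c1 c2 \<pi>P by metis
    next
      case 4
      then show ?thesis using v(3) c1 c2 \<pi>P by metis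
    qed
  qed
  have im: "g ` model_verts P R = V"
  proof -
    have "g ` model_verts P R = (\<Union>m\<in>P. {U (\<pi> m), W' (\<pi> m)}) \<union> \<rho> ` R"
    proof -
      have "P \<times> (UNIV :: bool set) = (\<Union>m\<in>P. {(m, True), (m, False)})" by (auto simp: UNIV_bool)
      then show ?thesis by (simp add: model_verts_def g_def image_Un image_UN image_image)
    qed
    also have "(\<Union>m\<in>P. {U (\<pi> m), W' (\<pi> m)}) = (\<Union>q\<in>\<pi> ` P. {U q, W' q})" by blast
    also have "\<pi> ` P = pairs" using \<pi> by (simp add: bij_betw_def)
    also have "(\<Union>q\<in>pairs. {U q, W' q}) = (\<Union>q\<in>pairs. cls q)" using UW by auto
    also have "\<rho> ` R = rest" using \<rho> by (simp add: bij_betw_def)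
    also have "(\<Union>q\<in>pairs. cls q) \<union> rest = V" by (auto simp: cls_def rest_def)
    finally show ?thesis .
  qed
  have edge: "E (g (Inr r)) (g (Inl (m, s))) \<longleftrightarrow> T r m s" if r: "r \<in> R" and m: "m \<in> P" for r m s
  proof -
    have V: "\<rho> r \<in> V" "c (\<rho> r) \<noteq> \<pi> m" using \<rho>R[OF r] \<pi>P[OF m] by (auto simp: rest_def)
    note uw = UW[OF \<pi>P[OF m]]
    consider "x (\<rho> r) = 1" | "x (\<rho> r) = 1 / 2" using weight[OF V(1)] by blast
    then show ?thesis
    proof cases
      case 1
      then have "E (\<rho> r) (U (\<pi> m))" "E (\<rho> r) (W' (\<pi> m))"
        using pair_adj(1)[OF \<pi>P[OF m] _ _ V 1] uw by auto
      then show ?thesis using T[OF r m] 1 by (simp add: g_def)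
    next
      case 2
      have "x (\<rho> r) \<noteq> 1" using 2 by simp
      moreover have "E (\<rho> r) (U (\<pi> m)) \<longleftrightarrow> \<not> E (\<rho> r) (W' (\<pi> m))"
        using pair_adj(2)[OF \<pi>P[OF m] _ _ V 2] uw by auto
      moreover have "\<pi> m \<in> agree h (\<rho> r) \<longleftrightarrow> (E h (U (\<pi> m)) \<longleftrightarrow> E (\<rho> r) (U (\<pi> m)))"
        by (rule agree_iff[OF \<pi>P[OF m] _ _ h \<rho>R[OF r] 2]) (use uw in auto)
      ultimately show ?thesis using T[OF r m, of s] uw by (auto simp: g_def)
    qed
  qed
  have pp: "E (g (Inl (m, s))) (g (Inl (m', s'))) \<longleftrightarrow> m \<noteq> m'" if "m \<in> P" "m' \<in> P" for m s m' s'
  proof -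
    have gm: "g (Inl (m, s)) \<in> cls (\<pi> m)" if "m \<in> P" for m s
      using UW[OF \<pi>P[OF that]] by (simp add: g_def)
    show ?thesis
    proof (cases "m = m'")
      case True
      have "g (Inl (m, s)) \<in> V \<and> c (g (Inl (m, s))) = \<pi> m" for s
        using gm[OF that(1), of s] by (simp add: cls_def)
      then have "\<not> E (g (Inl (m, s))) (g (Inl (m, s')))" by (intro same_class) auto
      then show ?thesis using True by simp
    next
      case False
      then have "\<pi> m \<noteq> \<pi> m'" using \<pi> that by (auto simp: bij_betw_def inj_on_eq_iff)
      then have "E (g (Inl (m, s))) (g (Inl (m', s')))"
        using one_adj_pair(1)[OF \<pi>P[OF that(2)] _ _ _ gm[OF that(2)]] gm[OF that(1), of s]
          pair_ones[OF \<pi>P[OF that(1)] gm[OF that(1)]] by (simp add: cls_def)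
      then show ?thesis using False by simp
    qed
  qed
  have "rel_iso (model_verts P R) (model_edge T W) V E"
    unfolding rel_iso_def
  proof (intro exI[of _ g] conjI ballI)
    show "bij_betw g (model_verts P R) V" using inj im by (simp add: bij_betw_def)
    fix v v' assume v: "v \<in> model_verts P R" "v' \<in> model_verts P R"
    then consider m s m' s' where "v = Inl (m, s)" "v' = Inl (m', s')" "m \<in> P" "m' \<in> P"
      | r r' where "v = Inr r" "v' = Inr r'" "r \<in> R" "r' \<in> R"
      | m s r where "v = Inl (m, s)" "v' = Inr r" "m \<in> P" "r \<in> R"
      | m s r where "v' = Inl (m, s)" "v = Inr r" "m \<in> P" "r \<in> R"
      by (auto simp: model_verts_def)
    then show "model_edge T W v v' \<longleftrightarrow> E (g v) (g v')"
    proof cases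
      case 1 then show ?thesis using pp by simp
    next
      case 2 then show ?thesis using W by (simp add: g_def)
    next
      case 3
      then show ?thesis using edge[of r m s] sym[of "g v" "g v'"] sym[of "g v'" "g v"] by auto
    next
      case 4
      then show ?thesis using edge[of r m s] by simp
    qed
  qed
  then show ?thesis by (rule rel_iso_sym)
qed

end

section \<open>The Fano plane\<close>

text \<open>Whether the binary expansions of \<open>r, m < 8\<close> share an even number of ones.\<close>

definition parity_even :: "nat \<Rightarrow> nat \<Rightarrow> bool" where
  "parity_even r m \<longleftrightarrow> (odd r \<and> odd m) \<noteq>
     ((odd (r div 2) \<and> odd (m div 2)) = (odd (r div 4) \<and> odd (m div 4)))"

lemma bij_betw_nth_from_1:
  assumes "distinct xs" shows "bij_betw (\<lambda>m. xs ! (m - 1)) {1..length xs} (set xs)"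
proof -
  have "bij_betw (\<lambda>m. m - 1) {1..length xs} {..<length xs}"
    by (rule bij_betw_byWitness[where f' = Suc]) auto
  moreover have "bij_betw ((!) xs) {..<length xs} (set xs)"
    using assms by (intro bij_betw_nth) auto
  ultimately have "bij_betw ((!) xs \<circ> (\<lambda>m. m - 1)) {1..length xs} (set xs)" by (rule bij_betw_trans)
  then show ?thesis by (simp add: comp_def)
qed

text \<open>Counting incidences gives degree sum 21, counting pairs of blocks gives 63 for the
  squares. The degrees thus have squared deviation 63 - 126 + 63 = 0 from 3.\<close>

lemma fano_degree:
  fixes S :: "'h \<Rightarrow> 'p set"
  assumes P: "finite P" "card P = 7" and H: "finite H" "card H = 7"
    and S: "\<forall>h\<in>H. S h \<subseteq> P \<and> card (S h) = 3"
    and inter: "\<forall>h\<in>H. \<forall>h'\<in>H. h \<noteq> h' \<longrightarrow> card (S h \<inter> S h') = 1"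
    and p: "p \<in> P"
  shows "card {h \<in> H. p \<in> S h} = 3"
proof -
  define f where "f h p = (of_bool (p \<in> S h) :: int)" for h p
  define r where "r p = (\<Sum>h\<in>H. f h p)" for p
  have r: "r p = int (card {h \<in> H. p \<in> S h})" for p
    using H(1) by (simp add: r_def f_def Int_def)
  have sumP: "(\<Sum>p\<in>P. f h p * f h' p) = int (card (S h \<inter> S h'))" if "h \<in> H" for h h'
  proof -
    have "(\<Sum>p\<in>P. f h p * f h' p) = (\<Sum>p\<in>P. of_bool (p \<in> S h \<inter> S h'))"
      by (intro sum.cong refl) (simp add: f_def of_bool_def)
    also have "\<dots> = int (card (P \<inter> (S h \<inter> S h')))" using P(1) by (simp add: Int_def)
    also have "P \<inter> (S h \<inter> S h') = S h \<inter> S h'" using S that by blast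
    finally show ?thesis .
  qed
  have "(\<Sum>p\<in>P. r p) = (\<Sum>h\<in>H. \<Sum>p\<in>P. f h p)" unfolding r_def by (rule sum.swap)
  also have "\<dots> = (\<Sum>h\<in>H. 3)"
  proof (intro sum.cong refl)
    fix h assume h: "h \<in> H"
    have "(\<Sum>p\<in>P. f h p) = (\<Sum>p\<in>P. f h p * f h p)" by (intro sum.cong refl) (simp add: f_def)
    then show "(\<Sum>p\<in>P. f h p) = 3" using sumP[OF h, of h] S h by simp
  qed
  finally have r1: "(\<Sum>p\<in>P. r p) = 21" using H by simp
  have "(\<Sum>p\<in>P. (r p)\<^sup>2) = (\<Sum>p\<in>P. \<Sum>h\<in>H. \<Sum>h'\<in>H. f h p * f h' p)"
    by (simp add: r_def power2_eq_square sum_product)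
  also have "\<dots> = (\<Sum>h\<in>H. \<Sum>p\<in>P. \<Sum>h'\<in>H. f h p * f h' p)" by (rule sum.swap)
  also have "\<dots> = (\<Sum>h\<in>H. \<Sum>h'\<in>H. \<Sum>p\<in>P. f h p * f h' p)" by (intro sum.cong refl sum.swap)
  also have "\<dots> = (\<Sum>h\<in>H. 9)"
  proof (intro sum.cong refl)
    fix h assume h: "h \<in> H"
    have "(\<Sum>h'\<in>H. \<Sum>p\<in>P. f h p * f h' p) = (\<Sum>h'\<in>H. int (card (S h \<inter> S h')))"
      by (simp add: sumP[OF h])
    also have "\<dots> = int (card (S h \<inter> S h)) + (\<Sum>h'\<in>H - {h}. int (card (S h \<inter> S h')))"
      using h H(1) by (intro sum.remove) auto
    also have "(\<Sum>h'\<in>H - {h}. int (card (S h \<inter> S h'))) = (\<Sum>h'\<in>H - {h}. 1)"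
      by (intro sum.cong refl) (use inter h in auto)
    finally show "(\<Sum>h'\<in>H. \<Sum>p\<in>P. f h p * f h' p) = 9" using S h H by simp
  qed
  finally have r2: "(\<Sum>p\<in>P. (r p)\<^sup>2) = 63" using H by simp
  have "(\<Sum>p\<in>P. (r p - 3)\<^sup>2) = (\<Sum>p\<in>P. (r p)\<^sup>2 - 6 * r p + 9)"
    by (intro sum.cong refl) (simp add: power2_eq_square algebra_simps)
  also have "\<dots> = 0" using P by (simp add: sum.distrib sum_subtractf r1 r2 flip: sum_distrib_left)
  finally have "(r p - 3)\<^sup>2 = 0" using p P(1) by (subst (asm) sum_nonneg_eq_0_iff) auto
  then show ?thesis by (simp add: r)
qed

text \<open>A block off \<open>p0\<close> meets the three blocks through \<open>p0\<close> in one
  point each, and this forces the other three blocks. The position of \<open>p0\<close> is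
  prescribed so that a point added artificially can be removed from a known column.\<close>

lemma fano_unique:
  fixes S :: "'h \<Rightarrow> 'p set"
  assumes P: "finite P" "card P = 7" and H: "finite H" "card H = 7"
    and S: "\<forall>h\<in>H. S h \<subseteq> P \<and> card (S h) = 3"
    and inter: "\<forall>h\<in>H. \<forall>h'\<in>H. h \<noteq> h' \<longrightarrow> card (S h \<inter> S h') = 1"
    and p0: "p0 \<in> P"
  obtains \<pi> \<rho> :: "nat \<Rightarrow> _" where "bij_betw \<pi> {1..7} P" "bij_betw \<rho> {1..7} H" "\<pi> 4 = p0"
    "\<And>r m. r \<in> {1..7} \<Longrightarrow> m \<in> {1..7} \<Longrightarrow> \<pi> m \<in> S (\<rho> r) \<longleftrightarrow> parity_even r m"
proof -
  note deg = fano_degree[of P H S, OF P H S inter]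
  have meet: "\<exists>y. S h \<inter> S h' = {y}" if "h \<in> H" "h' \<in> H" "h \<noteq> h'" for h h'
    using inter that by (auto simp: card_1_singleton_iff)
  have uniq: "y = y'" if hh: "h \<in> H" "h' \<in> H" "h \<noteq> h'" and y: "y \<in> S h" "y \<in> S h'" "y' \<in> S h" "y' \<in> S h'" for h h' y y'
  proof -
    obtain t where "S h \<inter> S h' = {t}" using meet[OF hh] by blast
    then have "y \<in> {t}" "y' \<in> {t}" using y by blast+
    then show ?thesis by simp
  qed
  have fill: "S h = {u, v, w}" if "h \<in> H" "u \<in> S h" "v \<in> S h" "w \<in> S h" "distinct [u, v, w]" for h u v w
  proof -
    have "finite (S h)" "card (S h) = 3" using S that(1) P(1) finite_subset[of "S h" P] by auto
    moreover have "card {u, v, w} = 3" using that(5) by simp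
    ultimately show ?thesis using that(2-4) by (metis card_subset_eq empty_subsetI insert_subset)
  qed
  have third: "\<exists>h\<in>H. h \<noteq> u \<and> h \<noteq> v \<and> p \<in> S h" if "p \<in> P" for u v p
  proof (rule ccontr)
    assume "\<not> ?thesis"
    then have "{h \<in> H. p \<in> S h} \<subseteq> {u, v}" by blast
    then have "card {h \<in> H. p \<in> S h} \<le> card {u, v}" by (intro card_mono) auto
    also have "\<dots> \<le> 2" by (simp add: card_insert_if)
    finally show False using deg[OF that] by simp
  qed
  obtain h1 h2 h3 where h123: "{h \<in> H. p0 \<in> S h} = {h1, h2, h3}" "h1 \<noteq> h2" "h1 \<noteq> h3" "h2 \<noteq> h3"
    using deg[OF p0] by (auto simp: card_3_iff)
  have h: "h1 \<in> H" "h2 \<in> H" "h3 \<in> H" "p0 \<in> S h1" "p0 \<in> S h2" "p0 \<in> S h3" using h123(1) by auto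
  have "card (H - {h1, h2, h3}) = 4" using h h123 H by (subst card_Diff_subset) auto
  then have "H - {h1, h2, h3} \<noteq> {}" by (metis card.empty zero_neq_numeral)
  then obtain h4 where h4: "h4 \<in> H" "h4 \<noteq> h1" "h4 \<noteq> h2" "h4 \<noteq> h3" by auto
  have p04: "p0 \<notin> S h4" using h123(1) h4 by blast
  obtain a1 b1 c1 where abc1: "S h4 \<inter> S h1 = {a1}" "S h4 \<inter> S h2 = {b1}" "S h4 \<inter> S h3 = {c1}"
    using meet[OF h4(1)] h h4 by metis
  have m1: "a1 \<in> S h4" "a1 \<in> S h1" "b1 \<in> S h4" "b1 \<in> S h2" "c1 \<in> S h4" "c1 \<in> S h3" using abc1 by auto
  have n1: "a1 \<noteq> p0" "b1 \<noteq> p0" "c1 \<noteq> p0" using m1 p04 by auto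
  have other: "\<exists>y. S h = {p0, u, y} \<and> y \<noteq> p0 \<and> y \<noteq> u" if "h \<in> H" "p0 \<in> S h" "u \<in> S h" "u \<noteq> p0" for h u
  proof -
    have "finite (S h)" "card (S h) = 3" using S that(1) P(1) finite_subset[of "S h" P] by auto
    then have "card (S h - {p0, u}) = 1" using that by (subst card_Diff_subset) auto
    then obtain y where "S h - {p0, u} = {y}" by (auto simp: card_1_singleton_iff)
    then show ?thesis using that by blast
  qed
  obtain a2 where a2: "S h1 = {p0, a1, a2}" "a2 \<noteq> p0" "a2 \<noteq> a1" using other h m1 n1 by metis
  obtain b2 where b2: "S h2 = {p0, b1, b2}" "b2 \<noteq> p0" "b2 \<noteq> b1" using other h m1 n1 by metis
  obtain c2 where c2: "S h3 = {p0, c1, c2}" "c2 \<noteq> p0" "c2 \<noteq> c1" using other h m1 n1 by metis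
  have disj: "y \<notin> S h'" if "y \<in> S h" "y \<noteq> p0" "h \<in> {h1, h2, h3}" "h' \<in> {h1, h2, h3}" "h \<noteq> h'" for y h h'
    using uniq[of h h' y p0] that h by auto
  have dist: "distinct [b1, a1, c1, p0, b2, a2, c2]"
    using disj[of a1 h1 h2] disj[of a1 h1 h3] disj[of a2 h1 h2] disj[of a2 h1 h3] disj[of b1 h2 h3] disj[of b2 h2 h3]
      a2 b2 c2 n1 h123 by auto
  have S4: "S h4 = {a1, b1, c1}" by (rule fill[OF h4(1)]) (use m1 dist in auto)
  have inP: "a1 \<in> P" "b1 \<in> P" "c1 \<in> P" using S h4(1) S4 by auto
  obtain h5 where h5: "h5 \<in> H" "h5 \<noteq> h1" "h5 \<noteq> h4" "a1 \<in> S h5" using third[OF inP(1)] by metis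
  obtain h6 where h6: "h6 \<in> H" "h6 \<noteq> h2" "h6 \<noteq> h4" "b1 \<in> S h6" using third[OF inP(2)] by metis
  obtain h7 where h7: "h7 \<in> H" "h7 \<noteq> h3" "h7 \<noteq> h4" "c1 \<in> S h7" using third[OF inP(3)] by metis
  have ne: "h5 \<noteq> h2" "h5 \<noteq> h3" "h6 \<noteq> h1" "h6 \<noteq> h3" "h7 \<noteq> h1" "h7 \<noteq> h2"
    using h5 h6 h7 a2 b2 c2 dist by auto
  have p0n: "p0 \<notin> S h5" "p0 \<notin> S h6" "p0 \<notin> S h7" using h123(1) h5 h6 h7 ne by blast+
  have not4: "b1 \<notin> S h5" "c1 \<notin> S h5" "a1 \<notin> S h6" "c1 \<notin> S h6" "a1 \<notin> S h7" "b1 \<notin> S h7"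
    using uniq[OF h5(1) h4(1) h5(3,4)] uniq[OF h6(1) h4(1) h6(3,4)] uniq[OF h7(1) h4(1) h7(3,4)] m1 dist
    by (metis distinct_length_2_or_more)+
  have "b2 \<in> S h5" using meet[OF h5(1) h(2) ne(1)] b2(1) p0n(1) not4(1) by auto
  moreover have "c2 \<in> S h5" using meet[OF h5(1) h(3) ne(2)] c2(1) p0n(1) not4(2) by auto
  ultimately have S5: "S h5 = {a1, b2, c2}" by (intro fill[OF h5(1)]) (use h5 dist in auto)
  have "a2 \<in> S h6" using meet[OF h6(1) h(1) ne(3)] a2(1) p0n(2) not4(3) by auto
  moreover have "c2 \<in> S h6" using meet[OF h6(1) h(3) ne(4)] c2(1) p0n(2) not4(4) by auto
  ultimately have S6: "S h6 = {b1, a2, c2}" by (intro fill[OF h6(1)]) (use h6 dist in auto)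
  have "a2 \<in> S h7" using meet[OF h7(1) h(1) ne(5)] a2(1) p0n(3) not4(5) by auto
  moreover have "b2 \<in> S h7" using meet[OF h7(1) h(2) ne(6)] b2(1) p0n(3) not4(6) by auto
  ultimately have S7: "S h7 = {c1, b2, a2}" by (intro fill[OF h7(1)]) (use h7 dist in auto)
  have disth: "distinct [h1, h2, h3, h4, h5, h6, h7]"
    using h123 h4 h5 h6 h7 ne not4 by auto
  \<comment> \<open>In this order, point m lies on block r exactly when the binary expansions of r
    and m are orthogonal over the field with two elements.\<close>
  define ps where "ps = [b1, a1, c1, p0, b2, a2, c2]"
  define hs where "hs = [h1, h2, h3, h4, h5, h6, h7]"
  have len: "length ps = 7" "length hs = 7" by (simp_all add: ps_def hs_def)
  have "set ps \<subseteq> P" unfolding ps_def using inP p0 bspec[OF S h(1)] bspec[OF S h(2)] bspec[OF S h(3)] a2 b2 c2 by auto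
  then have psP: "set ps = P"
    using card_subset_eq[OF P(1)] distinct_card[OF dist] P(2) by (simp add: ps_def)
  have "set hs \<subseteq> H" unfolding hs_def using h h4 h5 h6 h7 by auto
  then have hsH: "set hs = H"
    using card_subset_eq[OF H(1)] distinct_card[OF disth] H(2) by (simp add: hs_def)
  show thesis
  proof (rule that[of "\<lambda>m. ps ! (m - 1)" "\<lambda>r. hs ! (r - 1)"])
    show "bij_betw (\<lambda>m. ps ! (m - 1)) {1..7} P"
      using bij_betw_nth_from_1[OF dist[folded ps_def]] unfolding psP len .
    show "bij_betw (\<lambda>r. hs ! (r - 1)) {1..7} H"
      using bij_betw_nth_from_1[OF disth[folded hs_def]] unfolding hsH len .
    show "ps ! (4 - 1) = p0" by (simp add: ps_def)
    fix r m :: nat assume "r \<in> {1..7}" "m \<in> {1..7}"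
    then have r: "r \<in> {1, 2, 3, 4, 5, 6, 7}" and m: "m \<in> {1, 2, 3, 4, 5, 6, 7}" by auto
    have d: "b1 \<noteq> a1" "b1 \<noteq> c1" "b1 \<noteq> p0" "b1 \<noteq> b2" "b1 \<noteq> a2" "b1 \<noteq> c2" "a1 \<noteq> c1" "a1 \<noteq> p0" "a1 \<noteq> b2"
      "a1 \<noteq> a2" "a1 \<noteq> c2" "c1 \<noteq> p0" "c1 \<noteq> b2" "c1 \<noteq> a2" "c1 \<noteq> c2" "p0 \<noteq> b2" "p0 \<noteq> a2" "p0 \<noteq> c2"
      "b2 \<noteq> a2" "b2 \<noteq> c2" "a2 \<noteq> c2" using dist by auto
    note d' = d d[symmetric]
    show "ps ! (m - 1) \<in> S (hs ! (r - 1)) \<longleftrightarrow> parity_even r m"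
      using r
    proof (elim insertE emptyE)
      assume "r = 1" then show ?thesis using m
        by (elim insertE emptyE) (simp_all add: ps_def hs_def a2 parity_even_def d')
    next
      assume "r = 2" then show ?thesis using m
        by (elim insertE emptyE) (simp_all add: ps_def hs_def b2 parity_even_def d')
    next
      assume "r = 3" then show ?thesis using m
        by (elim insertE emptyE) (simp_all add: ps_def hs_def c2 parity_even_def d')
    next
      assume "r = 4" then show ?thesis using m
        by (elim insertE emptyE) (simp_all add: ps_def hs_def S4 parity_even_def d')
    next
      assume "r = 5" then show ?thesis using m
        by (elim insertE emptyE) (simp_all add: ps_def hs_def S5 parity_even_def d')
    next
      assume "r = 6" then show ?thesis using m
        by (elim insertE emptyE) (simp_all add: ps_def hs_def S6 parity_even_def d')
    next
      assume "r = 7" then show ?thesis using m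
        by (elim insertE emptyE) (simp_all add: ps_def hs_def S7 parity_even_def d')
    qed
  qed
qed

text \<open>Row 0 has the sign \<open>True\<close> throughout and is the reference vertex, rows 1 to
  7 are the lines of the Fano plane. Row 8 is a vertex of weight 1, which sees both vertices of each
  class of size 2.\<close>

definition fano_table :: "nat \<Rightarrow> nat \<Rightarrow> bool \<Rightarrow> bool" where
  "fano_table r m s \<longleftrightarrow> r = 8 \<or> (s \<longleftrightarrow> parity_even r m)"

abbreviation fano_model :: "nat set \<Rightarrow> nat set \<Rightarrow> 'a set \<Rightarrow> ('a \<Rightarrow> 'a \<Rightarrow> bool) \<Rightarrow> bool" where
  "fano_model P R V E \<equiv> rel_iso V E (model_verts P R) (model_edge fano_table (\<lambda>_ _. False))"

section \<open>One class of size 8\<close>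

context half_system
begin

lemma card_agree_agree:
  assumes "h \<in> rest" "x h = 1 / 2" "a \<in> rest" "x a = 1 / 2" "b \<in> rest" "x b = 1 / 2"
  shows "card (agree a b) + card (agree h a) + card (agree h b) = card pairs + 2 * card (agree h a \<inter> agree h b)"
proof -
  let ?A = "agree h a" and ?B = "agree h b"
  have "agree a b = ?A \<inter> ?B \<union> (pairs - (?A \<union> ?B))"
    using agree_agree[OF assms] agree_subset by blast
  then have "card (agree a b) = card (?A \<inter> ?B) + card (pairs - (?A \<union> ?B))"
    using fin_agree fin_pairs(1) by (simp add: card_Un_disjoint disjoint_iff)
  moreover have "card (pairs - (?A \<union> ?B)) = card pairs - card (?A \<union> ?B)"
    using fin_agree agree_subset by (intro card_Diff_subset) auto
  moreover have "card (?A \<union> ?B) \<le> card pairs"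
    using agree_subset fin_pairs(1) by (intro card_mono) auto
  moreover have "card (?A \<union> ?B) + card (?A \<inter> ?B) = card ?A + card ?B"
    using card_Un_Int[OF fin_agree fin_agree, of h a h b] by simp
  ultimately show ?thesis by linarith
qed

text \<open>Off-diagonal entries of \<open>kern\<close> are bounded by 7 minus the number of classes
  of size 2. For seven of these, any two rows agree in exactly three columns, so the agreements with
  \<open>h\<close> are seven triples that pairwise meet in one point. For six, the agreements have
  size 2 or 3, and an extra column makes them triples.\<close>

lemma oct_classification:
  assumes octs: "octs = {i}" and quints: "quints = {}"
  shows "card pairs = 7 \<Longrightarrow> fano_model {1..7} {0..7} V E"
    "card pairs = 6 \<Longrightarrow> fano_model {1, 2, 3, 5, 6, 7} {0..7} V E"
proof -
  have io: "i \<in> octs" using octs by simp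
  have rest: "rest = halves i" using rest_eq octs quints oct_card(2)[OF io] by simp
  have card8: "card rest = 8" using oct_card(1)[OF io] rest by simp
  have half: "x v = 1 / 2" if "v \<in> rest" for v using that halvesD(3) rest by blast
  have nE: "\<not> E a b" if "a \<in> rest" "b \<in> rest" for a b
    using that same_class[of a b] halvesD(1,2) rest by metis
  have "rest \<noteq> {}" using card8 by auto
  then obtain h where h: "h \<in> rest" by auto
  define H where "H = rest - {h}"
  have H: "finite H" "card H = 7" using h card8 fin_rest by (auto simp: H_def)
  have Hr: "a \<in> rest" "a \<noteq> h" if "a \<in> H" for a using that by (auto simp: H_def)
  have self: "agree h h = pairs" by (rule agree_self[OF h half[OF h]])
  have bij0: "bij_betw (\<rho>(0 := h)) {0..7} rest" if "bij_betw \<rho> {1..7} H" for \<rho> :: "nat \<Rightarrow> 'a"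
  proof -
    have "bij_betw (\<rho>(0 := h)) {1..7} H" using that by (rule bij_betw_cong[THEN iffD1, rotated]) auto
    moreover have "bij_betw (\<rho>(0 := h)) {0} {h}" by simp
    ultimately have "bij_betw (\<rho>(0 := h)) ({1..7} \<union> {0}) (H \<union> {h})"
      by (rule bij_betw_combine) (auto simp: H_def)
    moreover have "{1..7} \<union> {0} = {0..7 :: nat}" by auto
    moreover have "H \<union> {h} = rest" using h by (auto simp: H_def)
    ultimately show ?thesis by simp
  qed
  have kern: "kern a b = real (card pairs) - 1 - 2 * real (card (agree a b))" "kern a a = 7 - real (card pairs)"
    if "a \<in> rest" "b \<in> rest" "a \<noteq> b" for a b
    using kern_half_half[OF that(1) half[OF that(1)] that(2) half[OF that(2)] that(3)] nE that
      kern_half_self[OF that(1) half[OF that(1)]] by simp_all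
  have bound: "\<bar>real (card pairs) - 1 - 2 * real (card (agree a b))\<bar> \<le> 7 - real (card pairs)"
    if "pairs \<noteq> {}" "a \<in> rest" "b \<in> rest" "a \<noteq> b" for a b
    using kern_pair_bound[OF that] kern[OF that(2-4)] kern(2)[OF that(3,2) that(4)[symmetric]] by linarith
  note agree2 = card_agree_agree[OF h half[OF h] _ half _ half]
  have conclude: "fano_model P {0..7} V E"
    if \<pi>: "bij_betw \<pi> P pairs" and \<rho>: "bij_betw \<rho> {1..7} H"
      and T: "\<And>r m. r \<in> {1..7} \<Longrightarrow> m \<in> P \<Longrightarrow> \<pi> m \<in> agree h (\<rho> r) \<longleftrightarrow> parity_even r m" for \<pi> P \<rho>
  proof (rule model_iso[OF h half[OF h] \<pi> bij0[OF \<rho>]])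
    fix r m :: nat and s assume r: "r \<in> {0..7}" and m: "m \<in> P"
    have \<rho>r: "(\<rho>(0 := h)) r \<in> rest" using bij0[OF \<rho>] r by (rule bij_betw_apply)
    have "\<pi> m \<in> agree h ((\<rho>(0 := h)) r) \<longleftrightarrow> parity_even r m"
    proof (cases "r = 0")
      case True
      then show ?thesis using self bij_betw_apply[OF \<pi> m] by (simp add: parity_even_def)
    next
      case False
      then show ?thesis using T[of r m] r m by simp
    qed
    then show "fano_table r m s \<longleftrightarrow> x ((\<rho>(0 := h)) r) = 1 \<or> (s \<longleftrightarrow> \<pi> m \<in> agree h ((\<rho>(0 := h)) r))"
      using r half[OF \<rho>r] by (simp add: fano_table_def)
  next
    fix r r' :: nat assume "r \<in> {0..7}" "r' \<in> {0..7}"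
    then show "False \<longleftrightarrow> E ((\<rho>(0 := h)) r) ((\<rho>(0 := h)) r')"
      using bij_betw_apply[OF bij0[OF \<rho>]] nE by blast
  qed
  show "fano_model {1..7} {0..7} V E" if n: "card pairs = 7"
  proof -
    have ne: "pairs \<noteq> {}" using n by auto
    have three: "card (agree a b) = 3" if "a \<in> rest" "b \<in> rest" "a \<noteq> b" for a b
      using bound[OF ne that] n by simp
    obtain p0 where p0: "p0 \<in> pairs" using ne by auto
    have S: "agree h a \<subseteq> pairs \<and> card (agree h a) = 3" if "a \<in> H" for a
      using three[OF h Hr(1)[OF that]] Hr(2)[OF that] agree_subset by simp
    have Sall: "\<forall>a\<in>H. agree h a \<subseteq> pairs \<and> card (agree h a) = 3" using S by blast
    have "card (agree h a \<inter> agree h b) = 1" if "a \<in> H" "b \<in> H" "a \<noteq> b" for a b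
      using agree2[OF Hr(1)[OF that(1)] Hr(1)[OF that(1)] Hr(1)[OF that(2)] Hr(1)[OF that(2)]]
        three[OF Hr(1)[OF that(1)] Hr(1)[OF that(2)] that(3)] S[OF that(1)] S[OF that(2)] n by simp
    then have int: "\<forall>a\<in>H. \<forall>b\<in>H. a \<noteq> b \<longrightarrow> card (agree h a \<inter> agree h b) = 1" by blast
    show ?thesis
    proof (rule fano_unique[of pairs H "agree h" p0, OF fin_pairs(1) n H Sall int p0])
      fix \<pi> and \<rho> :: "nat \<Rightarrow> 'a"
      assume "bij_betw \<pi> {1..7} pairs" "bij_betw \<rho> {1..7} H"
        "\<And>r m. r \<in> {1..7} \<Longrightarrow> m \<in> {1..7} \<Longrightarrow> \<pi> m \<in> agree h (\<rho> r) \<longleftrightarrow> parity_even r m"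
      then show ?thesis by (rule conclude)
    qed
  qed
  show "fano_model {1, 2, 3, 5, 6, 7} {0..7} V E" if n: "card pairs = 6"
  proof -
    have ne: "pairs \<noteq> {}" using n by auto
    have two: "card (agree a b) = 2 \<or> card (agree a b) = 3" if "a \<in> rest" "b \<in> rest" "a \<noteq> b" for a b
    proof -
      have "\<bar>5 - 2 * real (card (agree a b))\<bar> \<le> 1" using bound[OF ne that] n by simp
      then have "2 * card (agree a b) \<le> 6" "4 \<le> 2 * card (agree a b)" by linarith+
      then show ?thesis by linarith
    qed
    have num: "(y = 2 \<and> z = 2 \<longrightarrow> t = 0) \<and> (\<not> (y = 2 \<and> z = 2) \<longrightarrow> t = 1)"
      if "w + y + z = 6 + 2 * t" "w = 2 \<or> w = 3" "y = 2 \<or> y = 3" "z = 2 \<or> z = 3" for w y z t :: nat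
      using that by presburger
    \<comment> \<open>Indices of classes are below \<open>k\<close>, so \<open>k\<close> itself is
      free to serve as the seventh point.\<close>
    have kp: "k \<notin> pairs" by (simp add: pairs_def)
    have kA: "k \<notin> agree a b" for a b using kp agree_subset by blast
    text \<open>The columns of the sign matrix are completed by one that records the parity of each row.\<close>
    define S where "S a = agree h a \<union> (if card (agree h a) = 2 then {k} else {})" for a
    have P: "finite (insert k pairs)" "card (insert k pairs) = 7" using fin_pairs(1) kp n by auto
    have S: "S a \<subseteq> insert k pairs \<and> card (S a) = 3" if "a \<in> H" for a
      using two[OF h Hr(1)[OF that]] Hr(2)[OF that] agree_subset[of h a] kA[of h a] fin_agree[of h a]
      by (auto simp: S_def)
    then have Sall: "\<forall>a\<in>H. S a \<subseteq> insert k pairs \<and> card (S a) = 3" by blast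
    have "card (S a \<inter> S b) = 1" if "a \<in> H" "b \<in> H" "a \<noteq> b" for a b
    proof -
      have sum: "card (agree a b) + card (agree h a) + card (agree h b) = 6 + 2 * card (agree h a \<inter> agree h b)"
        using agree2[OF Hr(1)[OF that(1)] Hr(1)[OF that(1)] Hr(1)[OF that(2)] Hr(1)[OF that(2)]] n by simp
      have c: "card (agree a b) = 2 \<or> card (agree a b) = 3" "card (agree h a) = 2 \<or> card (agree h a) = 3"
        "card (agree h b) = 2 \<or> card (agree h b) = 3"
        using two[OF Hr(1)[OF that(1)] Hr(1)[OF that(2)] that(3)] two[OF h Hr(1)[OF that(1)]] Hr(2)[OF that(1)]
          two[OF h Hr(1)[OF that(2)]] Hr(2)[OF that(2)] by auto
      show ?thesis
      proof (cases "card (agree h a) = 2 \<and> card (agree h b) = 2")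
        case True
        then have "card (agree h a \<inter> agree h b) = 0" using num[OF sum c] by simp
        then have "agree h a \<inter> agree h b = {}" using fin_agree by simp
        then have "S a \<inter> S b = {k}" using True kA by (auto simp: S_def)
        then show ?thesis by simp
      next
        case False
        then have "card (agree h a \<inter> agree h b) = 1" using num[OF sum c] by simp
        moreover have "S a \<inter> S b = agree h a \<inter> agree h b" using False kA by (auto simp: S_def)
        ultimately show ?thesis by simp
      qed
    qed
    then have int: "\<forall>a\<in>H. \<forall>b\<in>H. a \<noteq> b \<longrightarrow> card (S a \<inter> S b) = 1" by blast
    have eq: "{1..7} - {4} = {1, 2, 3, 5, 6, 7 :: nat}" by auto
    show ?thesis
    proof (rule fano_unique[of "insert k pairs" H S k, OF P H Sall int])
      fix \<pi> and \<rho> :: "nat \<Rightarrow> 'a"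
      assume \<pi>: "bij_betw \<pi> {1..7} (insert k pairs)" and \<rho>: "bij_betw \<rho> {1..7} H" and \<pi>4: "\<pi> 4 = k"
        and T: "\<And>r m. r \<in> {1..7} \<Longrightarrow> m \<in> {1..7} \<Longrightarrow> \<pi> m \<in> S (\<rho> r) \<longleftrightarrow> parity_even r m"
      have "bij_betw \<pi> ({1..7} - {4}) (insert k pairs - {k})"
        using \<pi>4 by (intro bij_betw_DiffI[OF \<pi>]) auto
      then have \<pi>': "bij_betw \<pi> {1, 2, 3, 5, 6, 7} pairs" unfolding eq using kp by simp
      show ?thesis
      proof (rule conclude[OF \<pi>' \<rho>])
        fix r m :: nat assume r: "r \<in> {1..7}" and m: "m \<in> {1, 2, 3, 5, 6, 7}"
        have "\<pi> m \<noteq> k" using bij_betw_apply[OF \<pi>' m] kp by auto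
        then have "\<pi> m \<in> agree h (\<rho> r) \<longleftrightarrow> \<pi> m \<in> S (\<rho> r)" by (auto simp: S_def)
        then show "\<pi> m \<in> agree h (\<rho> r) \<longleftrightarrow> parity_even r m" using T[OF r, of m] m by auto
      qed
    qed simp
  qed
qed

end

lemma bij_betw_three_parts:
  assumes fin: "finite I1" "finite I2" "finite I3" "finite A1" "finite A2" "finite A3"
    and card: "card I1 = card A1" "card I2 = card A2" "card I3 = card A3"
    and disj: "I1 \<inter> I2 = {}" "I1 \<inter> I3 = {}" "I2 \<inter> I3 = {}" "A1 \<inter> A2 = {}" "A1 \<inter> A3 = {}" "A2 \<inter> A3 = {}"
  obtains f where "bij_betw f (I1 \<union> I2 \<union> I3) (A1 \<union> A2 \<union> A3)"
    "\<And>m. m \<in> I1 \<union> I2 \<union> I3 \<Longrightarrow> (f m \<in> A1 \<longleftrightarrow> m \<in> I1) \<and> (f m \<in> A2 \<longleftrightarrow> m \<in> I2) \<and> (f m \<in> A3 \<longleftrightarrow> m \<in> I3)"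
proof -
  obtain f1 f2 f3 where f: "bij_betw f1 I1 A1" "bij_betw f2 I2 A2" "bij_betw f3 I3 A3"
    using finite_same_card_bij[OF fin(1,4) card(1)] finite_same_card_bij[OF fin(2,5) card(2)]
      finite_same_card_bij[OF fin(3,6) card(3)] by metis
  define f where "f m = (if m \<in> I1 then f1 m else if m \<in> I2 then f2 m else f3 m)" for m
  have 1: "bij_betw f I1 A1" using f(1) by (subst bij_betw_cong[of _ _ f1]) (auto simp: f_def)
  have 2: "bij_betw f I2 A2" using f(2) disj(1) by (subst bij_betw_cong[of _ _ f2]) (auto simp: f_def)
  have 3: "bij_betw f I3 A3" using f(3) disj(2,3) by (subst bij_betw_cong[of _ _ f3]) (auto simp: f_def)
  have "bij_betw f (I1 \<union> I2 \<union> I3) (A1 \<union> A2 \<union> A3)"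
    by (intro bij_betw_combine 1 2 3) (use disj in auto)
  moreover have "(f m \<in> A1 \<longleftrightarrow> m \<in> I1) \<and> (f m \<in> A2 \<longleftrightarrow> m \<in> I2) \<and> (f m \<in> A3 \<longleftrightarrow> m \<in> I3)"
    if m: "m \<in> I1 \<union> I2 \<union> I3" for m
  proof -
    have a: "m \<in> I1 \<Longrightarrow> f m \<in> A1" "m \<in> I2 \<Longrightarrow> f m \<in> A2" "m \<in> I3 \<Longrightarrow> f m \<in> A3"
      using bij_betw_apply[OF 1] bij_betw_apply[OF 2] bij_betw_apply[OF 3] by auto
    from m consider "m \<in> I1" | "m \<in> I2" | "m \<in> I3" by blast
    then show ?thesis using a disj by cases blast+
  qed
  ultimately show thesis by (rule that)
qed

section \<open>Classification for smallest eigenvalue -2\<close>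

context half_system
begin

text \<open>The only invariant is the partition of the number of classes of size 2 into three parts,
  each at most 2. With total at least 3 there are six of them: 111, 210, 211, 220, 221 and
  222.\<close>

lemma quint_classification:
  assumes quints: "quints = {i}" and octs: "octs = {}" and n: "3 \<le> card pairs"
  shows "\<exists>P\<in>{{1, 2, 3}, {1, 5, 2}, {1, 5, 2, 3}, {1, 5, 2, 6}, {1, 5, 2, 6, 3}, {1, 5, 2, 6, 3, 7}}.
    fano_model P {0, 1, 2, 3, 8} V E"
proof -
  have i: "i \<in> quints" using quints by simp
  have ne: "pairs \<noteq> {}" using n by auto
  obtain z a b d e where z: "ones i = {z}" and h: "halves i = {a, b, d, e}" "distinct [a, b, d, e]"
    and cls: "cls i = {z, a, b, d, e}" "z \<notin> {a, b, d, e}"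
    and ord: "card (agree a b) \<ge> card (agree a d)" "card (agree a d) \<ge> card (agree a e)"
    using quint_halves[OF i] by metis
  note A = quint_agree[OF i h]
  have rest: "rest = {z, a, b, d, e}" using rest_eq quints octs cls by simp
  define X Y Z where "X = card (agree a b)" and "Y = card (agree a d)" and "Z = card (agree a e)"
  have "X \<le> 2" using quint_agree_le[OF ne i h] by (simp add: X_def)
  then have c: "(X = 1 \<or> X = 2) \<and> (Y = 1 \<or> Y = 2) \<and> (Z = 0 \<or> Z = 1 \<or> Z = 2) \<and> Z \<le> Y \<and> Y \<le> X \<and> 3 \<le> X + Y + Z"
    using ord A(8) n unfolding X_def[symmetric] Y_def[symmetric] Z_def[symmetric] by presburger
  \<comment> \<open>Columns m and m + 4 of the Fano table coincide on rows 0 to 3, so a part of size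
    at most 2 is taken from such a couple of columns.\<close>
  define I1 where "I1 = (if X = 1 then {1} else {1, 5 :: nat})"
  define I2 where "I2 = (if Y = 1 then {2} else {2, 6 :: nat})"
  define I3 where "I3 = (if Z = 0 then {} else if Z = 1 then {3} else {3, 7 :: nat})"
  have I: "I1 \<subseteq> {1, 5}" "I2 \<subseteq> {2, 6}" "I3 \<subseteq> {3, 7}" by (auto simp: I1_def I2_def I3_def)
  have cards: "card I1 = X" "card I2 = Y" "card I3 = Z" using c by (auto simp: I1_def I2_def I3_def)
  define P where "P = I1 \<union> I2 \<union> I3"
  have finI: "finite I1" "finite I2" "finite I3" by (simp_all add: I1_def I2_def I3_def)
  have disjI: "I1 \<inter> I2 = {}" "I1 \<inter> I3 = {}" "I2 \<inter> I3 = {}" using I by fastforce+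
  obtain \<pi> where \<pi>: "bij_betw \<pi> P (agree a b \<union> agree a d \<union> agree a e)"
    and \<pi>I: "\<And>m. m \<in> P \<Longrightarrow> (\<pi> m \<in> agree a b \<longleftrightarrow> m \<in> I1) \<and> (\<pi> m \<in> agree a d \<longleftrightarrow> m \<in> I2) \<and> (\<pi> m \<in> agree a e \<longleftrightarrow> m \<in> I3)"
    using bij_betw_three_parts[OF finI fin_agree fin_agree fin_agree
        cards[unfolded X_def Y_def Z_def] disjI A(5-7)] unfolding P_def by metis
  have \<pi>': "bij_betw \<pi> P pairs" using \<pi> A(4) by simp
  \<comment> \<open>Among the columns in use, row 1 agrees with row 0 on 2 and 6, row 2 on 1 and 5,
    row 3 on 3 and 7. Hence \<open>d\<close> comes before \<open>b\<close>.\<close>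
  define \<rho> where "\<rho> r = (if r = 0 then a else if r = 1 then d else if r = 2 then b else if r = 3 then e else z)" for r :: nat
  have \<rho>: "bij_betw \<rho> {0, 1, 2, 3, 8} rest"
    using h(2) cls(2) by (auto simp: bij_betw_def inj_on_def \<rho>_def rest)
  have half: "x a = 1 / 2" "x b = 1 / 2" "x d = 1 / 2" "x e = 1 / 2"
    using halvesD(3)[of _ i] h(1) by auto
  have one: "x z = 1" using onesD(3)[of z i] z by simp
  have ar: "a \<in> rest" by (simp add: rest)
  have self: "agree a a = pairs" by (rule agree_self[OF ar half(1)])
  have "fano_model P {0, 1, 2, 3, 8} V E"
  proof (rule model_iso[OF ar half(1) \<pi>' \<rho>])
    fix r m :: nat and s assume r: "r \<in> {0, 1, 2, 3, 8}" and m: "m \<in> P"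
    have "\<pi> m \<in> pairs" using bij_betw_apply[OF \<pi>' m] .
    have mI: "m \<in> {1, 5} \<and> m \<in> I1 \<and> m \<notin> I2 \<and> m \<notin> I3 \<or> m \<in> {2, 6} \<and> m \<notin> I1 \<and> m \<in> I2 \<and> m \<notin> I3
        \<or> m \<in> {3, 7} \<and> m \<notin> I1 \<and> m \<notin> I2 \<and> m \<in> I3"
    proof -
      have "m \<in> I1 \<Longrightarrow> m \<in> {1, 5} \<and> m \<notin> I2 \<and> m \<notin> I3" using I(1) disjI(1,2) by blast
      moreover have "m \<in> I2 \<Longrightarrow> m \<in> {2, 6} \<and> m \<notin> I1 \<and> m \<notin> I3" using I(2) disjI(1,3) by blast
      moreover have "m \<in> I3 \<Longrightarrow> m \<in> {3, 7} \<and> m \<notin> I1 \<and> m \<notin> I2" using I(3) disjI(2,3) by blast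
      ultimately show ?thesis using m unfolding P_def by (elim UnE) simp_all
    qed
    show "fano_table r m s \<longleftrightarrow> x (\<rho> r) = 1 \<or> (s \<longleftrightarrow> \<pi> m \<in> agree a (\<rho> r))"
    proof (cases "r = 8")
      case True
      then show ?thesis by (simp add: fano_table_def \<rho>_def one)
    next
      case False
      then have "x (\<rho> r) = 1 / 2" using half by (simp add: \<rho>_def) (use r in auto)
      then have "x (\<rho> r) \<noteq> 1" by simp
      moreover have "\<pi> m \<in> agree a (\<rho> r) \<longleftrightarrow> parity_even r m"
        using r False \<pi>I[OF m] mI self \<open>\<pi> m \<in> pairs\<close>
        by (auto simp: \<rho>_def parity_even_def)
      ultimately show ?thesis using False by (simp add: fano_table_def)
    qed
  next
    fix r r' :: nat assume "r \<in> {0, 1, 2, 3, 8}" "r' \<in> {0, 1, 2, 3, 8}"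
    then have "\<rho> r \<in> cls i" "\<rho> r' \<in> cls i" using bij_betw_apply[OF \<rho>] rest cls by auto
    then have "\<not> E (\<rho> r) (\<rho> r')" by (intro same_class) (auto simp: cls_def)
    then show "False \<longleftrightarrow> E (\<rho> r) (\<rho> r')" by simp
  qed
  moreover have "P \<in> {{1, 2, 3}, {1, 5, 2}, {1, 5, 2, 3}, {1, 5, 2, 6}, {1, 5, 2, 6, 3}, {1, 5, 2, 6, 3, 7}}"
    using c unfolding P_def I1_def I2_def I3_def
    by (elim conjE disjE) (simp_all add: insert_commute)
  ultimately show ?thesis by blast
qed

section \<open>Two classes of size 5\<close>

lemma quint_neighbours:
  assumes i: "i \<in> quints" "ones i = {z}" and v: "v \<in> V" "c v \<noteq> i"
  shows "2 * x v = adj E v z + real (card {h \<in> halves i. E v h}) / 2"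
proof -
  have "i < k" using i by (simp add: quints_def)
  then have "2 * x v = (\<Sum>u\<in>ones i. adj E v u * x u) + (\<Sum>u\<in>halves i. adj E v u * x u)"
    using regular_cls[OF v(1) _ v(2)] by (simp only: sum_ones_halves)
  also have "(\<Sum>u\<in>ones i. adj E v u * x u) = adj E v z" using i(2) onesD(3)[of z i] by simp
  also have "(\<Sum>u\<in>halves i. adj E v u * x u) = (\<Sum>u\<in>halves i. adj E v u * (1 / 2))"
    by (intro sum.cong refl) (simp only: halvesD(3))
  also have "\<dots> = real (card {h \<in> halves i. E v h}) * (1 / 2)" by (rule sum_adj_const[OF fin_ones_halves(2)])
  finally show ?thesis by simp
qed

text \<open>
  If the vertices of weight 1 in two classes of size 5 are not adjacent, these classes can be
  traded for one of size 2 and one of size 8.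
\<close>

lemma quint_merge:
  assumes quints: "quints = {i, j}" "i \<noteq> j" and octs: "octs = {}"
    and z: "ones i = {z}" "ones j = {z'}" and nE: "\<not> E z z'"
  shows "card pairs = 6 \<Longrightarrow> fano_model {1..7} {0..7} V E"
    "card pairs = 5 \<Longrightarrow> fano_model {1, 2, 3, 5, 6, 7} {0..7} V E"
proof -
  have "i \<in> quints" "j \<in> quints" using quints by simp_all
  moreover from this have "i < k" "j < k" by (simp_all add: quints_def)
  ultimately have ij: "i \<in> quints" "j \<in> quints" "i < k" "j < k" .
  have zV: "z \<in> V" "c z = i" "x z = 1" "z' \<in> V" "c z' = j" "x z' = 1"
    using onesD[of z i] onesD[of z' j] z by simp_all
  \<comment> \<open>The vertex \<open>z\<close> needs weight 2 from class \<open>j\<close>; since z'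
    contributes nothing, all four halves are required. Each of them then gets its full weight 1 from
    \<open>z\<close> and sees no half of class \<open>i\<close>.\<close>
  have hz: "E z h" if "h \<in> halves j" for h
  proof -
    have "2 = real (card {h \<in> halves j. E z h}) / 2"
      using quint_neighbours[OF ij(2) z(2) zV(1)] zV nE quints by simp
    then have "card {h \<in> halves j. E z h} = card (halves j)" using quint_card(1)[OF ij(2)] by linarith
    then have "{h \<in> halves j. E z h} = halves j"
      by (intro card_subset_eq[OF fin_ones_halves(2)]) auto
    then show ?thesis using that by blast
  qed
  have nhh: "\<not> E h h'" if "h \<in> halves j" "h' \<in> halves i" for h h'
  proof -
    have "2 * (1 / 2) = 1 + real (card {h' \<in> halves i. E h h'}) / 2"
      using quint_neighbours[OF ij(1) z(1), of h] halvesD[OF that(1)] hz[OF that(1)] sym[of z h] quints(2) by simp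
    then have "{h' \<in> halves i. E h h'} = {}" using fin_ones_halves(2)[of i] by simp
    then show ?thesis using that(2) by blast
  qed
  define d where "d v = (if v = z \<or> v = z' then i else if v \<in> halves i \<union> halves j then j else c v)" for v
  have ci: "c v = i \<longleftrightarrow> v = z \<or> v \<in> halves i" "c v = j \<longleftrightarrow> v = z' \<or> v \<in> halves j" if "v \<in> V" for v
    using cls_ones_halves(1)[of i] cls_ones_halves(1)[of j] z that by (auto simp: cls_def)
  have dproper: "d u \<noteq> d v" if uv: "u \<in> V" "v \<in> V" "E u v" for u v
  proof
    assume eq: "d u = d v"
    have nc: "c u \<noteq> c v" using proper uv by blast
    have d1: "d v = i \<longleftrightarrow> v = z \<or> v = z'" if "v \<in> V" for v using ci[OF that] quints(2) by (auto simp: d_def)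
    have d2: "d v = j \<longleftrightarrow> v \<in> halves i \<union> halves j" if "v \<in> V" for v
    proof -
      have "z \<notin> halves i \<union> halves j" "z' \<notin> halves i \<union> halves j"
        using zV halvesD(3)[of z] halvesD(3)[of z'] by auto
      then show ?thesis using ci[OF that] quints(2) by (auto simp: d_def)
    qed
    consider "d u = i" | "d u = j" | "d u \<noteq> i" "d u \<noteq> j" by blast
    then show False
    proof cases
      case 1
      then have "u = z \<or> u = z'" "v = z \<or> v = z'"
        using d1[OF uv(1)] d1[OF uv(2)] eq by simp_all
      then show False using nE uv(3) irr[of z] irr[of z'] sym[of z' z] by blast
    next
      case 2
      then have "u \<in> halves i \<union> halves j" "v \<in> halves i \<union> halves j"
        using d2[OF uv(1)] d2[OF uv(2)] eq by simp_all
      then consider "u \<in> halves i" "v \<in> halves i" | "u \<in> halves i" "v \<in> halves j"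
        | "u \<in> halves j" "v \<in> halves i" | "u \<in> halves j" "v \<in> halves j" by blast
      then show False
      proof cases
        case 1 then show False using nc halvesD(2)[of u i] halvesD(2)[of v i] by simp
      next
        case 2 then show False using nhh[of v u] sym[OF uv(3)] by simp
      next
        case 3 then show False using nhh[of u v] uv(3) by simp
      next
        case 4 then show False using nc halvesD(2)[of u j] halvesD(2)[of v j] by simp
      qed
    next
      case 3
      have dc: "d v = c v" if "d v \<noteq> i" "d v \<noteq> j" for v
        using that by (simp add: d_def split: if_splits)
      have "d u = c u" using dc[OF 3] .
      moreover have "d v = c v" using dc[of v] 3 eq by simp
      ultimately show False using eq nc by simp
    qed
  qed
  have dk: "d v < k" if "v \<in> V" for v using that col ij by (simp add: d_def)
  interpret R: hoffman_system V E k d x 2 by (rule recolor[OF dk dproper])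
  have Rcls_i: "R.cls i = {z, z'}"
  proof -
    have "d v = i \<longleftrightarrow> v = z \<or> v = z'" if "v \<in> V" for v using ci[OF that] quints(2) by (auto simp: d_def)
    then show ?thesis using zV unfolding R.cls_def by blast
  qed
  have Rcls_j: "R.cls j = halves i \<union> halves j"
  proof -
    have "z \<notin> halves i \<union> halves j" "z' \<notin> halves i \<union> halves j"
      using zV halvesD(3)[of z] halvesD(3)[of z'] by auto
    then have "d v = j \<longleftrightarrow> v \<in> halves i \<union> halves j" if "v \<in> V" for v
      using ci[OF that] quints(2) by (auto simp: d_def)
    then show ?thesis using halvesD(1) unfolding R.cls_def by blast
  qed
  have Rcls: "R.cls l = cls l" if "l \<noteq> i" "l \<noteq> j" for l
  proof -
    have "d v = l \<longleftrightarrow> c v = l" if "v \<in> V" for v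
      using ci[OF that] zV \<open>l \<noteq> i\<close> \<open>l \<noteq> j\<close> by (cases "v = z"; cases "v = z'") (auto simp: d_def)
    then show ?thesis unfolding R.cls_def cls_def by blast
  qed
  have zz: "z \<noteq> z'" using zV quints by auto
  interpret R: half_system V E k d x
  proof
    show "x v = 1 \<or> x v = 1 / 2" if "v \<in> V" for v using weight[OF that] .
    show "(\<Sum>v\<in>R.cls l. (x v)\<^sup>2) = 2" if "l < k" for l
    proof -
      have "(\<Sum>v\<in>R.cls l. (x v)\<^sup>2) = (\<Sum>v\<in>R.cls i. (x v)\<^sup>2)" by (rule R.cls_norm[OF that ij(3)])
      also have "\<dots> = 2" using zV zz by (simp add: Rcls_i)
      finally show ?thesis .
    qed
  qed
  have card_i: "card (R.cls i) = 2" using zz by (simp add: Rcls_i)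
  have card_j: "card (R.cls j) = 8"
  proof -
    have "halves i \<inter> halves j = {}" using halvesD(2) quints(2) by blast
    then show ?thesis using quint_card(1)[OF ij(1)] quint_card(1)[OF ij(2)] fin_ones_halves(2)
      by (simp add: Rcls_j card_Un_disjoint)
  qed
  have "R.pairs = insert i pairs"
  proof (rule Set.set_eqI)
    fix l show "l \<in> R.pairs \<longleftrightarrow> l \<in> insert i pairs"
      using ij card_i card_j Rcls[of l] by (cases "l = i"; cases "l = j") (auto simp: R.pairs_def pairs_def quints_def)
  qed
  moreover have "i \<notin> pairs" using ij by (auto simp: pairs_def quints_def)
  ultimately have cp: "card R.pairs = Suc (card pairs)" using fin_pairs by simp
  have Rq: "R.quints = {}"
  proof (rule ccontr)
    assume "R.quints \<noteq> {}"
    then obtain l where l: "l < k" "card (R.cls l) = 5" by (auto simp: R.quints_def)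
    then have "l \<noteq> i" "l \<noteq> j" using card_i card_j by auto
    then have "l \<in> quints" using l Rcls by (simp add: quints_def)
    then show False using quints \<open>l \<noteq> i\<close> \<open>l \<noteq> j\<close> by simp
  qed
  have Ro: "R.octs = {j}"
  proof (rule Set.set_eqI)
    fix l show "l \<in> R.octs \<longleftrightarrow> l \<in> {j}"
    proof (cases "l = i \<or> l = j")
      case True
      then show ?thesis using ij card_i card_j quints(2) by (auto simp: R.octs_def)
    next
      case False
      then have "l \<notin> R.octs" using octs Rcls[of l] by (auto simp: R.octs_def octs_def)
      then show ?thesis using False by simp
    qed
  qed
  show "card pairs = 6 \<Longrightarrow> fano_model {1..7} {0..7} V E"
    using R.oct_classification(1)[OF Ro Rq] cp by simp
  show "card pairs = 5 \<Longrightarrow> fano_model {1, 2, 3, 5, 6, 7} {0..7} V E"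
    using R.oct_classification(2)[OF Ro Rq] cp by simp
qed

text \<open>With six classes of size 2, z + 2h is a null vector for any half \<open>h\<close> in the
  class of \<open>z\<close>. If \<open>z\<close> and z' are adjacent, the row of z' yields 0 plus
  twice 2 or - 2, which is not 0.\<close>

lemma six_pairs_adjacent_ones:
  assumes n: "card pairs = 6" and ij: "i \<in> quints" "j \<in> quints" "i \<noteq> j"
    and z: "ones i = {z}" "ones j = {z'}"
  shows "\<not> E z z'"
proof
  assume E: "E z z'"
  have ne: "pairs \<noteq> {}" using n by auto
  have zV: "z \<in> V" "c z = i" "x z = 1" "z' \<in> V" "c z' = j" "x z' = 1" "z \<in> rest" "z' \<in> rest"
    using onesD[of z i] onesD[of z' j] quint_one_rest[of z i] quint_one_rest[of z' j] ij z by simp_all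
  have "halves i \<noteq> {}" using quint_card(1)[OF ij(1)] by auto
  then obtain h where h: "h \<in> halves i" by auto
  note hr = half_rest[OF h] and hh = halvesD[OF h]
  have neq: "h \<noteq> z" "h \<noteq> z'" using hh zV by auto
  have "\<not> E z h" using same_class zV hh by simp
  then have k1: "kern z h = - 2" "kern z z = 4" "kern h h = 1"
    using kern_one(2)[OF zV(3) neq(1) hh(3)] kern_one(1)[OF zV(3)] kern_half_self[OF hr hh(3)] n by simp_all
  define y where "y v = (if v = z then 1 else 2 :: real)" for v
  have "qform {z, h} kern y = 0"
    using neq k1 kern_sym[of h z] by (simp add: qform_def y_def)
  then have "(\<Sum>u\<in>{z, h}. kern z' u * y u) = 0"
    by (intro kern_null[OF ne]) (use zV hr in auto)
  then have "kern z' z + 2 * kern z' h = 0" using neq by (simp add: y_def)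
  moreover have "kern z' z = 0"
    using kern_one(3)[OF zV(6), of z] zV ij(3) E sym[of z z'] by auto
  moreover have "kern z' h = 4 * adj E z' h - 2" by (rule kern_one(2)[OF zV(6) neq(2) hh(3)])
  ultimately show False by (cases "E z' h") auto
qed

end

section \<open>Two classes of size 5 with adjacent vertices of weight 1: the graph M_10\<close>

definition m10_rows :: "nat list list" where
  "m10_rows = [[1, 2, 3, 4, 5], [1, 2], [3, 4], [5], [1, 3, 5], [1, 4], [2, 3], [2, 4, 5]]"

text \<open>Rows 0 to 3 and 8 form one class of size 5, rows 4 to 7 and 9 the other; rows 8 and 9
  have weight 1. An entry of \<open>m10_rows\<close> lists the columns where a row agrees with row
  0.\<close>

definition m10_table :: "nat \<Rightarrow> nat \<Rightarrow> bool \<Rightarrow> bool" where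
  "m10_table r m s \<longleftrightarrow> r = 8 \<or> r = 9 \<or> (s \<longleftrightarrow> m \<in> set (m10_rows ! r))"

definition m10_edges :: "(nat \<times> nat) list" where
  "m10_edges = [(8, 9), (8, 5), (8, 6), (9, 1), (9, 2), (0, 4), (0, 7), (3, 4), (3, 7)]"

definition m10_rest_edge :: "nat \<Rightarrow> nat \<Rightarrow> bool" where
  "m10_rest_edge r r' \<longleftrightarrow> (r, r') \<in> set m10_edges \<or> (r', r) \<in> set m10_edges"

abbreviation m10_model :: "'a set \<Rightarrow> ('a \<Rightarrow> 'a \<Rightarrow> bool) \<Rightarrow> bool" where
  "m10_model V E \<equiv> rel_iso V E (model_verts {1..5} {..<10}) (model_edge m10_table m10_rest_edge)"

context half_system
begin

context
  assumes n: "card pairs = 5"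
begin

lemma pairs_nonempty: "pairs \<noteq> {}"
  using n by auto

text \<open>For agreements of sizes 2, 2, 1 the vectors h1 - h4, h2 - h3 and z + h1 + h2 are null
  vectors of \<open>kern\<close>; each one is a linear relation valid in all rows.\<close>

lemma five_pairs_null:
  assumes i: "i \<in> quints" "ones i = {z}" and h: "halves i = {h1, h2, h3, h4}" "distinct [h1, h2, h3, h4]"
    and cards: "card (agree h1 h2) = 2" "card (agree h1 h3) = 2" "card (agree h1 h4) = 1" and v: "v \<in> rest"
  shows "kern v h1 = kern v h4" "kern v h2 = kern v h3" "kern v z + kern v h1 + kern v h2 = 0"
proof -
  note ne = pairs_nonempty
  note A = quint_agree[OF i(1) h]
  have hs: "h1 \<in> halves i" "h2 \<in> halves i" "h3 \<in> halves i" "h4 \<in> halves i" using h by auto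
  note hr = hs[THEN half_rest] and hh = hs[THEN halvesD(3)]
  have zV: "z \<in> V" "c z = i" "x z = 1" "z \<in> rest"
    using onesD[of z i] quint_one_rest[of z i] i by simp_all
  have zh: "h1 \<noteq> z" "h2 \<noteq> z" using hh zV by auto
  have self: "kern h1 h1 = 2" "kern h2 h2 = 2" "kern h3 h3 = 2" "kern h4 h4 = 2"
    using kern_half_self[OF hr(1) hh(1)] kern_half_self[OF hr(2) hh(2)]
      kern_half_self[OF hr(3) hh(3)] kern_half_self[OF hr(4) hh(4)] n by simp_all
  have mixed: "kern h1 h4 = 2" "kern h2 h3 = 2" "kern h1 h2 = 0"
    using quint_kern[OF i(1) hs(1,4)] quint_kern[OF i(1) hs(2,3)] quint_kern[OF i(1) hs(1,2)] h(2) n cards A(3)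
    by simp_all
  have "\<not> E z h1" "\<not> E z h2" using same_class zV halvesD[OF hs(1)] halvesD[OF hs(2)] by simp_all
  then have zk: "kern z h1 = - 2" "kern z h2 = - 2" "kern z z = 4"
    using kern_one(2)[OF zV(3) zh(1) hh(1)] kern_one(2)[OF zV(3) zh(2) hh(2)] kern_one(1)[OF zV(3)] by simp_all
  have "qform {h1, h4} kern (\<lambda>v. if v = h1 then 1 else - 1) = 0"
    using h(2) self mixed kern_sym[of h4 h1] by (auto simp: qform_def)
  from kern_null[OF ne _ this v] show "kern v h1 = kern v h4" using hr h(2) by auto
  have "qform {h2, h3} kern (\<lambda>v. if v = h2 then 1 else - 1) = 0"
    using h(2) self mixed kern_sym[of h3 h2] by (auto simp: qform_def)
  from kern_null[OF ne _ this v] show "kern v h2 = kern v h3" using hr h(2) by auto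
  have "qform {z, h1, h2} kern (\<lambda>_. 1) = 0"
    using h(2) zh zh[symmetric] self mixed zk kern_sym[of h1 z] kern_sym[of h2 z] kern_sym[of h2 h1] by (auto simp: qform_def)
  from kern_null[OF ne _ this v] show "kern v z + kern v h1 + kern v h2 = 0" using hr zV h(2) zh by auto
qed

text \<open>Five is 2 + 2 + 1 as a sum of three parts at most 2. The null vectors show that z' sees
  either \<open>a\<close> and \<open>e\<close> or \<open>b\<close> and \<open>d\<close>; exchanging
  \<open>a\<close> with \<open>b\<close> and \<open>d\<close> with \<open>e\<close> preserves the
  sizes and selects the second case.\<close>

lemma five_pairs_quint:
  assumes i: "i \<in> quints" "ones i = {z}" and z': "z' \<in> rest" "x z' = 1" "z' \<notin> cls i" "E z' z"
  obtains h1 h2 h3 h4 where "halves i = {h1, h2, h3, h4}" "distinct [h1, h2, h3, h4]"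
    "card (agree h1 h2) = 2" "card (agree h1 h3) = 2" "card (agree h1 h4) = 1"
    "\<not> E z' h1" "\<not> E z' h4" "E z' h2" "E z' h3"
proof -
  note ne = pairs_nonempty
  obtain a b d e where h: "halves i = {a, b, d, e}" "distinct [a, b, d, e]"
    and ord: "card (agree a b) \<ge> card (agree a d)" "card (agree a d) \<ge> card (agree a e)"
    using quint_halves[OF i(1)] by metis
  note A = quint_agree[OF i(1) h]
  have le: "card (agree a b) \<le> 2" by (rule quint_agree_le[OF ne i(1) h])
  have "s = 2 \<and> t = 2 \<and> u = 1" if "s \<le> 2" "t \<le> s" "u \<le> t" "5 = s + t + u" for s t u :: nat
    using that by presburger
  from this[OF le ord A(8)[unfolded n]]
  have cards: "card (agree a b) = 2" "card (agree a d) = 2" "card (agree a e) = 1" by simp_all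
  have kz: "kern z' z = 0"
    using kern_one(3)[OF z'(2), of z] i z' onesD(3)[of z i] by (cases "z = z'") (auto simp: irr)
  have kh: "kern z' v = 4 * adj E z' v - 2" if "v \<in> halves i" for v
  proof (rule kern_one(2)[OF z'(2) _ halvesD(3)[OF that]])
    show "v \<noteq> z'" using z'(3) that cls_ones_halves(1)[of i] by blast
  qed
  have hs: "a \<in> halves i" "b \<in> halves i" "d \<in> halves i" "e \<in> halves i" using h by auto
  note N = five_pairs_null[OF i h cards z'(1)]
  have E1: "E z' a \<longleftrightarrow> E z' e" "E z' b \<longleftrightarrow> E z' d"
    subgoal using N(1) kh[OF hs(1)] kh[OF hs(4)] by (cases "E z' a"; cases "E z' e") simp_all
    subgoal using N(2) kh[OF hs(2)] kh[OF hs(3)] by (cases "E z' b"; cases "E z' d") simp_all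
    done
  have E2: "E z' a \<longleftrightarrow> \<not> E z' b"
    using N(3) kz kh[OF hs(1)] kh[OF hs(2)] by (cases "E z' a"; cases "E z' b") simp_all
  show thesis
  proof (cases "E z' a")
    case False
    then show ?thesis using that[OF h cards] E1 E2 by blast
  next
    case True
    have h': "halves i = {b, a, e, d}" "distinct [b, a, e, d]" using h by auto
    have "card (agree b a) = 2" "card (agree b e) = 2" "card (agree b d) = 1"
      using cards A(2,3) agree_commute[of b a] by simp_all
    then show ?thesis using that[OF h'] E1 E2 True by blast
  qed
qed

text \<open>The null vectors determine \<open>kern\<close> between the two classes, regularity
  determines the adjacencies, and together they give the numbers of agreements. These fix the sign
  table up to renaming columns within two couples and the rows \<open>g2\<close> and
  \<open>g3\<close>.\<close>

lemma m10_classification: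
  assumes quints: "quints = {i, j}" "i \<noteq> j" and octs: "octs = {}"
    and z: "ones i = {z}" "ones j = {w}" and E: "E z w"
  shows "m10_model V E"
proof -
  have ij: "i \<in> quints" "j \<in> quints" using quints by simp_all
  have zV: "z \<in> V" "c z = i" "x z = 1" "w \<in> V" "c w = j" "x w = 1" "z \<in> rest" "w \<in> rest"
    using onesD[of z i] onesD[of w j] quint_one_rest[of z i] quint_one_rest[of w j] ij z by simp_all
  have nc: "w \<notin> cls i" "z \<notin> cls j" using zV quints(2) by (auto simp: cls_def)
  obtain h1 h2 h3 h4 where h: "halves i = {h1, h2, h3, h4}" "distinct [h1, h2, h3, h4]"
    and ch: "card (agree h1 h2) = 2" "card (agree h1 h3) = 2" "card (agree h1 h4) = 1"
    and wh: "\<not> E w h1" "\<not> E w h4" "E w h2" "E w h3"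
    using five_pairs_quint[OF ij(1) z(1) zV(8,6) nc(1) sym[OF E]] by metis
  obtain g1 g2 g3 g4 where g: "halves j = {g1, g2, g3, g4}" "distinct [g1, g2, g3, g4]"
    and cg: "card (agree g1 g2) = 2" "card (agree g1 g3) = 2" "card (agree g1 g4) = 1"
    and zg: "\<not> E z g1" "\<not> E z g4" "E z g2" "E z g3"
    using five_pairs_quint[OF ij(2) z(2) zV(7,3) nc(2) E] by metis
  have hs: "h1 \<in> halves i" "h2 \<in> halves i" "h3 \<in> halves i" "h4 \<in> halves i" using h by auto
  have gs: "g1 \<in> halves j" "g2 \<in> halves j" "g3 \<in> halves j" "g4 \<in> halves j" using g by auto
  note hr = hs[THEN half_rest] gs[THEN half_rest] and hh = hs[THEN halvesD(3)] gs[THEN halvesD(3)]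
    and hc = hs[THEN halvesD(2)] gs[THEN halvesD(2)] and hV = hs[THEN halvesD(1)] gs[THEN halvesD(1)]
  have hg: "u \<noteq> v" if "u \<in> halves i" "v \<in> halves j" for u v using halvesD(2) that quints(2) by blast
  note Nh = five_pairs_null[OF ij(1) z(1) h ch]
  note Ng = five_pairs_null[OF ij(2) z(2) g cg]
  have selfk: "kern u u = 2" if "u \<in> rest" "x u = 1 / 2" for u using kern_half_self[OF that] n by simp
  have one_half: "kern v u = 4 * adj E v u - 2" if "x v = 1" "x u = 1 / 2" for u v
    using kern_one(2)[OF that(1) _ that(2)] that by fastforce
  have kw: "kern h1 w = - 2" "kern h2 w = 2" and kz: "kern g1 z = - 2" "kern g2 z = 2"
    using one_half[OF zV(6) hh(1)] one_half[OF zV(6) hh(2)] one_half[OF zV(3) hh(5)] one_half[OF zV(3) hh(6)]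
      kern_sym[of h1 w] kern_sym[of h2 w] kern_sym[of g1 z] kern_sym[of g2 z] wh zg by simp_all
  have bound: "\<bar>kern u v\<bar> \<le> 2" if "u \<in> halves i" "v \<in> halves j" for u v
    using kern_pair_bound[OF pairs_nonempty half_rest[OF that(1)] half_rest[OF that(2)] hg[OF that]]
      selfk[OF half_rest[OF that(1)] halvesD(3)[OF that(1)]] selfk[OF half_rest[OF that(2)] halvesD(3)[OF that(2)]]
    by linarith
  \<comment> \<open>The four relations leave one free parameter, \<open>kern h2 g1\<close>; the
    bound 2 on the first and on the last entry makes it 0.\<close>
  have k11: "kern h1 g1 = 2" and k12: "kern h1 g2 = 0" and k21: "kern h2 g1 = 0" and k22: "kern h2 g2 = - 2"
    using Nh(3)[OF hr(5)] Nh(3)[OF hr(6)] Ng(3)[OF hr(1)] Ng(3)[OF hr(2)] kw kz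
      kern_sym[of g1 h1] kern_sym[of g1 h2] kern_sym[of g2 h1] kern_sym[of g2 h2]
      bound[OF hs(1) gs(1)] bound[OF hs(2) gs(2)] by linarith+
  have kern4: "kern h1 v = kern h4 v" "kern h2 v = kern h3 v" if "v \<in> rest" for v
    using Nh(1,2)[OF that] kern_sym[of v] by simp_all
  have k: "kern u v = 2" if "u \<in> {h1, h4}" "v \<in> {g1, g4}" for u v
    using that k11 kern4(1)[OF hr(5)] kern4(1)[OF hr(8)] Ng(1)[OF hr(1)] by auto
  have k': "kern u v = 0" if "u \<in> {h1, h4}" "v \<in> {g2, g3}" for u v
    using that k12 kern4(1)[OF hr(6)] kern4(1)[OF hr(7)] Ng(2)[OF hr(1)] by auto
  have k'': "kern u v = 0" if "u \<in> {h2, h3}" "v \<in> {g1, g4}" for u v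
    using that k21 kern4(2)[OF hr(5)] kern4(2)[OF hr(8)] Ng(1)[OF hr(2)] by auto
  have k''': "kern u v = - 2" if "u \<in> {h2, h3}" "v \<in> {g2, g3}" for u v
    using that k22 kern4(2)[OF hr(6)] kern4(2)[OF hr(7)] Ng(2)[OF hr(2)] by auto
  have none_g: "\<not> E v u" if v: "v \<in> {g2, g3}" and u: "u \<in> halves i" for u v
  proof -
    have vV: "v \<in> V" "c v \<noteq> i" "x v = 1 / 2" "E v z" using v hV hc hh quints(2) zg sym by auto
    have "2 * (1 / 2) = 1 + real (card {u \<in> halves i. E v u}) / 2"
      using quint_neighbours[OF ij(1) z(1) vV(1,2)] vV(3,4) by simp
    then have "{u \<in> halves i. E v u} = {}" using fin_ones_halves(2)[of i] by simp
    then show ?thesis using u by blast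
  qed
  have none_h: "\<not> E v u" if v: "v \<in> {h2, h3}" and u: "u \<in> halves j" for u v
  proof -
    have vV: "v \<in> V" "c v \<noteq> j" "x v = 1 / 2" "E v w" using v hV hc hh quints(2) wh sym by auto
    have "2 * (1 / 2) = 1 + real (card {u \<in> halves j. E v u}) / 2"
      using quint_neighbours[OF ij(2) z(2) vV(1,2)] vV(3,4) by simp
    then have "{u \<in> halves j. E v u} = {}" using fin_ones_halves(2)[of j] by simp
    then show ?thesis using u by blast
  qed
  \<comment> \<open>Such a \<open>v\<close> needs weight 1 from class \<open>i\<close>. Neither
    \<open>z\<close> nor \<open>h2\<close> nor \<open>h3\<close> contributes, so \<open>h1\<close>
    and \<open>h4\<close> both do.\<close>
  have full_g: "E v h1 \<and> E v h4" if v: "v \<in> {g1, g4}" for v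
  proof -
    have vV: "v \<in> V" "c v \<noteq> i" "x v = 1 / 2" "\<not> E v z" using v hV hc hh quints(2) zg sym by auto
    have "2 * (1 / 2) = real (card {u \<in> halves i. E v u}) / 2"
      using quint_neighbours[OF ij(1) z(1) vV(1,2)] vV(3,4) by simp
    then have two: "card {u \<in> halves i. E v u} = 2" by simp
    have sub: "{u \<in> halves i. E v u} \<subseteq> {h1, h4}"
      using none_h[of h2 v] none_h[of h3 v] v gs sym unfolding h(1) by blast
    have "{u \<in> halves i. E v u} = {h1, h4}"
      by (rule card_subset_eq[OF _ sub]) (use two h(2) in auto)
    then show ?thesis by blast
  qed
  have symE: "E u v \<longleftrightarrow> E v u" for u v using sym by blast
  have hkern: "card (agree u v) = c" if "u \<in> halves i" "v \<in> halves j" "kern u v = 4 * adj E u v + 4 - 2 * real c" for u v c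
    using kern_half_half[OF half_rest[OF that(1)] halvesD(3)[OF that(1)] half_rest[OF that(2)] halvesD(3)[OF that(2)] hg[OF that(1,2)]]
      that(3) n by simp
  have c3: "card (agree u v) = 3" if "u \<in> {h1, h4}" "v \<in> {g1, g4}" for u v
    by (rule hkern) (use that hs gs k[OF that] full_g[OF that(2)] symE[of u v] in auto)
  have c2: "card (agree u v) = 2" if "u \<in> {h1, h4}" "v \<in> {g2, g3}" for u v
    by (rule hkern) (use that hs gs k'[OF that] none_g[OF that(2), of u] symE[of u v] in auto)
  have c2': "card (agree u v) = 2" if "u \<in> {h2, h3}" "v \<in> {g1, g4}" for u v
    by (rule hkern) (use that hs gs k''[OF that] none_h[OF that(1), of v] in auto)
  have c3': "card (agree u v) = 3" if "u \<in> {h2, h3}" "v \<in> {g2, g3}" for u v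
    by (rule hkern) (use that hs gs k'''[OF that] none_h[OF that(1), of v] in auto)
  note A = quint_agree[OF ij(1) h] and B = quint_agree[OF ij(2) g]
  note base = agree_agree[OF hr(1) hh(1)]
  define S where "S v = agree h1 v" for v
  obtain p where p: "S h4 = {p}" using ch(3) by (auto simp: S_def card_1_singleton_iff)
  obtain q1 q2 where q: "S h2 = {q1, q2}" "q1 \<noteq> q2" using ch(1) by (auto simp: S_def card_2_iff)
  obtain r1 r2 where r: "S h3 = {r1, r2}" "r1 \<noteq> r2" using ch(2) by (auto simp: S_def card_2_iff)
  have pairs: "pairs = {q1, q2, r1, r2, p}" using A(4) p q r by (auto simp: S_def)
  have dist: "distinct [q1, q2, r1, r2, p]"
    using A(5-7) unfolding S_def[symmetric] p q r using q(2) r(2) by auto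
  have count: "card {t \<in> pairs. Q t} = of_bool (Q q1) + of_bool (Q q2) + of_bool (Q r1) + of_bool (Q r2) + of_bool (Q p)" for Q
  proof -
    have "card {t \<in> pairs. Q t} = (\<Sum>t\<in>pairs. of_bool (Q t))" using fin_pairs(1) by (simp add: Int_def)
    also have "\<dots> = of_bool (Q q1) + of_bool (Q q2) + of_bool (Q r1) + of_bool (Q r2) + of_bool (Q p)"
      unfolding pairs using dist by (simp del: sum_of_bool_eq)
    finally show ?thesis .
  qed
  have agr: "card (agree u v) = of_bool (q1 \<in> S u \<longleftrightarrow> q1 \<in> S v) + of_bool (q2 \<in> S u \<longleftrightarrow> q2 \<in> S v)
      + of_bool (r1 \<in> S u \<longleftrightarrow> r1 \<in> S v) + of_bool (r2 \<in> S u \<longleftrightarrow> r2 \<in> S v) + of_bool (p \<in> S u \<longleftrightarrow> p \<in> S v)"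
    if "u \<in> rest" "x u = 1 / 2" "v \<in> rest" "x v = 1 / 2" for u v
  proof -
    have "agree u v = {t \<in> pairs. t \<in> S u \<longleftrightarrow> t \<in> S v}"
      using base[OF that] agree_subset unfolding S_def by blast
    then show ?thesis using count by simp
  qed
  have S1: "S h1 = pairs" unfolding S_def by (rule agree_self[OF hr(1) hh(1)])
  have mem: "q1 \<in> S h1" "q2 \<in> S h1" "r1 \<in> S h1" "r2 \<in> S h1" "p \<in> S h1"
    "q1 \<in> S h2" "q2 \<in> S h2" "r1 \<notin> S h2" "r2 \<notin> S h2" "p \<notin> S h2"
    "q1 \<notin> S h3" "q2 \<notin> S h3" "r1 \<in> S h3" "r2 \<in> S h3" "p \<notin> S h3"
    "q1 \<notin> S h4" "q2 \<notin> S h4" "r1 \<notin> S h4" "r2 \<notin> S h4" "p \<in> S h4"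
    unfolding S1 p q r pairs using dist by auto
  have odd: "p \<in> S v \<and> (q1 \<in> S v \<longleftrightarrow> q2 \<notin> S v) \<and> (r1 \<in> S v \<longleftrightarrow> r2 \<notin> S v)"
    if "v \<in> rest" "x v = 1 / 2" "card (agree h1 v) = 3" "card (agree h4 v) = 3" "card (agree h2 v) = 2" for v
    using that(3-5) unfolding agr[OF hr(1) hh(1) that(1,2)] agr[OF hr(4) hh(4) that(1,2)] agr[OF hr(2) hh(2) that(1,2)]
    by (simp add: mem) (cases "q1 \<in> S v"; cases "q2 \<in> S v"; cases "r1 \<in> S v"; cases "r2 \<in> S v"; cases "p \<in> S v"; simp)
  have even: "p \<notin> S v \<and> (q1 \<in> S v \<longleftrightarrow> q2 \<notin> S v) \<and> (r1 \<in> S v \<longleftrightarrow> r2 \<notin> S v)"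
    if "v \<in> rest" "x v = 1 / 2" "card (agree h1 v) = 2" "card (agree h4 v) = 2" "card (agree h2 v) = 3" for v
    using that(3-5) unfolding agr[OF hr(1) hh(1) that(1,2)] agr[OF hr(4) hh(4) that(1,2)] agr[OF hr(2) hh(2) that(1,2)]
    by (simp add: mem) (cases "q1 \<in> S v"; cases "q2 \<in> S v"; cases "r1 \<in> S v"; cases "r2 \<in> S v"; cases "p \<in> S v"; simp)
  have s1: "p \<in> S g1 \<and> (q1 \<in> S g1 \<longleftrightarrow> q2 \<notin> S g1) \<and> (r1 \<in> S g1 \<longleftrightarrow> r2 \<notin> S g1)"
    by (rule odd[OF hr(5) hh(5)]) (use c3 c2' in auto)
  have s4: "p \<in> S g4 \<and> (q1 \<in> S g4 \<longleftrightarrow> q2 \<notin> S g4) \<and> (r1 \<in> S g4 \<longleftrightarrow> r2 \<notin> S g4)"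
    by (rule odd[OF hr(8) hh(8)]) (use c3 c2' in auto)
  have s2: "p \<notin> S g2 \<and> (q1 \<in> S g2 \<longleftrightarrow> q2 \<notin> S g2) \<and> (r1 \<in> S g2 \<longleftrightarrow> r2 \<notin> S g2)"
    by (rule even[OF hr(6) hh(6)]) (use c3' c2 in auto)
  have s3: "p \<notin> S g3 \<and> (q1 \<in> S g3 \<longleftrightarrow> q2 \<notin> S g3) \<and> (r1 \<in> S g3 \<longleftrightarrow> r2 \<notin> S g3)"
    by (rule even[OF hr(7) hh(7)]) (use c3' c2 in auto)
  \<comment> \<open>The rows \<open>g1\<close> and \<open>g4\<close> agree in a single column, and
    both contain \<open>p\<close>; hence they are complementary on the other four columns. The same
    holds for \<open>g2\<close> and \<open>g3\<close>, which both omit \<open>p\<close>.\<close>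
  have t14: "(q1 \<in> S g4 \<longleftrightarrow> q1 \<notin> S g1) \<and> (r1 \<in> S g4 \<longleftrightarrow> r1 \<notin> S g1)"
    using cg(3) s1 s4 unfolding agr[OF hr(5) hh(5) hr(8) hh(8)]
    by (cases "q1 \<in> S g1"; cases "q1 \<in> S g4"; cases "r1 \<in> S g1"; cases "r1 \<in> S g4"; simp)
  have t23: "(q1 \<in> S g3 \<longleftrightarrow> q1 \<notin> S g2) \<and> (r1 \<in> S g3 \<longleftrightarrow> r1 \<notin> S g2)"
    using cg(3) s2 s3 unfolding B(3)[symmetric] agr[OF hr(6) hh(6) hr(7) hh(7)]
    by (cases "q1 \<in> S g2"; cases "q1 \<in> S g3"; cases "r1 \<in> S g2"; cases "r1 \<in> S g3"; simp)
  have t12: "(q1 \<in> S g1 \<longleftrightarrow> q1 \<in> S g2) \<longleftrightarrow> (r1 \<in> S g1 \<longleftrightarrow> r1 \<notin> S g2)"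
    using cg(1) s1 s2 unfolding agr[OF hr(5) hh(5) hr(6) hh(6)]
    by (cases "q1 \<in> S g1"; cases "q1 \<in> S g2"; cases "r1 \<in> S g1"; cases "r1 \<in> S g2"; simp)
  text \<open>The columns and the two middle rows are named so that the sign table becomes the one of the model.\<close>
  define c1 c2 where "c1 = (if q1 \<in> S g1 then q1 else q2)" and "c2 = (if q1 \<in> S g1 then q2 else q1)"
  define c3 c4 where "c3 = (if r1 \<in> S g1 then r1 else r2)" and "c4 = (if r1 \<in> S g1 then r2 else r1)"
  define u2 u3 where "u2 = (if q1 \<in> S g1 \<longleftrightarrow> q1 \<in> S g2 then g2 else g3)"
    and "u3 = (if q1 \<in> S g1 \<longleftrightarrow> q1 \<in> S g2 then g3 else g2)"
  have bits: "c1 \<in> S h1" "c2 \<in> S h1" "c3 \<in> S h1" "c4 \<in> S h1" "p \<in> S h1"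
    "c1 \<in> S h2" "c2 \<in> S h2" "c3 \<notin> S h2" "c4 \<notin> S h2" "p \<notin> S h2"
    "c1 \<notin> S h3" "c2 \<notin> S h3" "c3 \<in> S h3" "c4 \<in> S h3" "p \<notin> S h3"
    "c1 \<notin> S h4" "c2 \<notin> S h4" "c3 \<notin> S h4" "c4 \<notin> S h4" "p \<in> S h4"
    using mem by (simp_all add: c1_def c2_def c3_def c4_def)
  have bits1: "c1 \<in> S g1" "c2 \<notin> S g1" "c3 \<in> S g1" "c4 \<notin> S g1" "p \<in> S g1"
    using s1 by (simp_all add: c1_def c2_def c3_def c4_def)
  have bits4: "c1 \<notin> S g4" "c2 \<in> S g4" "c3 \<notin> S g4" "c4 \<in> S g4" "p \<in> S g4"
    using s4 t14 by (simp_all add: c1_def c2_def c3_def c4_def)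
  have bits2: "c1 \<in> S u2 \<and> c2 \<notin> S u2 \<and> c3 \<notin> S u2 \<and> c4 \<in> S u2 \<and> p \<notin> S u2"
    using s2 s3 t12 t23 unfolding c1_def c2_def c3_def c4_def u2_def
    by (cases "q1 \<in> S g1"; cases "q1 \<in> S g2"; cases "r1 \<in> S g1"; simp)
  have bits3: "c1 \<notin> S u3 \<and> c2 \<in> S u3 \<and> c3 \<in> S u3 \<and> c4 \<notin> S u3 \<and> p \<notin> S u3"
    using s2 s3 t12 t23 unfolding c1_def c2_def c3_def c4_def u3_def
    by (cases "q1 \<in> S g1"; cases "q1 \<in> S g2"; cases "r1 \<in> S g1"; simp)
  have u: "u2 \<in> {g2, g3}" "u3 \<in> {g2, g3}" "{u2, u3} = {g2, g3}" "u2 \<noteq> u3"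
    using g(2) by (auto simp: u2_def u3_def)
  define cs where "cs = [c1, c2, c3, c4, p]"
  define vs where "vs = [h1, h2, h3, h4, g1, u2, u3, g4, z, w]"
  have cs: "distinct cs" "set cs = pairs"
    unfolding cs_def c1_def c2_def c3_def c4_def pairs using dist by auto
  have len: "length cs = 5" by (simp add: cs_def)
  have \<pi>: "bij_betw (\<lambda>m. cs ! (m - 1)) {1..5} pairs"
    using bij_betw_nth_from_1[OF cs(1)] unfolding cs(2) len .
  have zh: "z \<notin> halves i \<union> halves j" "w \<notin> halves i \<union> halves j"
    using zV halvesD(3)[of z] halvesD(3)[of w] by auto
  have "distinct vs"
  proof -
    have "z \<noteq> w" using zV quints(2) by auto
    moreover have "halves i \<inter> halves j = {}" using hg by blast
    ultimately show ?thesis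
      using h g u zh unfolding vs_def by auto
  qed
  moreover have "set vs = rest"
  proof -
    have "rest = cls i \<union> cls j" using rest_eq quints octs by auto
    also have "\<dots> = {z, h1, h2, h3, h4} \<union> {w, g1, g2, g3, g4}"
      unfolding cls_ones_halves(1) z h(1) g(1) by auto
    finally show ?thesis using u(3) unfolding vs_def by auto
  qed
  ultimately have \<rho>: "bij_betw ((!) vs) {..<10} rest"
    by (intro bij_betw_nth) (simp_all add: vs_def)
  have nine: "r \<in> {0, 1, 2, 3, 4, 5, 6, 7, 8, 9}" if "r < 10" for r :: nat using that by auto
  show ?thesis
  proof (rule model_iso[OF hr(1) hh(1) \<pi> \<rho>])
    fix r m :: nat and s assume r: "r \<in> {..<10}" and m: "m \<in> {1..5}"
    have m': "m = 1 \<or> m = 2 \<or> m = 3 \<or> m = 4 \<or> m = 5" using m by auto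
    show "m10_table r m s \<longleftrightarrow> x (vs ! r) = 1 \<or> (s \<longleftrightarrow> cs ! (m - 1) \<in> agree h1 (vs ! r))"
    proof (cases "r = 8 \<or> r = 9")
      case True
      then have "x (vs ! r) = 1" using zV by (auto simp: vs_def)
      then show ?thesis using True by (auto simp: m10_table_def)
    next
      case False
      then have r': "r \<in> {0, 1, 2, 3, 4, 5, 6, 7}" using nine[of r] r by auto
      have "vs ! r \<in> halves i \<union> halves j" using r' hs gs u by (auto simp: vs_def)
      then have "x (vs ! r) = 1 / 2" using halvesD(3) by blast
      then have "x (vs ! r) \<noteq> 1" by simp
      moreover have "cs ! (m - 1) \<in> S (vs ! r) \<longleftrightarrow> m \<in> set (m10_rows ! r)"
        using r' m' bits bits1 bits2 bits3 bits4
        by (elim insertE emptyE disjE; simp add: cs_def vs_def m10_rows_def)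
      ultimately show ?thesis using False by (auto simp: m10_table_def S_def)
    qed
  next
    have same: "\<not> E u v" if "u \<in> cls l" "v \<in> cls l" for u v l using that same_class by (auto simp: cls_def)
    have ci: "cls i = {z, h1, h2, h3, h4}" "cls j = {w, g1, u2, u3, g4}"
      unfolding cls_ones_halves(1) z h(1) g(1) using u(3) by auto
    have e1: "E g1 h1" "E g1 h4" "E g4 h1" "E g4 h4" using full_g by auto
    have e2: "\<not> E v u" if "v \<in> {u2, u3}" "u \<in> {h1, h2, h3, h4}" for u v using none_g that u h(1) by auto
    have e3: "\<not> E v u" if "v \<in> {h2, h3}" "u \<in> {g1, u2, u3, g4}" for u v using none_h that u g(1) by auto
    have e4: "E z u2" "E z u3" using zg u by auto
    have cross: "E z w" "\<not> E z g1" "E z u2" "E z u3" "\<not> E z g4"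
      "\<not> E h1 w" "E h1 g1" "\<not> E h1 u2" "\<not> E h1 u3" "E h1 g4"
      "E h2 w" "\<not> E h2 g1" "\<not> E h2 u2" "\<not> E h2 u3" "\<not> E h2 g4"
      "E h3 w" "\<not> E h3 g1" "\<not> E h3 u2" "\<not> E h3 u3" "\<not> E h3 g4"
      "\<not> E h4 w" "E h4 g1" "\<not> E h4 u2" "\<not> E h4 u3" "E h4 g4"
    proof -
      have "E h1 g1" "E h1 g4" "E h4 g1" "E h4 g4" using e1 by (auto intro: sym)
      moreover have "\<not> E h1 w" "E h2 w" "E h3 w" "\<not> E h4 w"
        using wh symE[of w h1] symE[of w h2] symE[of w h3] symE[of w h4] by blast+
      moreover have "\<not> E h1 u2" "\<not> E h1 u3" "\<not> E h4 u2" "\<not> E h4 u3"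
        using e2[of u2 h1] e2[of u3 h1] e2[of u2 h4] e2[of u3 h4]
          symE[of u2 h1] symE[of u3 h1] symE[of u2 h4] symE[of u3 h4] by blast+
      ultimately show "E z w" "\<not> E z g1" "E z u2" "E z u3" "\<not> E z g4"
        "\<not> E h1 w" "E h1 g1" "\<not> E h1 u2" "\<not> E h1 u3" "E h1 g4"
        "E h2 w" "\<not> E h2 g1" "\<not> E h2 u2" "\<not> E h2 u3" "\<not> E h2 g4"
        "E h3 w" "\<not> E h3 g1" "\<not> E h3 u2" "\<not> E h3 u3" "\<not> E h3 g4"
        "\<not> E h4 w" "E h4 g1" "\<not> E h4 u2" "\<not> E h4 u3" "E h4 g4"
        using E zg e3 e4 by simp_all
    qed
    have cross': "E w z" "\<not> E g1 z" "E u2 z" "E u3 z" "\<not> E g4 z"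
      "\<not> E w h1" "E g1 h1" "\<not> E u2 h1" "\<not> E u3 h1" "E g4 h1"
      "E w h2" "\<not> E g1 h2" "\<not> E u2 h2" "\<not> E u3 h2" "\<not> E g4 h2"
      "E w h3" "\<not> E g1 h3" "\<not> E u2 h3" "\<not> E u3 h3" "\<not> E g4 h3"
      "\<not> E w h4" "E g1 h4" "\<not> E u2 h4" "\<not> E u3 h4" "E g4 h4"
      using cross by (simp_all add: symE[of w] symE[of g1] symE[of u2] symE[of u3] symE[of g4])
    have in_i: "\<not> E u v" if "u \<in> {z, h1, h2, h3, h4}" "v \<in> {z, h1, h2, h3, h4}" for u v
      using same[of u i v] that ci by simp
    have in_j: "\<not> E u v" if "u \<in> {w, g1, u2, u3, g4}" "v \<in> {w, g1, u2, u3, g4}" for u v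
      using same[of u j v] that ci by simp
    fix r r' :: nat assume "r \<in> {..<10}" "r' \<in> {..<10}"
    then have r: "r \<in> {0, 1, 2, 3, 4, 5, 6, 7, 8, 9}" and r': "r' \<in> {0, 1, 2, 3, 4, 5, 6, 7, 8, 9}"
      using nine by auto
    show "m10_rest_edge r r' \<longleftrightarrow> E (vs ! r) (vs ! r')"
      using r r'
      by (elim insertE emptyE;
          simp add: vs_def m10_rest_edge_def m10_edges_def cross cross' in_i in_j)
  qed
qed

end

text \<open>The bound on the order is \<open>ineq\<close>. With at most 7 classes of size 2 next to
  one of size 8, and at most 6 next to one of size 5, it admits a single class of size 8 or else one
  or two classes of size 5.\<close>

theorem half_classification:
  assumes small: "card V < 3 * k" and nontrivial: "quints \<noteq> {} \<or> octs \<noteq> {}"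
  shows "(\<exists>P\<in>{{1, 2, 3}, {1, 5, 2}, {1, 5, 2, 3}, {1, 5, 2, 6}, {1, 5, 2, 6, 3}, {1, 5, 2, 6, 3, 7}}.
      fano_model P {0, 1, 2, 3, 8} V E)
    \<or> fano_model {1, 2, 3, 5, 6, 7} {0..7} V E \<or> fano_model {1..7} {0..7} V E \<or> m10_model V E"
proof -
  have ineq: "2 * card quints + 5 * card octs < card pairs"
    using small k_eq card_V_eq by linarith
  then have ne: "pairs \<noteq> {}" by auto
  show ?thesis
  proof (cases "octs = {}")
    case False
    then have "card octs > 0" using fin_pairs by (simp add: card_gt_0_iff)
    moreover have "card pairs \<le> 7" by (rule oct_pairs_le[OF False])
    ultimately have o: "card octs = 1" "card quints = 0" "card pairs = 6 \<or> card pairs = 7" using ineq by linarith+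
    then obtain i where "octs = {i}" by (auto simp: card_1_singleton_iff)
    moreover have "quints = {}" using o fin_pairs by simp
    ultimately show ?thesis using oct_classification o(3) by blast
  next
    case True
    then have q: "quints \<noteq> {}" using nontrivial by simp
    then have "card quints > 0" using fin_pairs by (simp add: card_gt_0_iff)
    moreover have "card pairs \<le> 6" by (rule quint_pairs_le[OF q ne])
    ultimately consider "card quints = 1" "3 \<le> card pairs" | "card quints = 2" "card pairs = 5 \<or> card pairs = 6"
      using ineq by linarith
    then show ?thesis
    proof cases
      case 1
      then obtain i where "quints = {i}" by (auto simp: card_1_singleton_iff)
      then show ?thesis using quint_classification[OF _ True 1(2)] by blast
    next
      case 2
      then obtain i j where ij: "quints = {i, j}" "i \<noteq> j" by (auto simp: card_2_iff)
      then have ij': "i \<in> quints" "j \<in> quints" by simp_all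
      obtain z w where z: "ones i = {z}" "ones j = {w}"
        using quint_card(2)[OF ij'(1)] quint_card(2)[OF ij'(2)] by (auto simp: card_1_singleton_iff)
      show ?thesis
      proof (cases "E z w")
        case True
        then have "card pairs = 5" using six_pairs_adjacent_ones[OF _ ij' ij(2) z] 2(2) by blast
        then show ?thesis using m10_classification[OF _ ij \<open>octs = {}\<close> z True] by blast
      next
        case False
        then show ?thesis using quint_merge[OF ij \<open>octs = {}\<close> z False] 2(2) by blast
      qed
    qed
  qed
qed

end

section \<open>Small Hoffman colorable graphs\<close>

context half_system
begin

lemma connected_two_pairs:
  assumes "2 \<le> card pairs" shows "connected_on V E"
proof -
  obtain p q where pq: "p \<in> pairs" "q \<in> pairs" "p \<noteq> q"
    using assms fin_pairs(1) by (metis card_le_Suc0_iff_eq not_less_eq_eq numeral_2_eq_2)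
  let ?R = "{(a, b). a \<in> V \<and> b \<in> V \<and> E a b}"
  have pk: "p < k" "q < k" using pq by (auto simp: pairs_def)
  obtain y where y: "y \<in> cls p" using cls_nonempty[OF pk(1)] by auto
  have yV: "y \<in> V" "c y = p" using y by (auto simp: cls_def)
  have sym_R: "sym ?R" using sym by (auto simp: sym_def)
  have q1: "(u, y) \<in> ?R\<^sup>*" if "u \<in> cls q" for u
  proof -
    have "u \<in> V" "c u = q" using that by (auto simp: cls_def)
    then have "E u y" using one_adj_pair(1)[OF pq(1) _ _ pair_ones[OF pq(2) that] y] pq(3) by simp
    then show ?thesis using \<open>u \<in> V\<close> yV by auto
  qed
  have to_y: "(v, y) \<in> ?R\<^sup>*" if v: "v \<in> V" for v
  proof (cases "c v = q")
    case True
    then show ?thesis using q1 v by (simp add: cls_def)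
  next
    case False
    obtain u where u: "u \<in> cls q" "E v u" using neighbour_in_cls[OF v pk(2) False] by auto
    then have "(v, u) \<in> ?R" using v by (simp add: cls_def)
    then show ?thesis using q1[OF u(1)] by (rule converse_rtrancl_into_rtrancl)
  qed
  have "(y, v) \<in> ?R\<^sup>*" if "v \<in> V" for v
    using to_y[OF that] sym_rtrancl[OF sym_R] by (auto dest: symD)
  then show ?thesis unfolding connected_on_def using to_y by (meson rtrancl_trans)
qed

text \<open>A vertex in a class of size 2 sees some but not all halves of a larger class; two such
  halves with different behaviour are nonadjacent to each other.\<close>

lemma induced_nonadjacency:
  assumes "quints \<noteq> {} \<or> octs \<noteq> {}" "pairs \<noteq> {}"
  obtains u v w where "u \<in> V" "v \<in> V" "w \<in> V" "\<not> E u v" "\<not> E v w" "E u w"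
proof -
  obtain q where q: "q \<in> pairs" using assms by auto
  obtain w w' where w: "cls q = {w, w'}" "w \<noteq> w'" using pair_cls[OF q] .
  obtain i where i: "i \<in> quints \<or> i \<in> octs" using assms by auto
  then have ik: "i < k" "i \<noteq> q" using q by (auto simp: quints_def octs_def pairs_def)
  have "card (halves i) > 0" using i quint_card(1)[of i] oct_card(1)[of i] by auto
  moreover have bal: "2 * card {h \<in> halves i. E h w} = card (halves i)"
    by (rule halves_balanced[OF q _ ik]) (simp add: w)
  ultimately have lt: "card {h \<in> halves i. E h w} > 0" "card {h \<in> halves i. E h w} \<noteq> card (halves i)" by linarith+
  have "{h \<in> halves i. E h w} \<noteq> {}" using lt(1) unfolding card_gt_0_iff ..
  moreover have "{h \<in> halves i. E h w} \<noteq> halves i" using lt(2) by (intro notI) (simp only:)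
  ultimately
  obtain u v where uv: "u \<in> halves i" "E u w" "v \<in> halves i" "\<not> E v w" by blast
  have "w \<in> V" using w by (auto simp: cls_def)
  moreover have "\<not> E u v" using same_class halvesD[OF uv(1)] halvesD[OF uv(3)] by simp
  ultimately show thesis using that uv halvesD(1) by blast
qed

end

text \<open>An order different from 2k means that some class is larger than 2, which excludes the
  trivial graph with all parts of size 2.\<close>

lemma small_hoffman_graph_half_system:
  assumes G: "Digraph.graph G" and sys: "half_system (verts G) (edge G) k c x" and k: "3 \<le> k"
    and small: "card (verts G) < 3 * k" and "card (verts G) \<noteq> 2 * k"
  shows "small_hoffman_graph G"
proof -
  interpret half_system "verts G" "edge G" k c x by fact
  have nt: "quints \<noteq> {} \<or> octs \<noteq> {}"
    using assms(5) k_eq card_V_eq by auto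
  have p2: "2 \<le> card pairs"
    using small k k_eq card_V_eq by linarith
  then have ne: "pairs \<noteq> {}" by auto
  obtain u v w where "u \<in> verts G" "v \<in> verts G" "w \<in> verts G"
    "\<not> edge G u v" "\<not> edge G v w" "edge G u w"
    using induced_nonadjacency[OF nt ne] by metis
  then show ?thesis
    by (rule small_hoffman_graphI[OF G hoffman_system_axioms k connected_two_pairs[OF p2] small])
qed

section \<open>Recognition of the trivial Hoffman colorable graphs\<close>

lemma balanced_multipartite_iso:
  assumes G: "Digraph.graph G" and g: "bij_betw g (verts G) ({..<r} \<times> {..<m})"
    and e: "\<And>u v. u \<in> verts G \<Longrightarrow> v \<in> verts G \<Longrightarrow> edge G u v \<longleftrightarrow> fst (g u) \<noteq> fst (g v)"
  shows "digraph_iso G (with_proj (balanced_multipartite r m))"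
proof (rule digraph_isoI[OF G])
  show "Digraph.graph (with_proj (balanced_multipartite r m))"
    by (rule graph_with_projI) (auto simp: balanced_multipartite_def sym_def)
  show "rel_iso (verts G) (edge G) (verts (with_proj (balanced_multipartite r m)))
     (edge (with_proj (balanced_multipartite r m)))"
    unfolding rel_iso_def
  proof (intro exI[of _ g] conjI ballI)
    show "bij_betw g (verts G) (verts (with_proj (balanced_multipartite r m)))"
      using g by (simp add: balanced_multipartite_def)
    fix u v assume uv: "u \<in> verts G" "v \<in> verts G"
    then have "g u \<in> {..<r} \<times> {..<m}" "g v \<in> {..<r} \<times> {..<m}" using bij_betw_apply[OF g] by auto
    then show "edge G u v \<longleftrightarrow> edge (with_proj (balanced_multipartite r m)) (g u) (g v)"
      using e[OF uv] by (auto simp: balanced_multipartite_def)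
  qed
qed

lemma complete_graph_iso:
  assumes G: "Digraph.graph G" and e: "\<And>u v. u \<in> verts G \<Longrightarrow> v \<in> verts G \<Longrightarrow> u \<noteq> v \<Longrightarrow> edge G u v"
  shows "digraph_iso G (with_proj (balanced_multipartite (card (verts G)) 1))"
proof -
  obtain f where f: "bij_betw f (verts G) {0..<card (verts G)}"
    using ex_bij_betw_finite_nat graph_edge(1)[OF G] by metis
  have "bij_betw (\<lambda>v. (f v, 0 :: nat)) (verts G) ({..<card (verts G)} \<times> {..<1})"
    using f by (auto simp: bij_betw_def inj_on_def image_iff atLeast0LessThan)
  then show ?thesis
  proof (rule balanced_multipartite_iso[OF G])
    show "edge G u v \<longleftrightarrow> fst (f u, 0 :: nat) \<noteq> fst (f v, 0 :: nat)" if "u \<in> verts G" "v \<in> verts G" for u v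
      using e[OF that] graph_edge(3)[OF G] f that by (cases "u = v") (auto simp: bij_betw_def inj_on_eq_iff)
  qed
qed

lemma (in half_system) cocktail_party:
  assumes "quints = {}" "octs = {}"
  obtains g where "bij_betw g V ({..<k} \<times> {..<2 :: nat})"
    "\<And>u v. u \<in> V \<Longrightarrow> v \<in> V \<Longrightarrow> E u v \<longleftrightarrow> fst (g u) \<noteq> fst (g v)"
proof -
  have all: "i \<in> pairs" if i: "i < k" for i
    using class_cases[OF i] assms i unfolding pairs_def quints_def octs_def by blast
  have "\<exists>f. bij_betw f (cls i) {..<2 :: nat}" if "i < k" for i
  proof -
    have "card (cls i) = card {..<2 :: nat}" using all[OF that] by (simp add: pairs_def)
    then show ?thesis using fin_cls by (intro finite_same_card_bij) auto
  qed
  then obtain f where f: "\<And>i. i < k \<Longrightarrow> bij_betw (f i) (cls i) {..<2 :: nat}" by metis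
  define g where "g v = (c v, f (c v) v)" for v
  have "bij_betw g V ({..<k} \<times> {..<2})"
  proof (rule bij_betw_imageI)
    show "inj_on g V"
    proof (rule inj_onI)
      fix u v assume uv: "u \<in> V" "v \<in> V" "g u = g v"
      then have "c u = c v" "f (c u) u = f (c u) v" by (auto simp: g_def)
      moreover have "u \<in> cls (c u)" "v \<in> cls (c u)" using uv calculation by (auto simp: cls_def)
      ultimately show "u = v" using f[OF col[OF uv(1)]] by (auto simp: bij_betw_def inj_on_eq_iff)
    qed
    show "g ` V = {..<k} \<times> {..<2}"
    proof
      show "g ` V \<subseteq> {..<k} \<times> {..<2}"
      proof
        fix p assume "p \<in> g ` V"
        then obtain v where v: "v \<in> V" "p = g v" by auto
        have "f (c v) v \<in> {..<2}" using bij_betw_apply[OF f[OF col[OF v(1)]]] v by (simp add: cls_def)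
        then show "p \<in> {..<k} \<times> {..<2}" using v col by (simp add: g_def)
      qed
      show "{..<k} \<times> {..<2} \<subseteq> g ` V"
      proof
        fix p :: "nat \<times> nat" assume p: "p \<in> {..<k} \<times> {..<2}"
        obtain i s where ip: "p = (i, s)" "i < k" "s < 2" using p by auto
        then have "s \<in> f i ` cls i" using f[OF ip(2)] by (simp add: bij_betw_def)
        then obtain v where "v \<in> cls i" "s = f i v" by auto
        then have "v \<in> V" "p = g v" using ip by (auto simp: cls_def g_def)
        then show "p \<in> g ` V" by simp
      qed
    qed
  qed
  moreover have "E u v \<longleftrightarrow> fst (g u) \<noteq> fst (g v)" if uv: "u \<in> V" "v \<in> V" for u v
  proof (cases "c u = c v")
    case True
    then show ?thesis using same_class uv by (simp add: g_def)
  next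
    case False
    have "u \<in> cls (c u)" "v \<in> cls (c v)" using uv by (auto simp: cls_def)
    then have "E u v"
      using one_adj_pair(1)[OF all[OF col[OF uv(2)]] uv(1) False pair_ones[OF all[OF col[OF uv(1)]]]] by simp
    then show ?thesis using False by (simp add: g_def)
  qed
  ultimately show thesis by (rule that)
qed

lemma optimal_coloring_exists:
  assumes "Digraph.graph G" obtains c where "proper_coloring G (chromatic_number G) c"
proof -
  obtain f where f: "bij_betw f (verts G) {0..<card (verts G)}"
    using ex_bij_betw_finite_nat graph_edge(1)[OF assms] by metis
  have "proper_coloring G (card (verts G)) f"
    unfolding proper_coloring_def
  proof (intro conjI allI impI)
    show "f ` verts G \<subseteq> {..<card (verts G)}" using f by (auto simp: bij_betw_def)
    fix u v assume "edge G u v"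
    then have "u \<in> verts G" "v \<in> verts G" "u \<noteq> v" using graph_edge[OF assms] by auto
    then show "f u \<noteq> f v" using f by (auto simp: bij_betw_def inj_on_eq_iff)
  qed
  then have "\<exists>k. \<exists>c. proper_coloring G k c" by blast
  then have "\<exists>c. proper_coloring G (LEAST k. \<exists>c. proper_coloring G k c) c" by (rule LeastI_ex)
  then show thesis using that unfolding chromatic_number_def by blast
qed

text \<open>The coloring is arbitrary, so the structure is available for every optimal coloring and
  thereby for every chromatic component.\<close>

lemma small_hoffman_system:
  assumes "small_hoffman_graph G" and c: "proper_coloring G (chromatic_number G) c"
  shows "(\<exists>x. half_system (verts G) (edge G) (chromatic_number G) c x)
    \<or> chromatic_number G = 3 \<and> rel_iso (verts G) (edge G) (pverts F_graph) (edge (with_proj F_graph))"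
proof -
  have G: "Digraph.graph G" "Digraph_Component.connected G" "hoffman_colorable G"
    and nb: "\<not> bipartite G" and nm: "\<And>r m. \<not> digraph_iso G (with_proj (balanced_multipartite r m))"
    and small: "card (verts G) < 3 * chromatic_number G"
    using assms by (auto simp: small_hoffman_graph_def nontrivially_hoffman_colorable_def)
  have k: "3 \<le> chromatic_number G"
  proof (rule ccontr)
    assume "\<not> ?thesis"
    then have "proper_coloring G 2 c" using c by (auto simp: proper_coloring_def)
    then show False using nb by (auto simp: bipartite_def)
  qed
  obtain x \<theta> where "hoffman_system (verts G) (edge G) (chromatic_number G) c x \<theta>"
    using hoffman_colorable_system[OF G c] by blast
  then interpret hoffman_system "verts G" "edge G" "chromatic_number G" c x \<theta> .
  have con: "connected_on (verts G) (edge G)" using connected_edge[OF G(1)] G(2) by blast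
  have nc: "\<exists>u\<in>verts G. \<exists>v\<in>verts G. u \<noteq> v \<and> \<not> edge G u v"
    using complete_graph_iso[OF G(1)] nm by blast
  show ?thesis
    by (rule small_system_cases[OF k small con nc]) blast+
qed

theorem small_hoffman_classification:
  assumes "small_hoffman_graph G"
  shows "rel_iso (verts G) (edge G) (pverts F_graph) (edge (with_proj F_graph))
    \<or> m10_model (verts G) (edge G) \<or> fano_model {1..7} {0..7} (verts G) (edge G)
    \<or> fano_model {1, 2, 3, 5, 6, 7} {0..7} (verts G) (edge G)
    \<or> (\<exists>P\<in>{{1, 2, 3}, {1, 5, 2}, {1, 5, 2, 3}, {1, 5, 2, 6}, {1, 5, 2, 6, 3}, {1, 5, 2, 6, 3, 7}}.
      fano_model P {0, 1, 2, 3, 8} (verts G) (edge G))"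
proof -
  have G: "Digraph.graph G" and nm: "\<And>r m. \<not> digraph_iso G (with_proj (balanced_multipartite r m))"
    and small: "card (verts G) < 3 * chromatic_number G"
    using assms by (auto simp: small_hoffman_graph_def nontrivially_hoffman_colorable_def)
  obtain c where c: "proper_coloring G (chromatic_number G) c" using optimal_coloring_exists[OF G] .
  from small_hoffman_system[OF assms c] show ?thesis
  proof
    assume "\<exists>x. half_system (verts G) (edge G) (chromatic_number G) c x"
    then obtain x where "half_system (verts G) (edge G) (chromatic_number G) c x" ..
    then interpret half_system "verts G" "edge G" "chromatic_number G" c x .
    have "quints \<noteq> {} \<or> octs \<noteq> {}"
    proof (rule ccontr)
      assume "\<not> ?thesis"
      then have "quints = {}" "octs = {}" by auto
      from cocktail_party[OF this] obtain g where
        "bij_betw g (verts G) ({..<chromatic_number G} \<times> {..<2 :: nat})"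
        "\<And>u v. u \<in> verts G \<Longrightarrow> v \<in> verts G \<Longrightarrow> edge G u v \<longleftrightarrow> fst (g u) \<noteq> fst (g v)" by metis
      then show False using balanced_multipartite_iso[OF G] nm by blast
    qed
    from half_classification[OF small this] show ?thesis by (elim disjE) simp_all
  qed simp
qed

section \<open>Chromatic components as restricted systems\<close>

lemma psd_on_cong:
  assumes "\<And>u v. u \<in> V \<Longrightarrow> v \<in> V \<Longrightarrow> M u v = N u v" shows "psd_on V M \<longleftrightarrow> psd_on V N"
  unfolding psd_on_def using qform_cong[of V M N] assms by metis

text \<open>The edge relation of an induced subgraph is cut down to its vertices, whereas a
  restricted system keeps \<open>E\<close>; only the values on \<open>V\<close> count.\<close>

lemma half_system_cong:
  assumes "half_system V E k c x" and eq: "\<And>u v. u \<in> V \<Longrightarrow> v \<in> V \<Longrightarrow> F u v \<longleftrightarrow> E u v"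
    and outside: "\<And>u v. F u v \<Longrightarrow> u \<in> V \<and> v \<in> V"
  shows "half_system V F k c x"
proof -
  interpret half_system V E k c x by fact
  interpret F: hoffman_system V F k c x 2
  proof
    show "psd_on V (\<lambda>u v. adj F u v + diag 2 u v)"
      using psd by (subst psd_on_cong[of V _ "\<lambda>u v. adj E u v + diag 2 u v"]) (simp_all add: eq)
    show "(\<Sum>u | u \<in> V \<and> c u = i \<and> F v u. x u) = 2 * x v" if "v \<in> V" "i < k" "c v \<noteq> i" for v i
    proof -
      have "{u. u \<in> V \<and> c u = i \<and> F v u} = {u. u \<in> V \<and> c u = i \<and> E v u}" using eq[OF that(1)] by auto
      then show ?thesis using regular[OF that] by simp
    qed
    show "F v u" if "F u v" for u v using outside[OF that] that eq sym by blast
    show "\<not> F u u" for u using outside[of u u] eq irr by blast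
  qed (use fin ne pos col proper eq in auto)
  show ?thesis
  proof
    show "x v = 1 \<or> x v = 1 / 2" if "v \<in> V" for v using weight[OF that] .
    show "(\<Sum>v\<in>F.cls i. (x v)\<^sup>2) = 2" if "i < k" for i
      using norm[OF that] unfolding F.cls_def cls_def .
  qed
qed

text \<open>A union of m classes has order 2m + 3s, where s counts classes of size 5 once and
  classes of size 8 twice; s = 2 for all eight classes. The listed orders are those of proper
  components with 0 < 3s < m, which is both smallness and the presence of a class larger than
  2.\<close>

theorem chromatic_component_small:
  assumes G: "small_hoffman_graph G" "card (verts G) = 22" "chromatic_number G = 8"
    and c: "proper_coloring G (chromatic_number G) c"
    and card: "card {v \<in> verts G. c v < m} \<in> {11, 13, 15, 17, 20}" and m: "m \<le> chromatic_number G"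
  shows "small_hoffman_graph (G \<restriction> {v \<in> verts G. c v < m})"
proof -
  let ?W = "{v \<in> verts G. c v < m}"
  have gr: "Digraph.graph G" using G(1) by (simp add: small_hoffman_graph_def)
  obtain x where "half_system (verts G) (edge G) (chromatic_number G) c x"
    using small_hoffman_system[OF G(1) c] G(3) by auto
  then interpret S: half_system "verts G" "edge G" "chromatic_number G" c x .
  have "?W \<noteq> {}"
  proof
    assume "?W = {}"
    then have "card ?W = 0" by (simp only: card.empty)
    then show False using card by simp
  qed
  then have m0: "m > 0" by auto
  interpret R: hoffman_system ?W "edge G" m c x 2 by (rule S.restrict[OF refl m0 m])
  have cls: "R.cls i = S.cls i" if "i < m" for i using that by (auto simp: R.cls_def S.cls_def)
  interpret R: half_system ?W "edge G" m c x
  proof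
    show "x v = 1 \<or> x v = 1 / 2" if "v \<in> ?W" for v using S.weight that by simp
    show "(\<Sum>v\<in>R.cls i. (x v)\<^sup>2) = 2" if "i < m" for i using S.norm[of i] cls[OF that] that m by simp
  qed
  have "R.quints \<subseteq> S.quints" "R.octs \<subseteq> S.octs"
    using cls m by (auto simp: R.quints_def S.quints_def R.octs_def S.octs_def)
  then have le: "card R.quints \<le> card S.quints" "card R.octs \<le> card S.octs"
    using S.fin_pairs by (simp_all add: card_mono)
  have S: "card S.quints + 2 * card S.octs = 2"
    using S.card_V_eq S.k_eq G(2,3) by linarith
  define s where "s = card R.quints + 2 * card R.octs"
  have s: "s = 0 \<or> s = 1 \<or> s = 2" using le S unfolding s_def by linarith
  have "a = 2 * l + 3 * (q + 2 * t)" if "a = 2 * p + 5 * q + 8 * t" "l = p + q + t" for a l p q t :: nat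
    using that by simp
  from this[OF R.card_V_eq R.k_eq] have cW: "card ?W = 2 * m + 3 * s" unfolding s_def .
  have small: "3 \<le> m \<and> card ?W < 3 * m \<and> card ?W \<noteq> 2 * m"
  proof -
    have "2 * m + 3 * s = 11 \<or> 2 * m + 3 * s = 13 \<or> 2 * m + 3 * s = 15 \<or> 2 * m + 3 * s = 17 \<or> 2 * m + 3 * s = 20"
      using card unfolding cW by simp
    moreover have "m \<le> 8" using m G(3) by simp
    ultimately show ?thesis unfolding cW using s by presburger
  qed
  have sub: "?W \<subseteq> verts G" by auto
  note GI = graph_induce[OF gr sub]
  have "half_system ?W (\<lambda>u v. edge G u v \<and> u \<in> ?W \<and> v \<in> ?W) m c x"
    by (rule half_system_cong[OF R.half_system_axioms]) auto
  then have "half_system (verts (G \<restriction> ?W)) (edge (G \<restriction> ?W)) m c x" unfolding GI(2) by simp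
  then show ?thesis
    by (rule small_hoffman_graph_half_system[OF GI(1)]) (use small in auto)
qed

section \<open>The concrete graphs\<close>

lemma model_edge_sym: "symp W \<Longrightarrow> symp (model_edge T W)"
  by (rule sympI, rename_tac u v, case_tac u; case_tac v) (auto dest: sympD)

lemma model_edge_irrefl: "(\<And>r. \<not> W r r) \<Longrightarrow> \<not> model_edge T W v v"
  by (cases v) auto

lemma m10_rest_edge_sym: "symp m10_rest_edge" and m10_rest_edge_irrefl: "\<not> m10_rest_edge r r"
  by (auto simp: symp_def m10_rest_edge_def m10_edges_def)

section \<open>Integer coordinates of the vectors\<close>

definition real_of_list :: "int list \<Rightarrow> real vec" where
  "real_of_list xs = vec_of_list (map real_of_int xs)"

definition dot :: "int list \<Rightarrow> int list \<Rightarrow> int" where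
  "dot xs ys = sum_list (map2 (*) xs ys)"

lemma dim_real_of_list [simp]: "dim_vec (real_of_list xs) = length xs"
  by (simp add: real_of_list_def)

lemma real_of_list_eqI:
  assumes "dim_vec v = length xs" "\<And>i. i < length xs \<Longrightarrow> v $ i = real_of_int (xs ! i)"
  shows "v = real_of_list xs"
  using assms by (intro eq_vecI) (auto simp: real_of_list_def vec_of_list_index)

lemma real_of_list_inject: "real_of_list xs = real_of_list ys \<longleftrightarrow> xs = ys"
proof
  assume "real_of_list xs = real_of_list ys"
  then have "list_of_vec (real_of_list xs) = list_of_vec (real_of_list ys)" by simp
  then have "map real_of_int xs = map real_of_int ys" unfolding real_of_list_def list_vec .
  moreover have "inj (map real_of_int)" by (intro inj_mapI injI) simp
  ultimately show "xs = ys" by (simp add: inj_eq)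
qed simp

lemma scalar_prod_real_of_list:
  assumes "length xs = length ys"
  shows "real_of_list xs \<bullet> real_of_list ys = (\<Sum>i<length xs. real_of_int (xs ! i) * real_of_int (ys ! i))"
    "dot xs ys = (\<Sum>i<length xs. xs ! i * ys ! i)"
proof -
  show "real_of_list xs \<bullet> real_of_list ys = (\<Sum>i<length xs. real_of_int (xs ! i) * real_of_int (ys ! i))"
    using assms by (simp add: scalar_prod_def real_of_list_def vec_of_list_index atLeast0LessThan)
  show "dot xs ys = (\<Sum>i<length xs. xs ! i * ys ! i)"
    using assms by (simp add: dot_def sum_list_sum_nth atLeast0LessThan)
qed

lemma scalar_prod_dot:
  "length xs = length ys \<Longrightarrow> real_of_list xs \<bullet> real_of_list ys = real_of_int (dot xs ys)"
  by (simp add: scalar_prod_real_of_list)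

definition av :: "nat \<Rightarrow> nat \<Rightarrow> int list" where
  "av i j = map (\<lambda>t. (if t = i then 2 else 0) + (if t = j then 2 else 0)) [1..<9]"
definition bv :: "nat \<Rightarrow> nat \<Rightarrow> int list" where
  "bv i j = map (\<lambda>t. 1 - (if t = i then 2 else 0) - (if t = j then 2 else 0)) [1..<9]"
definition cv :: "nat \<Rightarrow> nat \<Rightarrow> int list" where
  "cv i j = map (\<lambda>t. (if t = i then 2 else 0) - (if t = j then 2 else 0)) [1..<9]"
definition dv :: "nat \<Rightarrow> nat \<Rightarrow> nat \<Rightarrow> nat \<Rightarrow> int list" where
  "dv i j k l = map (\<lambda>t. 1 - (if t = i then 2 else 0) - (if t = j then 2 else 0)
     - (if t = k then 2 else 0) - (if t = l then 2 else 0)) [1..<9]"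
definition ev :: "int list" where "ev = replicate 8 1"

lemma bas_index:
  assumes "i \<in> {1..8}" "t < 8"
  shows "bas i $ t = (if Suc t = i then 1 else 0)"
  using assms by (auto simp: bas_def)

lemma vec_lists:
  assumes ij: "i \<in> {1..8}" "j \<in> {1..8}"
  shows "a_vec i j = real_of_list (av i j)" "b_vec i j = real_of_list (bv i j)"
    "c_vec i j = real_of_list (cv i j)"
    "k \<in> {1..8} \<Longrightarrow> l \<in> {1..8} \<Longrightarrow> d_vec i j k l = real_of_list (dv i j k l)"
proof -
  note idx = bas_index[OF ij(1)] bas_index[OF ij(2)]
  have dim: "dim_vec (bas i) = 8" for i by (simp add: bas_def)
  have nth: "map f [1..<9] ! t = f (Suc t)" if "t < 8" for f :: "nat \<Rightarrow> int" and t
    using that by (simp add: nth_upt)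
  have len: "length (map f [1..<9]) = 8" for f :: "nat \<Rightarrow> int" by simp
  show "a_vec i j = real_of_list (av i j)"
    unfolding av_def a_vec_def
  proof (rule real_of_list_eqI, unfold len)
    fix t :: nat assume t: "t < 8"
    show "(2 \<cdot>\<^sub>v bas i + 2 \<cdot>\<^sub>v bas j) $ t =
        real_of_int (map (\<lambda>t. (if t = i then 2 else 0) + (if t = j then 2 else 0)) [1..<9] ! t)"
      using t idx[OF t] unfolding nth[OF t] by (simp add: dim)
  qed (simp add: dim)
  show "b_vec i j = real_of_list (bv i j)"
    unfolding bv_def b_vec_def
  proof (rule real_of_list_eqI, unfold len)
    fix t :: nat assume t: "t < 8"
    show "(ones - 2 \<cdot>\<^sub>v bas i - 2 \<cdot>\<^sub>v bas j) $ t =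
        real_of_int (map (\<lambda>t. 1 - (if t = i then 2 else 0) - (if t = j then 2 else 0)) [1..<9] ! t)"
      using t idx[OF t] unfolding nth[OF t] by (simp add: dim ones_def)
  qed (simp add: dim ones_def)
  show "c_vec i j = real_of_list (cv i j)"
    unfolding cv_def c_vec_def
  proof (rule real_of_list_eqI, unfold len)
    fix t :: nat assume t: "t < 8"
    show "(2 \<cdot>\<^sub>v bas i - 2 \<cdot>\<^sub>v bas j) $ t =
        real_of_int (map (\<lambda>t. (if t = i then 2 else 0) - (if t = j then 2 else 0)) [1..<9] ! t)"
      using t idx[OF t] unfolding nth[OF t] by (simp add: dim)
  qed (simp add: dim)
  show "d_vec i j k l = real_of_list (dv i j k l)" if kl: "k \<in> {1..8}" "l \<in> {1..8}"
    unfolding dv_def d_vec_def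
  proof (rule real_of_list_eqI, unfold len)
    fix t :: nat assume t: "t < 8"
    show "(ones - 2 \<cdot>\<^sub>v bas i - 2 \<cdot>\<^sub>v bas j - 2 \<cdot>\<^sub>v bas k - 2 \<cdot>\<^sub>v bas l) $ t =
        real_of_int (map (\<lambda>t. 1 - (if t = i then 2 else 0) - (if t = j then 2 else 0)
          - (if t = k then 2 else 0) - (if t = l then 2 else 0)) [1..<9] ! t)"
      using t idx[OF t] bas_index[OF kl(1) t] bas_index[OF kl(2) t] unfolding nth[OF t] by (simp add: dim ones_def)
  qed (simp add: dim ones_def)
qed

lemma e_vec_list: "e_vec = real_of_list ev"
  by (rule real_of_list_eqI) (simp_all add: e_vec_def ones_def ev_def)

section \<open>Sign tables of M_21 and M_10 realised by vectors\<close>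

type_synonym model_vertex = "nat \<times> bool + nat"

text \<open>All vectors are twice roots of E8 and have squared length 8; the two vectors with the
  same label are orthogonal and form a class of size 2.\<close>

definition table21 :: "(model_vertex \<times> int list) list" where
  "table21 =
    [(Inl (1, True), ev), (Inl (1, False), dv 5 6 7 8), (Inl (2, True), av 1 3), (Inl (2, False), av 2 4),
     (Inl (3, True), bv 6 8), (Inl (3, False), bv 5 7), (Inl (4, True), av 1 2), (Inl (4, False), av 3 4),
     (Inl (5, True), bv 7 8), (Inl (5, False), bv 5 6), (Inl (6, True), av 1 4), (Inl (6, False), av 2 3),
     (Inl (7, True), bv 6 7), (Inl (7, False), bv 5 8), (Inr 0, av 1 5), (Inr 1, cv 1 5), (Inr 2, av 2 6),
     (Inr 3, cv 2 6), (Inr 4, av 3 7), (Inr 5, cv 3 7), (Inr 6, av 4 8), (Inr 7, cv 4 8)]"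

definition table10 :: "(model_vertex \<times> int list) list" where
  "table10 =
    [(Inl (1, True), ev), (Inl (1, False), dv 5 6 7 8), (Inl (2, True), bv 5 8), (Inl (2, False), bv 6 7),
     (Inl (3, True), bv 5 6), (Inl (3, False), bv 7 8), (Inl (4, True), bv 6 8), (Inl (4, False), bv 5 7),
     (Inl (5, True), av 3 4), (Inl (5, False), av 1 2), (Inr 0, av 4 7), (Inr 1, av 2 6), (Inr 2, cv 2 6),
     (Inr 3, cv 4 7), (Inr 4, av 4 8), (Inr 5, av 1 5), (Inr 6, cv 1 5), (Inr 7, cv 4 8),
     (Inr 8, av 1 3), (Inr 9, av 2 3)]"

text \<open>The Gram matrix of the vectors is four times A + 2I of the model. With integer lists
  this is decided by evaluation.\<close>

definition table_check :: "(nat \<Rightarrow> nat \<Rightarrow> bool \<Rightarrow> bool) \<Rightarrow> (nat \<Rightarrow> nat \<Rightarrow> bool) \<Rightarrow> (model_vertex \<times> int list) list \<Rightarrow> bool" where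
  "table_check T W t \<longleftrightarrow> distinct (map fst t) \<and>
     list_all (\<lambda>(u, a). length a = 8 \<and>
       list_all (\<lambda>(v, b). dot a b = (if u = v then 8 else if model_edge T W u v then 4 else 0)) t) t"

lemma table21_check: "table_check fano_table (\<lambda>_ _. False) table21"
  by code_simp

lemma table10_check: "table_check m10_table m10_rest_edge table10"
  by code_simp

lemma table_checkD:
  assumes "table_check T W t"
  shows "distinct (map fst t)" "\<And>u a. (u, a) \<in> set t \<Longrightarrow> length a = 8"
    "\<And>u a v b. (u, a) \<in> set t \<Longrightarrow> (v, b) \<in> set t \<Longrightarrow>
       dot a b = (if u = v then 8 else if model_edge T W u v then 4 else 0)"
  using assms unfolding table_check_def list_all_iff by fastforce+

text \<open>Different model vertices carry different vectors, because the value 8 occurs in the Gram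
  matrix only on the diagonal.\<close>

lemma table_iso:
  assumes check: "table_check T W t" and irrefl: "\<And>r. \<not> W r r"
    and S: "S = real_of_list ` set (map snd t)"
  shows "rel_iso S (edge (with_proj (Gamma S))) (set (map fst t)) (model_edge T W)"
    "Digraph.graph (with_proj (Gamma S))"
proof -
  note D = table_checkD[OF check]
  have inj: "a \<noteq> b" if "(u, a) \<in> set t" "(v, b) \<in> set t" "u \<noteq> v" for u a v b
    using D(3)[OF that(1,1)] D(3)[OF that(1,2)] that(3) by (auto split: if_splits)
  have dist: "distinct (map snd t)"
  proof -
    have "distinct t" using D(1) by (simp add: distinct_map)
    moreover have "inj_on snd (set t)"
    proof (rule inj_onI)
      fix p q assume p: "p \<in> set t" "q \<in> set t" "snd p = snd q"
      obtain u a v b where uv: "p = (u, a)" "q = (v, b)" by (cases p, cases q) blast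
      then have "u = v" using inj[of u a v b] p by auto
      then show "p = q" using p(3) uv by simp
    qed
    ultimately show ?thesis by (simp add: distinct_map)
  qed
  let ?ys = "map (real_of_list \<circ> snd) t"
  have "inj_on real_of_list A" for A by (rule inj_onI) (simp add: real_of_list_inject)
  then have disty: "distinct ?ys" using dist by (simp add: distinct_map comp_inj_on_iff[symmetric])
  have mem: "(map fst t ! i, map snd t ! i) \<in> set t" if "i < length t" for i using that by simp
  have "rel_iso (set (map fst t)) (model_edge T W) (set ?ys) (edge (with_proj (Gamma S)))"
  proof (rule rel_iso_listI[OF D(1) disty])
    show "length (map fst t) = length ?ys" by simp
    fix i j assume "i < length (map fst t)" "j < length (map fst t)"
    then have i: "i < length t" and j: "j < length t" by auto
    define a b where "a = map snd t ! i" and "b = map snd t ! j"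
    define u v where "u = map fst t ! i" and "v = map fst t ! j"
    have m: "(u, a) \<in> set t" "(v, b) \<in> set t" using mem[OF i] mem[OF j] by (simp_all add: a_def b_def u_def v_def)
    have "real_of_list a \<in> S" "real_of_list b \<in> S" unfolding S using m by force+
    moreover have "real_of_list a \<bullet> real_of_list b = real_of_int (dot a b)"
      using D(2)[OF m(1)] D(2)[OF m(2)] by (intro scalar_prod_dot) simp
    moreover have "a \<noteq> b" if "u \<noteq> v" using inj[OF m that] .
    ultimately have "model_edge T W u v \<longleftrightarrow> edge (with_proj (Gamma S)) (real_of_list a) (real_of_list b)"
      using D(3)[OF m] model_edge_irrefl[of W T u, OF irrefl]
      by (auto simp: Gamma_def real_of_list_inject split: if_splits)
    then show "model_edge T W (map fst t ! i) (map fst t ! j) \<longleftrightarrow> edge (with_proj (Gamma S)) (?ys ! i) (?ys ! j)"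
      using i j by (simp add: a_def b_def u_def v_def)
  qed
  moreover have "set ?ys = S" by (simp add: S image_comp)
  ultimately show "rel_iso S (edge (with_proj (Gamma S))) (set (map fst t)) (model_edge T W)"
    using rel_iso_sym by simp
  have dim: "v \<in> carrier_vec 8" if "v \<in> S" for v
    using that D(2) unfolding S by (auto intro!: carrier_vecI)
  show "Digraph.graph (with_proj (Gamma S))"
  proof (rule graph_with_projI)
    show "sym (parcs (Gamma S))"
    proof (rule symI)
      fix v w assume "(v, w) \<in> parcs (Gamma S)"
      then have vw: "v \<in> S" "w \<in> S" "v \<noteq> w" "v \<bullet> w = 4" by (auto simp: Gamma_def)
      then have "w \<bullet> v = 4" using comm_scalar_prod[OF dim dim, of v w] by simp
      then show "(w, v) \<in> parcs (Gamma S)" using vw by (simp add: Gamma_def)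
    qed
  qed (auto simp: Gamma_def S)
qed

text \<open>Halving the coordinates turns the Gram matrix into A + 2I itself.\<close>

lemma table_psd:
  assumes check: "table_check T W t" and irrefl: "\<And>r. \<not> W r r"
  shows "psd_on (set (map fst t)) (\<lambda>u v. adj (model_edge T W) u v + diag 2 u v)"
proof (rule psd_on_gram)
  note D = table_checkD[OF check]
  fix u v assume "u \<in> set (map fst t)" "v \<in> set (map fst t)"
  then obtain a b where m: "(u, a) \<in> set t" "(v, b) \<in> set t" by auto
  have of: "map_of t u = Some a" "map_of t v = Some b" using m D(1) by simp_all
  have "(\<Sum>i<8. real_of_int (a ! i) * real_of_int (b ! i)) = real_of_int (dot a b)"
    using scalar_prod_real_of_list(2)[of a b] D(2)[OF m(1)] D(2)[OF m(2)] by simp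
  then have "(\<Sum>i<8. (real_of_int (a ! i) / 2) * (real_of_int (b ! i) / 2)) = real_of_int (dot a b) / 4"
    by (simp flip: sum_divide_distrib)
  moreover have "adj (model_edge T W) u v + diag 2 u v = real_of_int (dot a b) / 4"
    using D(3)[OF m] model_edge_irrefl[of W T u, OF irrefl] by auto
  ultimately show "adj (model_edge T W) u v + diag 2 u v =
      (\<Sum>i<8. real_of_int (the (map_of t u) ! i) / 2 * (real_of_int (the (map_of t v) ! i) / 2))"
    unfolding of by simp
qed simp

lemma S21_table: "S21 = real_of_list ` set (map snd table21)"
  by (simp add: S21_def table21_def vec_lists e_vec_list) blast

lemma S10_table: "S10 = real_of_list ` set (map snd table10)"
  by (simp add: S10_def table10_def vec_lists e_vec_list) blast

lemma verts21: "set (map fst table21) = model_verts {1..7} {0..7}"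
proof -
  have "{1..7} = {1, 2, 3, 4, 5, 6, 7 :: nat}" "{0..7} = {0, 1, 2, 3, 4, 5, 6, 7 :: nat}" by auto
  then show ?thesis by (simp add: table21_def model_verts_def UNIV_bool insert_Times_insert) auto
qed

lemma verts10: "set (map fst table10) = model_verts {1..5} {..<10}"
proof -
  have "{1..5} = {1, 2, 3, 4, 5 :: nat}" "{..<10} = {0, 1, 2, 3, 4, 5, 6, 7, 8, 9 :: nat}" by auto
  then show ?thesis by (simp add: table10_def model_verts_def UNIV_bool insert_Times_insert) auto
qed

text \<open>Weights are doubled to stay in \<open>nat\<close>: 1 and 2 stand for 1/2 and 1, and the
  norm 2 of a class becomes 8.\<close>

definition system_check :: "'v list \<Rightarrow> ('v \<Rightarrow> 'v \<Rightarrow> bool) \<Rightarrow> nat \<Rightarrow> ('v \<Rightarrow> nat) \<Rightarrow> ('v \<Rightarrow> nat) \<Rightarrow> bool" where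
  "system_check vs E k c w \<longleftrightarrow> list_all (\<lambda>v. c v < k \<and> (w v = 1 \<or> w v = 2) \<and>
      list_all (\<lambda>u. E u v \<longrightarrow> c u \<noteq> c v) vs \<and>
      list_all (\<lambda>i. c v \<noteq> i \<longrightarrow> sum_list (map w (filter (\<lambda>u. c u = i \<and> E v u) vs)) = 2 * w v) [0..<k]) vs
    \<and> list_all (\<lambda>i. sum_list (map (\<lambda>v. w v * w v) (filter (\<lambda>v. c v = i) vs)) = 8) [0..<k]"

fun color21 :: "model_vertex \<Rightarrow> nat" where
  "color21 (Inl (m, s)) = m - 1" | "color21 (Inr r) = 7"
fun weight21 :: "model_vertex \<Rightarrow> nat" where
  "weight21 (Inl p) = 2" | "weight21 (Inr r) = 1"
fun color10 :: "model_vertex \<Rightarrow> nat" where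
  "color10 (Inl (m, s)) = m - 1" | "color10 (Inr r) = (if r \<le> 3 \<or> r = 8 then 5 else 6)"
fun weight10 :: "model_vertex \<Rightarrow> nat" where
  "weight10 (Inl p) = 2" | "weight10 (Inr r) = (if r \<ge> 8 then 2 else 1)"

lemma system21_check:
  "system_check (map fst table21) (model_edge fano_table (\<lambda>_ _. False)) 8 color21 weight21"
  by code_simp

lemma system10_check:
  "system_check (map fst table10) (model_edge m10_table m10_rest_edge) 7 color10 weight10"
  by code_simp

lemma sum_filter_list:
  assumes "distinct vs"
  shows "(\<Sum>u | u \<in> set vs \<and> P u. f u) = sum_list (map f (filter P vs))"
  using sum.distinct_set_conv_list[of "filter P vs" f] assms by simp

lemma half_system_of_list:
  assumes check: "system_check vs E k c w" and vs: "distinct vs" "vs \<noteq> []"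
    and psd: "psd_on (set vs) (\<lambda>u v. adj E u v + diag 2 u v)"
    and sym: "symp E" and irr: "\<And>v. \<not> E v v"
  shows "half_system (set vs) E k c (\<lambda>v. real (w v) / 2)"
proof -
  have D: "c v < k" "w v = 1 \<or> w v = 2" "\<And>u. u \<in> set vs \<Longrightarrow> E u v \<Longrightarrow> c u \<noteq> c v"
    "\<And>i. i < k \<Longrightarrow> c v \<noteq> i \<Longrightarrow> sum_list (map w (filter (\<lambda>u. c u = i \<and> E v u) vs)) = 2 * w v"
    if "v \<in> set vs" for v
    using check that unfolding system_check_def list_all_iff by auto
  have N: "sum_list (map (\<lambda>v. w v * w v) (filter (\<lambda>v. c v = i) vs)) = 8" if "i < k" for i
    using check that unfolding system_check_def list_all_iff by auto
  interpret hoffman_system "set vs" E k c "\<lambda>v. real (w v) / 2" 2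
  proof
    show "E v u" if "E u v" for u v using sympD[OF sym that] .
    show "0 < real (w v) / 2" if "v \<in> set vs" for v using D(2)[OF that] by auto
    show "c u \<noteq> c v" if "u \<in> set vs" "v \<in> set vs" "E u v" for u v using D(3)[OF that(2) that(1,3)] .
    show "(\<Sum>u | u \<in> set vs \<and> c u = i \<and> E v u. real (w u) / 2) = 2 * (real (w v) / 2)"
      if "v \<in> set vs" "i < k" "c v \<noteq> i" for v i
    proof -
      have "(\<Sum>u | u \<in> set vs \<and> c u = i \<and> E v u. real (w u) / 2) = real (\<Sum>u | u \<in> set vs \<and> c u = i \<and> E v u. w u) / 2"
        by (simp flip: sum_divide_distrib)
      also have "(\<Sum>u | u \<in> set vs \<and> c u = i \<and> E v u. w u) = 2 * w v"
        using D(4)[OF that] by (simp only: sum_filter_list[OF vs(1)])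
      finally show ?thesis by simp
    qed
  qed (use vs psd irr D in auto)
  show ?thesis
  proof
    show "real (w v) / 2 = 1 \<or> real (w v) / 2 = 1 / 2" if "v \<in> set vs" for v using D(2)[OF that] by auto
    show "(\<Sum>v\<in>cls i. (real (w v) / 2)\<^sup>2) = 2" if "i < k" for i
    proof -
      have "(\<Sum>v\<in>cls i. (real (w v) / 2)\<^sup>2) = real (\<Sum>v\<in>cls i. w v * w v) / 4"
        by (simp add: power2_eq_square flip: sum_divide_distrib)
      also have "(\<Sum>v\<in>cls i. w v * w v) = 8"
        using N[OF that] unfolding cls_def by (simp only: sum_filter_list[OF vs(1)])
      finally show ?thesis by simp
    qed
  qed
qed

lemma half_system_pullback:
  fixes V :: "'a set" and W :: "'b set"
  assumes W: "half_system W F k c x" and f: "bij_betw f V W"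
    and E: "\<And>u v. u \<in> V \<Longrightarrow> v \<in> V \<Longrightarrow> E u v \<longleftrightarrow> F (f u) (f v)"
    and sym: "\<And>u v. E u v \<Longrightarrow> E v u" and irr: "\<And>v. \<not> E v v"
  shows "half_system V E k (c \<circ> f) (x \<circ> f)"
proof -
  interpret W: half_system W F k c x by fact
  have fV: "f v \<in> W" if "v \<in> V" for v using bij_betw_apply[OF f that] .
  have inj: "inj_on f V" using f by (simp add: bij_betw_def)
  have reindex: "(\<Sum>v | v \<in> V \<and> P (f v). g (f v)) = (\<Sum>w | w \<in> W \<and> P w. g w)" for P and g :: "'b \<Rightarrow> real"
  proof (rule sum.reindex_bij_betw)
    show "bij_betw f {v. v \<in> V \<and> P (f v)} {w. w \<in> W \<and> P w}"
      using f unfolding bij_betw_def by (auto simp: inj_on_def)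
  qed
  interpret V: hoffman_system V E k "c \<circ> f" "x \<circ> f" 2
  proof
    show "psd_on V (\<lambda>u v. adj E u v + diag 2 u v)"
      unfolding psd_on_def
    proof
      fix y :: "'a \<Rightarrow> real"
      define z where "z = y \<circ> the_inv_into V f"
      have z: "z (f v) = y v" if "v \<in> V" for v using that inj by (simp add: z_def the_inv_into_f_f)
      let ?M = "\<lambda>u v. adj F u v + diag 2 u v"
      have "0 \<le> qform W ?M z" using W.psd by (simp add: psd_on_def)
      also have "qform W ?M z = (\<Sum>u\<in>V. \<Sum>v\<in>V. ?M (f u) (f v) * z (f u) * z (f v))"
      proof -
        have "(\<Sum>w\<in>W. g w) = (\<Sum>v\<in>V. g (f v))" for g :: "'b \<Rightarrow> real"
          by (rule sum.reindex_bij_betw[OF f, symmetric])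
        then show ?thesis by (simp only: qform_def)
      qed
      also have "\<dots> = qform V (\<lambda>u v. adj E u v + diag 2 u v) y"
        unfolding qform_def by (intro sum.cong refl) (use inj in \<open>simp add: E z inj_on_eq_iff\<close>)
      finally show "0 \<le> qform V (\<lambda>u v. adj E u v + diag 2 u v) y" .
    qed
    show "finite V" using f W.fin bij_betw_finite by blast
    show "V \<noteq> {}" using f W.ne by (auto simp: bij_betw_def)
    show "(\<Sum>u | u \<in> V \<and> (c \<circ> f) u = i \<and> E v u. (x \<circ> f) u) = 2 * (x \<circ> f) v"
      if v: "v \<in> V" "i < k" "(c \<circ> f) v \<noteq> i" for v i
    proof -
      have "{u. u \<in> V \<and> (c \<circ> f) u = i \<and> E v u} = {u. u \<in> V \<and> (c (f u) = i \<and> F (f v) (f u))}"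
        using E v by auto
      then have "(\<Sum>u | u \<in> V \<and> (c \<circ> f) u = i \<and> E v u. (x \<circ> f) u) =
         (\<Sum>u | u \<in> V \<and> (c (f u) = i \<and> F (f v) (f u)). x (f u))" by simp
      also have "\<dots> = (\<Sum>w | w \<in> W \<and> (c w = i \<and> F (f v) w). x w)"
        by (rule reindex[where P = "\<lambda>w. c w = i \<and> F (f v) w" and g = x])
      also have "\<dots> = 2 * (x \<circ> f) v" using W.regular[OF fV[OF v(1)] v(2)] v(3) by simp
      finally show ?thesis .
    qed
    show "E v u" if "E u v" for u v using sym[OF that] .
  qed (use irr W.pos W.col fV W.proper E in auto)
  show ?thesis
  proof
    show "(x \<circ> f) v = 1 \<or> (x \<circ> f) v = 1 / 2" if "v \<in> V" for v using W.weight[OF fV[OF that]] by simp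
    show "(\<Sum>v\<in>V.cls i. ((x \<circ> f) v)\<^sup>2) = 2" if "i < k" for i
      using W.norm[OF that] reindex[where P = "\<lambda>w. c w = i" and g = "\<lambda>w. (x w)\<^sup>2"]
      unfolding V.cls_def W.cls_def by simp
  qed
qed

lemma Gamma_small:
  assumes check: "table_check T W t" "system_check (map fst t) (model_edge T W) k c w"
    and W: "symp W" "\<And>r. \<not> W r r" and S: "S = real_of_list ` set (map snd t)"
    and k: "3 \<le> k" "length t < 3 * k" "length t \<noteq> 2 * k"
  shows "small_hoffman_graph (with_proj (Gamma S))" "chromatic_number (with_proj (Gamma S)) = k"
    "card S = length t"
proof -
  note iso = table_iso[OF check(1) W(2) S] and ge = graph_edge[OF table_iso(2)[OF check(1) W(2) S]]
  have dist: "distinct (map fst t)" by (rule table_checkD(1)[OF check(1)])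
  have "map fst t \<noteq> []" using check(2) k(1) by (force simp: system_check_def list_all_iff)
  then have sys: "half_system (set (map fst t)) (model_edge T W) k c (\<lambda>v. real (w v) / 2)"
    using half_system_of_list[OF check(2) dist _ table_psd[OF check(1) W(2)] model_edge_sym[OF W(1)]
        model_edge_irrefl[of W, OF W(2)]] by blast
  obtain f where f: "bij_betw f S (set (map fst t))"
    "\<And>u v. u \<in> S \<Longrightarrow> v \<in> S \<Longrightarrow> edge (with_proj (Gamma S)) u v \<longleftrightarrow> model_edge T W (f u) (f v)"
    using iso(1) by (auto simp: rel_iso_def)
  have vS: "verts (with_proj (Gamma S)) = S" by (simp add: Gamma_def)
  have "half_system S (edge (with_proj (Gamma S))) k (c \<circ> f) ((\<lambda>v. real (w v) / 2) \<circ> f)"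
    by (rule half_system_pullback[OF sys f ge(2,3)])
  then have sys': "half_system (verts (with_proj (Gamma S))) (edge (with_proj (Gamma S))) k (c \<circ> f) ((\<lambda>v. real (w v) / 2) \<circ> f)"
    unfolding vS .
  show card: "card S = length t"
    using bij_betw_same_card[OF f(1)] distinct_card[OF dist] by simp
  show "small_hoffman_graph (with_proj (Gamma S))"
    by (rule small_hoffman_graph_half_system[OF iso(2) sys']) (use k card vS in auto)
  show "chromatic_number (with_proj (Gamma S)) = k"
    using hoffman_system_colorable(2)[OF iso(2) half_system.axioms(1)[OF sys']] k by simp
qed

lemma M21_small: "small_hoffman_graph (with_proj M21)" "chromatic_number (with_proj M21) = 8" "card S21 = 22"
proof -
  note * = Gamma_small[OF table21_check system21_check _ _ S21_table]
  show "small_hoffman_graph (with_proj M21)" unfolding M21_def by (rule *) (auto simp: symp_def table21_def)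
  show "chromatic_number (with_proj M21) = 8" unfolding M21_def by (rule *) (auto simp: symp_def table21_def)
  have "card S21 = length table21" by (rule *) (auto simp: symp_def table21_def)
  then show "card S21 = 22" by (simp add: table21_def)
qed

lemma M10_small: "small_hoffman_graph (with_proj M10)"
  unfolding M10_def
  by (rule Gamma_small[OF table10_check system10_check m10_rest_edge_sym m10_rest_edge_irrefl S10_table])
    (auto simp: table10_def)

lemma M21_model: "fano_model {1..7} {0..7} S21 (edge (with_proj M21))"
  unfolding M21_def verts21[symmetric]
  by (rule table_iso(1)[OF table21_check _ S21_table]) simp

lemma M10_model: "m10_model S10 (edge (with_proj M10))"
  unfolding M10_def verts10[symmetric]
  by (rule table_iso(1)[OF table10_check m10_rest_edge_irrefl S10_table])

lemma M21_graph: "Digraph.graph (with_proj M21)" "pverts M21 = S21"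
  using M21_small(1) by (simp_all add: small_hoffman_graph_def M21_def Gamma_def)

section \<open>The graph F\<close>

lemma F_psd:
  fixes \<phi> :: real assumes \<phi>: "\<phi>\<^sup>2 = \<phi> + 1" "0 < \<phi>"
  shows "psd_on {1, 2, 3, 4, 5, 6 :: nat} (\<lambda>u v. adj (edge (with_proj F_graph)) u v + diag \<phi> u v)"
  unfolding psd_on_def
proof
  fix y :: "nat \<Rightarrow> real"
  have s: "\<phi> * \<phi> = \<phi> + 1" "\<And>z. \<phi> * (\<phi> * z) = \<phi> * z + z"
    using \<phi> by (simp_all add: power2_eq_square flip: mult.assoc) (simp_all add: algebra_simps)
  have "\<phi> \<le> 2"
  proof (rule ccontr)
    assume "\<not> \<phi> \<le> 2"
    then have "2 * \<phi> < \<phi> * \<phi>" using \<phi>(2) by (intro mult_strict_right_mono) auto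
    then show False using s(1) \<open>\<not> \<phi> \<le> 2\<close> by linarith
  qed
  have "1 \<le> \<phi>"
  proof (rule ccontr)
    assume "\<not> 1 \<le> \<phi>"
    then have "\<phi> * \<phi> \<le> 1 * \<phi>" using \<phi>(2) by (intro mult_right_mono) auto
    then show False using s(1) \<phi>(2) by linarith
  qed
  let ?q = "qform {1, 2, 3, 4, 5, 6 :: nat} (\<lambda>u v. adj (edge (with_proj F_graph)) u v + diag \<phi> u v) y"
  \<comment> \<open>In each of the classes {3, 4}, {2, 5}, {1, 6} the coordinates are taken along
    the weights (\<phi>, 1) and the orthogonal direction (1, - \<phi>). Both have squared length
    \<phi> + 2, the factor in the identity below.\<close>
  define a1 a2 a3 where "a1 = \<phi> * y 4 + y 3" and "a2 = \<phi> * y 5 + y 2" and "a3 = \<phi> * y 6 + y 1"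
  define b1 b2 b3 where "b1 = y 4 - \<phi> * y 3" and "b2 = y 5 - \<phi> * y 2" and "b3 = y 6 - \<phi> * y 1"
  have q: "?q = \<phi> * (y 1 * y 1 + y 2 * y 2 + y 3 * y 3 + y 4 * y 4 + y 5 * y 5 + y 6 * y 6)
     + 2 * (y 4 * y 5 + y 4 * y 6 + y 5 * y 6 + y 1 * y 4 + y 1 * y 5 + y 2 * y 4 + y 2 * y 6 + y 3 * y 5 + y 3 * y 6)"
  proof -
    let ?M = "\<lambda>u v. adj (edge (with_proj F_graph)) u v + diag \<phi> u v"
    have rows: "(\<Sum>v\<in>{1, 2, 3, 4, 5, 6}. ?M 1 v * y v) = \<phi> * y 1 + y 4 + y 5"
      "(\<Sum>v\<in>{1, 2, 3, 4, 5, 6}. ?M 2 v * y v) = \<phi> * y 2 + y 4 + y 6"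
      "(\<Sum>v\<in>{1, 2, 3, 4, 5, 6}. ?M 3 v * y v) = \<phi> * y 3 + y 5 + y 6"
      "(\<Sum>v\<in>{1, 2, 3, 4, 5, 6}. ?M 4 v * y v) = y 1 + y 2 + \<phi> * y 4 + y 5 + y 6"
      "(\<Sum>v\<in>{1, 2, 3, 4, 5, 6}. ?M 5 v * y v) = y 1 + y 3 + y 4 + \<phi> * y 5 + y 6"
      "(\<Sum>v\<in>{1, 2, 3, 4, 5, 6}. ?M 6 v * y v) = y 2 + y 3 + y 4 + y 5 + \<phi> * y 6"
      by (simp_all add: F_graph_def F_edges_def)
    have "?q = y 1 * (\<Sum>v\<in>{1, 2, 3, 4, 5, 6}. ?M 1 v * y v) + y 2 * (\<Sum>v\<in>{1, 2, 3, 4, 5, 6}. ?M 2 v * y v)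
       + y 3 * (\<Sum>v\<in>{1, 2, 3, 4, 5, 6}. ?M 3 v * y v) + y 4 * (\<Sum>v\<in>{1, 2, 3, 4, 5, 6}. ?M 4 v * y v)
       + y 5 * (\<Sum>v\<in>{1, 2, 3, 4, 5, 6}. ?M 5 v * y v) + y 6 * (\<Sum>v\<in>{1, 2, 3, 4, 5, 6}. ?M 6 v * y v)"
    proof -
      have six: "(\<Sum>u\<in>{1, 2, 3, 4, 5, 6 :: nat}. f u) = f 1 + f 2 + f 3 + f 4 + f 5 + f 6" for f :: "nat \<Rightarrow> real"
        by simp
      show ?thesis unfolding qform_alt by (rule six)
    qed
    then show ?thesis unfolding rows by (simp add: algebra_simps)
  qed
  \<comment> \<open>Sum of squares along the eigenvectors of the quotient by the coloring.\<close>
  have "(\<phi> + 2) * ?q = \<phi> * (a1 + a2 + a3)\<^sup>2 + (\<phi> - 1) * ((b1 - b2)\<^sup>2 + (b1 - b3)\<^sup>2 + (b2 - b3)\<^sup>2)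
      + (2 - \<phi>) * (b1\<^sup>2 + b2\<^sup>2 + b3\<^sup>2)"
    unfolding q a1_def a2_def a3_def b1_def b2_def b3_def power2_eq_square
    by (simp add: algebra_simps s)
  also have "\<dots> \<ge> 0" using \<phi>(2) \<open>\<phi> \<le> 2\<close> \<open>1 \<le> \<phi>\<close> by simp
  finally show "0 \<le> ?q" using \<phi>(2) by (simp add: zero_le_mult_iff)
qed

lemma F_small: "small_hoffman_graph (with_proj F_graph)"
proof -
  let ?F = "with_proj F_graph"
  define \<phi> where "\<phi> = (1 + sqrt 5) / 2"
  have \<phi>: "\<phi>\<^sup>2 = \<phi> + 1" "0 < \<phi>" by (simp_all add: \<phi>_def power2_eq_square field_simps add_pos_pos)
  have s: "\<phi> * \<phi> = \<phi> + 1" using \<phi> by (simp add: power2_eq_square)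
  have V: "pverts F_graph = {1, 2, 3, 4, 5, 6}" by (auto simp: F_graph_def)
  have G: "Digraph.graph ?F"
    by (rule graph_with_projI) (auto simp: F_graph_def F_edges_def sym_def)
  \<comment> \<open>Each triangle vertex shares its color with the one outer vertex that it does not
    see.\<close>
  define c :: "nat \<Rightarrow> nat" where "c v = (if v = 1 \<or> v = 6 then 0 else if v = 2 \<or> v = 5 then 1 else 2)" for v
  define x where "x v = (if v \<ge> 4 then \<phi> else 1)" for v :: nat
  have E: "(u, v) \<in> parcs F_graph \<longleftrightarrow> (u, v) \<in> F_edges \<or> (v, u) \<in> F_edges" for u v
    by (auto simp: F_graph_def)
  have sys: "hoffman_system (verts ?F) (edge ?F) 3 c x \<phi>"
  proof
    show "psd_on (verts ?F) (\<lambda>u v. adj (edge ?F) u v + diag \<phi> u v)"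
      using F_psd[OF \<phi>] by (simp add: V)
    show "(\<Sum>u | u \<in> verts ?F \<and> c u = i \<and> edge ?F v u. x u) = \<phi> * x v" if "v \<in> verts ?F" "i < 3" "c v \<noteq> i" for v i
    proof -
      have "(\<Sum>u | u \<in> verts ?F \<and> c u = i \<and> edge ?F v u. x u) =
         (\<Sum>u\<in>{1, 2, 3, 4, 5, 6}. if c u = i \<and> edge ?F v u then x u else 0)"
        unfolding with_proj_simps(1) V by (subst sum.inter_filter[symmetric]) auto
      also have "\<dots> = \<phi> * x v"
      proof -
        have "v \<in> {1, 2, 3, 4, 5, 6}" "i \<in> {0, 1, 2}" using that V by auto
        then show ?thesis using \<open>c v \<noteq> i\<close> s
          by (elim insertE emptyE; simp add: E F_edges_def c_def x_def)
      qed
      finally show ?thesis .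
    qed
    show "c u \<noteq> c v" if "edge ?F u v" for u v
      using that by (auto simp: E F_edges_def c_def)
    show "edge ?F v u" if "edge ?F u v" for u v using that by (auto simp: E)
    show "\<not> edge ?F u u" for u by (auto simp: E F_edges_def)
  qed (use \<phi> in \<open>auto simp: V c_def x_def\<close>)
  have con: "connected_on (verts ?F) (edge ?F)"
  proof -
    let ?R = "{(a, b). a \<in> verts ?F \<and> b \<in> verts ?F \<and> edge ?F a b}"
    have r4: "(v, 4) \<in> ?R\<^sup>* \<and> (4, v) \<in> ?R\<^sup>*" if "v \<in> verts ?F" for v
    proof -
      have e: "(1, 4) \<in> ?R" "(2, 4) \<in> ?R" "(5, 4) \<in> ?R" "(6, 4) \<in> ?R" "(3, 5) \<in> ?R"
        "(4, 1) \<in> ?R" "(4, 2) \<in> ?R" "(4, 5) \<in> ?R" "(4, 6) \<in> ?R" "(5, 3) \<in> ?R"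
        by (auto simp: V E F_edges_def)
      have "(3, 4) \<in> ?R\<^sup>*" "(4, 3) \<in> ?R\<^sup>*" using e by (meson r_into_rtrancl rtrancl_trans)+
      moreover have "v \<in> {1, 2, 3, 4, 5, 6}" using that V by simp
      ultimately show ?thesis using e by (elim insertE emptyE) (auto intro: r_into_rtrancl)
    qed
    then show ?thesis unfolding connected_on_def by (meson rtrancl_trans)
  qed
  show ?thesis
    by (rule small_hoffman_graphI[OF G sys _ con, where u = 2 and v = 1 and w = 6])
      (auto simp: V E F_edges_def)
qed

section \<open>Transport along isomorphisms\<close>

lemma rel_iso_restrict:
  assumes f: "bij_betw f V W" "\<And>u v. u \<in> V \<Longrightarrow> v \<in> V \<Longrightarrow> E u v \<longleftrightarrow> F (f u) (f v)"
  shows "rel_iso {v \<in> V. P (f v)} E {w \<in> W. P w} F"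
proof -
  have "bij_betw f {v \<in> V. P (f v)} {w \<in> W. P w}"
    using f(1) unfolding bij_betw_def by (auto simp: inj_on_def)
  then show ?thesis unfolding rel_iso_def using f(2) by blast
qed

lemma rel_iso_eigvals:
  assumes "rel_iso V E W F" shows "eigvals W F \<subseteq> eigvals V E"
proof
  fix \<mu> assume "\<mu> \<in> eigvals W F"
  then obtain g w where g: "\<And>v. v \<in> W \<Longrightarrow> (\<Sum>u\<in>W. adj F v u * g u) = \<mu> * g v" and w: "w \<in> W" "g w \<noteq> 0"
    unfolding eigvals_def by blast
  obtain f where f: "bij_betw f V W" "\<And>u v. u \<in> V \<Longrightarrow> v \<in> V \<Longrightarrow> E u v \<longleftrightarrow> F (f u) (f v)"
    using assms by (auto simp: rel_iso_def)
  obtain v where v: "v \<in> V" "w = f v" using f(1) w by (auto simp: bij_betw_def)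
  show "\<mu> \<in> eigvals V E"
  proof (rule eigvalsI[of v V "g \<circ> f"])
    show "(g \<circ> f) v \<noteq> 0" using v w by simp
    fix v assume v: "v \<in> V"
    have "(\<Sum>u\<in>V. adj E v u * (g \<circ> f) u) = (\<Sum>u\<in>V. adj F (f v) (f u) * g (f u))"
      by (intro sum.cong refl) (simp add: f(2) v)
    also have "\<dots> = (\<Sum>u\<in>W. adj F (f v) u * g u)" by (rule sum.reindex_bij_betw[OF f(1)])
    also have "\<dots> = \<mu> * (g \<circ> f) v" using g bij_betw_apply[OF f(1) v] by simp
    finally show "(\<Sum>u\<in>V. adj E v u * (g \<circ> f) u) = \<mu> * (g \<circ> f) v" .
  qed (rule v(1))
qed

lemma rel_iso_coloring:
  assumes "rel_iso (verts G) (edge G) (verts H) (edge H)" "Digraph.graph G" "proper_coloring H k c"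
  shows "\<exists>c. proper_coloring G k c"
proof -
  obtain f where f: "bij_betw f (verts G) (verts H)"
    "\<And>u v. u \<in> verts G \<Longrightarrow> v \<in> verts G \<Longrightarrow> edge G u v \<longleftrightarrow> edge H (f u) (f v)"
    using assms(1) by (auto simp: rel_iso_def)
  have "proper_coloring G k (c \<circ> f)"
    unfolding proper_coloring_def
  proof (intro conjI allI impI)
    show "(c \<circ> f) ` verts G \<subseteq> {..<k}"
    proof
      fix i assume "i \<in> (c \<circ> f) ` verts G"
      then obtain v where v: "v \<in> verts G" "i = c (f v)" by auto
      have "f v \<in> verts H" using bij_betw_apply[OF f(1) v(1)] .
      then show "i \<in> {..<k}" using assms(3) v(2) by (auto simp: proper_coloring_def)
    qed
    fix u v assume uv: "edge G u v"
    then have "u \<in> verts G" "v \<in> verts G" using graph_edge(4,5)[OF assms(2)] by auto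
    then have "edge H (f u) (f v)" using f(2) uv by simp
    then show "(c \<circ> f) u \<noteq> (c \<circ> f) v" using assms(3) by (simp add: proper_coloring_def)
  qed
  then show ?thesis by blast
qed

text \<open>Spectrum, colorings, order and connectedness are transported one by one, since the two
  graphs may have different types of vertices and arcs.\<close>

lemma small_hoffman_graph_iso:
  assumes iso: "digraph_iso H K" and K: "small_hoffman_graph K"
  shows "small_hoffman_graph H"
proof -
  have gK: "Digraph.graph K" using K by (simp add: small_hoffman_graph_def)
  have gH: "Digraph.graph H" by (rule digraph_iso_graph_left[OF iso gK])
  have r: "rel_iso (verts H) (edge H) (verts K) (edge K)" using iso digraph_iso_iff[OF gH gK] by simp
  note r' = rel_iso_sym[OF r]
  have iso': "digraph_iso K H" by (rule digraph_isoI[OF gK gH r'])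
  have eig: "adjacency_eigenvalues H = adjacency_eigenvalues K"
    using rel_iso_eigvals[OF r] rel_iso_eigvals[OF r'] graph_edge(1)[OF gH] graph_edge(1)[OF gK]
    by (simp add: adjacency_eigenvalues_eq(1) subset_antisym)
  have col: "(\<exists>c. proper_coloring H k c) \<longleftrightarrow> (\<exists>c. proper_coloring K k c)" for k
    using rel_iso_coloring[OF r gH] rel_iso_coloring[OF r' gK] by blast
  have chi: "chromatic_number H = chromatic_number K" by (simp add: chromatic_number_def col)
  have card: "card (verts H) = card (verts K)" using r by (auto simp: rel_iso_def bij_betw_same_card)
  have arcs: "arcs H = {} \<longleftrightarrow> arcs K = {}"
    using iso by (auto simp: digraph_iso_def)
  obtain h where h: "pre_digraph.digraph_isomorphism K h" "H = app_iso h K"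
    using iso' by (auto simp: digraph_iso_def)
  have "wf_digraph K" using h(1) by (simp add: pre_digraph.digraph_isomorphism_def)
  then have con: "Digraph_Component.connected H"
    using K h wf_digraph.connectedI_app_iso by (auto simp: small_hoffman_graph_def)
  have multi: "\<not> digraph_iso H (with_proj (balanced_multipartite p m))" for p m
    using K digraph_iso_trans[OF iso'] by (auto simp: small_hoffman_graph_def nontrivially_hoffman_colorable_def)
  show ?thesis
    using K gH con multi unfolding small_hoffman_graph_def nontrivially_hoffman_colorable_def hoffman_colorable_def
      hoffman_bound_def lambda_max_def lambda_min_def bipartite_def eig col chi card arcs by simp
qed

text \<open>Graphs on vectors and graphs on numbers are to appear in one list; the copies give them
  the same type.\<close>

lemma nat_copy:
  assumes G: "Digraph.graph G"
  obtains N :: "nat pair_pre_digraph" where "Digraph.graph (with_proj N)" "digraph_iso (with_proj N) G"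
proof -
  obtain f where f: "bij_betw f {0..<card (verts G)} (verts G)"
    using ex_bij_betw_nat_finite graph_edge(1)[OF G] by metis
  define N where "N = \<lparr>pverts = {0..<card (verts G)},
    parcs = {(i, j). i < card (verts G) \<and> j < card (verts G) \<and> edge G (f i) (f j)}\<rparr>"
  have gN: "Digraph.graph (with_proj N)"
    by (rule graph_with_projI) (auto simp: N_def sym_def graph_edge(3)[OF G] intro: graph_edge(2)[OF G])
  have "rel_iso (verts (with_proj N)) (edge (with_proj N)) (verts G) (edge G)"
    unfolding rel_iso_def using f by (intro exI[of _ f]) (auto simp: N_def)
  then have "digraph_iso (with_proj N) G" by (rule digraph_isoI[OF gN G])
  then show thesis using gN that by blast
qed

section \<open>Chromatic components of $M_{21}$\<close>

text \<open>
  Colorings of the sign model of $M_{21}$. With \<open>True\<close> the two vertices labelled 4 are separated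
  and each forms a class with four rows; with \<open>False\<close> the eight rows form a class.
\<close>

fun comp_color :: "nat list \<Rightarrow> bool \<Rightarrow> model_vertex \<Rightarrow> nat" where
  "comp_color ns split (Inl (q, s)) = (if split \<and> q = 4 \<and> \<not> s then 0 else ns ! q)"
| "comp_color ns split (Inr r) = (if split \<and> r \<ge> 4 then 7 else 0)"

definition coloring_check :: "'v list \<Rightarrow> ('v \<Rightarrow> 'v \<Rightarrow> bool) \<Rightarrow> nat \<Rightarrow> ('v \<Rightarrow> nat) \<Rightarrow> bool" where
  "coloring_check vs E k c \<longleftrightarrow> list_all (\<lambda>v. c v < k \<and> list_all (\<lambda>u. E u v \<longrightarrow> c u \<noteq> c v) vs) vs"

abbreviation fano_edge :: "model_vertex \<Rightarrow> model_vertex \<Rightarrow> bool" where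
  "fano_edge \<equiv> model_edge fano_table (\<lambda>_ _. False)"

text \<open>Labels of classes of size 2 start at 1, so entry 0 is a placeholder. Label 4 comes last
  in both orders; \<open>order2\<close> takes the columns m and m + 4 in succession, which yields
  the partitions 210 and 220.\<close>

abbreviation order1 :: "nat list" where "order1 \<equiv> [0, 1, 2, 3, 7, 4, 5, 6]"
abbreviation order2 :: "nat list" where "order2 \<equiv> [0, 1, 3, 5, 7, 2, 4, 6]"

lemma coloring_checks:
  "coloring_check (map fst table21) fano_edge 8 (comp_color order1 True)"
  "coloring_check (map fst table21) fano_edge 8 (comp_color order2 True)"
  "coloring_check (map fst table21) fano_edge 8 (comp_color order1 False)"
  by code_simp+

text \<open>The vertex \<open>Inl (4, False)\<close> sees none of the rows 0 to 3 and shares their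
  color. In the component it is the vertex of weight 1 of a class of size 5, and so it is renamed to
  row 8.\<close>

lemma quint_component_model:
  assumes "ns ! 4 = 7" "0 < m" "m \<le> 7" and P: "P = {q \<in> {1, 2, 3, 5, 6, 7}. ns ! q < m}"
  shows "rel_iso {v \<in> model_verts {1..7} {0..7}. comp_color ns True v < m} fano_edge
    (model_verts P {0, 1, 2, 3, 8}) fano_edge"
proof -
  define A :: "model_vertex set" where "A = Inl ` (P \<times> UNIV) \<union> {Inl (4, False)} \<union> Inr ` {0, 1, 2, 3}"
  have seven: "{1..7} = {1, 2, 3, 4, 5, 6, 7 :: nat}" "{0..7} = {0, 1, 2, 3, 4, 5, 6, 7 :: nat}" by auto
  have P4: "4 \<notin> P" using P by simp
  have mem: "v \<in> A \<longleftrightarrow> v \<in> model_verts {1..7} {0..7} \<and> comp_color ns True v < m" for v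
  proof (cases v)
    case (Inl p)
    obtain q s where p: "p = (q, s)" by (cases p)
    show ?thesis
    proof (cases "q = 4")
      case True
      then show ?thesis using assms(1-3) P4 by (auto simp: Inl p A_def model_verts_def)
    next
      case False
      then have "q \<in> {1..7} \<longleftrightarrow> q \<in> {1, 2, 3, 5, 6, 7}" unfolding seven by blast
      then show ?thesis using False by (auto simp: Inl p A_def model_verts_def P)
    qed
  next
    case (Inr r)
    show ?thesis using assms(2,3) by (auto simp: Inr A_def model_verts_def)
  qed
  then have A: "{v \<in> model_verts {1..7} {0..7}. comp_color ns True v < m} = A" by blast
  define h :: "model_vertex \<Rightarrow> model_vertex" where
    "h v = (if v = Inl (4, False) then Inr 8 else v)" for v
  have "inj_on h A" by (auto simp: inj_on_def h_def A_def)
  moreover have "h ` A = model_verts P {0, 1, 2, 3, 8}"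
  proof -
    have "h ` (Inl ` (P \<times> UNIV)) = Inl ` (P \<times> UNIV)" "h ` Inr ` {0, 1, 2, 3} = Inr ` {0, 1, 2, 3}"
      using P4 by (force simp: h_def image_iff)+
    then show ?thesis unfolding A_def image_Un by (auto simp: h_def model_verts_def)
  qed
  ultimately have bij: "bij_betw h A (model_verts P {0, 1, 2, 3, 8})" by (simp add: bij_betw_def)
  have special: "fano_edge (Inl (4, False)) v \<longleftrightarrow> fano_edge (Inr 8) v"
    "fano_edge v (Inl (4, False)) \<longleftrightarrow> fano_edge v (Inr 8)" if "v \<in> A" "v \<noteq> Inl (4, False)" for v
  proof -
    have "(\<exists>q s. v = Inl (q, s) \<and> q \<noteq> 4) \<or> v \<in> {Inr 0, Inr 1, Inr 2, Inr 3}"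
      using that P4 by (auto simp: A_def)
    then show "fano_edge (Inl (4, False)) v \<longleftrightarrow> fano_edge (Inr 8) v"
      "fano_edge v (Inl (4, False)) \<longleftrightarrow> fano_edge v (Inr 8)"
      by (auto simp: fano_table_def parity_even_def)
  qed
  have "fano_edge u v \<longleftrightarrow> fano_edge (h u) (h v)" if "u \<in> A" "v \<in> A" for u v
    using special[OF that(1)] special[OF that(2)] by (cases "u = Inl (4, False)"; cases "v = Inl (4, False)") (simp_all add: h_def)
  then show ?thesis unfolding A rel_iso_def using bij by blast
qed

lemma oct_component_model:
  assumes "0 < m" and P: "P = {q \<in> {1, 2, 3, 4, 5, 6, 7}. ns ! q < m}"
  shows "rel_iso {v \<in> model_verts {1..7} {0..7}. comp_color ns False v < m} fano_edge
    (model_verts P {0..7}) fano_edge"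
proof -
  have seven: "{1..7} = {1, 2, 3, 4, 5, 6, 7 :: nat}" by auto
  have mem: "v \<in> model_verts {1..7} {0..7} \<and> comp_color ns False v < m \<longleftrightarrow> v \<in> model_verts P {0..7}" for v
  proof (cases v)
    case (Inl p)
    obtain q s where p: "p = (q, s)" by (cases p)
    have "v \<in> model_verts A R \<longleftrightarrow> q \<in> A" for A R by (auto simp: Inl p model_verts_def)
    then show ?thesis unfolding seven P by (simp add: Inl p)
  next
    case (Inr r)
    have "v \<in> model_verts A R \<longleftrightarrow> r \<in> R" for A R by (auto simp: Inr model_verts_def)
    then show ?thesis using assms(1) by (simp add: Inr)
  qed
  have "{v \<in> model_verts {1..7} {0..7}. comp_color ns False v < m} = model_verts P {0..7}"
    using mem by blast
  then show ?thesis unfolding rel_iso_def by (intro exI[of _ id]) simp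
qed

text \<open>A coloring verified on the sign model is pulled back to M_21; its first m classes then
  induce the component with the given model.\<close>

lemma M21_component:
  assumes check: "coloring_check (map fst table21) fano_edge 8 \<gamma>" and m: "2 \<le> m" "m \<le> 8"
    and iso: "rel_iso {v \<in> model_verts {1..7} {0..7}. \<gamma> v < m} fano_edge (model_verts P R) fano_edge"
  shows "\<exists>N :: nat pair_pre_digraph. Digraph.graph (with_proj N) \<and>
    chromatic_component (with_proj N) (with_proj M21) \<and> fano_model P R (pverts N) (edge (with_proj N))"
proof -
  let ?M = "model_verts {1..7} {0..7}"
  obtain f where f: "bij_betw f S21 ?M"
    "\<And>u v. u \<in> S21 \<Longrightarrow> v \<in> S21 \<Longrightarrow> edge (with_proj M21) u v \<longleftrightarrow> fano_edge (f u) (f v)"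
    using M21_model by (auto simp: rel_iso_def)
  have colM: "\<gamma> v < 8" "\<And>u. u \<in> ?M \<Longrightarrow> fano_edge u v \<Longrightarrow> \<gamma> u \<noteq> \<gamma> v" if "v \<in> ?M" for v
    using check that unfolding coloring_check_def list_all_iff verts21[symmetric] by auto
  have fM: "f v \<in> ?M" if "v \<in> S21" for v using bij_betw_apply[OF f(1) that] .
  note vM = M21_graph(2)
  let ?c = "\<gamma> \<circ> f"
  have c: "proper_coloring (with_proj M21) (chromatic_number (with_proj M21)) ?c"
    unfolding proper_coloring_def M21_small(2)
  proof (intro conjI allI impI)
    show "?c ` verts (with_proj M21) \<subseteq> {..<8}" using colM(1) fM by (auto simp: vM)
    fix u v assume e: "edge (with_proj M21) u v"
    then have uv: "u \<in> S21" "v \<in> S21" using graph_edge(4,5)[OF M21_graph(1)] vM by auto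
    then have "fano_edge (f u) (f v)" using e f(2) by blast
    then show "?c u \<noteq> ?c v" using colM(2)[OF fM[OF uv(2)] fM[OF uv(1)]] by simp
  qed
  let ?W = "{v \<in> verts (with_proj M21). ?c v < m}"
  have W: "?W = {v \<in> S21. \<gamma> (f v) < m}" by (simp add: vM)
  have sub: "?W \<subseteq> verts (with_proj M21)" by auto
  note GI = graph_induce[OF M21_graph(1) sub]
  obtain N :: "nat pair_pre_digraph" where N: "Digraph.graph (with_proj N)" "digraph_iso (with_proj N) (with_proj M21 \<restriction> ?W)"
    using nat_copy[OF GI(1)] .
  have "rel_iso ?W (edge (with_proj M21)) {v \<in> ?M. \<gamma> v < m} fano_edge"
    unfolding W by (rule rel_iso_restrict[of f S21, OF f(1)]) (rule f(2))
  then have "fano_model P R ?W (edge (with_proj M21))" using iso by (rule rel_iso_trans)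
  then have "fano_model P R (verts (with_proj M21 \<restriction> ?W)) (edge (with_proj M21 \<restriction> ?W))"
    unfolding GI(2) rel_iso_def by simp
  moreover have "rel_iso (verts (with_proj N)) (edge (with_proj N)) (verts (with_proj M21 \<restriction> ?W)) (edge (with_proj M21 \<restriction> ?W))"
    using N digraph_iso_iff[OF N(1) GI(1)] by blast
  ultimately have "fano_model P R (pverts N) (edge (with_proj N))"
    using rel_iso_trans by fastforce
  moreover have "chromatic_component (with_proj N) (with_proj M21)"
    unfolding chromatic_component_def m_chromatic_component_def M21_small(2)
    using m c[unfolded M21_small(2)] N(2) by blast
  ultimately show ?thesis using N(1) by blast
qed

definition components :: "(nat set \<times> nat set) list" where
  "components = [({1, 2, 3}, {0, 1, 2, 3, 8}), ({1, 5, 2}, {0, 1, 2, 3, 8}), ({1, 5, 2, 3}, {0, 1, 2, 3, 8}),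
     ({1, 5, 2, 6}, {0, 1, 2, 3, 8}), ({1, 5, 2, 6, 3}, {0, 1, 2, 3, 8}), ({1, 5, 2, 6, 3, 7}, {0, 1, 2, 3, 8}),
     ({1, 2, 3, 5, 6, 7}, {0..7})]"

lemma components_exist:
  assumes "(P, R) \<in> set components"
  shows "\<exists>N :: nat pair_pre_digraph. Digraph.graph (with_proj N) \<and>
    chromatic_component (with_proj N) (with_proj M21) \<and> fano_model P R (pverts N) (edge (with_proj N))"
proof -
  have "(P, R) = ({1, 2, 3}, {0, 1, 2, 3, 8})
    \<or> (P, R) = ({1, 5, 2}, {0, 1, 2, 3, 8})
    \<or> (P, R) = ({1, 5, 2, 3}, {0, 1, 2, 3, 8})
    \<or> (P, R) = ({1, 5, 2, 6}, {0, 1, 2, 3, 8})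
    \<or> (P, R) = ({1, 5, 2, 6, 3}, {0, 1, 2, 3, 8})
    \<or> (P, R) = ({1, 5, 2, 6, 3, 7}, {0, 1, 2, 3, 8})
    \<or> (P, R) = ({1, 2, 3, 5, 6, 7}, {0..7})"
    using assms by (simp only: components_def list.set insert_iff empty_iff simp_thms)
  then show ?thesis
  proof (elim disjE)
    assume "(P, R) = ({1, 2, 3}, {0, 1, 2, 3, 8})"
    then have PR: "P = {1, 2, 3}" "R = {0, 1, 2, 3, 8}" by (metis fst_conv, metis snd_conv)
    show ?thesis unfolding PR
      by (rule M21_component[OF coloring_checks(1), where m = 4], simp, simp, rule quint_component_model) auto
  next
    assume "(P, R) = ({1, 5, 2}, {0, 1, 2, 3, 8})"
    then have PR: "P = {1, 5, 2}" "R = {0, 1, 2, 3, 8}" by (metis fst_conv, metis snd_conv)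
    show ?thesis unfolding PR
      by (rule M21_component[OF coloring_checks(2), where m = 4], simp, simp, rule quint_component_model) auto
  next
    assume "(P, R) = ({1, 5, 2, 3}, {0, 1, 2, 3, 8})"
    then have PR: "P = {1, 5, 2, 3}" "R = {0, 1, 2, 3, 8}" by (metis fst_conv, metis snd_conv)
    show ?thesis unfolding PR
      by (rule M21_component[OF coloring_checks(1), where m = 5], simp, simp, rule quint_component_model) auto
  next
    assume "(P, R) = ({1, 5, 2, 6}, {0, 1, 2, 3, 8})"
    then have PR: "P = {1, 5, 2, 6}" "R = {0, 1, 2, 3, 8}" by (metis fst_conv, metis snd_conv)
    show ?thesis unfolding PR
      by (rule M21_component[OF coloring_checks(2), where m = 5], simp, simp, rule quint_component_model) auto
  next
    assume "(P, R) = ({1, 5, 2, 6, 3}, {0, 1, 2, 3, 8})"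
    then have PR: "P = {1, 5, 2, 6, 3}" "R = {0, 1, 2, 3, 8}" by (metis fst_conv, metis snd_conv)
    show ?thesis unfolding PR
      by (rule M21_component[OF coloring_checks(1), where m = 6], simp, simp, rule quint_component_model) auto
  next
    assume "(P, R) = ({1, 5, 2, 6, 3, 7}, {0, 1, 2, 3, 8})"
    then have PR: "P = {1, 5, 2, 6, 3, 7}" "R = {0, 1, 2, 3, 8}" by (metis fst_conv, metis snd_conv)
    show ?thesis unfolding PR
      by (rule M21_component[OF coloring_checks(1), where m = 7], simp, simp, rule quint_component_model) auto
  next
    assume "(P, R) = ({1, 2, 3, 5, 6, 7}, {0..7})"
    then have PR: "P = {1, 2, 3, 5, 6, 7}" "R = {0..7}" by (metis fst_conv, metis snd_conv)
    show ?thesis unfolding PR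
      by (rule M21_component[OF coloring_checks(3), where m = 7], simp, simp, rule oct_component_model) auto
  qed
qed

lemma card_model_verts:
  assumes "finite P" "finite R" shows "card (model_verts P R) = 2 * card P + card R"
proof -
  have "card (model_verts P R) = card (Inl ` (P \<times> (UNIV :: bool set)) :: model_vertex set) + card (Inr ` R :: model_vertex set)"
    unfolding model_verts_def by (rule card_Un_disjoint) (use assms in auto)
  then show ?thesis using assms by (simp add: card_image card_cartesian_product)
qed

lemma fano_model_card:
  assumes "fano_model P R V E" "finite P" "finite R" shows "card V = 2 * card P + card R"
proof -
  have "card V = card (model_verts P R)" using assms(1) by (auto simp: rel_iso_def bij_betw_same_card)
  then show ?thesis using card_model_verts assms by simp
qed

section \<open>Isomorphism invariants\<close>

text \<open>Two vertices without a common neighbour distinguish the two components of order 11 and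
  the two of order 13.\<close>

definition separated_pair :: "'a set \<Rightarrow> ('a \<Rightarrow> 'a \<Rightarrow> bool) \<Rightarrow> bool" where
  "separated_pair V E \<longleftrightarrow> (\<exists>u\<in>V. \<exists>v\<in>V. u \<noteq> v \<and> (\<forall>w\<in>V. \<not> (E u w \<and> E v w)))"

text \<open>Degree 13 tells M_10 from the component of M_21 that also has 20 vertices.\<close>

definition has_degree :: "nat \<Rightarrow> 'a set \<Rightarrow> ('a \<Rightarrow> 'a \<Rightarrow> bool) \<Rightarrow> bool" where
  "has_degree d V E \<longleftrightarrow> (\<exists>v\<in>V. card {u \<in> V. E v u} = d)"

lemma separated_pair_iso:
  assumes "rel_iso V E W F" "separated_pair V E" shows "separated_pair W F"
proof -
  obtain f where f: "bij_betw f V W" "\<And>u v. u \<in> V \<Longrightarrow> v \<in> V \<Longrightarrow> E u v \<longleftrightarrow> F (f u) (f v)"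
    using assms(1) by (auto simp: rel_iso_def)
  obtain u v where uv: "u \<in> V" "v \<in> V" "u \<noteq> v" "\<And>w. w \<in> V \<Longrightarrow> \<not> (E u w \<and> E v w)"
    using assms(2) by (auto simp: separated_pair_def)
  have "f u \<in> W" "f v \<in> W" using bij_betw_apply[OF f(1)] uv by auto
  moreover have "f u \<noteq> f v" using f(1) uv by (auto simp: bij_betw_def inj_on_eq_iff)
  moreover have "\<not> (F (f u) w \<and> F (f v) w)" if "w \<in> W" for w
  proof -
    obtain w' where "w' \<in> V" "w = f w'" using f(1) \<open>w \<in> W\<close> by (auto simp: bij_betw_def)
    then show ?thesis using uv f(2) by simp
  qed
  ultimately show ?thesis unfolding separated_pair_def by blast
qed

lemma has_degree_iso:
  assumes "rel_iso V E W F" "has_degree d V E" shows "has_degree d W F"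
proof -
  obtain f where f: "bij_betw f V W" "\<And>u v. u \<in> V \<Longrightarrow> v \<in> V \<Longrightarrow> E u v \<longleftrightarrow> F (f u) (f v)"
    using assms(1) by (auto simp: rel_iso_def)
  obtain v where v: "v \<in> V" "card {u \<in> V. E v u} = d" using assms(2) by (auto simp: has_degree_def)
  have "bij_betw f {u \<in> V. E v u} {w \<in> W. F (f v) w}"
    using f(1) f(2)[OF v(1)] unfolding bij_betw_def by (auto simp: inj_on_def)
  then have "card {w \<in> W. F (f v) w} = d" using v(2) by (simp add: bij_betw_same_card[symmetric])
  then show ?thesis using bij_betw_apply[OF f(1) v(1)] unfolding has_degree_def by blast
qed

text \<open>Without the columns 3 and 7, rows 0 and 3 have opposite signs everywhere.\<close>

lemma separated_pair_components:
  "separated_pair (model_verts {1, 5, 2} {0, 1, 2, 3, 8}) fano_edge"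
  "separated_pair (model_verts {1, 5, 2, 6} {0, 1, 2, 3, 8}) fano_edge"
  unfolding separated_pair_def
  by (rule bexI[of _ "Inr 0"], rule bexI[of _ "Inr 3"];
      auto simp: model_verts_def fano_table_def parity_even_def)+

definition model_list :: "nat list \<Rightarrow> nat list \<Rightarrow> model_vertex list" where
  "model_list ps rs = map (\<lambda>q. Inl (q, True)) ps @ map (\<lambda>q. Inl (q, False)) ps @ map Inr rs"

lemma set_model_list: "set (model_list ps rs) = model_verts (set ps) (set rs)"
  by (auto simp: model_list_def model_verts_def image_iff)

lemma no_separated_pair_components:
  "\<not> separated_pair (model_verts {1, 2, 3} {0, 1, 2, 3, 8}) fano_edge"
  "\<not> separated_pair (model_verts {1, 5, 2, 3} {0, 1, 2, 3, 8}) fano_edge"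
proof -
  have check: "\<not> separated_pair (set vs) fano_edge"
    if "list_all (\<lambda>u. list_all (\<lambda>v. u \<noteq> v \<longrightarrow> list_ex (\<lambda>w. fano_edge u w \<and> fano_edge v w) vs) vs) vs" for vs
    using that unfolding separated_pair_def list_all_iff list_ex_iff by blast
  have "\<not> separated_pair (set (model_list [1, 2, 3] [0, 1, 2, 3, 8])) fano_edge"
    by (rule check) code_simp
  then show "\<not> separated_pair (model_verts {1, 2, 3} {0, 1, 2, 3, 8}) fano_edge"
    unfolding set_model_list by simp
  have "\<not> separated_pair (set (model_list [1, 5, 2, 3] [0, 1, 2, 3, 8])) fano_edge"
    by (rule check) code_simp
  then show "\<not> separated_pair (model_verts {1, 5, 2, 3} {0, 1, 2, 3, 8}) fano_edge"
    unfolding set_model_list by simp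
qed

lemma card_filter_distinct:
  assumes "distinct vs" shows "card {u \<in> set vs. Q u} = length (filter Q vs)"
  using distinct_card[OF distinct_filter[OF assms, of Q]] by simp

text \<open>Row 8 sees all ten vertices of the classes of size 2 and three further rows.\<close>

lemma m10_degree: "has_degree 13 (model_verts {1..5} {..<10}) (model_edge m10_table m10_rest_edge)"
proof -
  let ?E = "model_edge m10_table m10_rest_edge"
  have "length (filter (?E (Inr 8)) (map fst table10)) = 13" by code_simp
  moreover have "distinct (map fst table10)" by (rule table_checkD(1)[OF table10_check])
  then have "card {u \<in> set (map fst table10). ?E (Inr 8) u} = length (filter (?E (Inr 8)) (map fst table10))"
    by (rule card_filter_distinct)
  ultimately have "card {u \<in> model_verts {1..5} {..<10}. ?E (Inr 8) u} = 13" unfolding verts10 by simp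
  moreover have "Inr 8 \<in> model_verts {1..5} {..<10}" by (simp add: model_verts_def)
  ultimately show ?thesis unfolding has_degree_def by blast
qed

text \<open>A row has one neighbour in each of the seven classes of size 2; a vertex of such a class
  sees the 12 vertices of the other six and four of the eight rows.\<close>

lemma M21_degrees:
  assumes "has_degree d S21 (edge (with_proj M21))" shows "d = 7 \<or> d = 16"
proof -
  have "has_degree d (set (map fst table21)) fano_edge"
    unfolding verts21 by (rule has_degree_iso[OF M21_model assms])
  then obtain v where v: "v \<in> set (map fst table21)" "card {u \<in> set (map fst table21). fano_edge v u} = d"
    unfolding has_degree_def by blast
  have "distinct (map fst table21)" by (rule table_checkD(1)[OF table21_check])
  then have "card {u \<in> set (map fst table21). fano_edge v u} = length (filter (fano_edge v) (map fst table21))"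
    by (rule card_filter_distinct)
  moreover have "list_all (\<lambda>v. length (filter (fano_edge v) (map fst table21)) \<in> {7, 16}) (map fst table21)"
    by code_simp
  ultimately show ?thesis using v by (auto simp: list_all_iff)
qed

text \<open>Removing two vertices lowers each degree by at most 2, and 13 is not in reach of 7 or 16.\<close>

lemma component_degree:
  assumes "W \<subseteq> S21" "card W = 20" shows "\<not> has_degree 13 W (edge (with_proj M21))"
proof
  assume "has_degree 13 W (edge (with_proj M21))"
  then obtain v where v: "v \<in> W" "card {u \<in> W. edge (with_proj M21) v u} = 13" unfolding has_degree_def by blast
  let ?N = "{u \<in> S21. edge (with_proj M21) v u}"
  have fin: "finite S21" by (simp add: S21_def)
  have "card ?N = 7 \<or> card ?N = 16"
    using v(1) assms(1) by (intro M21_degrees) (auto simp: has_degree_def)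
  moreover have "13 \<le> card ?N"
    unfolding v(2)[symmetric] using assms(1) fin by (intro card_mono) auto
  moreover have "card ?N \<le> 13 + 2"
  proof -
    have "?N \<subseteq> {u \<in> W. edge (with_proj M21) v u} \<union> (S21 - W)" by blast
    then have "card ?N \<le> card ({u \<in> W. edge (with_proj M21) v u} \<union> (S21 - W))"
      using fin finite_subset[OF assms(1) fin] by (intro card_mono) auto
    also have "\<dots> \<le> 13 + card (S21 - W)" using card_Un_le v(2) by metis
    also have "card (S21 - W) = 2"
      using assms M21_small(3) finite_subset[OF assms(1) fin] by (subst card_Diff_subset) auto
    finally show ?thesis .
  qed
  ultimately show False by linarith
qed

lemma M21_chromatic_component:
  assumes "chromatic_component H (with_proj M21)" "card (verts H) \<in> {11, 13, 15, 17, 20}"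
  shows "small_hoffman_graph H" "card (verts H) = 20 \<Longrightarrow> \<not> has_degree 13 (verts H) (edge H)"
proof -
  obtain c m where m: "m \<le> chromatic_number (with_proj M21)"
    and c: "proper_coloring (with_proj M21) (chromatic_number (with_proj M21)) c"
    and iso: "digraph_iso H (with_proj M21 \<restriction> {v \<in> verts (with_proj M21). c v < m})"
    using assms(1) unfolding chromatic_component_def m_chromatic_component_def by blast
  let ?W = "{v \<in> verts (with_proj M21). c v < m}"
  have sub: "?W \<subseteq> verts (with_proj M21)" by auto
  note GI = graph_induce[OF M21_graph(1) sub]
  have gH: "Digraph.graph H" by (rule digraph_iso_graph_left[OF iso GI(1)])
  have r: "rel_iso (verts H) (edge H) ?W (edge (with_proj M21 \<restriction> ?W))"
    using digraph_iso_graph[OF gH iso] by simp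
  have "rel_iso ?W (edge (with_proj M21 \<restriction> ?W)) ?W (edge (with_proj M21))"
    unfolding GI(2) rel_iso_def by (intro exI[of _ id]) simp
  then have r': "rel_iso (verts H) (edge H) ?W (edge (with_proj M21))" by (rule rel_iso_trans[OF r])
  have card: "card (verts H) = card ?W" using r by (auto simp: rel_iso_def bij_betw_same_card)
  have v22: "card (verts (with_proj M21)) = 22" using M21_small(3) M21_graph(2) by simp
  have "small_hoffman_graph (with_proj M21 \<restriction> ?W)"
    by (rule chromatic_component_small[OF M21_small(1) v22 M21_small(2) c _ m]) (use assms(2) card in simp)
  then show "small_hoffman_graph H" by (rule small_hoffman_graph_iso[OF iso])
  show "\<not> has_degree 13 (verts H) (edge H)" if "card (verts H) = 20"
  proof
    assume "has_degree 13 (verts H) (edge H)"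
    then have "has_degree 13 ?W (edge (with_proj M21))" by (rule has_degree_iso[OF r'])
    moreover have "?W \<subseteq> S21" using M21_graph(2) by auto
    moreover have "card ?W = 20" using that card by simp
    ultimately show False using component_degree by blast
  qed
qed

section \<open>The classification\<close>

lemma digraph_iso_common_model:
  assumes "Digraph.graph G" "Digraph.graph H"
    and "rel_iso (verts G) (edge G) W E" "rel_iso (verts H) (edge H) W E"
  shows "digraph_iso G H"
  using assms(1,2) rel_iso_trans[OF assms(3) rel_iso_sym[OF assms(4)]] by (rule digraph_isoI)

lemma small_hoffman_graph_model:
  assumes "small_hoffman_graph G"
  shows "rel_iso (verts G) (edge G) (pverts F_graph) (edge (with_proj F_graph))
    \<or> m10_model (verts G) (edge G) \<or> fano_model {1..7} {0..7} (verts G) (edge G)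
    \<or> (\<exists>(P, R)\<in>set components. fano_model P R (verts G) (edge G))"
proof -
  consider (base) "rel_iso (verts G) (edge G) (pverts F_graph) (edge (with_proj F_graph))
      \<or> m10_model (verts G) (edge G) \<or> fano_model {1..7} {0..7} (verts G) (edge G)"
    | (oct) "fano_model {1, 2, 3, 5, 6, 7} {0..7} (verts G) (edge G)"
    | (quint) P where "P \<in> {{1, 2, 3}, {1, 5, 2}, {1, 5, 2, 3}, {1, 5, 2, 6}, {1, 5, 2, 6, 3}, {1, 5, 2, 6, 3, 7}}"
        "fano_model P {0, 1, 2, 3, 8} (verts G) (edge G)"
    using small_hoffman_classification[OF assms] by blast
  then show ?thesis
  proof cases
    case base
    then show ?thesis by blast
  next
    case oct
    have "({1, 2, 3, 5, 6, 7}, {0..7}) \<in> set components" 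
      by (simp only: components_def list.set insert_iff simp_thms)
    then show ?thesis using oct by blast
  next
    case (quint P)
    have "(P, {0, 1, 2, 3, 8}) \<in> set components" 
      using quint(1) by (elim insertE emptyE) (simp_all only: components_def list.set insert_iff simp_thms)
    then show ?thesis using quint(2) by blast
  qed
qed

text \<open>The classification applies to the component itself. Orders exclude F and M_21, degree 13
  excludes M_10, and one of the seven models remains.\<close>

lemma M21_chromatic_component_model:
  assumes "chromatic_component H (with_proj M21)" "card (verts H) \<in> {11, 13, 15, 17, 20}"
  shows "\<exists>(P, R)\<in>set components. fano_model P R (verts H) (edge H)"
proof -
  have "\<not> rel_iso (verts H) (edge H) (pverts F_graph) (edge (with_proj F_graph))"
  proof
    assume "rel_iso (verts H) (edge H) (pverts F_graph) (edge (with_proj F_graph))"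
    then have "card (verts H) = card (pverts F_graph)" by (auto simp: rel_iso_def bij_betw_same_card)
    then show False using assms(2) by (simp add: F_graph_def)
  qed
  moreover have "\<not> m10_model (verts H) (edge H)"
  proof
    assume m: "m10_model (verts H) (edge H)"
    then have "card (verts H) = card (model_verts {1..5} {..<10})" by (auto simp: rel_iso_def bij_betw_same_card)
    then have "card (verts H) = 20" by (simp add: card_model_verts)
    moreover have "has_degree 13 (verts H) (edge H)" by (rule has_degree_iso[OF rel_iso_sym[OF m] m10_degree])
    ultimately show False using M21_chromatic_component(2)[OF assms] by simp
  qed
  moreover have "\<not> fano_model {1..7} {0..7} (verts H) (edge H)"
  proof
    assume "fano_model {1..7} {0..7} (verts H) (edge H)"
    then have "card (verts H) = 2 * card {1..7 :: nat} + card {0..7 :: nat}" by (rule fano_model_card) simp_all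
    then show False using assms(2) by simp
  qed
  ultimately show ?thesis using small_hoffman_graph_model[OF M21_chromatic_component(1)[OF assms]] by blast
qed

section \<open>Numbering of the seven components and the final list\<close>

lemma length_components: "length components = 7"
  by (simp add: components_def)

lemma component_index:
  assumes "\<exists>(P, R)\<in>set components. fano_model P R V E"
  shows "\<exists>k<7. fano_model (fst (components ! k)) (snd (components ! k)) V E"
proof -
  obtain P R where p: "(P, R) \<in> set components" "fano_model P R V E" using assms by blast
  then obtain k where k: "k < 7" "(P, R) = components ! k" by (auto simp: in_set_conv_nth length_components)
  have "fano_model (fst (P, R)) (snd (P, R)) V E" using p(2) unfolding fst_conv snd_conv .
  then show ?thesis using k by auto
qed

lemma components_card:
  "map (\<lambda>(P, R). 2 * card P + card R) components = [11, 11, 13, 13, 15, 17, 20]"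
  by (simp add: components_def)

lemma components_finite: "\<forall>(P, R)\<in>set components. finite P \<and> finite R"
  by (simp add: components_def)

lemma equal_sizes:
  "list_all (\<lambda>i. list_all (\<lambda>j. [6, 20, 22, 11, 11, 13, 13, 15, 17, 20 :: nat] ! i = [6, 20, 22, 11, 11, 13, 13, 15, 17, 20] ! j
      \<longrightarrow> i = j \<or> (i, j) \<in> set [(4, 3), (3, 4), (6, 5), (5, 6), (1, 9), (9, 1)]) [0..<10]) [0..<10]"
  by code_simp

text \<open>A list has a single element type, so all representatives live on \<open>nat\<close>,
  while \<open>G\<close> and \<open>H\<close> range over arbitrary types of vertices and
  arcs.\<close>

theorem mainTheorem2:
  shows "\<exists>Gs :: nat pair_pre_digraph list.
      length Gs = 10
    \<and> (\<forall>i < 10. small_hoffman_graph (with_proj (Gs ! i)))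
    \<and> (\<forall>i < 10. \<forall>j < 10. i \<noteq> j \<longrightarrow>
          \<not> digraph_iso (with_proj (Gs ! i)) (with_proj (Gs ! j)))
    \<and> (\<forall>G :: ('a, 'b) pre_digraph. small_hoffman_graph G \<longrightarrow>
          (\<exists>i < 10. digraph_iso G (with_proj (Gs ! i))))
    \<and> digraph_iso (with_proj (Gs ! 0)) (with_proj F_graph)
    \<and> digraph_iso (with_proj (Gs ! 1)) (with_proj M10)
    \<and> digraph_iso (with_proj (Gs ! 2)) (with_proj M21)
    \<and> (\<forall>i \<in> {3..<10}. chromatic_component (with_proj (Gs ! i)) (with_proj M21))
    \<and> (\<lambda>i. card (pverts (Gs ! i))) ` {3..<10} = {11, 13, 15, 17, 20}
    \<and> (\<forall>H :: ('c, 'd) pre_digraph.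
          chromatic_component H (with_proj M21) \<and> card (verts H) \<in> {11, 13, 15, 17, 20} \<longrightarrow>
          (\<exists>i \<in> {3..<10}. digraph_iso H (with_proj (Gs ! i))))"
proof -
  have graphs: "Digraph.graph (with_proj M10)" "Digraph.graph (with_proj F_graph)"
    using M10_small F_small by (simp_all add: small_hoffman_graph_def)
  obtain N10 :: "nat pair_pre_digraph" where N10: "Digraph.graph (with_proj N10)" "digraph_iso (with_proj N10) (with_proj M10)"
    using nat_copy[OF graphs(1)] .
  obtain N21 :: "nat pair_pre_digraph" where N21: "Digraph.graph (with_proj N21)" "digraph_iso (with_proj N21) (with_proj M21)"
    using nat_copy[OF M21_graph(1)] .
  define Rep where "Rep N k \<longleftrightarrow> Digraph.graph (with_proj N) \<and> chromatic_component (with_proj N) (with_proj M21)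
      \<and> fano_model (fst (components ! k)) (snd (components ! k)) (pverts N) (edge (with_proj N))"
    for N :: "nat pair_pre_digraph" and k
  have "\<exists>N. Rep N k" if "k < 7" for k
  proof -
    have "(fst (components ! k), snd (components ! k)) \<in> set components"
      using nth_mem[of k components] that by (simp add: length_components)
    then show ?thesis unfolding Rep_def by (rule components_exist)
  qed
  then obtain Nc where "Rep (Nc k) k" if "k < 7" for k by metis
  then have Nc: "Digraph.graph (with_proj (Nc k))" "chromatic_component (with_proj (Nc k)) (with_proj M21)"
    "fano_model (fst (components ! k)) (snd (components ! k)) (pverts (Nc k)) (edge (with_proj (Nc k)))"
    if "k < 7" for k using that unfolding Rep_def by blast+
  \<comment> \<open>Position 3 + k holds the component with index k; hence the shift by 3
    throughout.\<close>
  define Gs where "Gs = [F_graph, N10, N21] @ map Nc [0..<7]"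
  let ?G = "\<lambda>i. with_proj (Gs ! i)"
  have len: "length Gs = 10" by (simp add: Gs_def)
  have Gs012: "Gs ! 0 = F_graph" "Gs ! 1 = N10" "Gs ! 2 = N21" by (simp_all add: Gs_def)
  have Gsk: "Gs ! (3 + k) = Nc k" if "k < 7" for k using that by (simp add: Gs_def)
  have indices: "i \<in> {0, 1, 2} \<or> (\<exists>k<7. i = 3 + k)" if "i < 10" for i :: nat
  proof (cases "i < 3")
    case False
    then show ?thesis using that by (intro disjI2 exI[of _ "i - 3"]) simp
  qed auto
  have late: "\<exists>k<7. i = 3 + k" if "i \<in> {3..<10}" for i :: nat
    using that by (intro exI[of _ "i - 3"]) auto
  have size_k: "card (pverts (Nc k)) = [11, 11, 13, 13, 15, 17, 20] ! k" if k: "k < 7" for k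
  proof -
    have "components ! k \<in> set components" using k by (simp add: length_components)
    then have "card (pverts (Nc k)) = 2 * card (fst (components ! k)) + card (snd (components ! k))"
      using components_finite by (intro fano_model_card[OF Nc(3)[OF k]]) auto
    also have "\<dots> = map (\<lambda>(P, R). 2 * card P + card R) components ! k"
      using k by (simp add: length_components split_beta)
    finally show ?thesis unfolding components_card .
  qed
  have small_k: "small_hoffman_graph (with_proj (Nc k))"
    and degree_k: "card (pverts (Nc k)) = 20 \<Longrightarrow> \<not> has_degree 13 (pverts (Nc k)) (edge (with_proj (Nc k)))" if k: "k < 7" for k
  proof -
    have "\<forall>n\<in>set [11, 11, 13, 13, 15, 17, 20]. n \<in> {11, 13, 15, 17, 20 :: nat}" by simp
    then have "[11, 11, 13, 13, 15, 17, 20] ! k \<in> {11, 13, 15, 17, 20 :: nat}"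
      using k by (metis length_components components_card length_map nth_mem)
    then have "card (verts (with_proj (Nc k))) \<in> {11, 13, 15, 17, 20}" using size_k[OF k] by simp
    note * = M21_chromatic_component[OF Nc(2)[OF k] this]
    show "small_hoffman_graph (with_proj (Nc k))" by (rule *(1))
    show "\<not> has_degree 13 (pverts (Nc k)) (edge (with_proj (Nc k)))" if "card (pverts (Nc k)) = 20"
      using *(2) that by simp
  qed
  have small: "small_hoffman_graph (?G i)" if "i < 10" for i
    using indices[OF that] small_k Gsk Gs012 F_small
      small_hoffman_graph_iso[OF N10(2) M10_small] small_hoffman_graph_iso[OF N21(2) M21_small(1)] by auto
  then have graph: "Digraph.graph (?G i)" if "i < 10" for i using that by (simp add: small_hoffman_graph_def)
  have m10: "m10_model (pverts N10) (edge (with_proj N10))"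
  proof -
    have "rel_iso (pverts N10) (edge (with_proj N10)) S10 (edge (with_proj M10))"
      using digraph_iso_graph[OF N10] by (simp add: M10_def Gamma_def)
    then show ?thesis using M10_model by (rule rel_iso_trans)
  qed
  have m21: "fano_model {1..7} {0..7} (pverts N21) (edge (with_proj N21))"
  proof -
    have "rel_iso (pverts N21) (edge (with_proj N21)) S21 (edge (with_proj M21))"
      using digraph_iso_graph[OF N21] M21_graph(2) by simp
    then show ?thesis using M21_model by (rule rel_iso_trans)
  qed
  have size: "card (pverts (Gs ! i)) = [6, 20, 22, 11, 11, 13, 13, 15, 17, 20] ! i" if "i < 10" for i
  proof -
    have "card (pverts F_graph) = 6" by (simp add: F_graph_def)
    moreover have "card (pverts N10) = 20"
      using m10 card_model_verts[of "{1..5}" "{..<10}"] by (auto simp: rel_iso_def dest!: bij_betw_same_card)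
    moreover have "card (pverts N21) = 22" using fano_model_card[OF m21] by simp
    ultimately show ?thesis using indices[OF that] size_k Gsk Gs012 by auto
  qed
  let ?iso = "\<lambda>i j. rel_iso (pverts (Gs ! i)) (edge (?G i)) (pverts (Gs ! j)) (edge (?G j))"
  \<comment> \<open>Up to symmetry these are the only coincidences of orders: 11 and 13 are settled
    by \<open>separated_pair\<close>, 20 by a vertex of degree 13.\<close>
  have not43: "\<not> ?iso 4 3" and not65: "\<not> ?iso 6 5" and not19: "\<not> ?iso 1 9"
  proof -
    have c: "components ! 0 = ({1, 2, 3}, {0, 1, 2, 3, 8})" "components ! 1 = ({1, 5, 2}, {0, 1, 2, 3, 8})"
      "components ! 2 = ({1, 5, 2, 3}, {0, 1, 2, 3, 8})" "components ! 3 = ({1, 5, 2, 6}, {0, 1, 2, 3, 8})"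
      by (simp_all add: components_def)
    have G: "Gs ! 3 = Nc 0" "Gs ! 4 = Nc 1" "Gs ! 5 = Nc 2" "Gs ! 6 = Nc 3" "Gs ! 9 = Nc 6"
      using Gsk[of 0] Gsk[of 1] Gsk[of 2] Gsk[of 3] Gsk[of 6] by simp_all
    have m: "fano_model {1, 2, 3} {0, 1, 2, 3, 8} (pverts (Gs ! 3)) (edge (?G 3))"
      "fano_model {1, 5, 2} {0, 1, 2, 3, 8} (pverts (Gs ! 4)) (edge (?G 4))"
      "fano_model {1, 5, 2, 3} {0, 1, 2, 3, 8} (pverts (Gs ! 5)) (edge (?G 5))"
      "fano_model {1, 5, 2, 6} {0, 1, 2, 3, 8} (pverts (Gs ! 6)) (edge (?G 6))"
      using Nc(3)[of 0] Nc(3)[of 1] Nc(3)[of 2] Nc(3)[of 3] unfolding G c fst_conv snd_conv by simp_all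
    show "\<not> ?iso 4 3"
    proof
      assume i: "?iso 4 3"
      show False
        using separated_pair_iso[OF rel_iso_trans[OF rel_iso_trans[OF rel_iso_sym[OF m(2)] i] m(1)]]
          separated_pair_components(1) no_separated_pair_components(1) by blast
    qed
    show "\<not> ?iso 6 5"
    proof
      assume i: "?iso 6 5"
      show False
        using separated_pair_iso[OF rel_iso_trans[OF rel_iso_trans[OF rel_iso_sym[OF m(4)] i] m(3)]]
          separated_pair_components(2) no_separated_pair_components(2) by blast
    qed
    show "\<not> ?iso 1 9"
    proof
      assume i: "?iso 1 9"
      have "has_degree 13 (pverts (Gs ! 1)) (edge (?G 1))"
        unfolding Gs012 by (rule has_degree_iso[OF rel_iso_sym[OF m10] m10_degree])
      then have "has_degree 13 (pverts (Gs ! 9)) (edge (?G 9))" by (rule has_degree_iso[OF i])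
      then show False using degree_k[of 6] size_k[of 6] unfolding G by simp
    qed
  qed
  have distinct: "\<not> digraph_iso (?G i) (?G j)" if ij: "i < 10" "j < 10" "i \<noteq> j" for i j
  proof
    assume "digraph_iso (?G i) (?G j)"
    then have iso: "?iso i j" using digraph_iso_iff[OF graph graph] ij by simp
    then have "card (pverts (Gs ! i)) = card (pverts (Gs ! j))" by (auto simp: rel_iso_def bij_betw_same_card)
    then have "[6, 20, 22, 11, 11, 13, 13, 15, 17, 20 :: nat] ! i = [6, 20, 22, 11, 11, 13, 13, 15, 17, 20] ! j"
      using size ij by simp
    then have "(i, j) \<in> set [(4, 3), (3, 4), (6, 5), (5, 6), (1, 9), (9, 1)]"
    proof -
      have "i \<in> set [0..<10]" "j \<in> set [0..<10]" using ij by simp_all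
      then show ?thesis using equal_sizes[unfolded list_all_iff] \<open>_ ! i = _ ! j\<close> \<open>i \<noteq> j\<close> by blast
    qed
    then have "(i, j) \<in> {(4, 3), (6, 5), (1, 9)} \<or> (j, i) \<in> {(4, 3), (6, 5), (1, 9)}"
      unfolding list.set insert_iff empty_iff prod.inject by blast
    moreover have "?iso j i" by (rule rel_iso_sym[OF iso])
    ultimately show False using iso not43 not65 not19 by auto
  qed
  have complete: "\<exists>i<10. digraph_iso G (?G i)" if G: "small_hoffman_graph G" for G :: "('a, 'b) pre_digraph"
  proof -
    have gG: "Digraph.graph G" using G by (simp add: small_hoffman_graph_def)
    consider "rel_iso (verts G) (edge G) (pverts F_graph) (edge (with_proj F_graph))"
      | "m10_model (verts G) (edge G)" | "fano_model {1..7} {0..7} (verts G) (edge G)"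
      | k where "k < 7" "fano_model (fst (components ! k)) (snd (components ! k)) (verts G) (edge G)"
      using small_hoffman_graph_model[OF G] component_index by blast
    then show ?thesis
    proof cases
      case 1
      then have "digraph_iso G (?G 0)" unfolding Gs012 by (intro digraph_isoI gG graphs) simp
      then show ?thesis by (intro exI[of _ 0]) simp
    next
      case 2
      have "digraph_iso G (?G 1)"
        unfolding Gs012 by (rule digraph_iso_common_model[OF gG N10(1) 2]) (use m10 in simp)
      then show ?thesis by (intro exI[of _ 1]) simp
    next
      case 3
      have "digraph_iso G (?G 2)"
        unfolding Gs012 by (rule digraph_iso_common_model[OF gG N21(1) 3]) (use m21 in simp)
      then show ?thesis by (intro exI[of _ 2]) simp
    next
      case (4 k)
      have "digraph_iso G (?G (3 + k))"
        unfolding Gsk[OF 4(1)] by (rule digraph_iso_common_model[OF gG Nc(1)[OF 4(1)] 4(2)]) (use Nc(3)[OF 4(1)] in simp)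
      then show ?thesis using 4(1) by (intro exI[of _ "3 + k"]) simp
    qed
  qed
  have complete': "\<exists>i\<in>{3..<10}. digraph_iso H (?G i)"
    if H: "chromatic_component H (with_proj M21)" "card (verts H) \<in> {11, 13, 15, 17, 20}" for H :: "('c, 'd) pre_digraph"
  proof -
    have gH: "Digraph.graph H" using M21_chromatic_component(1)[OF H] by (simp add: small_hoffman_graph_def)
    obtain k where k: "k < 7" "fano_model (fst (components ! k)) (snd (components ! k)) (verts H) (edge H)"
      using component_index[OF M21_chromatic_component_model[OF H]] by blast
    have "digraph_iso H (?G (3 + k))"
      unfolding Gsk[OF k(1)]
      by (rule digraph_iso_common_model[OF gH Nc(1)[OF k(1)] k(2)]) (use Nc(3)[OF k(1)] in simp)
    then show ?thesis using k(1) by (intro bexI[of _ "3 + k"]) auto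
  qed
  have F: "digraph_iso (?G 0) (with_proj F_graph)"
    unfolding Gs012 by (rule digraph_isoI[OF graphs(2,2)]) (auto simp: rel_iso_def intro!: exI[of _ id])
  have chrom: "\<forall>i\<in>{3..<10}. chromatic_component (?G i) (with_proj M21)"
    using late Nc(2) Gsk by metis
  have cards: "(\<lambda>i. card (pverts (Gs ! i))) ` {3..<10} = {11, 13, 15, 17, 20}"
  proof -
    have "{3..<10} = {3, 4, 5, 6, 7, 8, 9 :: nat}" by auto
    then show ?thesis using size[of 3] size[of 4] size[of 5] size[of 6] size[of 7] size[of 8] size[of 9] by simp
  qed
  show ?thesis
  proof (intro exI[of _ Gs] conjI)
    show "digraph_iso (?G 1) (with_proj M10)" "digraph_iso (?G 2) (with_proj M21)"
      unfolding Gs012 by (rule N10(2), rule N21(2))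
  qed (use len small distinct complete complete' F chrom cards in blast)+
qed

end
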